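(* Consider the product structure, regular local likelihood process $X$, data-generating law $P_\theta$, Gaussian location counterpart $Y$, and product operators $H,\Sigma,B$ defined in the context, with $a\in\{-1,0\}$. Suppose the local moment bounds stated in the context hold with $\delta_n(\theta)$, $r_n\lesssim\sqrt{n/M_n}$, and $\max_{m\le M_n}(\|H_m^{(n)}\|_{\mathrm{op}}+\|B_m^{(n)}\|_{\mathrm{op}})=O(1)$. Set $\widetilde\delta_n(\theta)=\delta_n(\theta)\{1+\delta_n(\theta)\}$. Let $(\nu_n)$ be probability measures on $\Theta_n$ satisfying $$\int_{\Theta_n}\widetilde\delta_n(\theta)\,\nu_n(\mathrm d\theta)\to0.$$ Assume that, for $\beta$ in a neighborhood of zero, the averaged Gaussian free energies $$\mathcal F_n^{\mathrm G}(\beta)=\int_{\Theta_n}F_n^{\mathrm G}(\theta,\beta)\,\nu_n(\mathrm d\theta)$$ converge pointwise to a finite limit $\mathcal F^{\mathrm G}(\beta)$. Then $$\partial_-\mathcal F^{\mathrm G}(0)\le\liminf_{n\to\infty}\int_{\Theta_n}\Phi_n(\theta)\,\nu_n(\mathrm d\theta)\le\limsup_{n\to\infty}\int_{\Theta_n}\Phi_n(\theta)\,\nu_n(\mathrm d\theta)\le\partial_+\mathcal F^{\mathrm G}(0).$$ In particular, if $\mathcal F^{\mathrm G}$ is differentiable at the origin, then $$\lim_{n\to\infty}\int_{\Theta_n}\Phi_n(\theta)\,\nu_n(\mathrm d\theta)=\lim_{n\to\infty}\int_{\Theta_n}\Phi_n^{\mathrm G}(\theta)\,\nu_n(\mathrm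 d\theta)=(\mathcal F^{\mathrm G})'(0).$$
   Context: For each $n$: $\Theta_n$ is a compact parameter space, $T_n\subseteq\Theta_n$ a compact metric space with a Borel probability measure $\pi$ (prior), $M_n$ a number of local components, $\Omega=\prod_{m=1}^{M_n}\Omega_m$ the sample space; all may depend on $n$. For $m\le M_n$, $\mathcal H_m$ is a real separable Hilbert space and $\eta_m:\Theta_n\to\mathcal H_m$ a continuous feature map; $\mathcal H=\bigoplus_m\mathcal H_m$ and $\eta=(\eta_1,\dots,\eta_{M_n}):\Theta_n\to\mathcal H$. The feature radius is $r_n=\max_{m\le M_n}\sup_{u\in\Theta_n}\|\eta_m(u)\|_{\mathcal H_m}$, with $r_n>0$. The notation $\lesssim$ means $\le$ up to a finite constant independent of $n$, $m$, $\theta$. Likelihood process: $X(t,\omega)=\sum_{m=1}^{M_n}X_m^{(n)}(t,\omega_m)$, $t\in T_n$, with continuous sample paths, where $$X_m^{(n)}(t,\omega_m)=\langle U_m^{(n)}(\omega_m),\eta_m(t)\rangle_{\mathcal H_m}-\tfrac12\langle V_m^{(n)}(\omega_m)\eta_m(t),\eta_m(t)\rangle_{\mathcal H_m}+R_m^{(n)}(t,\omega_m),$$ $U_m^{(n)}$ is a random element of $\mathcal H_m$, $V_m^{(n)}$ a random (bounded) self-adjoint operator on $\mathcal H_m$, and $R_m^{(n)}$ a remainder. Data-generating laws: $P_0=\bigotimes_mP_{0,m}^{(n)}$ is a null product probability measure independent of $\theta$, $P_\theta=\bigotimes_mP_{\theta,m}^{(n)}$, and $$\log\frac{\mathrm dP_{\theta,m}^{(n)}}{\mathrm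 dP_{0,m}^{(n)}}(\omega_m)=\langle S_m^{(n)}(\omega_m),\eta_m(\theta)\rangle_{\mathcal H_m}+\Delta_m^{(n)}(\theta,\omega_m),\qquad\theta\in\Theta_n,$$ with $S_m^{(n)}$ a random element of $\mathcal H_m$ and $\Delta_m^{(n)}$ a (real-valued) remainder. $\mathbb E_0,\mathbb E_\theta$ denote expectation under $P_{0,m}^{(n)}$ and $P_{\theta,m}^{(n)}$. Local moment bounds (superscripts $(n)$ dropped). Put $\mathsf L_{m,n}=\mathbb E_0\|U_m\|^2+\mathbb E_0\|S_m\|^2$, $$\mathcal E^U_{m,n}(\theta)=r_n(\mathbb E_0\|U_m\|^3+\mathbb E_\theta\|U_m\|^3),\qquad\mathcal E^S_{m,n}(\theta)=r_n(\mathbb E_0\|S_m\|^3+\mathbb E_\theta\|S_m\|^3),$$ $$\mathcal E^V_{m,n}(\theta)=r_n\sqrt{\mathbb E_0\|V_m\|_{\mathrm{op}}^2}+r_n^4(\mathbb E_0\|V_m\|_{\mathrm{op}}^3+\mathbb E_\theta\|V_m\|_{\mathrm{op}}^3),$$ $$\mathcal E^R_{m,n}(\theta)=\sup_{t\in T_n}\Bigl\{r_n^{-2}|\mathbb E_0R_m(t)|+r_n^{-1}\sqrt{\mathbb E_0|R_m(t)|^2}+r_n^{-2}\mathbb E_0|R_m(t)|^3\Bigr\}+r_n^{-2}\mathbb E_\theta\Bigl[\sup_{t\in T_n}|R_m(t)|^3\Bigr],$$ $$\mathcal E^\Delta_{m,n}(\theta)=r_n^{-1}\sqrt{\mathbb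 E_0|\Delta_m(\theta)|^2}+r_n^{-2}(\mathbb E_0|\Delta_m(\theta)|^3+\mathbb E_\theta|\Delta_m(\theta)|^3).$$ The assumption is: $\delta_n(\theta)\ge0$ is a (finite) deterministic quantity such that, uniformly over $m\le M_n$ and $\theta\in\Theta_n$, $$\mathbb E_0[U_m]=0,\qquad\mathsf L_{m,n}\lesssim1,\qquad\mathcal E^U_{m,n}(\theta)+\mathcal E^S_{m,n}(\theta)+\mathcal E^V_{m,n}(\theta)+\mathcal E^R_{m,n}(\theta)+\mathcal E^\Delta_{m,n}(\theta)\lesssim\delta_n(\theta).$$ Gaussian counterpart: bounded operators on $\mathcal H_m$ are defined by $$\langle A_mh,g\rangle=\mathbb E_0[\langle S_m,h\rangle\langle U_m,g\rangle],\quad\langle\Sigma_mh,g\rangle=\mathbb E_0[\langle U_m,h\rangle\langle U_m,g\rangle],\quad\langle K_mh,g\rangle=\mathbb E_0[\langle V_mh,g\rangle],$$ and $A=\bigoplus_mA_m$, $\Sigma=\bigoplus_m\Sigma_m$, $K=\bigoplus_mK_m$. Under $Q_\theta$, with $\xi\sim N(0,\Sigma)$ in $\mathcal H$, $$Y(t)=\langle\xi,\eta(t)\rangle+\langle A\eta(\theta),\eta(t)\rangle-\tfrac12\langle K\eta(t),\eta(t)\rangle.$$ Directions: $H_m^{(n)}:\mathcal H_m\to\mathcal H_m$ are self-adjoint bounded operators, independent of $\theta$, with $\mathrm{Range}(H_m^{(n)})\subseteq\mathrm{Range}(\Sigma_m^{(n)})$, and $B_m^{(n)}$ are bounded operators with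 $H_m^{(n)}=\Sigma_m^{(n)}B_m^{(n)}$; $H=\bigoplus_mH_m^{(n)}$, $B=\bigoplus_mB_m^{(n)}$. The perturbed Gaussian process is $Y_\beta(t)=Y(t)+\beta\widetilde Y(t)$ with $$\widetilde Y(t)=\langle\xi,B\eta(t)\rangle+a\langle H[\eta(\theta)-\eta(t)],\eta(\theta)-\eta(t)\rangle,$$ and $F_n^{\mathrm G}(\theta,\beta)=\frac1n\mathbb E_{Q_\theta}[\log\int_{T_n}e^{Y_\beta(t)}\pi(\mathrm dt)]$. The test function is $$\phi_\theta(s,t)=a\langle H[\eta(\theta)-\eta(t)],\eta(\theta)-\eta(t)\rangle+\langle H\eta(t),\eta(t)\rangle-\langle H\eta(s),\eta(t)\rangle.$$ With $\pi_Z(\mathrm dt)=e^{Z(t)}\pi(\mathrm dt)/\int_{T_n}e^{Z(s)}\pi(\mathrm ds)$, $$\Phi_n(\theta)=\frac1n\iint\phi_\theta(s,t)\,\mathbb E_{P_\theta}[\pi_X^{\otimes2}](\mathrm ds,\mathrm dt),\qquad\Phi_n^{\mathrm G}(\theta)=\frac1n\iint\phi_\theta(s,t)\,\mathbb E_{Q_\theta}[\pi_{Y}^{\otimes2}](\mathrm ds,\mathrm dt).$$ $\partial_-$ and $\partial_+$ denote left and right derivatives. All functions of $\theta$ integrated against $\nu_n$ are taken to be measurable with well-defined integrals. *)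

theory Defs
  imports "HOL-Probability.Probability" "HOL-Library.Landau_Symbols"
begin

definition borel_of :: "'p topology \<Rightarrow> 'p measure" where
  "borel_of X = sigma (topspace X) {W. openin X W}"

definition esqrt :: "ennreal \<Rightarrow> ennreal" where
  "esqrt x = (if x = \<infinity> then \<infinity> else ennreal (sqrt (enn2real x)))"

text \<open>Moments of non-negative quantities are taken in the extended non-negative reals, so that
  an upper bound on a moment includes its finiteness.\<close>

abbreviation moment :: "'w measure \<Rightarrow> ('w \<Rightarrow> real) \<Rightarrow> ennreal" where
  "moment P f \<equiv> (\<integral>\<^sup>+ \<omega>. ennreal (f \<omega>) \<partial>P)"

text \<open>The component Hilbert spaces may change with the component and with the sample size. They are
  closed subspaces of one ambient separable Hilbert space (every countable family of separable
  Hilbert spaces can be placed in such a space). A bounded operator on a closed subspace \<open>S\<close> is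
  represented by its extension by zero on the orthogonal complement of \<open>S\<close>; this changes neither
  the operator norm nor the range.\<close>

definition ops_on :: "'h::real_inner set \<Rightarrow> ('h \<Rightarrow>\<^sub>L 'h) set" where
  "ops_on S = {F. (\<forall>x. blinfun_apply F x \<in> S) \<and>
                  (\<forall>x. (\<forall>y\<in>S. x \<bullet> y = 0) \<longrightarrow> blinfun_apply F x = 0)}"

definition self_adjoint :: "('h::real_inner \<Rightarrow>\<^sub>L 'h) \<Rightarrow> bool" where
  "self_adjoint F \<longleftrightarrow> (\<forall>x y. blinfun_apply F x \<bullet> y = x \<bullet> blinfun_apply F y)"

text \<open>Elements of a Hilbert direct sum of \<open>k\<close> components are families indexed by
  \<open>1, \<dots>, k\<close>; values at other indices are irrelevant.\<close>

definition dsum_inner :: "nat \<Rightarrow> (nat \<Rightarrow> 'h::real_inner) \<Rightarrow> (nat \<Rightarrow> 'h) \<Rightarrow> real" where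
  "dsum_inner k x y = (\<Sum>m\<in>{1..k}. x m \<bullet> y m)"

definition dsum_op :: "(nat \<Rightarrow> 'h::real_inner \<Rightarrow>\<^sub>L 'h) \<Rightarrow> (nat \<Rightarrow> 'h) \<Rightarrow> (nat \<Rightarrow> 'h)" where
  "dsum_op F x = (\<lambda>m. blinfun_apply (F m) (x m))"

definition real_gaussian :: "real \<Rightarrow> real measure" where
  "real_gaussian v = (if v = 0 then return borel 0
                      else density lborel (\<lambda>x. ennreal (normal_density 0 (sqrt v) x)))"

definition gaussian_dsum ::
  "'q measure \<Rightarrow> nat \<Rightarrow> (nat \<Rightarrow> 'h set) \<Rightarrow> (nat \<Rightarrow> 'h::real_inner \<Rightarrow>\<^sub>L 'h) \<Rightarrow> ('q \<Rightarrow> nat \<Rightarrow> 'h) \<Rightarrow> bool" where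
  "gaussian_dsum Q k S C x \<longleftrightarrow>
     (\<forall>m\<in>{1..k}. (\<lambda>\<omega>. x \<omega> m) \<in> borel_measurable Q \<and> (\<forall>\<omega>\<in>space Q. x \<omega> m \<in> S m)) \<and>
     (\<forall>h. (\<forall>m\<in>{1..k}. h m \<in> S m) \<longrightarrow>
        distr Q borel (\<lambda>\<omega>. dsum_inner k (x \<omega>) h) = real_gaussian (dsum_inner k (dsum_op C h) h))"

text \<open>All objects at one fixed sample size. \<open>Uvec\<close>, \<open>Vop\<close>, \<open>Rrem\<close> are the linear term, quadratic
  term and remainder of the local likelihood process; \<open>Svec\<close>, \<open>Drem\<close> are the score and remainder
  in the log density of \<open>Pth m \<theta>\<close> with respect to \<open>P0 m\<close>.\<close>

record (overloaded) ('p, 'w, 'h) local_experiment =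
  Theta :: "'p topology"
  Tset :: "'p set"
  prior :: "'p measure"
  comps :: nat
  hilb :: "nat \<Rightarrow> 'h::{real_inner,banach,second_countable_topology} set"
  feat :: "nat \<Rightarrow> 'p \<Rightarrow> 'h"
  P0 :: "nat \<Rightarrow> 'w measure"
  Pth :: "nat \<Rightarrow> 'p \<Rightarrow> 'w measure"
  Uvec :: "nat \<Rightarrow> 'w \<Rightarrow> 'h"
  Vop :: "nat \<Rightarrow> 'w \<Rightarrow> ('h \<Rightarrow>\<^sub>L 'h)"
  Rrem :: "nat \<Rightarrow> 'p \<Rightarrow> 'w \<Rightarrow> real"
  Svec :: "nat \<Rightarrow> 'w \<Rightarrow> 'h"
  Drem :: "nat \<Rightarrow> 'p \<Rightarrow> 'w \<Rightarrow> real"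

definition eta where "eta E t = (\<lambda>m. feat E m t)"

definition radius where
  "radius E = (MAX m\<in>{1..comps E}. SUP u\<in>topspace (Theta E). norm (feat E m u))"

definition Xcomp where
  "Xcomp E m t w = Uvec E m w \<bullet> feat E m t
     - 1/2 * (blinfun_apply (Vop E m w) (feat E m t) \<bullet> feat E m t) + Rrem E m t w"

definition Xproc where
  "Xproc E t \<omega> = (\<Sum>m\<in>{1..comps E}. Xcomp E m t (\<omega> m))"

definition Plaw where
  "Plaw E \<theta> = Pi\<^sub>M {1..comps E} (\<lambda>m. Pth E m \<theta>)"

text \<open>The random operator \<open>Vop\<close> is measurable in the strong operator sense (norm-Borel
  measurability would be more restrictive).\<close>

definition regular_experiment where
  "regular_experiment E \<longleftrightarrow>
     compact_space (Theta E) \<and>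
     Tset E \<subseteq> topspace (Theta E) \<and> compactin (Theta E) (Tset E) \<and>
     metrizable_space (subtopology (Theta E) (Tset E)) \<and>
     prob_space (prior E) \<and> space (prior E) = Tset E \<and>
     sets (prior E) = sets (borel_of (subtopology (Theta E) (Tset E))) \<and>
     1 \<le> comps E \<and> 0 < radius E \<and>
     (\<forall>m\<in>{1..comps E}.
        subspace (hilb E m) \<and> closed (hilb E m) \<and>
        continuous_map (Theta E) (top_of_set (hilb E m)) (feat E m) \<and>
        prob_space (P0 E m) \<and>
        Uvec E m \<in> borel_measurable (P0 E m) \<and> (\<forall>w\<in>space (P0 E m). Uvec E m w \<in> hilb E m) \<and>
        Svec E m \<in> borel_measurable (P0 E m) \<and> (\<forall>w\<in>space (P0 E m). Svec E m w \<in> hilb E m) \<and>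
        (\<forall>h. (\<lambda>w. blinfun_apply (Vop E m w) h) \<in> borel_measurable (P0 E m)) \<and>
        (\<forall>w\<in>space (P0 E m). Vop E m w \<in> ops_on (hilb E m) \<and> self_adjoint (Vop E m w)) \<and>
        (\<forall>t\<in>Tset E. Rrem E m t \<in> borel_measurable (P0 E m)) \<and>
        (\<lambda>w. SUP t\<in>Tset E. ennreal (\<bar>Rrem E m t w\<bar> ^ 3)) \<in> borel_measurable (P0 E m) \<and>
        (\<forall>\<theta>\<in>topspace (Theta E).
           Drem E m \<theta> \<in> borel_measurable (P0 E m) \<and>
           prob_space (Pth E m \<theta>) \<and>
           Pth E m \<theta> = density (P0 E m)
             (\<lambda>w. ennreal (exp (Svec E m w \<bullet> feat E m \<theta> + Drem E m \<theta> w))))) \<and>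
     (\<forall>\<omega>\<in>space (Pi\<^sub>M {1..comps E} (P0 E)).
        continuous_map (subtopology (Theta E) (Tset E)) euclidean (\<lambda>t. Xproc E t \<omega>))"

definition L_loc where
  "L_loc E m = moment (P0 E m) (\<lambda>w. norm (Uvec E m w) ^ 2)
             + moment (P0 E m) (\<lambda>w. norm (Svec E m w) ^ 2)"

definition err_U where
  "err_U E m \<theta> = ennreal (radius E) *
     (moment (P0 E m) (\<lambda>w. norm (Uvec E m w) ^ 3) + moment (Pth E m \<theta>) (\<lambda>w. norm (Uvec E m w) ^ 3))"

definition err_S where
  "err_S E m \<theta> = ennreal (radius E) *
     (moment (P0 E m) (\<lambda>w. norm (Svec E m w) ^ 3) + moment (Pth E m \<theta>) (\<lambda>w. norm (Svec E m w) ^ 3))"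

definition err_V where
  "err_V E m \<theta> =
     ennreal (radius E) * esqrt (moment (P0 E m) (\<lambda>w. norm (Vop E m w) ^ 2)) +
     ennreal (radius E ^ 4) *
       (moment (P0 E m) (\<lambda>w. norm (Vop E m w) ^ 3) + moment (Pth E m \<theta>) (\<lambda>w. norm (Vop E m w) ^ 3))"

definition err_R where
  "err_R E m \<theta> =
     (SUP t\<in>Tset E.
        ennreal (1 / radius E ^ 2) * ennreal \<bar>\<integral>w. Rrem E m t w \<partial>P0 E m\<bar> +
        ennreal (1 / radius E) * esqrt (moment (P0 E m) (\<lambda>w. \<bar>Rrem E m t w\<bar> ^ 2)) +
        ennreal (1 / radius E ^ 2) * moment (P0 E m) (\<lambda>w. \<bar>Rrem E m t w\<bar> ^ 3)) +
     ennreal (1 / radius E ^ 2) *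
       (\<integral>\<^sup>+ w. (SUP t\<in>Tset E. ennreal (\<bar>Rrem E m t w\<bar> ^ 3)) \<partial>Pth E m \<theta>)"

definition err_D where
  "err_D E m \<theta> =
     ennreal (1 / radius E) * esqrt (moment (P0 E m) (\<lambda>w. \<bar>Drem E m \<theta> w\<bar> ^ 2)) +
     ennreal (1 / radius E ^ 2) *
       (moment (P0 E m) (\<lambda>w. \<bar>Drem E m \<theta> w\<bar> ^ 3) + moment (Pth E m \<theta>) (\<lambda>w. \<bar>Drem E m \<theta> w\<bar> ^ 3))"

definition local_moment_bounds where
  "local_moment_bounds E \<delta> \<longleftrightarrow>
     (\<forall>n\<ge>1. \<forall>\<theta>\<in>topspace (Theta (E n)). (0::real) \<le> \<delta> n \<theta>) \<and>
     (\<forall>n\<ge>1. \<forall>m\<in>{1..comps (E n)}. (\<integral>w. Uvec (E n) m w \<partial>P0 (E n) m) = 0) \<and>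
     (\<exists>C. \<forall>n\<ge>1. \<forall>m\<in>{1..comps (E n)}. L_loc (E n) m \<le> ennreal C) \<and>
     (\<exists>C. \<forall>n\<ge>1. \<forall>m\<in>{1..comps (E n)}. \<forall>\<theta>\<in>topspace (Theta (E n)).
        err_U (E n) m \<theta> + err_S (E n) m \<theta> + err_V (E n) m \<theta> + err_R (E n) m \<theta> + err_D (E n) m \<theta>
          \<le> ennreal (C * \<delta> n \<theta>))"

text \<open>The Gaussian counterpart, with operators \<open>Aop\<close>, \<open>Sigma_op\<close>, \<open>Kop\<close>, the laws \<open>Qlaw \<theta>\<close> and the
  Gaussian element \<open>xi\<close>, together with the directions \<open>Hop\<close> and \<open>Bop\<close>. The operators \<open>Aop m\<close>,
  \<open>Sigma_op m\<close>, \<open>Kop m\<close> are determined on \<open>hilb E m\<close> by the identities in \<open>gaussian_counterpart\<close>.\<close>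

record (overloaded) ('p, 'w, 'h, 'q) gauss_experiment = "('p, 'w, 'h::{real_inner,banach,second_countable_topology}) local_experiment" +
  Aop :: "nat \<Rightarrow> 'h \<Rightarrow>\<^sub>L 'h"
  Sigma_op :: "nat \<Rightarrow> 'h \<Rightarrow>\<^sub>L 'h"
  Kop :: "nat \<Rightarrow> 'h \<Rightarrow>\<^sub>L 'h"
  Qlaw :: "'p \<Rightarrow> 'q measure"
  xi :: "'q \<Rightarrow> nat \<Rightarrow> 'h"
  Hop :: "nat \<Rightarrow> 'h \<Rightarrow>\<^sub>L 'h"
  Bop :: "nat \<Rightarrow> 'h \<Rightarrow>\<^sub>L 'h"

definition gaussian_counterpart where
  "gaussian_counterpart E \<longleftrightarrow>
     (\<forall>m\<in>{1..comps E}.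
        Aop E m \<in> ops_on (hilb E m) \<and> Sigma_op E m \<in> ops_on (hilb E m) \<and> Kop E m \<in> ops_on (hilb E m) \<and>
        (\<forall>h\<in>hilb E m. \<forall>g\<in>hilb E m.
           blinfun_apply (Aop E m) h \<bullet> g = (\<integral>w. (Svec E m w \<bullet> h) * (Uvec E m w \<bullet> g) \<partial>P0 E m) \<and>
           blinfun_apply (Sigma_op E m) h \<bullet> g = (\<integral>w. (Uvec E m w \<bullet> h) * (Uvec E m w \<bullet> g) \<partial>P0 E m) \<and>
           blinfun_apply (Kop E m) h \<bullet> g = (\<integral>w. blinfun_apply (Vop E m w) h \<bullet> g \<partial>P0 E m))) \<and>
     (\<forall>\<theta>\<in>topspace (Theta E).
        prob_space (Qlaw E \<theta>) \<and> gaussian_dsum (Qlaw E \<theta>) (comps E) (hilb E) (Sigma_op E) (xi E))"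

definition directions where
  "directions E \<longleftrightarrow>
     (\<forall>m\<in>{1..comps E}.
        Hop E m \<in> ops_on (hilb E m) \<and> self_adjoint (Hop E m) \<and> Bop E m \<in> ops_on (hilb E m) \<and>
        range (blinfun_apply (Hop E m)) \<subseteq> range (blinfun_apply (Sigma_op E m)) \<and>
        Hop E m = Sigma_op E m o\<^sub>L Bop E m)"

definition Yproc where
  "Yproc E \<theta> t q =
     dsum_inner (comps E) (xi E q) (eta E t)
     + dsum_inner (comps E) (dsum_op (Aop E) (eta E \<theta>)) (eta E t)
     - 1/2 * dsum_inner (comps E) (dsum_op (Kop E) (eta E t)) (eta E t)"

definition Hquad where
  "Hquad E \<theta> t =
     dsum_inner (comps E) (dsum_op (Hop E) (eta E \<theta> - eta E t)) (eta E \<theta> - eta E t)"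

definition Ytilde where
  "Ytilde E a \<theta> t q =
     dsum_inner (comps E) (xi E q) (dsum_op (Bop E) (eta E t)) + a * Hquad E \<theta> t"

definition Ybeta where
  "Ybeta E a \<beta> \<theta> t q = Yproc E \<theta> t q + \<beta> * Ytilde E a \<theta> t q"

definition F_G where
  "F_G n E a \<theta> \<beta> =
     1 / real n * (\<integral>q. ln (\<integral>t. exp (Ybeta E a \<beta> \<theta> t q) \<partial>prior E) \<partial>Qlaw E \<theta>)"

definition phi where
  "phi E a \<theta> s t =
     a * Hquad E \<theta> t
     + dsum_inner (comps E) (dsum_op (Hop E) (eta E t)) (eta E t)
     - dsum_inner (comps E) (dsum_op (Hop E) (eta E s)) (eta E t)"

definition gibbs :: "'p measure \<Rightarrow> ('p \<Rightarrow> real) \<Rightarrow> 'p measure" where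
  "gibbs \<pi> Z = density \<pi> (\<lambda>t. ennreal (exp (Z t) / (\<integral>s. exp (Z s) \<partial>\<pi>)))"

text \<open>The expectation of a random measure is rendered by the monadic bind of measures.\<close>

definition mean_gibbs2 :: "'w measure \<Rightarrow> 'p measure \<Rightarrow> ('p \<Rightarrow> 'w \<Rightarrow> real) \<Rightarrow> ('p \<times> 'p) measure" where
  "mean_gibbs2 P \<pi> Z =
     Giry_Monad.bind P (\<lambda>\<omega>. gibbs \<pi> (\<lambda>t. Z t \<omega>) \<Otimes>\<^sub>M gibbs \<pi> (\<lambda>t. Z t \<omega>))"

definition Phi where
  "Phi n E a \<theta> =
     1 / real n * (\<integral>(s, t). phi E a \<theta> s t \<partial>mean_gibbs2 (Plaw E \<theta>) (prior E) (Xproc E))"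

definition Phi_G where
  "Phi_G n E a \<theta> =
     1 / real n * (\<integral>(s, t). phi E a \<theta> s t \<partial>mean_gibbs2 (Qlaw E \<theta>) (prior E) (Yproc E \<theta>))"

end

theory Submission
  imports Defs
begin

text \<open>Perturb the likelihood process in the same direction as the Gaussian one: let \<open>X\<^sub>\<beta>(t)\<close> be
\<open>X(t)\<close> plus \<open>\<beta>\<close> times the sum over the components of \<open>\<langle>U\<^sub>m - A\<^sub>m \<eta>\<^sub>m(\<theta>), B\<^sub>m \<eta>\<^sub>m(t)\<rangle>\<close>, plus
\<open>\<beta> a \<langle>H(\<eta>(\<theta>) - \<eta>(t)), \<eta>(\<theta>) - \<eta>(t)\<rangle>\<close>. Three facts give the theorem.

\<^item> \<^emph>\<open>The mean free energies of \<open>X\<^sub>\<beta>\<close> under \<open>P\<^sub>\<theta>\<close> and of \<open>Y\<^sub>\<beta>\<close> under \<open>Q\<^sub>\<theta>\<close> agree up to a small error.\<close> Both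
  exponents are deterministic functions plus sums of independent component fields, so the components
  can be exchanged one at a time (\<open>mean_logint_swap\<close>). Seen from one component, all the others
  merely replace the prior by some Gibbs measure \<open>\<mu>\<close>. For every probability measure \<open>\<mu>\<close>, a small
  random field with mean near \<open>0\<close> and covariance near \<open>c(s,t)\<close> has mean free energy close to half
  of \<open>\<integral> c(t,t) d\<mu> - \<integral>\<integral> c(s,t) d\<mu> d\<mu>\<close> (\<open>logint_average_expansion\<close>), with an error governed by third
  moments. The likelihood field of a component under \<open>P\<^sub>\<theta>\<close> and the Gaussian field share this
  covariance \<open>\<langle>\<Sigma> e(s), e(t)\<rangle>\<close>: passing from \<open>P\<^sub>0\<close> to \<open>P\<^sub>\<theta>\<close> shifts the mean of \<open>U\<close> by
  \<open>E\<^sub>0[\<langle>S, \<eta>(\<theta>)\<rangle> U] = A \<eta>(\<theta>)\<close>, and everything else is of third order. Hence one exchange costs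
  at most a constant times \<open>r\<^sup>2 \<delta> (1 + \<delta>)\<close>, and \<open>M r\<^sup>2 / n\<close> is bounded.

\<^item> \<^emph>\<open>The free energy of \<open>X\<^sub>\<beta>\<close> lies above a line whose slope is close to \<open>n \<Phi>\<close>.\<close> A log-partition function
  lies above its tangent (\<open>logint_tangent\<close>), whose slope is the Gibbs average of the perturbation.
  The same second-order expansion, applied to a Gibbs average, replaces the contribution of
  \<open>\<langle>U\<^sub>m - A\<^sub>m \<eta>\<^sub>m(\<theta>), B\<^sub>m \<eta>\<^sub>m(t)\<rangle>\<close> by the Gibbs average of \<open>\<langle>H\<^sub>m \<eta>\<^sub>m(t), \<eta>\<^sub>m(t)\<rangle> - \<langle>H\<^sub>m \<eta>\<^sub>m(s), \<eta>\<^sub>m(t)\<rangle>\<close> over two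
  replicas, because the covariance of \<open>\<langle>U, B \<eta>(s)\<rangle>\<close> and \<open>\<langle>U, \<eta>(t)\<rangle>\<close> is \<open>\<langle>\<Sigma> B \<eta>(s), \<eta>(t)\<rangle>\<close> and
  \<open>\<Sigma> B = H\<close>. This takes the place of Gaussian integration by parts (\<open>free_energy_tangent\<close>), and it
  applies to \<open>Y\<^sub>\<beta>\<close> and \<open>\<Phi>\<^sup>G\<close> as well.

\<^item> \<^emph>\<open>Griffiths' convexity argument.\<close> Together these give, for all small \<open>\<beta>\<close> of either sign,
  \<open>F\<^sup>G(\<theta>, \<beta>) - F\<^sup>G(\<theta>, 0) \<ge> \<beta> \<Phi>(\<theta>) - C \<delta> (1 + \<delta>)\<close> (\<open>free_energy_increment\<close>). After averaging over
  \<open>\<nu>\<^sub>n\<close> the error vanishes; dividing by \<open>\<beta>\<close>, letting \<open>n\<close> tend to infinity and then \<open>\<beta>\<close> to \<open>0\<close> from either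
  side yields the two bounds (\<open>griffiths_sandwich\<close>). The one-sided derivatives exist because the
  limit of the convex functions \<open>\<F>\<^sub>n\<^sup>G\<close> is convex.\<close>

section \<open>Log-partition functions and Gibbs measures\<close>

text \<open>The factor \<open>1 + exp z\<close> is the natural weight for a change of measure with density \<open>exp z\<close>: its
integral is a sum of one integral against each of the two measures, so that no exponential moment
has to be bounded.\<close>

lemma abs_exp_minus_one_le: "\<bar>exp z - 1\<bar> \<le> \<bar>z\<bar> * (1 + exp z)" for z :: real
proof (cases "z \<ge> 0")
  case True
  have "1 - z \<le> exp (- z)" using exp_ge_add_one_self[of "-z"] by simp
  then have "(1 - z) * exp z \<le> exp (-z) * exp z" by (rule mult_right_mono) simp
  then have "(1 - z) * exp z \<le> 1" by (simp add: exp_minus)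
  then have "exp z - 1 \<le> z * exp z" by (simp add: algebra_simps)
  then show ?thesis using True by (simp add: algebra_simps)
next
  case False
  have "1 + z \<le> exp z" by (rule exp_ge_add_one_self)
  moreover have "exp z \<le> 1" using False by simp
  moreover have "0 \<le> - z * exp z" using False by (simp add: mult_nonpos_nonneg)
  moreover have "\<bar>z\<bar> * (1 + exp z) = - z + - z * exp z" using False by (simp add: algebra_simps)
  ultimately show ?thesis by linarith
qed

lemma abs_exp_minus_linear_le: "\<bar>exp z - 1 - z\<bar> \<le> z\<^sup>2 * (1 + exp z)" for z :: real
proof -
  have ge: "0 \<le> exp z - 1 - z" using exp_ge_add_one_self[of z] by linarith
  have "exp z - 1 - z \<le> z\<^sup>2 * (1 + exp z)"
  proof (cases "z \<ge> 0")
    case True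
    have "(1 + z) * (1 - z) \<le> (1 + z) * exp (- z)"
      using exp_ge_add_one_self[of "-z"] True by (intro mult_left_mono) auto
    then have "(1 + z) * (1 - z) * exp z \<le> (1 + z) * exp (-z) * exp z"
      by (rule mult_right_mono) simp
    moreover have "exp (-z) * exp z = 1" by (simp add: exp_minus)
    ultimately have "(1 + z) * (1 - z) * exp z \<le> 1 + z" by (simp only: mult.assoc mult_1_right)
    then have "exp z - 1 - z \<le> z\<^sup>2 * exp z" by (simp add: algebra_simps power2_eq_square)
    also have "\<dots> \<le> z\<^sup>2 * (1 + exp z)" by (simp add: algebra_simps)
    finally show ?thesis .
  next
    case False
    have "(1 - z) * exp z \<le> exp (-z) * exp z"
      using exp_ge_add_one_self[of "-z"] by (intro mult_right_mono) auto
    then have *: "(1 - z) * exp z \<le> 1" by (simp add: exp_minus)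
    have "(1 - z) * (exp z - 1 - z) \<le> z\<^sup>2" using * by (simp add: algebra_simps power2_eq_square)
    moreover have "exp z - 1 - z \<le> (1 - z) * (exp z - 1 - z)"
      using ge False by (simp add: mult_le_cancel_right1)
    moreover have "z\<^sup>2 \<le> z\<^sup>2 * (1 + exp z)" by (simp add: algebra_simps)
    ultimately show ?thesis by linarith
  qed
  with ge show ?thesis by simp
qed

lemma exp_le_9: "exp y \<le> 9" if "y \<le> 2" for y :: real
proof -
  have "exp y \<le> exp (1 + 1)" using that by simp
  also have "\<dots> = exp 1 * exp (1::real)" by (rule exp_add)
  also have "\<dots> \<le> 3 * 3" using exp_le by (intro mult_mono) auto
  finally show ?thesis by simp
qed

lemma abs_exp_minus_quadratic_le:
  fixes y :: real
  assumes "\<bar>y\<bar> \<le> 2"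
  shows "\<bar>exp y - 1 - y - y\<^sup>2 / 2\<bar> \<le> 3/2 * \<bar>y\<bar> ^ 3"
proof -
  obtain t where t: "\<bar>t\<bar> \<le> \<bar>y\<bar>" "exp y = (\<Sum>m<3. y ^ m / fact m) + exp t / fact 3 * y ^ 3"
    using Maclaurin_exp_le[of y 3] by blast
  have "exp y - 1 - y - y\<^sup>2 / 2 = exp t / 6 * y ^ 3"
    using t(2) by (simp add: eval_nat_numeral fact_numeral)
  then have "\<bar>exp y - 1 - y - y\<^sup>2 / 2\<bar> = \<bar>exp t / 6 * y ^ 3\<bar>" by (rule arg_cong)
  also have "\<dots> = exp t / 6 * \<bar>y\<bar> ^ 3" by (simp add: abs_mult power_abs)
  also have "\<dots> \<le> 9 / 6 * \<bar>y\<bar> ^ 3"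
    using exp_le_9[of t] t(1) assms by (intro mult_right_mono) auto
  finally show ?thesis by simp
qed

lemma ln_one_plus_lower: "q - q\<^sup>2 \<le> ln (1 + q)" if "0 \<le> q" for q :: real
proof -
  have "ln (1 / (1 + q)) \<le> 1 / (1 + q) - 1" using that by (intro ln_le_minus_one) auto
  then have "1 - 1 / (1 + q) \<le> ln (1 + q)" using that by (simp add: ln_div)
  moreover have "q - q\<^sup>2 \<le> 1 - 1 / (1 + q)" using that
    by (simp add: field_simps power2_eq_square)
  ultimately show ?thesis by linarith
qed

definition logint :: "'p measure \<Rightarrow> ('p \<Rightarrow> real) \<Rightarrow> real" where
  "logint \<mu> f = ln (\<integral>t. exp (f t) \<partial>\<mu>)"

text \<open>The bound is a parameter because it is the quantity that the expansions are measured in; for a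
random field it becomes the envelope of \<open>dom_field\<close> below.\<close>

definition bdmeas :: "'p measure \<Rightarrow> real \<Rightarrow> ('p \<Rightarrow> real) \<Rightarrow> bool" where
  "bdmeas \<mu> B f \<longleftrightarrow> f \<in> borel_measurable \<mu> \<and> (\<forall>t\<in>space \<mu>. \<bar>f t\<bar> \<le> B)"

lemma bdmeasI: "f \<in> borel_measurable \<mu> \<Longrightarrow> (\<And>t. t \<in> space \<mu> \<Longrightarrow> \<bar>f t\<bar> \<le> B) \<Longrightarrow> bdmeas \<mu> B f"
  by (simp add: bdmeas_def)

lemma bdmeas_meas: "bdmeas \<mu> B f \<Longrightarrow> f \<in> borel_measurable \<mu>"
  by (simp add: bdmeas_def)

lemma bdmeas_bound: "bdmeas \<mu> B f \<Longrightarrow> t \<in> space \<mu> \<Longrightarrow> \<bar>f t\<bar> \<le> B"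
  by (simp add: bdmeas_def)

lemma bdmeas_add: "bdmeas \<mu> B f \<Longrightarrow> bdmeas \<mu> B' g \<Longrightarrow> bdmeas \<mu> (B + B') (\<lambda>t. f t + g t)"
  unfolding bdmeas_def by (auto intro: order_trans[OF abs_triangle_ineq] add_mono)

context prob_space begin

lemma bdmeas_nonneg: "bdmeas M B f \<Longrightarrow> 0 \<le> B"
  using not_empty unfolding bdmeas_def by (meson abs_ge_zero all_not_in_conv order_trans)

lemma bdmeas_integrable: "bdmeas M B f \<Longrightarrow> integrable M f"
  unfolding bdmeas_def by (intro integrable_const_bound[where B=B]) auto

lemma bdmeas_abs_integral: "bdmeas M B f \<Longrightarrow> \<bar>\<integral>t. f t \<partial>M\<bar> \<le> B"
proof -
  assume f: "bdmeas M B f"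
  have "\<bar>\<integral>t. f t \<partial>M\<bar> \<le> (\<integral>t. \<bar>f t\<bar> \<partial>M)" by (rule integral_abs_bound)
  also have "\<dots> \<le> (\<integral>t. B \<partial>M)"
    using bdmeas_integrable[OF f] bdmeas_bound[OF f] by (intro integral_mono) auto
  finally show ?thesis by (simp add: prob_space)
qed

lemma bdmeas_exp: "bdmeas M B f \<Longrightarrow> bdmeas M (exp B) (\<lambda>t. exp (f t))"
  unfolding bdmeas_def by (auto simp: abs_le_iff)

lemma bdmeas_mult: "bdmeas M B f \<Longrightarrow> bdmeas M B' g \<Longrightarrow> bdmeas M (B * B') (\<lambda>t. f t * g t)"
  using bdmeas_nonneg[of B f] by (intro bdmeasI) (auto simp: abs_mult dest: bdmeas_meas bdmeas_bound intro!: mult_mono borel_measurable_times)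

lemma bdmeas_expI: "bdmeas M B f \<Longrightarrow> integrable M (\<lambda>t. exp (f t))"
  by (rule bdmeas_integrable[OF bdmeas_exp])

lemma integral_ge_exp:
  assumes "bdmeas M B f"
  shows "exp (-B) \<le> (\<integral>t. exp (f t) \<partial>M)"
proof -
  have "(\<integral>t. exp (-B) \<partial>M) \<le> (\<integral>t. exp (f t) \<partial>M)"
    using assms bdmeas_expI[OF assms] by (intro integral_mono) (auto simp: bdmeas_def abs_le_iff)
  then show ?thesis by (simp add: prob_space)
qed

lemma integral_exp_pos: "bdmeas M B f \<Longrightarrow> 0 < (\<integral>t. exp (f t) \<partial>M)"
  using integral_ge_exp[of B f] exp_gt_zero[of "-B"] by linarith

lemma sets_gibbs: "sets (gibbs M f) = sets M" and space_gibbs: "space (gibbs M f) = space M"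
  by (simp_all add: gibbs_def)

lemma bdmeas_gibbs: "bdmeas (gibbs M f) B g \<longleftrightarrow> bdmeas M B g"
  unfolding bdmeas_def using measurable_cong_sets[OF sets_gibbs refl] by (auto simp: space_gibbs)

lemma integral_gibbs:
  assumes f: "bdmeas M B f" and g: "g \<in> borel_measurable M"
  shows "(\<integral>t. g t \<partial>gibbs M f) = (\<integral>t. g t * exp (f t) \<partial>M) / (\<integral>t. exp (f t) \<partial>M)"
proof -
  note [measurable] = bdmeas_meas[OF f] g
  have "(\<integral>t. g t \<partial>gibbs M f) = (\<integral>t. (exp (f t) / (\<integral>s. exp (f s) \<partial>M)) *\<^sub>R g t \<partial>M)"
    unfolding gibbs_def using integral_exp_pos[OF f]
    by (intro integral_density) auto
  also have "\<dots> = (\<integral>t. (g t * exp (f t)) / (\<integral>s. exp (f s) \<partial>M) \<partial>M)"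
    by (simp add: mult.commute)
  also have "\<dots> = (\<integral>t. g t * exp (f t) \<partial>M) / (\<integral>t. exp (f t) \<partial>M)" by (simp del: times_divide_eq_left)
  finally show ?thesis .
qed

lemma prob_space_gibbs:
  assumes f: "bdmeas M B f"
  shows "prob_space (gibbs M f)"
proof
  note [measurable] = bdmeas_meas[OF f]
  have "emeasure (gibbs M f) (space (gibbs M f))
      = (\<integral>\<^sup>+t. ennreal (exp (f t) / (\<integral>s. exp (f s) \<partial>M)) \<partial>M)"
    by (simp add: space_gibbs, simp add: gibbs_def emeasure_density cong: nn_integral_cong)
  also have "\<dots> = ennreal (\<integral>t. exp (f t) / (\<integral>s. exp (f s) \<partial>M) \<partial>M)"
    using bdmeas_expI[OF f] integral_exp_pos[OF f] by (intro nn_integral_eq_integral) auto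
  also have "\<dots> = 1" using integral_exp_pos[OF f] by simp
  finally show "emeasure (gibbs M f) (space (gibbs M f)) = 1" .
qed

text \<open>A Gibbs measure absorbs any part of the exponent. This is what lets one summand of a large sum be
treated as a perturbation of some prior, whatever the other summands are.\<close>

lemma logint_add:
  assumes f: "bdmeas M B f" and g: "bdmeas M B' g"
  shows "logint M (\<lambda>t. f t + g t) = logint M f + logint (gibbs M f) g"
proof -
  note [measurable] = bdmeas_meas[OF f] bdmeas_meas[OF g]
  have "(\<integral>t. exp (g t) \<partial>gibbs M f) = (\<integral>t. exp (f t + g t) \<partial>M) / (\<integral>t. exp (f t) \<partial>M)"
    by (subst integral_gibbs[OF f]) (auto simp: exp_add mult.commute)
  then show ?thesis
    using integral_exp_pos[OF f] integral_exp_pos[OF bdmeas_add[OF f g]]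
    by (simp add: logint_def ln_div)
qed

lemma gibbs_add:
  assumes f: "bdmeas M B f" and g: "bdmeas M B' g"
  shows "gibbs M (\<lambda>t. f t + g t) = gibbs (gibbs M f) g"
proof -
  note [measurable] = bdmeas_meas[OF f] bdmeas_meas[OF g]
  have Z: "(\<integral>t. exp (g t) \<partial>gibbs M f) = (\<integral>t. exp (f t + g t) \<partial>M) / (\<integral>t. exp (f t) \<partial>M)"
    by (subst integral_gibbs[OF f]) (auto simp: exp_add mult.commute)
  have "gibbs (gibbs M f) g = density M (\<lambda>t. ennreal (exp (f t) / (\<integral>s. exp (f s) \<partial>M)) *
        ennreal (exp (g t) / (\<integral>s. exp (g s) \<partial>gibbs M f)))"
    unfolding gibbs_def[of "gibbs M f"] unfolding gibbs_def[of M]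
    by (rule density_density_eq) auto
  also have "\<dots> = gibbs M (\<lambda>t. f t + g t)"
    unfolding gibbs_def Z using integral_exp_pos[OF f] integral_exp_pos[OF bdmeas_add[OF f g]]
    by (intro density_cong) (auto simp: gibbs_def[symmetric] Z ennreal_mult'[symmetric] exp_add field_simps)
  finally show ?thesis by simp
qed

lemma abs_logint_le:
  assumes f: "bdmeas M B f"
  shows "\<bar>logint M f\<bar> \<le> B"
proof -
  have "(\<integral>t. exp (f t) \<partial>M) \<le> exp B"
    using bdmeas_abs_integral[OF bdmeas_exp[OF f]] by linarith
  then have "ln (\<integral>t. exp (f t) \<partial>M) \<le> B"
    using integral_exp_pos[OF f] by (metis exp_gt_zero ln_exp ln_le_cancel_iff)
  moreover have "-B \<le> ln (\<integral>t. exp (f t) \<partial>M)"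
    using integral_ge_exp[OF f] integral_exp_pos[OF f] by (simp add: ln_ge_iff)
  ultimately show ?thesis by (simp add: logint_def)
qed

lemma logint_ge_integral:
  assumes f: "bdmeas M B f"
  shows "(\<integral>t. f t \<partial>M) \<le> logint M f"
proof -
  let ?m = "\<integral>t. f t \<partial>M"
  have "(\<integral>t. exp ?m * (1 + (f t - ?m)) \<partial>M) \<le> (\<integral>t. exp (f t) \<partial>M)"
  proof (rule integral_mono)
    fix t
    have "1 + (f t - ?m) \<le> exp (f t - ?m)" by (rule exp_ge_add_one_self)
    then have "exp ?m * (1 + (f t - ?m)) \<le> exp ?m * exp (f t - ?m)" by (rule mult_left_mono) simp
    then show "exp ?m * (1 + (f t - ?m)) \<le> exp (f t)" by (simp add: exp_diff)
  qed (use bdmeas_expI[OF f] bdmeas_integrable[OF f] in auto)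
  then have "exp ?m \<le> (\<integral>t. exp (f t) \<partial>M)"
    using bdmeas_integrable[OF f] by (simp add: prob_space)
  then show ?thesis using integral_exp_pos[OF f] by (simp add: logint_def ln_ge_iff)
qed

text \<open>Jensen's inequality for the measure \<open>gibbs M f\<close>: the log-partition function is convex, and Gibbs
averages are its slopes.\<close>

lemma logint_tangent:
  assumes f: "bdmeas M B f" and g: "bdmeas M B' g"
  shows "logint M f + (\<integral>t. g t \<partial>gibbs M f) \<le> logint M (\<lambda>t. f t + g t)"
proof -
  interpret G: prob_space "gibbs M f" by (rule prob_space_gibbs[OF f])
  show ?thesis using logint_add[OF f g] G.logint_ge_integral[of B' g] g by (simp add: bdmeas_gibbs)
qed

text \<open>Second-order cumulant expansion. If \<open>W \<ge> 1\<close> every term is trivially of order \<open>W\<^sup>3\<close>; otherwise the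
centred exponent is at most \<open>2\<close> in absolute value, and the Taylor bounds for \<open>exp\<close> and \<open>ln\<close> apply.
A bound that holds for every \<open>W\<close> can be averaged over a random \<open>W\<close> with a third moment.\<close>

lemma logint_expansion:
  assumes x: "bdmeas M W x"
  shows "\<bar>logint M x - (\<integral>t. x t \<partial>M) - ((\<integral>t. (x t)\<^sup>2 \<partial>M) - (\<integral>t. x t \<partial>M)\<^sup>2) / 2\<bar> \<le> 208 * W ^ 3"
proof -
  define m where "m = (\<integral>t. x t \<partial>M)"
  define v where "v = (\<integral>t. (x t)\<^sup>2 \<partial>M) - m\<^sup>2"
  have W: "0 \<le> W" by (rule bdmeas_nonneg[OF x])
  have mW: "\<bar>m\<bar> \<le> W" unfolding m_def by (rule bdmeas_abs_integral[OF x])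
  have x2: "bdmeas M (W * W) (\<lambda>t. (x t)\<^sup>2)" using bdmeas_mult[OF x x] by (simp add: power2_eq_square)
  define y where "y = (\<lambda>t. x t - m)"
  have y: "bdmeas M (2 * W) y"
    using bdmeas_add[OF x, of W "\<lambda>_. - m"] mW by (simp add: y_def bdmeas_def)
  have y2: "bdmeas M (2 * W * (2 * W)) (\<lambda>t. (y t)\<^sup>2)" using bdmeas_mult[OF y y] by (simp add: power2_eq_square)
  have iy: "(\<integral>t. y t \<partial>M) = 0"
    using bdmeas_integrable[OF x] by (simp add: y_def m_def prob_space)
  have "(\<integral>t. (y t)\<^sup>2 \<partial>M) = (\<integral>t. (x t)\<^sup>2 - 2 * m * x t + m\<^sup>2 \<partial>M)"
    by (simp add: y_def power2_diff algebra_simps)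
  also have "\<dots> = (\<integral>t. (x t)\<^sup>2 \<partial>M) - 2 * m * m + m\<^sup>2"
    using bdmeas_integrable[OF x] bdmeas_integrable[OF x2] by (simp add: prob_space m_def)
  finally have iy2: "(\<integral>t. (y t)\<^sup>2 \<partial>M) = v" by (simp add: v_def power2_eq_square)
  have v: "0 \<le> v" "v \<le> 4 * W\<^sup>2"
    using bdmeas_abs_integral[OF y2] iy2 by (auto simp flip: iy2 simp: power2_eq_square)
  have "\<bar>logint M x - m - v / 2\<bar> \<le> 208 * W ^ 3"
  proof (cases "W \<le> 1")
    case False
    then have "W \<le> W ^ 3" "W\<^sup>2 \<le> W ^ 3" using power_increasing[of 1 3 W] power_increasing[of 2 3 W] by auto
    then show ?thesis using abs_logint_le[OF x] mW v W by linarith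
  next
    case True
    define q where "q = (\<integral>t. exp (y t) \<partial>M) - 1"
    have iexpy: "integrable M (\<lambda>t. exp (y t))" by (rule bdmeas_expI[OF y])
    have "(\<integral>t. 1 + y t \<partial>M) \<le> (\<integral>t. exp (y t) \<partial>M)"
      using bdmeas_integrable[OF y] iexpy by (intro integral_mono) auto
    then have q0: "0 \<le> q" using bdmeas_integrable[OF y] iy by (simp add: q_def prob_space)
    have pt: "\<bar>exp (y t) - 1 - y t - (y t)\<^sup>2 / 2\<bar> \<le> 12 * W ^ 3" if t: "t \<in> space M" for t
    proof -
      have yt: "\<bar>y t\<bar> \<le> 2 * W" by (rule bdmeas_bound[OF y t])
      have "\<bar>exp (y t) - 1 - y t - (y t)\<^sup>2 / 2\<bar> \<le> 3/2 * \<bar>y t\<bar> ^ 3"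
        using yt True by (intro abs_exp_minus_quadratic_le) auto
      also have "\<dots> \<le> 3/2 * (2 * W) ^ 3" using yt by (intro mult_left_mono power_mono) auto
      finally show ?thesis by (simp add: power_mult_distrib)
    qed
    have "bdmeas M (12 * W ^ 3) (\<lambda>t. exp (y t) - 1 - y t - (y t)\<^sup>2 / 2)"
      using bdmeas_meas[OF y] pt by (intro bdmeasI) auto
    then have "\<bar>\<integral>t. exp (y t) - 1 - y t - (y t)\<^sup>2 / 2 \<partial>M\<bar> \<le> 12 * W ^ 3"
      by (rule bdmeas_abs_integral)
    also have "(\<integral>t. exp (y t) - 1 - y t - (y t)\<^sup>2 / 2 \<partial>M) = q - v / 2"
      using iexpy bdmeas_integrable[OF y] bdmeas_integrable[OF y2] iy iy2 by (simp add: q_def prob_space)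
    finally have qv: "\<bar>q - v / 2\<bar> \<le> 12 * W ^ 3" .
    have W32: "W ^ 3 \<le> W\<^sup>2" using power_decreasing[of 2 3 W] W True by simp
    have "q \<le> 14 * W\<^sup>2" using qv v W32 by linarith
    then have "q\<^sup>2 \<le> (14 * W\<^sup>2)\<^sup>2" using q0 by (intro power_mono) auto
    also have "\<dots> = 196 * W ^ 4" by (simp add: power_mult_distrib)
    also have "\<dots> \<le> 196 * W ^ 3" using power_decreasing[of 3 4 W] W True by simp
    finally have q2: "q\<^sup>2 \<le> 196 * W ^ 3" .
    have "(\<integral>t. exp (x t) \<partial>M) = (\<integral>t. exp m * exp (y t) \<partial>M)" by (simp add: y_def exp_add[symmetric])
    also have "\<dots> = exp m * (1 + q)" by (simp add: q_def)
    finally have L: "logint M x = m + ln (1 + q)" using q0 by (simp add: logint_def ln_mult)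
    have "ln (1 + q) \<le> q" using q0 by (intro ln_add_one_self_le_self) auto
    moreover have "q - q\<^sup>2 \<le> ln (1 + q)" by (rule ln_one_plus_lower[OF q0])
    ultimately show ?thesis using q2 qv L by linarith
  qed
  then show ?thesis by (simp add: m_def v_def)
qed

text \<open>The Gibbs average of \<open>w\<close> is the derivative of the log-partition function in the direction \<open>w\<close>;
accordingly the first correction is the covariance of \<open>w\<close> and the exponent. As above, large \<open>W\<close> is
covered by the trivial bound.\<close>

lemma gibbs_mean_expansion:
  assumes x: "bdmeas M W x" and w: "bdmeas M Ww w"
  shows "\<bar>(\<integral>t. w t \<partial>gibbs M x) - (\<integral>t. w t \<partial>M) - ((\<integral>t. w t * x t \<partial>M) - (\<integral>t. w t \<partial>M) * (\<integral>t. x t \<partial>M))\<bar>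
          \<le> 80 * Ww * W\<^sup>2"
proof -
  define m where "m = (\<integral>t. x t \<partial>M)"
  have W: "0 \<le> W" by (rule bdmeas_nonneg[OF x])
  have Ww: "0 \<le> Ww" by (rule bdmeas_nonneg[OF w])
  have mW: "\<bar>m\<bar> \<le> W" unfolding m_def by (rule bdmeas_abs_integral[OF x])
  define y where "y = (\<lambda>t. x t - m)"
  have y: "bdmeas M (2 * W) y"
    using bdmeas_add[OF x, of W "\<lambda>_. - m"] mW by (simp add: y_def bdmeas_def)
  have wy: "bdmeas M (Ww * (2 * W)) (\<lambda>t. w t * y t)" by (rule bdmeas_mult[OF w y])
  have wx: "integrable M (\<lambda>t. w t * x t)" by (rule bdmeas_integrable[OF bdmeas_mult[OF w x]])
  have iwy: "(\<integral>t. w t * y t \<partial>M) = (\<integral>t. w t * x t \<partial>M) - (\<integral>t. w t \<partial>M) * m"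
    using bdmeas_integrable[OF w] wx by (simp add: y_def right_diff_distrib)
  have iy: "(\<integral>t. y t \<partial>M) = 0"
    using bdmeas_integrable[OF x] by (simp add: y_def m_def prob_space)
  interpret G: prob_space "gibbs M x" by (rule prob_space_gibbs[OF x])
  have Gw: "\<bar>\<integral>t. w t \<partial>gibbs M x\<bar> \<le> Ww" using w by (intro G.bdmeas_abs_integral) (simp add: bdmeas_gibbs)
  have Mw: "\<bar>\<integral>t. w t \<partial>M\<bar> \<le> Ww" by (rule bdmeas_abs_integral[OF w])
  have "\<bar>(\<integral>t. w t \<partial>gibbs M x) - (\<integral>t. w t \<partial>M) - (\<integral>t. w t * y t \<partial>M)\<bar> \<le> 80 * Ww * W\<^sup>2"
  proof (cases "W \<le> 1")
    case False
    have 1: "Ww * W \<le> Ww * W\<^sup>2" using False Ww power_increasing[of 1 2 W] by (intro mult_left_mono) auto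
    have 2: "Ww * 1 \<le> Ww * W\<^sup>2" using False Ww power_increasing[of 0 2 W] by (intro mult_left_mono) auto
    have 3: "\<bar>\<integral>t. w t * y t \<partial>M\<bar> \<le> Ww * (2 * W)" by (rule bdmeas_abs_integral[OF wy])
    show ?thesis using 1 2 3 Gw Mw by (simp add: algebra_simps)
  next
    case True
    have ew: "bdmeas M (Ww * exp (2 * W)) (\<lambda>t. w t * exp (y t))"
      by (rule bdmeas_mult[OF w bdmeas_exp[OF y]])
    define q where "q = (\<integral>t. exp (y t) \<partial>M) - 1"
    define N where "N = (\<integral>t. w t * exp (y t) \<partial>M)"
    have iexpy: "integrable M (\<lambda>t. exp (y t))" by (rule bdmeas_expI[OF y])
    have pt: "\<bar>exp (y t) - 1 - y t\<bar> \<le> 40 * W\<^sup>2" if t: "t \<in> space M" for t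
    proof -
      have yt: "\<bar>y t\<bar> \<le> 2 * W" by (rule bdmeas_bound[OF y t])
      have "\<bar>exp (y t) - 1 - y t\<bar> \<le> (y t)\<^sup>2 * (1 + exp (y t))" by (rule abs_exp_minus_linear_le)
      also have "\<dots> \<le> (2 * W)\<^sup>2 * (1 + 9)"
        using yt True power_mono[OF yt, of 2] by (intro mult_mono add_mono exp_le_9) (auto simp: add_nonneg_nonneg)
      finally show ?thesis by (simp add: power_mult_distrib)
    qed
    have r: "bdmeas M (40 * W\<^sup>2) (\<lambda>t. exp (y t) - 1 - y t)"
      using bdmeas_meas[OF y] pt by (intro bdmeasI) auto
    have "\<bar>\<integral>t. exp (y t) - 1 - y t \<partial>M\<bar> \<le> 40 * W\<^sup>2" by (rule bdmeas_abs_integral[OF r])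
    also have "(\<integral>t. exp (y t) - 1 - y t \<partial>M) = q"
      using iexpy bdmeas_integrable[OF y] iy by (simp add: q_def prob_space)
    finally have q: "\<bar>q\<bar> \<le> 40 * W\<^sup>2" .
    have "\<bar>\<integral>t. w t * (exp (y t) - 1 - y t) \<partial>M\<bar> \<le> Ww * (40 * W\<^sup>2)"
      by (rule bdmeas_abs_integral[OF bdmeas_mult[OF w r]])
    also have "(\<integral>t. w t * (exp (y t) - 1 - y t) \<partial>M) = N - (\<integral>t. w t \<partial>M) - (\<integral>t. w t * y t \<partial>M)"
      using bdmeas_integrable[OF ew] bdmeas_integrable[OF w] bdmeas_integrable[OF wy]
      by (simp add: right_diff_distrib N_def)
    finally have N: "\<bar>N - (\<integral>t. w t \<partial>M) - (\<integral>t. w t * y t \<partial>M)\<bar> \<le> Ww * (40 * W\<^sup>2)" .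
    have gG: "(\<integral>t. w t \<partial>gibbs M x) = N / (1 + q)"
    proof -
      have a: "(\<integral>t. exp (x t) \<partial>M) = exp m * (1 + q)"
      proof -
        have "(\<integral>t. exp (x t) \<partial>M) = (\<integral>t. exp m * exp (y t) \<partial>M)" by (simp add: y_def exp_add[symmetric])
        then show ?thesis by (simp add: q_def)
      qed
      have b: "(\<integral>t. w t * exp (x t) \<partial>M) = exp m * N"
      proof -
        have "(\<integral>t. w t * exp (x t) \<partial>M) = (\<integral>t. exp m * (w t * exp (y t)) \<partial>M)"
          by (rule Bochner_Integration.integral_cong) (auto simp: y_def exp_diff)
        then show ?thesis by (simp add: N_def)
      qed
      show ?thesis using a b by (simp add: integral_gibbs[OF x bdmeas_meas[OF w]])
    qed
    have "0 < 1 + q" using integral_exp_pos[OF y] by (simp add: q_def)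
    then have "N / (1 + q) - N = - (N / (1 + q)) * q" by (simp add: field_simps)
    then have "\<bar>N / (1 + q) - N\<bar> = \<bar>N / (1 + q)\<bar> * \<bar>q\<bar>" by (simp only: abs_mult abs_minus_cancel)
    also have "\<dots> \<le> Ww * (40 * W\<^sup>2)"
      using Gw q Ww unfolding gG by (intro mult_mono) auto
    finally have "\<bar>N / (1 + q) - N\<bar> \<le> Ww * (40 * W\<^sup>2)" .
    then show ?thesis using N gG by linarith
  qed
  then show ?thesis by (simp add: iwy m_def algebra_simps)
qed

lemma gibbs_mean_perturb:
  assumes x: "bdmeas M W x" and g: "bdmeas M G g"
  shows "\<bar>(\<integral>t. g t \<partial>gibbs M x) - (\<integral>t. g t \<partial>M)\<bar> \<le> 20 * G * W"
proof -
  have W: "0 \<le> W" by (rule bdmeas_nonneg[OF x])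
  have G: "0 \<le> G" by (rule bdmeas_nonneg[OF g])
  interpret P: prob_space "gibbs M x" by (rule prob_space_gibbs[OF x])
  show ?thesis
  proof (cases "W \<le> 1")
    case False
    have "G * 1 \<le> G * W" using False G by (intro mult_left_mono) auto
    moreover have "\<bar>\<integral>t. g t \<partial>gibbs M x\<bar> \<le> G" using g by (intro P.bdmeas_abs_integral) (simp add: bdmeas_gibbs)
    moreover have "\<bar>\<integral>t. g t \<partial>M\<bar> \<le> G" by (rule bdmeas_abs_integral[OF g])
    ultimately show ?thesis using G by (simp add: algebra_simps)
  next
    case True
    let ?Z = "\<integral>t. exp (x t) \<partial>M"
    have Z: "0 < ?Z" by (rule integral_exp_pos[OF x])
    have pt: "\<bar>exp (x t) / ?Z - 1\<bar> \<le> 20 * W" if t: "t \<in> space M" for t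
    proof -
      have 1: "\<bar>x t - logint M x\<bar> \<le> 2 * W" using bdmeas_bound[OF x t] abs_logint_le[OF x] by linarith
      have "exp (x t) / ?Z = exp (x t - logint M x)" using Z by (simp add: logint_def exp_diff)
      then have "\<bar>exp (x t) / ?Z - 1\<bar> \<le> \<bar>x t - logint M x\<bar> * (1 + exp (x t - logint M x))"
        using abs_exp_minus_one_le by simp
      also have "\<dots> \<le> (2 * W) * (1 + 9)"
        using 1 True W by (intro mult_mono add_mono exp_le_9) (auto simp: add_nonneg_nonneg)
      finally show ?thesis by simp
    qed
    have r: "bdmeas M (20 * W) (\<lambda>t. exp (x t) / ?Z - 1)"
      using bdmeas_meas[OF x] pt by (intro bdmeasI) auto
    have "\<bar>\<integral>t. g t * (exp (x t) / ?Z - 1) \<partial>M\<bar> \<le> G * (20 * W)"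
      by (rule bdmeas_abs_integral[OF bdmeas_mult[OF g r]])
    also have "(\<integral>t. g t * (exp (x t) / ?Z - 1) \<partial>M) = (\<integral>t. g t * exp (x t) / ?Z \<partial>M) - (\<integral>t. g t \<partial>M)"
      using bdmeas_integrable[OF bdmeas_mult[OF g bdmeas_exp[OF x]]] bdmeas_integrable[OF g]
      by (simp add: right_diff_distrib)
    also have "(\<integral>t. g t * exp (x t) / ?Z \<partial>M) = (\<integral>t. g t \<partial>gibbs M x)"
      by (simp add: integral_gibbs[OF x bdmeas_meas[OF g]])
    finally show ?thesis by (simp add: mult_ac)
  qed
qed

end

section \<open>Random fields with an integrable envelope\<close>

text \<open>A jointly measurable field \<open>x t w\<close> with an envelope \<open>W w\<close>, uniform in \<open>t\<close>. Moments of the envelope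
control the error of the pointwise expansions after averaging over \<open>w\<close>.\<close>

definition dom_field :: "'t measure \<Rightarrow> 'w measure \<Rightarrow> ('w \<Rightarrow> real) \<Rightarrow> ('t \<Rightarrow> 'w \<Rightarrow> real) \<Rightarrow> bool" where
  "dom_field \<mu> N W x \<longleftrightarrow> (\<lambda>(t, w). x t w) \<in> borel_measurable (\<mu> \<Otimes>\<^sub>M N) \<and> W \<in> borel_measurable N \<and>
     (\<forall>t\<in>space \<mu>. \<forall>w\<in>space N. \<bar>x t w\<bar> \<le> W w)"

lemma dom_field_cong_sets:
  assumes "sets \<mu> = sets \<mu>'" "sets N = sets N'"
  shows "dom_field \<mu> N W x \<longleftrightarrow> dom_field \<mu>' N' W x"
proof -
  have "sets (\<mu> \<Otimes>\<^sub>M N) = sets (\<mu>' \<Otimes>\<^sub>M N')" using assms by (rule sets_pair_measure_cong)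
  then show ?thesis
    unfolding dom_field_def assms[THEN sets_eq_imp_space_eq]
      measurable_cong_sets[OF assms(2) refl] by (simp cong: measurable_cong_sets)
qed

lemma dom_field_bdmeas: "dom_field \<mu> N W x \<Longrightarrow> w \<in> space N \<Longrightarrow> bdmeas \<mu> (W w) (\<lambda>t. x t w)"
  unfolding dom_field_def by (auto intro!: bdmeasI)

lemma dom_field_measurable: "dom_field \<mu> N W x \<Longrightarrow> (\<lambda>(t, w). x t w) \<in> borel_measurable (\<mu> \<Otimes>\<^sub>M N)"
  by (simp add: dom_field_def)

lemma dom_field_section: "dom_field \<mu> N W x \<Longrightarrow> t \<in> space \<mu> \<Longrightarrow> x t \<in> borel_measurable N"
  unfolding dom_field_def by auto

lemma dom_field_bound: "dom_field \<mu> N W x \<Longrightarrow> t \<in> space \<mu> \<Longrightarrow> w \<in> space N \<Longrightarrow> \<bar>x t w\<bar> \<le> W w"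
  by (simp add: dom_field_def)

lemma dom_field_W: "dom_field \<mu> N W x \<Longrightarrow> W \<in> borel_measurable N"
  by (simp add: dom_field_def)

lemma dom_field_mult:
  assumes "dom_field \<mu> N W x" "dom_field \<mu> N W' y"
  shows "dom_field \<mu> N (\<lambda>w. W w * W' w) (\<lambda>t w. x t w * y t w)"
  using assms unfolding dom_field_def split_beta'
  by (auto simp: abs_mult intro!: mult_mono borel_measurable_times order_trans[OF abs_ge_zero])

lemma dom_field_add:
  assumes "dom_field \<mu> N W x" "dom_field \<mu> N W' y"
  shows "dom_field \<mu> N (\<lambda>w. W w + W' w) (\<lambda>t w. x t w + y t w)"
  using assms unfolding dom_field_def split_beta'
  by (auto intro!: order_trans[OF abs_triangle_ineq] add_mono borel_measurable_add)

lemma dom_field_cmult: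
  assumes "dom_field \<mu> N W x"
  shows "dom_field \<mu> N (\<lambda>w. \<bar>c\<bar> * W w) (\<lambda>t w. c * x t w)"
  using assms unfolding dom_field_def split_beta'
  by (auto simp: abs_mult intro!: mult_left_mono)

lemma dom_field_const:
  assumes "bdmeas \<mu> B b"
  shows "dom_field \<mu> N (\<lambda>_. B) (\<lambda>t w. b t)"
  using assms unfolding dom_field_def bdmeas_def by auto

locale two_probs = mu: prob_space \<mu> + N: prob_space N for \<mu> :: "'t measure" and N :: "'w measure"
begin

sublocale pair_prob_space \<mu> N ..

lemma dom_field_nonneg: "dom_field \<mu> N W x \<Longrightarrow> w \<in> space N \<Longrightarrow> 0 \<le> W w"
  using mu.not_empty unfolding dom_field_def by (meson abs_ge_zero all_not_in_conv order_trans)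

lemma dom_field_integrable:
  assumes x: "dom_field \<mu> N W x" and W: "integrable N W"
  shows "integrable (\<mu> \<Otimes>\<^sub>M N) (\<lambda>(t, w). x t w)"
proof (rule Bochner_Integration.integrable_bound)
  show "integrable (\<mu> \<Otimes>\<^sub>M N) (\<lambda>(t, w). W w)"
    using W by (intro Fubini_integrable) (auto simp: mu.prob_space)
  show "AE tw in \<mu> \<Otimes>\<^sub>M N. norm (case tw of (t, w) \<Rightarrow> x t w) \<le> norm (case tw of (t, w) \<Rightarrow> W w)"
    using x by (intro AE_I2) (auto simp: space_pair_measure dest: dom_field_bound intro: order_trans[OF _ abs_ge_self])
qed (rule dom_field_measurable[OF x])

lemma dom_field_swap:
  assumes x: "dom_field \<mu> N W x" and W: "integrable N W"
  shows "(\<integral>w. (\<integral>t. x t w \<partial>\<mu>) \<partial>N) = (\<integral>t. (\<integral>w. x t w \<partial>N) \<partial>\<mu>)"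
    and "integrable N (\<lambda>w. \<integral>t. x t w \<partial>\<mu>)" and "integrable \<mu> (\<lambda>t. \<integral>w. x t w \<partial>N)"
  using Fubini_integral[OF dom_field_integrable[OF x W]] integrable_snd[OF dom_field_integrable[OF x W]]
    integrable_fst[OF dom_field_integrable[OF x W]] by auto

lemma average_close:
  assumes x: "dom_field \<mu> N W x" and W: "integrable N W" and c: "integrable \<mu> c"
    and close: "\<And>t. t \<in> space \<mu> \<Longrightarrow> \<bar>(\<integral>w. x t w \<partial>N) - c t\<bar> \<le> e"
  shows "\<bar>(\<integral>w. (\<integral>t. x t w \<partial>\<mu>) \<partial>N) - (\<integral>t. c t \<partial>\<mu>)\<bar> \<le> e"
proof -
  note i = dom_field_swap[OF x W]
  have "\<bar>(\<integral>t. (\<integral>w. x t w \<partial>N) - c t \<partial>\<mu>)\<bar> \<le> (\<integral>t. \<bar>(\<integral>w. x t w \<partial>N) - c t\<bar> \<partial>\<mu>)"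
    by (rule integral_abs_bound)
  also have "\<dots> \<le> (\<integral>t. e \<partial>\<mu>)" using i(3) c close by (intro integral_mono) auto
  finally show ?thesis using i c by (simp add: mu.prob_space)
qed

text \<open>Products of two averages over \<open>\<mu>\<close> are averages over two replicas, so a bound on the mean of
\<open>x s w * y t w\<close> for all pairs of points suffices.\<close>

lemma average_close2:
  assumes x: "dom_field \<mu> N W x" and y: "dom_field \<mu> N W' y" and W: "integrable N (\<lambda>w. W w * W' w)"
    and c: "integrable (\<mu> \<Otimes>\<^sub>M \<mu>) (\<lambda>(s, t). c s t)"
    and cs: "\<And>s. s \<in> space \<mu> \<Longrightarrow> integrable \<mu> (c s)"
    and close: "\<And>s t. s \<in> space \<mu> \<Longrightarrow> t \<in> space \<mu> \<Longrightarrow> \<bar>(\<integral>w. x s w * y t w \<partial>N) - c s t\<bar> \<le> e"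
  shows "\<bar>(\<integral>w. (\<integral>s. x s w \<partial>\<mu>) * (\<integral>t. y t w \<partial>\<mu>) \<partial>N) - (\<integral>s. (\<integral>t. c s t \<partial>\<mu>) \<partial>\<mu>)\<bar> \<le> e"
proof -
  interpret mm: pair_prob_space \<mu> \<mu> ..
  define z where "z = (\<lambda>s w. x s w * (\<integral>t. y t w \<partial>\<mu>))"
  have ym: "(\<lambda>w. \<integral>t. y t w \<partial>\<mu>) \<in> borel_measurable N"
  proof -
    have [measurable]: "(\<lambda>(w, t). y t w) \<in> borel_measurable (N \<Otimes>\<^sub>M \<mu>)"
      using measurable_pair_swap[OF dom_field_measurable[OF y]] by (simp add: split_beta')
    show ?thesis by (rule mu.borel_measurable_lebesgue_integral) measurable
  qed
  have z: "dom_field \<mu> N (\<lambda>w. W w * W' w) z"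
    unfolding z_def
  proof (rule dom_field_mult[OF x])
    show "dom_field \<mu> N W' (\<lambda>t w. \<integral>t. y t w \<partial>\<mu>)"
      using ym dom_field_W[OF y] mu.bdmeas_abs_integral[OF dom_field_bdmeas[OF y]]
      by (auto simp: dom_field_def)
  qed
  have "\<bar>(\<integral>w. (\<integral>s. z s w \<partial>\<mu>) \<partial>N) - (\<integral>s. (\<integral>t. c s t \<partial>\<mu>) \<partial>\<mu>)\<bar> \<le> e"
  proof (rule average_close[OF z W])
    show "integrable \<mu> (\<lambda>s. \<integral>t. c s t \<partial>\<mu>)" using mm.integrable_fst[OF c] by simp
    fix s assume s: "s \<in> space \<mu>"
    have xs: "dom_field \<mu> N W (\<lambda>t. x s)"
      using dom_field_section[OF x s] dom_field_bound[OF x s] dom_field_W[OF x] by (auto simp: dom_field_def)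
    have "\<bar>(\<integral>w. (\<integral>t. x s w * y t w \<partial>\<mu>) \<partial>N) - (\<integral>t. c s t \<partial>\<mu>)\<bar> \<le> e"
      by (rule average_close[OF dom_field_mult[OF xs y] W cs[OF s] close[OF s]])
    then show "\<bar>(\<integral>w. z s w \<partial>N) - (\<integral>t. c s t \<partial>\<mu>)\<bar> \<le> e" by (simp add: z_def)
  qed
  then show ?thesis by (simp add: z_def)
qed

lemma logint_measurable:
  assumes x: "(\<lambda>(t, w). x t w) \<in> borel_measurable (\<mu> \<Otimes>\<^sub>M N)"
  shows "(\<lambda>w. logint \<mu> (\<lambda>t. x t w)) \<in> borel_measurable N"
proof -
  have [measurable]: "(\<lambda>(w, t). x t w) \<in> borel_measurable (N \<Otimes>\<^sub>M \<mu>)"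
    using measurable_pair_swap[OF x] by (simp add: split_beta')
  have [measurable]: "(\<lambda>w. \<integral>t. exp (x t w) \<partial>\<mu>) \<in> borel_measurable N"
    by (rule mu.borel_measurable_lebesgue_integral) measurable
  show ?thesis unfolding logint_def by measurable
qed

lemma gibbs_integral_measurable:
  fixes f :: "'t \<Rightarrow> 'w \<Rightarrow> real"
  assumes x: "dom_field \<mu> N W x" and f: "(\<lambda>(t, w). f t w) \<in> borel_measurable (\<mu> \<Otimes>\<^sub>M N)"
  shows "(\<lambda>w. \<integral>t. f t w \<partial>gibbs \<mu> (\<lambda>t. x t w)) \<in> borel_measurable N"
proof -
  have [measurable]: "(\<lambda>(w, t). x t w) \<in> borel_measurable (N \<Otimes>\<^sub>M \<mu>)"
    using measurable_pair_swap[OF dom_field_measurable[OF x]] by (simp add: split_beta')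
  have [measurable]: "(\<lambda>(w, t). f t w) \<in> borel_measurable (N \<Otimes>\<^sub>M \<mu>)"
    using measurable_pair_swap[OF f] by (simp add: split_beta')
  have 1: "(\<lambda>w. \<integral>t. exp (x t w) \<partial>\<mu>) \<in> borel_measurable N"
    by (rule mu.borel_measurable_lebesgue_integral) measurable
  have 2: "(\<lambda>w. \<integral>t. f t w * exp (x t w) \<partial>\<mu>) \<in> borel_measurable N"
    by (rule mu.borel_measurable_lebesgue_integral) measurable
  have "(\<lambda>w. (\<integral>t. f t w * exp (x t w) \<partial>\<mu>) / (\<integral>t. exp (x t w) \<partial>\<mu>)) \<in> borel_measurable N"
    using 1 2 by measurable
  then show ?thesis
    using f by (subst measurable_cong) (auto simp: mu.integral_gibbs[OF dom_field_bdmeas[OF x]])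
qed

lemma logint_integrable:
  assumes x: "dom_field \<mu> N W x" and W: "integrable N W"
  shows "integrable N (\<lambda>w. logint \<mu> (\<lambda>t. x t w))"
    and "\<bar>\<integral>w. logint \<mu> (\<lambda>t. x t w) \<partial>N\<bar> \<le> (\<integral>w. W w \<partial>N)"
proof -
  have b: "\<bar>logint \<mu> (\<lambda>t. x t w)\<bar> \<le> W w" if "w \<in> space N" for w
    by (rule mu.abs_logint_le[OF dom_field_bdmeas[OF x that]])
  show i: "integrable N (\<lambda>w. logint \<mu> (\<lambda>t. x t w))"
    by (rule Bochner_Integration.integrable_bound[OF W logint_measurable[OF dom_field_measurable[OF x]]])
      (auto intro: order_trans[OF b abs_ge_self])
  have "\<bar>\<integral>w. logint \<mu> (\<lambda>t. x t w) \<partial>N\<bar> \<le> (\<integral>w. \<bar>logint \<mu> (\<lambda>t. x t w)\<bar> \<partial>N)" by (rule integral_abs_bound)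
  also have "\<dots> \<le> (\<integral>w. W w \<partial>N)" using i W b by (intro integral_mono) auto
  finally show "\<bar>\<integral>w. logint \<mu> (\<lambda>t. x t w) \<partial>N\<bar> \<le> (\<integral>w. W w \<partial>N)" .
qed

lemma integrable_powers:
  fixes W :: "'w \<Rightarrow> real"
  assumes [measurable]: "W \<in> borel_measurable N" and nonneg: "\<And>w. w \<in> space N \<Longrightarrow> 0 \<le> W w"
    and W3: "integrable N (\<lambda>w. W w ^ 3)"
  shows "integrable N W" "integrable N (\<lambda>w. W w * W w)"
proof -
  have 1: "(x::real) \<le> 1 + x ^ 3" "x * x \<le> 1 + x ^ 3" if "0 \<le> x" for x
  proof -
    have "x \<le> 1 \<or> x \<le> x ^ 3" using power_increasing[of 1 3 x] by force
    then show "x \<le> 1 + x ^ 3" using that zero_le_power[OF that, of 3] by linarith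
    have "x\<^sup>2 \<le> 1 \<or> x\<^sup>2 \<le> x ^ 3" using power_increasing[of 2 3 x] power_le_one[OF that, of 2] by force
    then show "x * x \<le> 1 + x ^ 3"
      using that zero_le_power[OF that, of 3] unfolding power2_eq_square by linarith
  qed
  have i: "integrable N (\<lambda>w. 1 + W w ^ 3)" using W3 by simp
  show "integrable N W" "integrable N (\<lambda>w. W w * W w)"
    using 1 nonneg by (auto intro!: Bochner_Integration.integrable_bound[OF i] AE_I2)
qed

end

definition bdkernel :: "'t measure \<Rightarrow> real \<Rightarrow> ('t \<Rightarrow> 't \<Rightarrow> real) \<Rightarrow> bool" where
  "bdkernel \<mu> B c \<longleftrightarrow> bdmeas (\<mu> \<Otimes>\<^sub>M \<mu>) B (\<lambda>(s, t). c s t)"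

text \<open>For the covariance kernel \<open>c\<close> of a centred random field, this is the mean of the variance of
the field under \<open>\<mu>\<close>.\<close>

definition diag_excess :: "'t measure \<Rightarrow> ('t \<Rightarrow> 't \<Rightarrow> real) \<Rightarrow> real" where
  "diag_excess \<mu> c = (\<integral>t. c t t \<partial>\<mu>) - (\<integral>s. (\<integral>t. c s t \<partial>\<mu>) \<partial>\<mu>)"

lemma bdkernel_cong_sets: "sets \<mu> = sets \<mu>' \<Longrightarrow> bdkernel \<mu> B c \<longleftrightarrow> bdkernel \<mu>' B c"
  unfolding bdkernel_def bdmeas_def
  by (auto simp: space_pair_measure dest: sets_eq_imp_space_eq cong: measurable_cong_sets sets_pair_measure_cong)

lemma bdkernelD:
  assumes "bdkernel \<mu> B c"
  shows bdkernel_measurable: "(\<lambda>(s, t). c s t) \<in> borel_measurable (\<mu> \<Otimes>\<^sub>M \<mu>)"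
    and bdkernel_section: "s \<in> space \<mu> \<Longrightarrow> bdmeas \<mu> B (c s)"
    and bdkernel_diag: "bdmeas \<mu> B (\<lambda>t. c t t)"
proof -
  show 1: "(\<lambda>(s, t). c s t) \<in> borel_measurable (\<mu> \<Otimes>\<^sub>M \<mu>)" using assms by (simp add: bdkernel_def bdmeas_def)
  show "s \<in> space \<mu> \<Longrightarrow> bdmeas \<mu> B (c s)"
    using assms measurable_compose[OF measurable_Pair1' 1]
    by (auto simp: bdkernel_def bdmeas_def space_pair_measure)
  have "(\<lambda>t. (t, t)) \<in> measurable \<mu> (\<mu> \<Otimes>\<^sub>M \<mu>)" by measurable
  from measurable_compose[OF this 1] show "bdmeas \<mu> B (\<lambda>t. c t t)"
    using assms by (auto simp: bdkernel_def bdmeas_def space_pair_measure)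
qed

context prob_space begin

lemma bdkernel_inner:
  assumes "bdkernel M B c" shows "bdmeas M B (\<lambda>s. \<integral>t. c s t \<partial>M)"
proof (rule bdmeasI)
  show "(\<lambda>s. \<integral>t. c s t \<partial>M) \<in> borel_measurable M"
    by (rule borel_measurable_lebesgue_integral[OF bdkernel_measurable[OF assms]])
qed (use bdmeas_abs_integral[OF bdkernel_section[OF assms]] in auto)

lemma abs_diag_excess_le:
  assumes "bdkernel M B c" shows "\<bar>diag_excess M c\<bar> \<le> 2 * B"
  using bdmeas_abs_integral[OF bdkernel_diag[OF assms]] bdmeas_abs_integral[OF bdkernel_inner[OF assms]]
  unfolding diag_excess_def by linarith

lemma diag_excess_perturb:
  assumes x: "bdmeas M W x" and c: "bdkernel M B c"
  shows "\<bar>diag_excess (gibbs M x) c - diag_excess M c\<bar> \<le> 60 * B * W"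
proof -
  interpret G: prob_space "gibbs M x" by (rule prob_space_gibbs[OF x])
  have cG: "bdkernel (gibbs M x) B c" using c bdkernel_cong_sets[OF sets_gibbs] by blast
  have 1: "\<bar>(\<integral>t. c t t \<partial>gibbs M x) - (\<integral>t. c t t \<partial>M)\<bar> \<le> 20 * B * W"
    by (rule gibbs_mean_perturb[OF x bdkernel_diag[OF c]])
  let ?i = "\<lambda>s. \<integral>t. c s t \<partial>M" and ?j = "\<lambda>s. \<integral>t. c s t \<partial>gibbs M x"
  have i: "bdmeas M B ?i" by (rule bdkernel_inner[OF c])
  have j: "bdmeas M B ?j" using G.bdkernel_inner[OF cG] by (simp add: bdmeas_gibbs)
  have 2: "\<bar>(\<integral>s. ?i s \<partial>gibbs M x) - (\<integral>s. ?i s \<partial>M)\<bar> \<le> 20 * B * W"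
    by (rule gibbs_mean_perturb[OF x i])
  have "bdmeas (gibbs M x) (20 * B * W) (\<lambda>s. ?j s - ?i s)"
    using gibbs_mean_perturb[OF x bdkernel_section[OF c]] bdmeas_meas[OF i] bdmeas_meas[OF j]
    by (auto simp: bdmeas_gibbs intro!: bdmeasI)
  then have "\<bar>\<integral>s. ?j s - ?i s \<partial>gibbs M x\<bar> \<le> 20 * B * W" by (rule G.bdmeas_abs_integral)
  also have "(\<integral>s. ?j s - ?i s \<partial>gibbs M x) = (\<integral>s. ?j s \<partial>gibbs M x) - (\<integral>s. ?i s \<partial>gibbs M x)"
    using i j by (intro Bochner_Integration.integral_diff G.bdmeas_integrable) (auto simp: bdmeas_gibbs)
  finally show ?thesis using 1 2 unfolding diag_excess_def by linarith
qed

end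

context two_probs begin

lemma gibbs_field_integrable:
  assumes x: "dom_field \<mu> N W x" and w: "dom_field \<mu> N V v" and V: "integrable N V"
  shows "integrable N (\<lambda>w. \<integral>t. v t w \<partial>gibbs \<mu> (\<lambda>t. x t w))"
    and "\<bar>\<integral>w. (\<integral>t. v t w \<partial>gibbs \<mu> (\<lambda>t. x t w)) \<partial>N\<bar> \<le> (\<integral>w. V w \<partial>N)"
proof -
  have b: "\<bar>\<integral>t. v t w \<partial>gibbs \<mu> (\<lambda>t. x t w)\<bar> \<le> V w" if w': "w \<in> space N" for w
  proof -
    interpret G: prob_space "gibbs \<mu> (\<lambda>t. x t w)" by (rule mu.prob_space_gibbs[OF dom_field_bdmeas[OF x w']])
    show ?thesis using dom_field_bdmeas[OF w w'] by (intro G.bdmeas_abs_integral) (simp add: mu.bdmeas_gibbs)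
  qed
  show i: "integrable N (\<lambda>w. \<integral>t. v t w \<partial>gibbs \<mu> (\<lambda>t. x t w))"
    by (rule Bochner_Integration.integrable_bound[OF V gibbs_integral_measurable[OF x dom_field_measurable[OF w]]])
      (auto intro: order_trans[OF b abs_ge_self])
  have "\<bar>\<integral>w. (\<integral>t. v t w \<partial>gibbs \<mu> (\<lambda>t. x t w)) \<partial>N\<bar> \<le> (\<integral>w. \<bar>\<integral>t. v t w \<partial>gibbs \<mu> (\<lambda>t. x t w)\<bar> \<partial>N)"
    by (rule integral_abs_bound)
  also have "\<dots> \<le> (\<integral>w. V w \<partial>N)" using i V b by (intro integral_mono) auto
  finally show "\<bar>\<integral>w. (\<integral>t. v t w \<partial>gibbs \<mu> (\<lambda>t. x t w)) \<partial>N\<bar> \<le> (\<integral>w. V w \<partial>N)" .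
qed

lemma diag_excess_gibbs_measurable:
  assumes x: "dom_field \<mu> N W x" and c: "bdkernel \<mu> B c"
  shows "(\<lambda>w. diag_excess (gibbs \<mu> (\<lambda>t. x t w)) c) \<in> borel_measurable N"
proof -
  have cd: "(\<lambda>(t, w). c t t) \<in> borel_measurable (\<mu> \<Otimes>\<^sub>M N)"
    using bdmeas_meas[OF bdkernel_diag[OF c]] by measurable
  have [measurable]: "(\<lambda>(t, w). x t w) \<in> borel_measurable (\<mu> \<Otimes>\<^sub>M N)" by (rule dom_field_measurable[OF x])
  have [measurable]: "(\<lambda>(s, t). c s t) \<in> borel_measurable (\<mu> \<Otimes>\<^sub>M \<mu>)" by (rule bdkernel_measurable[OF c])
  have "(\<lambda>p. \<integral>t. c (fst p) t * exp (x t (snd p)) \<partial>\<mu>) \<in> borel_measurable (\<mu> \<Otimes>\<^sub>M N)"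
    by (rule mu.borel_measurable_lebesgue_integral) measurable
  moreover have "(\<lambda>p. \<integral>t. exp (x t (snd p)) \<partial>\<mu>) \<in> borel_measurable (\<mu> \<Otimes>\<^sub>M N)"
    by (rule mu.borel_measurable_lebesgue_integral) measurable
  ultimately have "(\<lambda>p. (\<integral>t. c (fst p) t * exp (x t (snd p)) \<partial>\<mu>) / (\<integral>t. exp (x t (snd p)) \<partial>\<mu>)) \<in> borel_measurable (\<mu> \<Otimes>\<^sub>M N)"
    by measurable
  moreover have "(\<integral>t. c (fst p) t \<partial>gibbs \<mu> (\<lambda>t. x t (snd p))) =
      (\<integral>t. c (fst p) t * exp (x t (snd p)) \<partial>\<mu>) / (\<integral>t. exp (x t (snd p)) \<partial>\<mu>)" if "p \<in> space (\<mu> \<Otimes>\<^sub>M N)" for p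
    using that bdmeas_meas[OF bdkernel_section[OF c]]
    by (intro mu.integral_gibbs[OF dom_field_bdmeas[OF x]]) (auto simp: space_pair_measure)
  ultimately have ci: "(\<lambda>(s, w). \<integral>t. c s t \<partial>gibbs \<mu> (\<lambda>t. x t w)) \<in> borel_measurable (\<mu> \<Otimes>\<^sub>M N)"
    unfolding split_beta' by (simp cong: measurable_cong)
  show ?thesis unfolding diag_excess_def
    using gibbs_integral_measurable[OF x cd] gibbs_integral_measurable[OF x ci] by (rule borel_measurable_diff)
qed

lemma diag_excess_gibbs_integrable:
  assumes x: "dom_field \<mu> N W x" and c: "bdkernel \<mu> B c"
  shows "integrable N (\<lambda>w. diag_excess (gibbs \<mu> (\<lambda>t. x t w)) c)"
    and "\<bar>\<integral>w. diag_excess (gibbs \<mu> (\<lambda>t. x t w)) c \<partial>N\<bar> \<le> 2 * B"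
proof -
  have "bdmeas N (2 * B) (\<lambda>w. diag_excess (gibbs \<mu> (\<lambda>t. x t w)) c)"
  proof (rule bdmeasI[OF diag_excess_gibbs_measurable[OF x c]])
    fix w assume w: "w \<in> space N"
    interpret G: prob_space "gibbs \<mu> (\<lambda>t. x t w)" by (rule mu.prob_space_gibbs[OF dom_field_bdmeas[OF x w]])
    show "\<bar>diag_excess (gibbs \<mu> (\<lambda>t. x t w)) c\<bar> \<le> 2 * B"
      using c bdkernel_cong_sets[OF mu.sets_gibbs] by (intro G.abs_diag_excess_le) blast
  qed
  then show "integrable N (\<lambda>w. diag_excess (gibbs \<mu> (\<lambda>t. x t w)) c)"
    and "\<bar>\<integral>w. diag_excess (gibbs \<mu> (\<lambda>t. x t w)) c \<partial>N\<bar> \<le> 2 * B"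
    by (rule N.bdmeas_integrable, rule N.bdmeas_abs_integral)
qed

text \<open>The pointwise expansion is averaged over \<open>w\<close>: its mean term disappears since the field is nearly
centred, and its variance term becomes the excess of the covariance kernel. Only the mean and
the covariance of the field enter, which is the source of the universality.\<close>

lemma logint_average_expansion:
  assumes x: "dom_field \<mu> N W x" and W3: "integrable N (\<lambda>w. W w ^ 3)" "(\<integral>w. W w ^ 3 \<partial>N) \<le> e"
    and c: "bdkernel \<mu> B c"
    and mean: "\<And>t. t \<in> space \<mu> \<Longrightarrow> \<bar>\<integral>w. x t w \<partial>N\<bar> \<le> e"
    and cov: "\<And>s t. s \<in> space \<mu> \<Longrightarrow> t \<in> space \<mu> \<Longrightarrow> \<bar>(\<integral>w. x s w * x t w \<partial>N) - c s t\<bar> \<le> e"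
  shows "\<bar>(\<integral>w. logint \<mu> (\<lambda>t. x t w) \<partial>N) - diag_excess \<mu> c / 2\<bar> \<le> 210 * e"
proof -
  interpret mm: pair_prob_space \<mu> \<mu> ..
  note W = integrable_powers[OF dom_field_W[OF x] dom_field_nonneg[OF x] W3(1)]
  have x2: "dom_field \<mu> N (\<lambda>w. W w * W w) (\<lambda>t w. x t w * x t w)" by (rule dom_field_mult[OF x x])
  define m1 where "m1 = (\<lambda>w. \<integral>t. x t w \<partial>\<mu>)"
  define m2 where "m2 = (\<lambda>w. \<integral>t. x t w * x t w \<partial>\<mu>)"
  have i1: "integrable N m1" unfolding m1_def by (rule dom_field_swap(2)[OF x W(1)])
  have i2: "integrable N m2" unfolding m2_def by (rule dom_field_swap(2)[OF x2 W(2)])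
  have i11: "integrable N (\<lambda>w. m1 w * m1 w)"
  proof (rule Bochner_Integration.integrable_bound[OF W(2)])
    show "AE w in N. norm (m1 w * m1 w) \<le> norm (W w * W w)"
    proof (rule AE_I2)
      fix w assume w: "w \<in> space N"
      have "\<bar>m1 w\<bar> \<le> W w" unfolding m1_def by (rule mu.bdmeas_abs_integral[OF dom_field_bdmeas[OF x w]])
      then have "\<bar>m1 w\<bar> * \<bar>m1 w\<bar> \<le> W w * W w" by (intro mult_mono) auto
      then show "norm (m1 w * m1 w) \<le> norm (W w * W w)" by (simp add: abs_mult)
    qed
  qed (use i1 in measurable)
  have il: "integrable N (\<lambda>w. logint \<mu> (\<lambda>t. x t w))" by (rule logint_integrable(1)[OF x W(1)])
  have "\<bar>\<integral>w. logint \<mu> (\<lambda>t. x t w) - m1 w - (m2 w - m1 w * m1 w) / 2 \<partial>N\<bar> \<le>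
      (\<integral>w. \<bar>logint \<mu> (\<lambda>t. x t w) - m1 w - (m2 w - m1 w * m1 w) / 2\<bar> \<partial>N)" by (rule integral_abs_bound)
  also have "\<dots> \<le> (\<integral>w. 208 * W w ^ 3 \<partial>N)"
    using i1 i2 i11 il W3(1) mu.logint_expansion[OF dom_field_bdmeas[OF x]]
    by (intro integral_mono) (auto simp: m1_def m2_def power2_eq_square)
  also have "\<dots> \<le> 208 * e" using W3 by simp
  finally have 1: "\<bar>(\<integral>w. logint \<mu> (\<lambda>t. x t w) \<partial>N) - (\<integral>w. m1 w \<partial>N) - ((\<integral>w. m2 w \<partial>N) - (\<integral>w. m1 w * m1 w \<partial>N)) / 2\<bar> \<le> 208 * e"
    using i1 i2 i11 il by simp
  have 2: "\<bar>\<integral>w. m1 w \<partial>N\<bar> \<le> e"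
    using average_close[OF x W(1), of "\<lambda>_. 0" e] mean by (simp add: m1_def)
  have 3: "\<bar>(\<integral>w. m2 w \<partial>N) - (\<integral>t. c t t \<partial>\<mu>)\<bar> \<le> e"
    unfolding m2_def by (rule average_close[OF x2 W(2) mu.bdmeas_integrable[OF bdkernel_diag[OF c]] cov])
  have 4: "\<bar>(\<integral>w. m1 w * m1 w \<partial>N) - (\<integral>s. (\<integral>t. c s t \<partial>\<mu>) \<partial>\<mu>)\<bar> \<le> e"
    unfolding m1_def
    by (rule average_close2[OF x x W(2) mm.bdmeas_integrable mu.bdmeas_integrable[OF bdkernel_section[OF c]] cov])
      (use c in \<open>auto simp: bdkernel_def\<close>)
  have "\<bar>L - (p - q) / 2\<bar> \<le> 210 * e"
    if "\<bar>L - a - (b - d) / 2\<bar> \<le> 208 * e" "\<bar>a\<bar> \<le> e" "\<bar>b - p\<bar> \<le> e" "\<bar>d - q\<bar> \<le> e" for L a b d p q :: real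
    using that unfolding abs_le_iff by (simp add: field_simps)
  from this[OF 1 2 3 4] show ?thesis unfolding diag_excess_def .
qed

text \<open>For large fields the expansion is worthless, but then every term is already of the size of the
admissible error.\<close>

lemma logint_average_crude:
  assumes x: "dom_field \<mu> N W x" and W: "integrable N W" "(\<integral>w. W w \<partial>N) \<le> e" and c: "bdkernel \<mu> e c"
  shows "\<bar>(\<integral>w. logint \<mu> (\<lambda>t. x t w) \<partial>N) - diag_excess \<mu> c / 2\<bar> \<le> 2 * e"
  using logint_integrable(2)[OF x W(1)] W(2) mu.abs_diag_excess_le[OF c] by linarith

text \<open>The substitute for Gaussian integration by parts. The Gibbs average of \<open>v\<close> is to first order the
covariance of \<open>v\<close> and \<open>x\<close> under \<open>\<mu>\<close>, whose mean is the excess of the kernel \<open>h\<close> under \<open>\<mu>\<close>. In the conclusion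
the excess is taken under the random Gibbs measure, not under \<open>\<mu>\<close>, because that is what a replica
average contains; the hypothesis on \<open>B * (\<integral>w. W w \<partial>N)\<close> pays for the difference.\<close>

lemma gibbs_average_expansion:
  assumes x: "dom_field \<mu> N W x" and v: "dom_field \<mu> N V v" and h: "bdkernel \<mu> B h"
    and W3: "integrable N (\<lambda>w. W w ^ 3)" and V3: "integrable N (\<lambda>w. V w ^ 3)"
    and VW: "integrable N (\<lambda>w. V w * (W w)\<^sup>2)" "(\<integral>w. V w * (W w)\<^sup>2 \<partial>N) \<le> e"
    and BW: "B * (\<integral>w. W w \<partial>N) \<le> e"
    and mean: "\<And>t. t \<in> space \<mu> \<Longrightarrow> \<bar>\<integral>w. v t w \<partial>N\<bar> \<le> e"
    and cov: "\<And>s t. s \<in> space \<mu> \<Longrightarrow> t \<in> space \<mu> \<Longrightarrow> \<bar>(\<integral>w. v s w * x t w \<partial>N) - h s t\<bar> \<le> e"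
  shows "\<bar>(\<integral>w. (\<integral>t. v t w \<partial>gibbs \<mu> (\<lambda>t. x t w)) \<partial>N) - (\<integral>w. diag_excess (gibbs \<mu> (\<lambda>t. x t w)) h \<partial>N)\<bar> \<le> 143 * e"
proof -
  interpret mm: pair_prob_space \<mu> \<mu> ..
  note W = integrable_powers[OF dom_field_W[OF x] dom_field_nonneg[OF x] W3]
  note V = integrable_powers[OF dom_field_W[OF v] dom_field_nonneg[OF v] V3]
  have iVW: "integrable N (\<lambda>w. V w * W w)"
  proof (rule Bochner_Integration.integrable_bound[OF Bochner_Integration.integrable_add[OF V(2) W(2)]])
    show "AE w in N. norm (V w * W w) \<le> norm (V w * V w + W w * W w)"
    proof (rule AE_I2)
      fix w assume w: "w \<in> space N"
      have "2 * (V w * W w) \<le> V w * V w + W w * W w"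
        using sum_squares_bound[of "V w" "W w"] by (simp add: power2_eq_square)
      moreover have "0 \<le> V w * W w" using dom_field_nonneg[OF x w] dom_field_nonneg[OF v w] by simp
      ultimately show "norm (V w * W w) \<le> norm (V w * V w + W w * W w)" by simp
    qed
  qed (use dom_field_W[OF x] dom_field_W[OF v] in measurable)
  have vx: "dom_field \<mu> N (\<lambda>w. V w * W w) (\<lambda>t w. v t w * x t w)" by (rule dom_field_mult[OF v x])
  define mv where "mv = (\<lambda>w. \<integral>t. v t w \<partial>\<mu>)"
  define mx where "mx = (\<lambda>w. \<integral>t. x t w \<partial>\<mu>)"
  define mvx where "mvx = (\<lambda>w. \<integral>t. v t w * x t w \<partial>\<mu>)"
  let ?G = "\<lambda>w. \<integral>t. v t w \<partial>gibbs \<mu> (\<lambda>t. x t w)"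
  let ?H = "\<lambda>w. diag_excess (gibbs \<mu> (\<lambda>t. x t w)) h"
  have i1: "integrable N mv" unfolding mv_def by (rule dom_field_swap(2)[OF v V(1)])
  have ix: "integrable N mx" unfolding mx_def by (rule dom_field_swap(2)[OF x W(1)])
  have i2: "integrable N mvx" unfolding mvx_def by (rule dom_field_swap(2)[OF vx iVW])
  have i11: "integrable N (\<lambda>w. mv w * mx w)"
  proof (rule Bochner_Integration.integrable_bound[OF iVW])
    show "AE w in N. norm (mv w * mx w) \<le> norm (V w * W w)"
    proof (rule AE_I2)
      fix w assume w: "w \<in> space N"
      have "\<bar>mx w\<bar> \<le> W w" unfolding mx_def by (rule mu.bdmeas_abs_integral[OF dom_field_bdmeas[OF x w]])
      moreover have "\<bar>mv w\<bar> \<le> V w" unfolding mv_def by (rule mu.bdmeas_abs_integral[OF dom_field_bdmeas[OF v w]])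
      ultimately have "\<bar>mv w\<bar> * \<bar>mx w\<bar> \<le> V w * W w" by (intro mult_mono) auto
      then show "norm (mv w * mx w) \<le> norm (V w * W w)" by (simp only: real_norm_def abs_mult[symmetric])
    qed
  qed (use i1 ix in measurable)
  have iG: "integrable N ?G" by (rule gibbs_field_integrable(1)[OF x v V(1)])
  have iH: "integrable N ?H" by (rule diag_excess_gibbs_integrable(1)[OF x h])
  have "\<bar>\<integral>w. ?G w - mv w - (mvx w - mv w * mx w) \<partial>N\<bar> \<le> (\<integral>w. \<bar>?G w - mv w - (mvx w - mv w * mx w)\<bar> \<partial>N)"
    by (rule integral_abs_bound)
  also have "\<dots> \<le> (\<integral>w. 80 * (V w * (W w)\<^sup>2) \<partial>N)"
    using i1 i2 i11 iG VW(1) mu.gibbs_mean_expansion[OF dom_field_bdmeas[OF x] dom_field_bdmeas[OF v]]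
    by (intro integral_mono) (auto simp: mv_def mx_def mvx_def mult.assoc)
  also have "\<dots> \<le> 80 * e" using VW by simp
  finally have 1: "\<bar>(\<integral>w. ?G w \<partial>N) - (\<integral>w. mv w \<partial>N) - ((\<integral>w. mvx w \<partial>N) - (\<integral>w. mv w * mx w \<partial>N))\<bar> \<le> 80 * e"
    using i1 i2 i11 iG by simp
  have "\<bar>\<integral>w. ?H w - diag_excess \<mu> h \<partial>N\<bar> \<le> (\<integral>w. \<bar>?H w - diag_excess \<mu> h\<bar> \<partial>N)" by (rule integral_abs_bound)
  also have "\<dots> \<le> (\<integral>w. 60 * B * W w \<partial>N)"
    using iH W(1) mu.diag_excess_perturb[OF dom_field_bdmeas[OF x] h] by (intro integral_mono) auto
  also have "\<dots> \<le> 60 * e" using BW by simp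
  finally have 5: "\<bar>(\<integral>w. ?H w \<partial>N) - diag_excess \<mu> h\<bar> \<le> 60 * e" using iH by (simp add: N.prob_space)
  have 2: "\<bar>\<integral>w. mv w \<partial>N\<bar> \<le> e"
    using average_close[OF v V(1), of "\<lambda>_. 0" e] mean by (simp add: mv_def)
  have 3: "\<bar>(\<integral>w. mvx w \<partial>N) - (\<integral>t. h t t \<partial>\<mu>)\<bar> \<le> e"
    unfolding mvx_def by (rule average_close[OF vx iVW mu.bdmeas_integrable[OF bdkernel_diag[OF h]] cov])
  have 4: "\<bar>(\<integral>w. mv w * mx w \<partial>N) - (\<integral>s. (\<integral>t. h s t \<partial>\<mu>) \<partial>\<mu>)\<bar> \<le> e"
    unfolding mv_def mx_def
    by (rule average_close2[OF v x iVW mm.bdmeas_integrable mu.bdmeas_integrable[OF bdkernel_section[OF h]] cov])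
      (use h in \<open>auto simp: bdkernel_def\<close>)
  show ?thesis using 1 2 3 4 5 unfolding diag_excess_def by linarith
qed

lemma gibbs_average_crude:
  assumes x: "dom_field \<mu> N W x" and v: "dom_field \<mu> N V v" and h: "bdkernel \<mu> e h"
    and V: "integrable N V" "(\<integral>w. V w \<partial>N) \<le> e"
  shows "\<bar>(\<integral>w. (\<integral>t. v t w \<partial>gibbs \<mu> (\<lambda>t. x t w)) \<partial>N) - (\<integral>w. diag_excess (gibbs \<mu> (\<lambda>t. x t w)) h \<partial>N)\<bar> \<le> 3 * e"
  using gibbs_field_integrable(2)[OF x v V(1)] V(2) diag_excess_gibbs_integrable(2)[OF x h] by linarith

end

section \<open>Sums of independent fields\<close>

lemma dom_field_component:
  assumes "dom_field \<mu> (N i) W x" "i \<in> I"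
  shows "dom_field \<mu> (Pi\<^sub>M I N) (\<lambda>\<omega>. W (\<omega> i)) (\<lambda>t \<omega>. x t (\<omega> i))"
  unfolding dom_field_def
proof (intro conjI ballI)
  have "(\<lambda>p. (fst p, snd p i)) \<in> measurable (\<mu> \<Otimes>\<^sub>M Pi\<^sub>M I N) (\<mu> \<Otimes>\<^sub>M N i)" using assms(2) by measurable
  from measurable_compose[OF this dom_field_measurable[OF assms(1)]]
  show "(\<lambda>(t, \<omega>). x t (\<omega> i)) \<in> borel_measurable (\<mu> \<Otimes>\<^sub>M Pi\<^sub>M I N)" by (simp add: split_beta')
  show "(\<lambda>\<omega>. W (\<omega> i)) \<in> borel_measurable (Pi\<^sub>M I N)"
    using assms(2) dom_field_W[OF assms(1)] by measurable
  show "\<bar>x t (\<omega> i)\<bar> \<le> W (\<omega> i)" if "t \<in> space \<mu>" "\<omega> \<in> space (Pi\<^sub>M I N)" for t \<omega>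
    using that assms by (auto simp: space_PiM intro!: dom_field_bound[OF assms(1)])
qed

lemma dom_field_sum:
  assumes "finite J" "\<And>i. i \<in> J \<Longrightarrow> dom_field \<mu> N (W i) (x i)"
  shows "dom_field \<mu> N (\<lambda>w. \<Sum>i\<in>J. W i w) (\<lambda>t w. \<Sum>i\<in>J. x i t w)"
  using assms
proof (induction J rule: finite_induct)
  case empty
  then show ?case by (simp add: dom_field_def)
next
  case (insert j J)
  then show ?case using dom_field_add[of \<mu> N "W j" "x j" "\<lambda>w. \<Sum>i\<in>J. W i w" "\<lambda>t w. \<Sum>i\<in>J. x i t w"] by simp
qed

lemma integrable_PiM_component:
  fixes f :: "'a \<Rightarrow> real"
  assumes N: "\<And>i. prob_space (N i)" and i: "i \<in> I" and f: "integrable (N i) f"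
  shows "integrable (Pi\<^sub>M I N) (\<lambda>\<omega>. f (\<omega> i))" and "(\<integral>\<omega>. f (\<omega> i) \<partial>Pi\<^sub>M I N) = (\<integral>w. f w \<partial>N i)"
proof -
  interpret product_prob_space N I
    using N by (simp add: product_prob_space_def product_prob_space_axioms_def product_sigma_finite_def prob_space_imp_sigma_finite)
  have d: "distr (Pi\<^sub>M I N) (N i) (\<lambda>\<omega>. \<omega> i) = N i" by (rule PiM_component[OF i])
  have m: "(\<lambda>\<omega>. \<omega> i) \<in> measurable (Pi\<^sub>M I N) (N i)" using i by measurable
  show "integrable (Pi\<^sub>M I N) (\<lambda>\<omega>. f (\<omega> i))"
    using f by (intro integrable_distr[OF m]) (simp add: d)
  show "(\<integral>\<omega>. f (\<omega> i) \<partial>Pi\<^sub>M I N) = (\<integral>w. f w \<partial>N i)"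
    using integral_distr[OF m, of f] f by (simp add: d)
qed

text \<open>The measures \<open>N i\<close> are probability measures for all \<open>i\<close>, also outside \<open>I\<close>, so that products over
subsets of \<open>I\<close> are available without side conditions.\<close>

locale indep_fields = mu: prob_space \<pi> for \<pi> :: "'t measure" +
  fixes N :: "'i \<Rightarrow> 'a measure" and I :: "'i set" and W :: "'i \<Rightarrow> 'a \<Rightarrow> real" and x :: "'i \<Rightarrow> 't \<Rightarrow> 'a \<Rightarrow> real"
  assumes N: "\<And>i. prob_space (N i)"
    and fin: "finite I"
    and x: "\<And>i. i \<in> I \<Longrightarrow> dom_field \<pi> (N i) (W i) (x i)"
    and W: "\<And>i. i \<in> I \<Longrightarrow> integrable (N i) (W i)"
begin

sublocale P: product_prob_space N I
  using N by (simp add: product_prob_space_def product_prob_space_axioms_def product_sigma_finite_def prob_space_imp_sigma_finite)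

lemma sublocale_subset: "J \<subseteq> I \<Longrightarrow> indep_fields \<pi> N J W x"
  using N x W finite_subset[OF _ fin] by unfold_locales auto

definition field :: "('t \<Rightarrow> real) \<Rightarrow> 't \<Rightarrow> ('i \<Rightarrow> 'a) \<Rightarrow> real" where
  "field b t \<omega> = b t + (\<Sum>i\<in>I. x i t (\<omega> i))"

lemma prob_PiM: "prob_space (Pi\<^sub>M J N)"
  by (rule prob_space_PiM) (rule N)

lemma field_dom:
  assumes "bdmeas \<pi> B b"
  shows "dom_field \<pi> (Pi\<^sub>M I N) (\<lambda>\<omega>. B + (\<Sum>i\<in>I. W i (\<omega> i))) (field b)"
proof -
  have "dom_field \<pi> (Pi\<^sub>M I N) (\<lambda>\<omega>. \<Sum>i\<in>I. W i (\<omega> i)) (\<lambda>t \<omega>. \<Sum>i\<in>I. x i t (\<omega> i))"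
    by (intro dom_field_sum[OF fin] dom_field_component x)
  from dom_field_add[OF dom_field_const[OF assms] this] show ?thesis unfolding field_def[abs_def] .
qed

lemma envelope_integrable: "integrable (Pi\<^sub>M I N) (\<lambda>\<omega>. B + (\<Sum>i\<in>I. W i (\<omega> i)))"
proof -
  interpret prob_space "Pi\<^sub>M I N" by (rule prob_PiM)
  have "integrable (Pi\<^sub>M I N) (\<lambda>\<omega>. W i (\<omega> i))" if "i \<in> I" for i
    by (rule integrable_PiM_component(1)[where N=N and i=i, OF N that W[OF that]])
  then show ?thesis by (intro Bochner_Integration.integrable_add Bochner_Integration.integrable_sum) auto
qed

lemma two_probs_PiM: "two_probs \<pi> (Pi\<^sub>M I N)"
  using prob_PiM by (simp add: two_probs_def mu.prob_space_axioms)

lemma field_bdmeas: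
  "bdmeas \<pi> B b \<Longrightarrow> \<omega> \<in> space (Pi\<^sub>M I N) \<Longrightarrow> bdmeas \<pi> (B + (\<Sum>i\<in>I. W i (\<omega> i))) (\<lambda>t. field b t \<omega>)"
  by (rule dom_field_bdmeas[OF field_dom])

lemma integrable_logint:
  assumes "bdmeas \<pi> B b"
  shows "integrable (Pi\<^sub>M I N) (\<lambda>\<omega>. logint \<pi> (\<lambda>t. field b t \<omega>))"
  by (rule two_probs.logint_integrable(1)[OF two_probs_PiM field_dom[OF assms] envelope_integrable])

lemma integrable_logint_pair:
  fixes K :: "'c measure"
  assumes K: "prob_space K" and y: "dom_field \<pi> K V y" and V: "integrable K V" and b: "bdmeas \<pi> B b"
  shows "integrable (Pi\<^sub>M I N \<Otimes>\<^sub>M K) (\<lambda>(\<omega>, w). logint \<pi> (\<lambda>t. field b t \<omega> + y t w))"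
proof -
  interpret K: prob_space K by (rule K)
  interpret PI: prob_space "Pi\<^sub>M I N" by (rule prob_PiM)
  interpret J: pair_prob_space "Pi\<^sub>M I N" K ..
  interpret T: two_probs \<pi> "Pi\<^sub>M I N \<Otimes>\<^sub>M K" ..
  have 1: "dom_field \<pi> (Pi\<^sub>M I N \<Otimes>\<^sub>M K) (\<lambda>p. B + (\<Sum>i\<in>I. W i (fst p i))) (\<lambda>t p. field b t (fst p))"
    unfolding dom_field_def
  proof (intro conjI ballI)
    have "(\<lambda>p. (fst p, fst (snd p))) \<in> measurable (\<pi> \<Otimes>\<^sub>M (Pi\<^sub>M I N \<Otimes>\<^sub>M K)) (\<pi> \<Otimes>\<^sub>M Pi\<^sub>M I N)" by measurable
    from measurable_compose[OF this dom_field_measurable[OF field_dom[OF b]]]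
    show "(\<lambda>(t, p). field b t (fst p)) \<in> borel_measurable (\<pi> \<Otimes>\<^sub>M (Pi\<^sub>M I N \<Otimes>\<^sub>M K))" by (simp add: split_beta')
    show "(\<lambda>p. B + (\<Sum>i\<in>I. W i (fst p i))) \<in> borel_measurable (Pi\<^sub>M I N \<Otimes>\<^sub>M K)"
      by (rule measurable_compose[OF measurable_fst dom_field_W[OF field_dom[OF b]]])
  qed (auto simp: space_pair_measure intro: dom_field_bound[OF field_dom[OF b]])
  have 2: "dom_field \<pi> (Pi\<^sub>M I N \<Otimes>\<^sub>M K) (\<lambda>p. V (snd p)) (\<lambda>t p. y t (snd p))"
    unfolding dom_field_def
  proof (intro conjI ballI)
    have "(\<lambda>p. (fst p, snd (snd p))) \<in> measurable (\<pi> \<Otimes>\<^sub>M (Pi\<^sub>M I N \<Otimes>\<^sub>M K)) (\<pi> \<Otimes>\<^sub>M K)" by measurable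
    from measurable_compose[OF this dom_field_measurable[OF y]]
    show "(\<lambda>(t, p). y t (snd p)) \<in> borel_measurable (\<pi> \<Otimes>\<^sub>M (Pi\<^sub>M I N \<Otimes>\<^sub>M K))" by (simp add: split_beta')
    show "(\<lambda>p. V (snd p)) \<in> borel_measurable (Pi\<^sub>M I N \<Otimes>\<^sub>M K)"
      by (rule measurable_compose[OF measurable_snd dom_field_W[OF y]])
  qed (auto simp: space_pair_measure intro: dom_field_bound[OF y])
  have i: "integrable (Pi\<^sub>M I N \<Otimes>\<^sub>M K) (\<lambda>p. (B + (\<Sum>i\<in>I. W i (fst p i))) + V (snd p))"
  proof (rule Bochner_Integration.integrable_add)
    have "integrable (distr (Pi\<^sub>M I N \<Otimes>\<^sub>M K) (Pi\<^sub>M I N) fst) (\<lambda>\<omega>. B + (\<Sum>i\<in>I. W i (\<omega> i)))"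
      by (simp only: K.distr_pair_fst envelope_integrable)
    then show "integrable (Pi\<^sub>M I N \<Otimes>\<^sub>M K) (\<lambda>p. B + (\<Sum>i\<in>I. W i (fst p i)))"
      by (rule integrable_distr[OF measurable_fst])
    have "integrable (Pi\<^sub>M I N \<Otimes>\<^sub>M K) (\<lambda>(\<omega>, w). V w)"
      using V by (intro J.Fubini_integrable) auto
    then show "integrable (Pi\<^sub>M I N \<Otimes>\<^sub>M K) (\<lambda>p. V (snd p))" by (simp add: split_beta')
  qed
  show ?thesis using T.logint_integrable(1)[OF dom_field_add[OF 1 2] i] by (simp add: split_beta')
qed

lemma mean_logint_base_change:
  assumes b: "bdmeas \<pi> B b" and b': "bdmeas \<pi> B' b'" and d: "\<And>t. t \<in> space \<pi> \<Longrightarrow> \<bar>b' t - b t\<bar> \<le> e"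
  shows "\<bar>(\<integral>\<omega>. logint \<pi> (\<lambda>t. field b' t \<omega>) \<partial>Pi\<^sub>M I N) - (\<integral>\<omega>. logint \<pi> (\<lambda>t. field b t \<omega>) \<partial>Pi\<^sub>M I N)\<bar> \<le> e"
proof -
  interpret PI: prob_space "Pi\<^sub>M I N" by (rule prob_PiM)
  have dd: "bdmeas \<pi> e (\<lambda>t. b' t - b t)"
    using b b' d by (intro bdmeasI borel_measurable_diff) (auto dest: bdmeas_meas)
  have pt: "\<bar>logint \<pi> (\<lambda>t. field b' t \<omega>) - logint \<pi> (\<lambda>t. field b t \<omega>)\<bar> \<le> e"
    if w: "\<omega> \<in> space (Pi\<^sub>M I N)" for \<omega>
  proof -
    have eq: "(\<lambda>t. field b' t \<omega>) = (\<lambda>t. field b t \<omega> + (b' t - b t))" by (auto simp: field_def)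
    interpret G: prob_space "gibbs \<pi> (\<lambda>t. field b t \<omega>)" by (rule mu.prob_space_gibbs[OF field_bdmeas[OF b w]])
    show ?thesis
      unfolding eq using mu.logint_add[OF field_bdmeas[OF b w] dd] G.abs_logint_le[of e] dd
      by (simp add: mu.bdmeas_gibbs)
  qed
  have "\<bar>\<integral>\<omega>. logint \<pi> (\<lambda>t. field b' t \<omega>) - logint \<pi> (\<lambda>t. field b t \<omega>) \<partial>Pi\<^sub>M I N\<bar>
     \<le> (\<integral>\<omega>. \<bar>logint \<pi> (\<lambda>t. field b' t \<omega>) - logint \<pi> (\<lambda>t. field b t \<omega>)\<bar> \<partial>Pi\<^sub>M I N)" by (rule integral_abs_bound)
  also have "\<dots> \<le> (\<integral>\<omega>. e \<partial>Pi\<^sub>M I N)"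
    using pt integrable_logint[OF b] integrable_logint[OF b'] by (intro integral_mono) auto
  finally show ?thesis using integrable_logint[OF b] integrable_logint[OF b'] by (simp add: prob_space.prob_space[OF prob_PiM])
qed

end

text \<open>Lindeberg's exchange argument by induction on the index set: exchange one component while the
others are held fixed as part of the exponent \<open>b\<close>, then apply the induction hypothesis with the
exchanged component held fixed. The hypothesis \<open>single\<close> has to hold for every bounded \<open>b\<close> because nothing is known
about the fixed part.\<close>

lemma mean_logint_swap:
  fixes N :: "'i \<Rightarrow> 'a measure" and N' :: "'i \<Rightarrow> 'b measure"
  assumes "indep_fields \<pi> N I W x" and "indep_fields \<pi> N' I W' x'"
    and single: "\<And>i b B. i \<in> I \<Longrightarrow> bdmeas \<pi> B b \<Longrightarrow>
      \<bar>(\<integral>w. logint \<pi> (\<lambda>t. b t + x i t w) \<partial>N i) - (\<integral>w. logint \<pi> (\<lambda>t. b t + x' i t w) \<partial>N' i)\<bar> \<le> e i"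
    and b: "bdmeas \<pi> B b"
  shows "\<bar>(\<integral>\<omega>. logint \<pi> (\<lambda>t. b t + (\<Sum>i\<in>I. x i t (\<omega> i))) \<partial>Pi\<^sub>M I N)
        - (\<integral>\<omega>. logint \<pi> (\<lambda>t. b t + (\<Sum>i\<in>I. x' i t (\<omega> i))) \<partial>Pi\<^sub>M I N')\<bar> \<le> (\<Sum>i\<in>I. e i)"
proof -
  have "finite I" using assms(1) by (simp add: indep_fields_def indep_fields_axioms_def)
  then show ?thesis using assms
  proof (induction I arbitrary: b B rule: finite_induct)
    case empty
    then show ?case by (simp add: PiM_empty lebesgue_integral_count_space_finite)
  next
    case (insert j I)
    interpret F: indep_fields \<pi> N "insert j I" W x by (rule insert.prems)
    interpret F': indep_fields \<pi> N' "insert j I" W' x' by (rule insert.prems)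
    interpret A: indep_fields \<pi> N I W x by (rule F.sublocale_subset) auto
    interpret A': indep_fields \<pi> N' I W' x' by (rule F'.sublocale_subset) auto
    interpret Nj: prob_space "N j" by (rule F.N)
    interpret Nj': prob_space "N' j" by (rule F'.N)
    interpret PA: prob_space "Pi\<^sub>M I N" by (rule A.prob_PiM)
    interpret PA': prob_space "Pi\<^sub>M I N'" by (rule A'.prob_PiM)
    interpret Jj: pair_prob_space "Pi\<^sub>M I N" "N j" ..
    interpret J': pair_prob_space "Pi\<^sub>M I N" "N' j" ..
    interpret J'': pair_prob_space "Pi\<^sub>M I N'" "N' j" ..
    note b = insert.prems(4)
    have xj: "dom_field \<pi> (N j) (W j) (x j)" "integrable (N j) (W j)" using F.x F.W by simp_all
    have xj': "dom_field \<pi> (N' j) (W' j) (x' j)" "integrable (N' j) (W' j)" using F'.x F'.W by simp_all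
    note i = A.integrable_logint_pair[OF F.N xj b] 
    note i' = A.integrable_logint_pair[OF F'.N xj' b] 
    note i'' = A'.integrable_logint_pair[OF F'.N xj' b]
    let ?M = "\<lambda>\<omega>. \<integral>w. logint \<pi> (\<lambda>t. A.field b t \<omega> + x j t w) \<partial>N j"
    let ?M' = "\<lambda>\<omega>. \<integral>w. logint \<pi> (\<lambda>t. A.field b t \<omega> + x' j t w) \<partial>N' j"
    have ins: "F.field b t (fun_upd \<omega> j w) = A.field b t \<omega> + x j t w" for t \<omega> w
    proof -
      have "(\<Sum>i\<in>I. x i t ((fun_upd \<omega> j w) i)) = (\<Sum>i\<in>I. x i t (\<omega> i))"
        using insert.hyps by (intro sum.cong) auto
      then show ?thesis using insert.hyps by (simp add: F.field_def A.field_def)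
    qed
    have ins': "F'.field b t (fun_upd \<omega> j w) = A'.field b t \<omega> + x' j t w" for t \<omega> w
    proof -
      have "(\<Sum>i\<in>I. x' i t ((fun_upd \<omega> j w) i)) = (\<Sum>i\<in>I. x' i t (\<omega> i))"
        using insert.hyps by (intro sum.cong) auto
      then show ?thesis using insert.hyps by (simp add: F'.field_def A'.field_def)
    qed
    have L: "(\<integral>\<omega>. logint \<pi> (\<lambda>t. F.field b t \<omega>) \<partial>Pi\<^sub>M (insert j I) N) = (\<integral>\<omega>. ?M \<omega> \<partial>Pi\<^sub>M I N)"
      by (simp only: F.P.product_integral_insert[OF insert.hyps(1,2) F.integrable_logint[OF b]] ins)
    have R: "(\<integral>\<omega>. logint \<pi> (\<lambda>t. F'.field b t \<omega>) \<partial>Pi\<^sub>M (insert j I) N')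
        = (\<integral>w. (\<integral>\<omega>. logint \<pi> (\<lambda>t. A'.field b t \<omega> + x' j t w) \<partial>Pi\<^sub>M I N') \<partial>N' j)"
      unfolding F'.P.product_integral_insert[OF insert.hyps(1,2) F'.integrable_logint[OF b]] ins'
      by (rule J''.Fubini_integral[OF i'', symmetric])
    have C: "(\<integral>\<omega>. ?M' \<omega> \<partial>Pi\<^sub>M I N) = (\<integral>w. (\<integral>\<omega>. logint \<pi> (\<lambda>t. A.field b t \<omega> + x' j t w) \<partial>Pi\<^sub>M I N) \<partial>N' j)"
      by (rule J'.Fubini_integral[OF i', symmetric])
    have iM: "integrable (Pi\<^sub>M I N) ?M" "integrable (Pi\<^sub>M I N) ?M'"
      using Jj.integrable_fst[OF i] J'.integrable_fst[OF i'] by simp_all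
    have "\<bar>\<integral>\<omega>. ?M \<omega> - ?M' \<omega> \<partial>Pi\<^sub>M I N\<bar> \<le> (\<integral>\<omega>. \<bar>?M \<omega> - ?M' \<omega>\<bar> \<partial>Pi\<^sub>M I N)" by (rule integral_abs_bound)
    also have "\<dots> \<le> (\<integral>\<omega>. e j \<partial>Pi\<^sub>M I N)"
      using iM by (intro integral_mono insert.prems(3)[OF insertI1 A.field_bdmeas[OF b]]) auto
    finally have 1: "\<bar>(\<integral>\<omega>. ?M \<omega> \<partial>Pi\<^sub>M I N) - (\<integral>\<omega>. ?M' \<omega> \<partial>Pi\<^sub>M I N)\<bar> \<le> e j"
      using iM by (simp add: prob_space.prob_space[OF A.prob_PiM])
    let ?h = "\<lambda>w. \<integral>\<omega>. logint \<pi> (\<lambda>t. A.field b t \<omega> + x' j t w) \<partial>Pi\<^sub>M I N"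
    let ?h' = "\<lambda>w. \<integral>\<omega>. logint \<pi> (\<lambda>t. A'.field b t \<omega> + x' j t w) \<partial>Pi\<^sub>M I N'"
    have ih: "integrable (N' j) ?h" "integrable (N' j) ?h'"
      using J'.integrable_snd[OF i'] J''.integrable_snd[OF i''] by simp_all
    have IH: "\<bar>?h w - ?h' w\<bar> \<le> (\<Sum>i\<in>I. e i)" if w: "w \<in> space (N' j)" for w
    proof -
      have bw: "bdmeas \<pi> (B + W' j w) (\<lambda>t. b t + x' j t w)"
        by (rule bdmeas_add[OF b dom_field_bdmeas[OF xj'(1) w]])
      have "\<bar>(\<integral>\<omega>. logint \<pi> (\<lambda>t. (b t + x' j t w) + (\<Sum>i\<in>I. x i t (\<omega> i))) \<partial>Pi\<^sub>M I N)
        - (\<integral>\<omega>. logint \<pi> (\<lambda>t. (b t + x' j t w) + (\<Sum>i\<in>I. x' i t (\<omega> i))) \<partial>Pi\<^sub>M I N')\<bar> \<le> (\<Sum>i\<in>I. e i)"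
        by (rule insert.IH[OF A.indep_fields_axioms A'.indep_fields_axioms insert.prems(3) bw]) auto
      then show ?thesis by (simp add: A.field_def A'.field_def algebra_simps)
    qed
    have "\<bar>\<integral>w. ?h w - ?h' w \<partial>N' j\<bar> \<le> (\<integral>w. \<bar>?h w - ?h' w\<bar> \<partial>N' j)" by (rule integral_abs_bound)
    also have "\<dots> \<le> (\<integral>w. (\<Sum>i\<in>I. e i) \<partial>N' j)" using ih IH by (intro integral_mono) auto
    finally have 2: "\<bar>(\<integral>w. ?h w \<partial>N' j) - (\<integral>w. ?h' w \<partial>N' j)\<bar> \<le> (\<Sum>i\<in>I. e i)"
      using ih by (simp add: prob_space.prob_space[OF F'.N])
    have "\<bar>(\<integral>\<omega>. logint \<pi> (\<lambda>t. F.field b t \<omega>) \<partial>Pi\<^sub>M (insert j I) N)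
        - (\<integral>\<omega>. logint \<pi> (\<lambda>t. F'.field b t \<omega>) \<partial>Pi\<^sub>M (insert j I) N')\<bar> \<le> (\<Sum>i\<in>insert j I. e i)"
      using 1 2 insert.hyps unfolding L R C by simp
    then show ?case by (simp only: F.field_def F'.field_def)
  qed
qed

context indep_fields begin

text \<open>Each summand \<open>v i\<close> depends on one coordinate only. Integrating that coordinate first, with the others
held fixed in the exponent, reduces the claim to a single component.\<close>

lemma mean_gibbs_sum:
  assumes b: "bdmeas \<pi> B b"
    and v: "\<And>i. i \<in> I \<Longrightarrow> dom_field \<pi> (N i) (V i) (v i)" and V: "\<And>i. i \<in> I \<Longrightarrow> integrable (N i) (V i)"
    and h: "\<And>i. i \<in> I \<Longrightarrow> bdkernel \<pi> (H i) (h i)"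
    and single: "\<And>i b B. i \<in> I \<Longrightarrow> bdmeas \<pi> B b \<Longrightarrow>
      \<bar>(\<integral>w. (\<integral>t. v i t w \<partial>gibbs \<pi> (\<lambda>t. b t + x i t w)) \<partial>N i)
        - (\<integral>w. diag_excess (gibbs \<pi> (\<lambda>t. b t + x i t w)) (h i) \<partial>N i)\<bar> \<le> e i"
  shows "\<bar>(\<integral>\<omega>. (\<integral>t. (\<Sum>i\<in>I. v i t (\<omega> i)) \<partial>gibbs \<pi> (\<lambda>t. field b t \<omega>)) \<partial>Pi\<^sub>M I N)
      - (\<integral>\<omega>. (\<Sum>i\<in>I. diag_excess (gibbs \<pi> (\<lambda>t. field b t \<omega>)) (h i)) \<partial>Pi\<^sub>M I N)\<bar> \<le> (\<Sum>i\<in>I. e i)"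
proof -
  interpret PI: prob_space "Pi\<^sub>M I N" by (rule prob_PiM)
  interpret T: two_probs \<pi> "Pi\<^sub>M I N" by (rule two_probs_PiM)
  note fd = field_dom[OF b]
  let ?g = "\<lambda>\<omega>. gibbs \<pi> (\<lambda>t. field b t \<omega>)"
  have vi: "integrable (Pi\<^sub>M I N) (\<lambda>\<omega>. \<integral>t. v i t (\<omega> i) \<partial>?g \<omega>)" if i: "i \<in> I" for i
    by (rule T.gibbs_field_integrable(1)[OF fd dom_field_component[where N=N and i=i, OF v[OF i] i] integrable_PiM_component(1)[where N=N and i=i, OF N i V[OF i]]])
  have hi: "integrable (Pi\<^sub>M I N) (\<lambda>\<omega>. diag_excess (?g \<omega>) (h i))" if i: "i \<in> I" for i
    by (rule T.diag_excess_gibbs_integrable(1)[OF fd h[OF i]])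
  have one: "\<bar>(\<integral>\<omega>. (\<integral>t. v j t (\<omega> j) \<partial>?g \<omega>) \<partial>Pi\<^sub>M I N) - (\<integral>\<omega>. diag_excess (?g \<omega>) (h j) \<partial>Pi\<^sub>M I N)\<bar> \<le> e j"
    if j: "j \<in> I" for j
  proof -
    define J where "J = I - {j}"
    have I: "insert j J = I" and J: "finite J" "j \<notin> J" using j fin by (auto simp: J_def)
    interpret A: indep_fields \<pi> N J W x by (rule sublocale_subset) (auto simp: J_def)
    interpret Nj: prob_space "N j" by (rule N)
    interpret PJ: prob_space "Pi\<^sub>M J N" by (rule prob_PiM)
    have ins: "field b t (fun_upd \<omega> j w) = A.field b t \<omega> + x j t w" for t \<omega> w
    proof -
      have "(\<Sum>i\<in>J. x i t ((fun_upd \<omega> j w) i)) = (\<Sum>i\<in>J. x i t (\<omega> i))"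
        using J by (intro sum.cong) auto
      moreover have "(\<Sum>i\<in>I. f i) = f j + (\<Sum>i\<in>J. f i)" for f :: "'i \<Rightarrow> real"
        unfolding I[symmetric] using J by simp
      ultimately show ?thesis by (simp add: field_def A.field_def)
    qed
    let ?d = "\<lambda>\<omega>. (\<integral>t. v j t (\<omega> j) \<partial>?g \<omega>) - diag_excess (?g \<omega>) (h j)"
    have di: "integrable (Pi\<^sub>M I N) ?d" by (rule Bochner_Integration.integrable_diff[OF vi[OF j] hi[OF j]])
    have "(\<integral>\<omega>. ?d \<omega> \<partial>Pi\<^sub>M I N) = (\<integral>\<omega>. (\<integral>w. ?d (fun_upd \<omega> j w) \<partial>N j) \<partial>Pi\<^sub>M J N)"
      using P.product_integral_insert[OF J, of ?d] di by (simp only: I)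
    also have "\<bar>\<dots>\<bar> \<le> e j"
    proof -
      let ?k = "\<lambda>\<omega>. \<integral>w. ?d (fun_upd \<omega> j w) \<partial>N j"
      have k: "\<bar>?k \<omega>\<bar> \<le> e j" if w: "\<omega> \<in> space (Pi\<^sub>M J N)" for \<omega>
      proof -
        interpret S: two_probs \<pi> "N j" ..
        note bw = A.field_bdmeas[OF b w]
        have dj: "dom_field \<pi> (N j) (\<lambda>w. (B + (\<Sum>i\<in>J. W i (\<omega> i))) + W j w) (\<lambda>t w. A.field b t \<omega> + x j t w)"
          by (rule dom_field_add[OF dom_field_const[OF bw] x[OF j]])
        have "?k \<omega> = (\<integral>w. (\<integral>t. v j t w \<partial>gibbs \<pi> (\<lambda>t. A.field b t \<omega> + x j t w)) \<partial>N j)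
            - (\<integral>w. diag_excess (gibbs \<pi> (\<lambda>t. A.field b t \<omega> + x j t w)) (h j) \<partial>N j)"
          unfolding ins fun_upd_same
          by (rule Bochner_Integration.integral_diff[OF S.gibbs_field_integrable(1)[OF dj v[OF j] V[OF j]]
                S.diag_excess_gibbs_integrable(1)[OF dj h[OF j]]])
        then show ?thesis using single[OF j bw] by simp
      qed
      \<comment> \<open>If the inner mean were not integrable, its integral would be \<open>0\<close> by convention, which the
        bound also covers.\<close>
      have e: "0 \<le> e j" using prob_space.not_empty[OF A.prob_PiM] k abs_ge_zero by (meson all_not_in_conv order_trans)
      show ?thesis
      proof (cases "integrable (Pi\<^sub>M J N) ?k")
        case True
        have "\<bar>\<integral>\<omega>. ?k \<omega> \<partial>Pi\<^sub>M J N\<bar> \<le> (\<integral>\<omega>. \<bar>?k \<omega>\<bar> \<partial>Pi\<^sub>M J N)" by (rule integral_abs_bound)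
        also have "\<dots> \<le> (\<integral>\<omega>. e j \<partial>Pi\<^sub>M J N)" using True k by (intro integral_mono) auto
        finally show ?thesis by (simp add: prob_space.prob_space[OF A.prob_PiM])
      qed (simp add: not_integrable_integral_eq e)
    qed
    finally show ?thesis using vi[OF j] hi[OF j] by simp
  qed
  have "(\<integral>\<omega>. (\<integral>t. (\<Sum>i\<in>I. v i t (\<omega> i)) \<partial>?g \<omega>) \<partial>Pi\<^sub>M I N) = (\<integral>\<omega>. (\<Sum>i\<in>I. (\<integral>t. v i t (\<omega> i) \<partial>?g \<omega>)) \<partial>Pi\<^sub>M I N)"
  proof (rule Bochner_Integration.integral_cong[OF refl])
    fix \<omega> assume w: "\<omega> \<in> space (Pi\<^sub>M I N)"
    interpret G: prob_space "?g \<omega>" by (rule mu.prob_space_gibbs[OF field_bdmeas[OF b w]])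
    have "integrable (?g \<omega>) (\<lambda>t. v i t (\<omega> i))" if i: "i \<in> I" for i
      using dom_field_bdmeas[OF dom_field_component[where N=N and i=i, OF v[OF i] i] w]
      by (intro G.bdmeas_integrable[where B="V i (\<omega> i)"]) (simp add: mu.bdmeas_gibbs)
    then show "(\<integral>t. (\<Sum>i\<in>I. v i t (\<omega> i)) \<partial>?g \<omega>) = (\<Sum>i\<in>I. (\<integral>t. v i t (\<omega> i) \<partial>?g \<omega>))"
      by (rule Bochner_Integration.integral_sum)
  qed
  also have "\<dots> = (\<Sum>i\<in>I. (\<integral>\<omega>. (\<integral>t. v i t (\<omega> i) \<partial>?g \<omega>) \<partial>Pi\<^sub>M I N))"
    by (rule Bochner_Integration.integral_sum[OF vi])
  finally have 1: "(\<integral>\<omega>. (\<integral>t. (\<Sum>i\<in>I. v i t (\<omega> i)) \<partial>?g \<omega>) \<partial>Pi\<^sub>M I N) = \<dots>" .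
  have 2: "(\<integral>\<omega>. (\<Sum>i\<in>I. diag_excess (?g \<omega>) (h i)) \<partial>Pi\<^sub>M I N) = (\<Sum>i\<in>I. (\<integral>\<omega>. diag_excess (?g \<omega>) (h i) \<partial>Pi\<^sub>M I N))"
    by (rule Bochner_Integration.integral_sum[OF hi])
  show ?thesis unfolding 1 2 sum_subtractf[symmetric] using one by (intro order_trans[OF sum_abs] sum_mono)
qed

end

section \<open>Gaussian vectors in a Hilbert space\<close>

text \<open>Two facts about a Gaussian element of a direct sum are needed: its components are independent, and
their third moments are bounded by the trace of the covariance. Independence is proved by comparing
two laws with the same characteristic functional, after the following uniqueness argument.\<close>

lemma char_real_gaussian:
  assumes "0 \<le> v"
  shows "(\<integral>x. iexp x \<partial>real_gaussian v) = complex_of_real (exp (- v / 2))"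
proof (cases "v = 0")
  case True
  then show ?thesis by (simp add: real_gaussian_def integral_return)
next
  case False
  define s where "s = sqrt v"
  have s: "0 < s" and sv: "s\<^sup>2 = v" using False assms by (simp_all add: s_def)
  have "(\<integral>x. iexp x \<partial>real_gaussian v) = (\<integral>x. normal_density 0 s x *\<^sub>R iexp x \<partial>lborel)"
    using False s unfolding real_gaussian_def by (simp add: s_def[symmetric], subst integral_density) auto
  also have "\<dots> = \<bar>s\<bar> *\<^sub>R (\<integral>y. normal_density 0 s (0 + s * y) *\<^sub>R iexp (0 + s * y) \<partial>lborel)"
    using s by (intro lborel_integral_real_affine) auto
  also have "\<dots> = (\<integral>y. s *\<^sub>R (normal_density 0 s (s * y) *\<^sub>R iexp (s * y)) \<partial>lborel)"
    by (simp only: integral_scaleR_right abs_of_pos[OF s] add_0_left)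
  also have "\<dots> = (\<integral>y. std_normal_density y *\<^sub>R iexp (s * y) \<partial>lborel)"
  proof (rule Bochner_Integration.integral_cong[OF refl])
    fix y
    have "s * normal_density 0 s (s * y) = std_normal_density y"
      using s by (simp add: normal_density_def power_mult_distrib real_sqrt_mult field_simps)
    then show "s *\<^sub>R (normal_density 0 s (s * y) *\<^sub>R iexp (s * y)) = std_normal_density y *\<^sub>R iexp (s * y)"
      by (simp only: scaleR_scaleR)
  qed
  also have "\<dots> = char std_normal_distribution s"
    unfolding char_def by (subst integral_density) auto
  also have "\<dots> = complex_of_real (exp (- v / 2))" by (simp add: char_std_normal_distribution sv)
  finally show ?thesis .
qed

lemma real_gaussian_moments:
  assumes "0 \<le> v"
  shows "integrable (real_gaussian v) (\<lambda>x. x ^ k)"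
    and "(\<integral>x. x \<partial>real_gaussian v) = 0" and "(\<integral>x. x\<^sup>2 \<partial>real_gaussian v) = v"
    and "(\<integral>x. x ^ 4 \<partial>real_gaussian v) = 3 * v\<^sup>2"
proof -
  define s where "s = sqrt v"
  have sv: "s\<^sup>2 = v" using assms by (simp add: s_def)
  have I: "integrable (real_gaussian v) f \<longleftrightarrow> integrable lborel (\<lambda>x. normal_density 0 s x * f x)"
    and E: "(\<integral>x. f x \<partial>real_gaussian v) = (\<integral>x. normal_density 0 s x * f x \<partial>lborel)"
    if "v \<noteq> 0" "f \<in> borel_measurable borel" for f :: "real \<Rightarrow> real"
    using that unfolding real_gaussian_def by (auto simp: s_def integrable_density integral_density)
  show "integrable (real_gaussian v) (\<lambda>x. x ^ k)"
  proof (cases "v = 0")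
    case False
    then have "0 < s" using assms by (simp add: s_def)
    from integrable_normal_moment[OF this, of 0 k] show ?thesis using False by (simp add: I)
  qed (simp add: real_gaussian_def integrable_iff_bounded nn_integral_return)
  show "(\<integral>x. x \<partial>real_gaussian v) = 0" "(\<integral>x. x\<^sup>2 \<partial>real_gaussian v) = v" "(\<integral>x. x ^ 4 \<partial>real_gaussian v) = 3 * v\<^sup>2"
  proof -
    show "(\<integral>x. x \<partial>real_gaussian v) = 0"
    proof (cases "v = 0")
      case False
      then have "0 < s" using assms by (simp add: s_def)
      from integral_normal_moment_nz_1[OF this, of 0] show ?thesis using False by (simp add: E)
    qed (simp add: real_gaussian_def integral_return)
    show "(\<integral>x. x\<^sup>2 \<partial>real_gaussian v) = v"
    proof (cases "v = 0")
      case False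
      then have "0 < s" using assms by (simp add: s_def)
      from integral_normal_moment_even[OF this, of 0 1] show ?thesis using False sv by (simp add: E)
    qed (simp add: real_gaussian_def integral_return)
    show "(\<integral>x. x ^ 4 \<partial>real_gaussian v) = 3 * v\<^sup>2"
    proof (cases "v = 0")
      case False
      then have "0 < s" using assms by (simp add: s_def)
      from integral_normal_moment_even[OF this, of 0 2] show ?thesis
        using False by (simp add: E fact_numeral power_divide sv)
    qed (simp add: real_gaussian_def integral_return)
  qed
qed

text \<open>Uniqueness of characteristic functions on the line, applied to the image under \<open>l\<close> of the measure
with density \<open>g\<close>. The weight makes it possible to treat several linear functionals one after the
other.\<close>

lemma weighted_levy:
  fixes l g :: "'a \<Rightarrow> real"
  assumes mu: "prob_space \<mu>" and nu: "prob_space \<nu>" and sets: "sets \<nu> = sets \<mu>"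
    and l[measurable]: "l \<in> borel_measurable \<mu>" and g: "bdmeas \<mu> B g" and g0: "\<And>x. x \<in> space \<mu> \<Longrightarrow> 0 \<le> g x"
    and eq: "\<And>s. (\<integral>x. g x *\<^sub>R iexp (s * l x) \<partial>\<mu>) = (\<integral>x. g x *\<^sub>R iexp (s * l x) \<partial>\<nu>)"
    and A[measurable]: "A \<in> sets borel"
  shows "(\<integral>x. g x * indicator A (l x) \<partial>\<mu>) = (\<integral>x. g x * indicator A (l x) \<partial>\<nu>)"
proof -
  interpret m: prob_space \<mu> by (rule mu)
  interpret n: prob_space \<nu> by (rule nu)
  have sp: "space \<nu> = space \<mu>" using sets by (rule sets_eq_imp_space_eq)
  note [measurable_cong] = sets
  have [measurable]: "g \<in> borel_measurable \<mu>" by (rule bdmeas_meas[OF g])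
  have gn: "bdmeas \<nu> B g" using g sp by (auto simp: bdmeas_def)
  have ig: "integrable \<mu> g" "integrable \<nu> g" using g gn m.bdmeas_integrable n.bdmeas_integrable by auto
  define m where "m = (\<integral>x. g x \<partial>\<mu>)"
  have mn: "m = (\<integral>x. g x \<partial>\<nu>)"
  proof -
    have "complex_of_real m = (\<integral>x. complex_of_real (g x) \<partial>\<mu>)" by (simp add: m_def)
    also have "\<dots> = (\<integral>x. complex_of_real (g x) \<partial>\<nu>)" using eq[of 0] by (simp add: scaleR_conv_of_real)
    finally show ?thesis by simp
  qed
  have m0: "0 \<le> m" unfolding m_def using g0 by (intro integral_nonneg_AE AE_I2) auto
  show ?thesis
  proof (cases "m = 0")
    case True
    have "AE x in \<mu>. g x = 0"
      using True g0 integral_nonneg_eq_0_iff_AE[OF ig(1)] by (auto simp: m_def)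
    moreover have "AE x in \<nu>. g x = 0"
      using True g0 sp integral_nonneg_eq_0_iff_AE[OF ig(2)] by (auto simp: mn)
    ultimately have "AE x in \<mu>. g x * indicator A (l x) = 0" "AE x in \<nu>. g x * indicator A (l x) = 0" by auto
    then have "(\<integral>x. g x * indicator A (l x) \<partial>\<mu>) = (\<integral>x. 0 \<partial>\<mu>)" "(\<integral>x. g x * indicator A (l x) \<partial>\<nu>) = (\<integral>x. 0 \<partial>\<nu>)"
      by (simp_all only: integral_eq_zero_AE integral_zero)
    then show ?thesis by simp
  next
    case False
    with m0 have m0: "0 < m" by simp
    define D where "D = (\<lambda>M. distr (density M (\<lambda>x. ennreal (g x / m))) borel l)"
    have *: "real_distribution (D M) \<and> (\<forall>s. char (D M) s = (\<integral>x. g x *\<^sub>R iexp (s * l x) \<partial>M) / m)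
        \<and> measure (D M) A = (\<integral>x. g x * indicator A (l x) \<partial>M) / m"
      if M: "sets M = sets \<mu>" and iM: "integrable M g" and mM: "m = (\<integral>x. g x \<partial>M)" for M
    proof -
      note [measurable_cong] = M
      have sM: "space M = space \<mu>" using M by (rule sets_eq_imp_space_eq)
      have g0': "AE x in M. 0 \<le> g x / m" using g0 m0 sM by auto
      have "emeasure (density M (\<lambda>x. ennreal (g x / m))) (space (density M (\<lambda>x. ennreal (g x / m)))) = (\<integral>\<^sup>+x. ennreal (g x / m) \<partial>M)"
        by (simp add: emeasure_density cong: nn_integral_cong)
      also have "\<dots> = ennreal (\<integral>x. g x / m \<partial>M)" using iM g0' by (intro nn_integral_eq_integral) auto
      also have "\<dots> = 1" using m0 by (simp add: mM[symmetric])
      finally interpret P: prob_space "density M (\<lambda>x. ennreal (g x / m))" by rule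
      have "real_distribution (D M)" unfolding D_def
        by (intro P.real_distribution_distr) measurable
      moreover have "char (D M) s = (\<integral>x. g x *\<^sub>R iexp (s * l x) \<partial>M) / m" for s
      proof -
        have "char (D M) s = (\<integral>x. iexp (s * l x) \<partial>density M (\<lambda>x. ennreal (g x / m)))"
          unfolding char_def D_def by (rule integral_distr) measurable
        also have "\<dots> = (\<integral>x. (g x / m) *\<^sub>R iexp (s * l x) \<partial>M)"
          using g0' by (intro integral_density) measurable
        also have "\<dots> = (\<integral>x. (g x *\<^sub>R iexp (s * l x)) / m \<partial>M)" by (simp add: scaleR_conv_of_real)
        finally show ?thesis by (simp only: integral_divide_zero)
      qed
      moreover have "measure (D M) A = (\<integral>x. g x * indicator A (l x) \<partial>M) / m"
      proof -
        have "measure (D M) A = (\<integral>x. indicator A (l x) \<partial>density M (\<lambda>x. ennreal (g x / m)))"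
        proof -
          have "measure (D M) A = (\<integral>x. indicator A x \<partial>D M)" by (simp add: D_def)
          also have "\<dots> = (\<integral>x. indicator A (l x) \<partial>density M (\<lambda>x. ennreal (g x / m)))"
            unfolding D_def by (rule integral_distr) measurable
          finally show ?thesis .
        qed
        also have "\<dots> = (\<integral>x. (g x / m) *\<^sub>R indicator A (l x) \<partial>M)"
          using g0' by (intro integral_density) measurable
        also have "\<dots> = (\<integral>x. (g x * indicator A (l x)) / m \<partial>M)" by simp
        finally show ?thesis by (simp only: integral_divide_zero)
      qed
      ultimately show ?thesis by blast
    qed
    note 1 = *[OF refl ig(1) m_def] and 2 = *[OF sets ig(2) mn]
    have "D \<mu> = D \<nu>" using 1 2 eq by (intro Levy_uniqueness) auto
    then show ?thesis using 1 2 m0 by (metis divide_cancel_right less_irrefl)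
  qed
qed

text \<open>An event \<open>l0 x \<in> A\<close> may be inserted into a weight without destroying the equality of the weighted
characteristic functionals. The function \<open>iexp (l x)\<close> is not a non-negative weight, so the step
uses the non-negative weights \<open>g\<close>, \<open>g * (1 + cos l)\<close> and \<open>g * (1 + sin l)\<close>, whose characteristic functions along
\<open>l0\<close> are combinations of given ones because \<open>L\<close> is a vector space.\<close>

lemma char_determined_step:
  fixes L :: "('a \<Rightarrow> real) set"
  assumes mu: "prob_space \<mu>" and nu: "prob_space \<nu>" and sets: "sets \<nu> = sets \<mu>"
    and L: "\<And>l. l \<in> L \<Longrightarrow> l \<in> borel_measurable \<mu>"
    and lin: "\<And>l l' s. l \<in> L \<Longrightarrow> l' \<in> L \<Longrightarrow> (\<lambda>x. s * l x + l' x) \<in> L"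
    and zero: "(\<lambda>x. 0) \<in> L"
    and g: "bdmeas \<mu> B g" and g0: "\<And>x. x \<in> space \<mu> \<Longrightarrow> 0 \<le> g x"
    and eq: "\<And>l. l \<in> L \<Longrightarrow> (\<integral>x. g x *\<^sub>R iexp (l x) \<partial>\<mu>) = (\<integral>x. g x *\<^sub>R iexp (l x) \<partial>\<nu>)"
    and l0: "l0 \<in> L" and A: "A \<in> sets borel" and l: "l \<in> L"
  shows "(\<integral>x. (g x * indicator A (l0 x)) *\<^sub>R iexp (l x) \<partial>\<mu>) = (\<integral>x. (g x * indicator A (l0 x)) *\<^sub>R iexp (l x) \<partial>\<nu>)"
proof -
  interpret m: prob_space \<mu> by (rule mu)
  interpret n: prob_space \<nu> by (rule nu)
  have sp: "space \<nu> = space \<mu>" using sets by (rule sets_eq_imp_space_eq)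
  note [measurable_cong] = sets
  note [measurable] = L[OF l0] L[OF l] bdmeas_meas[OF g] A
  have gn: "bdmeas \<nu> B g" using g sp by (auto simp: bdmeas_def)
  have B: "0 \<le> B" by (rule m.bdmeas_nonneg[OF g])
  have gb: "\<bar>g x\<bar> \<le> B" if "x \<in> space \<mu>" for x using bdmeas_bound[OF g that] .
  have int: "integrable \<mu> (\<lambda>x. g x *\<^sub>R iexp (f x))" "integrable \<nu> (\<lambda>x. g x *\<^sub>R iexp (f x))"
    if [measurable]: "f \<in> borel_measurable \<mu>" for f
    using gb sp by (auto intro!: m.integrable_const_bound[where B=B] n.integrable_const_bound[where B=B])
  have mean_cos: "(\<integral>x. (g x * (1 + cos (l x))) *\<^sub>R iexp (s * l0 x) \<partial>M) =
      (\<integral>x. g x *\<^sub>R iexp (s * l0 x) \<partial>M) + ((\<integral>x. g x *\<^sub>R iexp (s * l0 x + l x) \<partial>M) + (\<integral>x. g x *\<^sub>R iexp ((-1) * l x + s * l0 x) \<partial>M)) / 2"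
    and mean_sin: "(\<integral>x. (g x * (1 + sin (l x))) *\<^sub>R iexp (s * l0 x) \<partial>M) =
      (\<integral>x. g x *\<^sub>R iexp (s * l0 x) \<partial>M) + ((\<integral>x. g x *\<^sub>R iexp (s * l0 x + l x) \<partial>M) - (\<integral>x. g x *\<^sub>R iexp ((-1) * l x + s * l0 x) \<partial>M)) / (2 * \<i>)"
    if M: "M = \<mu> \<or> M = \<nu>" for s M
  proof -
    have iM: "integrable M (\<lambda>x. g x *\<^sub>R iexp (f x))" if "f \<in> borel_measurable \<mu>" for f
      using M int[OF that] by blast
    have i: "integrable M (\<lambda>x. g x *\<^sub>R iexp (s * l0 x))" "integrable M (\<lambda>x. g x *\<^sub>R iexp (s * l0 x + l x))"
      "integrable M (\<lambda>x. g x *\<^sub>R iexp ((-1) * l x + s * l0 x))" by (rule iM, measurable)+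
    have e: "complex_of_real (cos y) = (iexp y + iexp (-y)) / 2" "complex_of_real (sin y) = (iexp y - iexp (-y)) / (2 * \<i>)" for y
      by (simp_all add: cos_of_real[symmetric] sin_of_real[symmetric] cos_exp_eq sin_exp_eq)
    have a: "iexp (s * l0 x + l x) = iexp (s * l0 x) * iexp (l x)"
      "iexp ((-1) * l x + s * l0 x) = iexp (s * l0 x) * iexp (- l x)" for x
      by (simp_all add: exp_add[symmetric] ring_distribs)
    have alg: "(G * (1 + (p + q) / 2)) * u = G * u + (G * (u * p) + G * (u * q)) / 2"
      "(G * (1 + (p - q) / (2 * \<i>))) * u = G * u + (G * (u * p) - G * (u * q)) / (2 * \<i>)" for G p q u :: complex
      by (simp_all add: field_simps)
    have "(\<integral>x. (g x * (1 + cos (l x))) *\<^sub>R iexp (s * l0 x) \<partial>M) =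
      (\<integral>x. g x *\<^sub>R iexp (s * l0 x) + (g x *\<^sub>R iexp (s * l0 x + l x) + g x *\<^sub>R iexp ((-1) * l x + s * l0 x)) / 2 \<partial>M)"
      by (rule Bochner_Integration.integral_cong[OF refl])
        (simp only: scaleR_conv_of_real of_real_mult of_real_add of_real_1 e a[unfolded of_real_add of_real_mult] alg)
    then show "(\<integral>x. (g x * (1 + cos (l x))) *\<^sub>R iexp (s * l0 x) \<partial>M) =
      (\<integral>x. g x *\<^sub>R iexp (s * l0 x) \<partial>M) + ((\<integral>x. g x *\<^sub>R iexp (s * l0 x + l x) \<partial>M) + (\<integral>x. g x *\<^sub>R iexp ((-1) * l x + s * l0 x) \<partial>M)) / 2"
      using i by (simp del: mult_minus1)
    have "(\<integral>x. (g x * (1 + sin (l x))) *\<^sub>R iexp (s * l0 x) \<partial>M) =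
      (\<integral>x. g x *\<^sub>R iexp (s * l0 x) + (g x *\<^sub>R iexp (s * l0 x + l x) - g x *\<^sub>R iexp ((-1) * l x + s * l0 x)) / (2 * \<i>) \<partial>M)"
      by (rule Bochner_Integration.integral_cong[OF refl])
        (simp only: scaleR_conv_of_real of_real_mult of_real_add of_real_1 e a[unfolded of_real_add of_real_mult] alg)
    then show "(\<integral>x. (g x * (1 + sin (l x))) *\<^sub>R iexp (s * l0 x) \<partial>M) =
      (\<integral>x. g x *\<^sub>R iexp (s * l0 x) \<partial>M) + ((\<integral>x. g x *\<^sub>R iexp (s * l0 x + l x) \<partial>M) - (\<integral>x. g x *\<^sub>R iexp ((-1) * l x + s * l0 x) \<partial>M)) / (2 * \<i>)"
      using i by (simp del: mult_minus1)
  qed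
  have in1: "(\<lambda>x. s * l0 x) \<in> L" for s using lin[OF l0 zero] by simp
  have eqs: "(\<integral>x. g x *\<^sub>R iexp (s * l0 x) \<partial>\<mu>) = (\<integral>x. g x *\<^sub>R iexp (s * l0 x) \<partial>\<nu>)"
    "(\<integral>x. g x *\<^sub>R iexp (s * l0 x + l x) \<partial>\<mu>) = (\<integral>x. g x *\<^sub>R iexp (s * l0 x + l x) \<partial>\<nu>)"
    "(\<integral>x. g x *\<^sub>R iexp ((-1) * l x + s * l0 x) \<partial>\<mu>) = (\<integral>x. g x *\<^sub>R iexp ((-1) * l x + s * l0 x) \<partial>\<nu>)" for s
    by (rule eq[OF in1] eq[OF lin[OF l0 l]] eq[OF lin[OF l in1]])+
  have bd: "bdmeas \<mu> (B * 2) (\<lambda>x. g x * (1 + f (l x)))" if "f \<in> {cos, sin}" for f :: "real \<Rightarrow> real"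
  proof (rule m.bdmeas_mult[OF g], rule bdmeasI)
    show "(\<lambda>x. 1 + f (l x)) \<in> borel_measurable \<mu>" using that by auto
    show "\<bar>1 + f (l t)\<bar> \<le> 2" for t
    proof -
      have "\<bar>f (l t)\<bar> \<le> 1" using that by auto
      then show ?thesis by linarith
    qed
  qed
  have nn: "0 \<le> g x * (1 + f (l x))" if "f \<in> {cos, sin}" "x \<in> space \<mu>" for f :: "real \<Rightarrow> real" and x
  proof -
    have "\<bar>f (l x)\<bar> \<le> 1" using that by auto
    then have "0 \<le> 1 + f (l x)" by linarith
    then show ?thesis using g0[OF that(2)] by simp
  qed
  have c: "(\<integral>x. g x * (1 + cos (l x)) * indicator A (l0 x) \<partial>\<mu>) = (\<integral>x. g x * (1 + cos (l x)) * indicator A (l0 x) \<partial>\<nu>)"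
  proof (rule weighted_levy[OF mu nu sets L[OF l0] bd nn _ A])
    show "(\<integral>x. (g x * (1 + cos (l x))) *\<^sub>R iexp (s * l0 x) \<partial>\<mu>) = (\<integral>x. (g x * (1 + cos (l x))) *\<^sub>R iexp (s * l0 x) \<partial>\<nu>)" for s
      unfolding mean_cos[OF disjI1[OF refl]] mean_cos[OF disjI2[OF refl]] eqs ..
  qed auto
  have s: "(\<integral>x. g x * (1 + sin (l x)) * indicator A (l0 x) \<partial>\<mu>) = (\<integral>x. g x * (1 + sin (l x)) * indicator A (l0 x) \<partial>\<nu>)"
  proof (rule weighted_levy[OF mu nu sets L[OF l0] bd nn _ A])
    show "(\<integral>x. (g x * (1 + sin (l x))) *\<^sub>R iexp (s * l0 x) \<partial>\<mu>) = (\<integral>x. (g x * (1 + sin (l x))) *\<^sub>R iexp (s * l0 x) \<partial>\<nu>)" for s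
      unfolding mean_sin[OF disjI1[OF refl]] mean_sin[OF disjI2[OF refl]] eqs ..
  qed auto
  have o: "(\<integral>x. g x * indicator A (l0 x) \<partial>\<mu>) = (\<integral>x. g x * indicator A (l0 x) \<partial>\<nu>)"
    by (rule weighted_levy[OF mu nu sets L[OF l0] g g0 eqs(1) A]) 
  have split: "(\<integral>x. (g x * indicator A (l0 x)) *\<^sub>R iexp (l x) \<partial>M) =
      complex_of_real ((\<integral>x. g x * (1 + cos (l x)) * indicator A (l0 x) \<partial>M) - (\<integral>x. g x * indicator A (l0 x) \<partial>M))
      + \<i> * complex_of_real ((\<integral>x. g x * (1 + sin (l x)) * indicator A (l0 x) \<partial>M) - (\<integral>x. g x * indicator A (l0 x) \<partial>M))"
    if M: "M = \<mu> \<or> M = \<nu>" for M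
  proof -
    have pm: "prob_space M" using M mu nu by auto
    interpret M: prob_space M by (rule pm)
    have bM: "bdmeas M B' f" if "bdmeas \<mu> B' f" for B' f using M that sp by (auto simp: bdmeas_def)
    have ind: "bdmeas \<mu> 1 (\<lambda>x. indicator A (l0 x))" by (rule bdmeasI) (auto simp: indicator_def)
    have i: "integrable M (\<lambda>x. g x * indicator A (l0 x))"
      "integrable M (\<lambda>x. g x * (1 + cos (l x)) * indicator A (l0 x))"
      "integrable M (\<lambda>x. g x * (1 + sin (l x)) * indicator A (l0 x))"
      using M.bdmeas_integrable[OF bM[OF m.bdmeas_mult[OF g ind]]]
        M.bdmeas_integrable[OF bM[OF m.bdmeas_mult[OF bd[of cos] ind]]]
        M.bdmeas_integrable[OF bM[OF m.bdmeas_mult[OF bd[of sin] ind]]] by simp_all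
    have "(\<integral>x. (g x * indicator A (l0 x)) *\<^sub>R iexp (l x) \<partial>M) =
       (\<integral>x. complex_of_real (g x * (1 + cos (l x)) * indicator A (l0 x) - g x * indicator A (l0 x))
        + \<i> * complex_of_real (g x * (1 + sin (l x)) * indicator A (l0 x) - g x * indicator A (l0 x)) \<partial>M)"
      by (rule Bochner_Integration.integral_cong[OF refl])
        (simp add: scaleR_conv_of_real exp_Euler[of "complex_of_real _"] cos_of_real sin_of_real algebra_simps)
    also have "\<dots> = complex_of_real (\<integral>x. g x * (1 + cos (l x)) * indicator A (l0 x) - g x * indicator A (l0 x) \<partial>M)
      + \<i> * complex_of_real (\<integral>x. g x * (1 + sin (l x)) * indicator A (l0 x) - g x * indicator A (l0 x) \<partial>M)"
      using i by (subst Bochner_Integration.integral_add) (auto intro!: integrable_mult_right simp del: of_real_diff of_real_mult)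
    finally show ?thesis using i by simp
  qed
  show ?thesis using split[of \<mu>] split[of \<nu>] c s o by simp
qed

lemma char_determined_cylinder:
  fixes L :: "('a \<Rightarrow> real) set"
  assumes mu: "prob_space \<mu>" and nu: "prob_space \<nu>" and sets: "sets \<nu> = sets \<mu>"
    and L: "\<And>l. l \<in> L \<Longrightarrow> l \<in> borel_measurable \<mu>"
    and lin: "\<And>l l' s. l \<in> L \<Longrightarrow> l' \<in> L \<Longrightarrow> (\<lambda>x. s * l x + l' x) \<in> L"
    and zero: "(\<lambda>x. 0) \<in> L"
    and eq: "\<And>l. l \<in> L \<Longrightarrow> (\<integral>x. iexp (l x) \<partial>\<mu>) = (\<integral>x. iexp (l x) \<partial>\<nu>)"
    and xs: "set xs \<subseteq> L \<times> sets borel"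
  shows "emeasure \<mu> {x\<in>space \<mu>. \<forall>(l, A)\<in>set xs. l x \<in> A} = emeasure \<nu> {x\<in>space \<mu>. \<forall>(l, A)\<in>set xs. l x \<in> A}"
proof -
  interpret m: prob_space \<mu> by (rule mu)
  interpret n: prob_space \<nu> by (rule nu)
  have sp: "space \<nu> = space \<mu>" using sets by (rule sets_eq_imp_space_eq)
  define C where "C = (\<lambda>xs :: (('a \<Rightarrow> real) \<times> real set) list. {x\<in>space \<mu>. \<forall>(l, A)\<in>set xs. l x \<in> A})"
  have Cm: "C xs \<in> sets \<mu>" if "set xs \<subseteq> L \<times> sets borel" for xs
    using that
  proof (induction xs)
    case (Cons a xs)
    obtain l A where a: "a = (l, A)" by (cases a)
    have 1: "l -` A \<inter> space \<mu> \<in> sets \<mu>" using Cons.prems L a by (intro measurable_sets) auto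
    have "C (a # xs) = (l -` A \<inter> space \<mu>) \<inter> C xs" by (auto simp: C_def a)
    then show ?case using Cons 1 by auto
  qed (simp add: C_def)
  have Ci: "bdmeas \<mu> 1 (indicator (C xs))" if "set xs \<subseteq> L \<times> sets borel" for xs
    using Cm[OF that] by (intro bdmeasI) (auto simp: indicator_def)
  have key: "(\<integral>x. indicator (C xs) x *\<^sub>R iexp (l x) \<partial>\<mu>) = (\<integral>x. indicator (C xs) x *\<^sub>R iexp (l x) \<partial>\<nu>)"
    if "set xs \<subseteq> L \<times> sets borel" "l \<in> L" for xs l
    using that
  proof (induction xs arbitrary: l)
    case Nil
    have "(\<integral>x. indicator (C []) x *\<^sub>R iexp (l x) \<partial>M) = (\<integral>x. iexp (l x) \<partial>M)" if "space M = space \<mu>" for M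
      using that by (intro Bochner_Integration.integral_cong refl) (simp add: C_def)
    then show ?case using eq[OF Nil(2)] sp by simp
  next
    case (Cons a xs)
    obtain l0 A where a: "a = (l0, A)" by (cases a)
    have xs: "set xs \<subseteq> L \<times> sets borel" "l0 \<in> L" "A \<in> sets borel" using Cons.prems a by auto
    have *: "(\<integral>x. indicator (C (a # xs)) x *\<^sub>R iexp (l x) \<partial>M) =
        (\<integral>x. (indicator (C xs) x * indicator A (l0 x)) *\<^sub>R iexp (l x) \<partial>M)" if "space M = space \<mu>" for M
      using that by (intro Bochner_Integration.integral_cong refl) (auto simp: C_def a indicator_def)
    have "(\<integral>x. (indicator (C xs) x * indicator A (l0 x)) *\<^sub>R iexp (l x) \<partial>\<mu>) =
        (\<integral>x. (indicator (C xs) x * indicator A (l0 x)) *\<^sub>R iexp (l x) \<partial>\<nu>)"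
      by (rule char_determined_step[OF mu nu sets L lin zero Ci[OF xs(1)] _ Cons.IH[OF xs(1)] xs(2,3) Cons.prems(2)])
        (auto simp: indicator_def)
    then show ?case using * sp by simp
  qed
  have "(\<integral>x. indicator (C xs) x *\<^sub>R iexp 0 \<partial>\<mu>) = (\<integral>x. indicator (C xs) x *\<^sub>R iexp 0 \<partial>\<nu>)"
    using key[OF xs zero] by simp
  then have "complex_of_real (\<integral>x. indicator (C xs) x \<partial>\<mu>) = complex_of_real (\<integral>x. indicator (C xs) x \<partial>\<nu>)"
    by (simp add: scaleR_conv_of_real)
  then have "measure \<mu> (C xs) = measure \<nu> (C xs)"
    using Cm[OF xs] sets by (simp add: sets.Int_space_eq2 sp)
  then show ?thesis by (simp add: m.emeasure_eq_measure n.emeasure_eq_measure C_def)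
qed

text \<open>By separability a closed ball around \<open>c\<close> is an intersection of countably many half-spaces, and an
open set is a countable union of balls.\<close>

lemma borel_measurable_by_inner:
  fixes f :: "'a \<Rightarrow> 'h::{real_inner, second_countable_topology}"
  assumes S: "subspace S" and f: "\<And>w. w \<in> space M \<Longrightarrow> f w \<in> S"
    and m: "\<And>h. h \<in> S \<Longrightarrow> (\<lambda>w. f w \<bullet> h) \<in> borel_measurable M"
  shows "f \<in> borel_measurable M"
proof (rule borel_measurableI)
  obtain D where D: "countable D" "D \<subseteq> S" "S \<subseteq> closure D" by (rule separable)
  have ball: "{w\<in>space M. dist c (f w) \<le> r} \<in> sets M" if c: "c \<in> S" and r: "0 \<le> r" for c r
  proof -
    have "{w\<in>space M. dist c (f w) \<le> r} = {w\<in>space M. \<forall>d\<in>D. f w \<bullet> d - c \<bullet> d \<le> r * norm d}"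
    proof (intro Collect_cong conj_cong refl iffI ballI)
      fix w d assume w: "w \<in> space M" and d: "dist c (f w) \<le> r"
      have "f w \<bullet> d - c \<bullet> d = (f w - c) \<bullet> d" by (simp add: inner_diff_left)
      also have "\<dots> \<le> norm (f w - c) * norm d" by (rule norm_cauchy_schwarz)
      also have "\<dots> \<le> r * norm d" using d by (intro mult_right_mono) (auto simp: dist_norm norm_minus_commute)
      finally show "f w \<bullet> d - c \<bullet> d \<le> r * norm d" .
    next
      fix w assume w: "w \<in> space M" and a: "\<forall>d\<in>D. f w \<bullet> d - c \<bullet> d \<le> r * norm d"
      let ?y = "f w - c"
      have y: "?y \<in> S" using f[OF w] c S by (simp add: subspace_diff)
      have cl: "closed {d. ?y \<bullet> d \<le> r * norm d}" by (intro closed_Collect_le continuous_intros)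
      have "D \<subseteq> {d. ?y \<bullet> d \<le> r * norm d}" using a by (auto simp: inner_diff_left)
      then have "closure D \<subseteq> {d. ?y \<bullet> d \<le> r * norm d}" by (rule closure_minimal[OF _ cl])
      then have "?y \<bullet> ?y \<le> r * norm ?y" using y D(3) by auto
      then have "norm ?y * norm ?y \<le> r * norm ?y" by (simp add: dot_square_norm power2_eq_square)
      then have "norm ?y \<le> r" using r by (cases "norm ?y = 0") auto
      then show "dist c (f w) \<le> r" by (simp add: dist_norm norm_minus_commute)
    qed
    also have "\<dots> \<in> sets M"
    proof (rule sets.sets_Collect_countable_All'[OF _ D(1)])
      fix d assume "d \<in> D"
      then have [measurable]: "(\<lambda>w. f w \<bullet> d) \<in> borel_measurable M" using m D(2) by auto
      show "{w\<in>space M. f w \<bullet> d - c \<bullet> d \<le> r * norm d} \<in> sets M" by measurable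
    qed
    finally show ?thesis .
  qed
  fix U :: "'h set" assume U: "open U"
  define P where "P = {p. fst p \<in> D \<and> cball (fst p) (1 / Suc (snd p)) \<subseteq> U}"
  have P: "countable P"
    by (rule countable_subset[of _ "D \<times> (UNIV :: nat set)"]) (use D(1) in \<open>auto simp: P_def\<close>)
  have "f -` U \<inter> space M = (\<Union>p\<in>P. {w\<in>space M. dist (fst p) (f w) \<le> 1 / Suc (snd p)})"
  proof (intro equalityI subsetI)
    fix w assume w: "w \<in> f -` U \<inter> space M"
    then obtain e where e: "0 < e" "ball (f w) e \<subseteq> U" using U by (auto simp: open_contains_ball)
    obtain n where n: "1 / Suc n < e / 2" using nat_approx_posE[of "e/2"] e by auto
    have "f w \<in> closure D" using f w D(3) by auto
    moreover have "0 < 1 / real (Suc n)" by simp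
    ultimately have "\<exists>c\<in>D. dist c (f w) < 1 / Suc n" by (rule closure_approachable[THEN iffD1, rule_format])
    then obtain c where c: "c \<in> D" "dist c (f w) < 1 / Suc n" ..
    have "cball c (1 / Suc n) \<subseteq> ball (f w) e"
    proof
      fix z assume "z \<in> cball c (1 / Suc n)"
      then have "dist (f w) z < e" using dist_triangle[of "f w" z c] c(2) n by (simp add: dist_commute)
      then show "z \<in> ball (f w) e" by simp
    qed
    then show "w \<in> (\<Union>p\<in>P. {w\<in>space M. dist (fst p) (f w) \<le> 1 / Suc (snd p)})"
      using c e w by (intro UN_I[of "(c, n)"]) (auto simp: P_def)
  qed (auto simp: P_def)
  also have "\<dots> \<in> sets M"
  proof -
    have "{w\<in>space M. dist (fst p) (f w) \<le> 1 / Suc (snd p)} \<in> sets M" if "p \<in> P" for p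
      using that D(2) by (intro ball) (auto simp: P_def)
    then show ?thesis by (intro sets.countable_UN' P) auto
  qed
  finally show "f -` U \<inter> space M \<in> sets M" .
qed

lemma gaussian_dsum_single:
  assumes g: "gaussian_dsum Q k S C x" and S: "\<And>m. m \<in> {1..k} \<Longrightarrow> subspace (S m)"
    and m: "m \<in> {1..k}" and h: "h \<in> S m"
  shows "distr Q borel (\<lambda>q. x q m \<bullet> h) = real_gaussian (blinfun_apply (C m) h \<bullet> h)"
proof -
  define h' where "h' = (\<lambda>j. if j = m then h else 0)"
  have "\<forall>j\<in>{1..k}. h' j \<in> S j" using h S by (auto simp: h'_def subspace_0)
  then have "distr Q borel (\<lambda>q. dsum_inner k (x q) h') = real_gaussian (dsum_inner k (dsum_op C h') h')"
    using g by (simp add: gaussian_dsum_def)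
  moreover have "dsum_inner k y h' = y m \<bullet> h" for y
  proof -
    have "dsum_inner k y h' = (\<Sum>j\<in>{1..k}. if j = m then y j \<bullet> h else 0)"
      unfolding dsum_inner_def h'_def by (rule sum.cong) auto
    then show ?thesis using m by simp
  qed
  ultimately show ?thesis by (simp add: dsum_op_def h'_def)
qed

text \<open>The law is carried by the subspace \<open>S m\<close>, so that pointwise statements about elements of \<open>S m\<close> hold
on its whole space. Outside \<open>{1..k}\<close> a point mass keeps every component law a probability measure.\<close>

definition component_law :: "'q measure \<Rightarrow> nat \<Rightarrow> (nat \<Rightarrow> 'h::real_inner set) \<Rightarrow> ('q \<Rightarrow> nat \<Rightarrow> 'h) \<Rightarrow> nat \<Rightarrow> 'h measure" where
  "component_law Q k S x m =
     (if m \<in> {1..k} then distr Q (restrict_space borel (S m)) (\<lambda>q. x q m) else return borel 0)"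

text \<open>The components of a Gaussian element of the direct sum are independent: the joint law and the
product of the marginals have the same characteristic functional, since a variance that is a sum
over the components turns the exponential into a product. The cylinder sets of the functionals
\<open>\<omega> \<mapsto> (\<Sum>m. \<omega> m \<bullet> h m)\<close> generate the product \<open>\<sigma>\<close>-algebra, so the two laws agree.\<close>

lemma gaussian_dsum_distr:
  fixes x :: "'q \<Rightarrow> nat \<Rightarrow> 'h::{real_inner, second_countable_topology}"
  assumes Q: "prob_space Q" and g: "gaussian_dsum Q k S C x" and S: "\<And>m. m \<in> {1..k} \<Longrightarrow> subspace (S m)"
    and C: "\<And>m h. m \<in> {1..k} \<Longrightarrow> h \<in> S m \<Longrightarrow> 0 \<le> blinfun_apply (C m) h \<bullet> h"
  shows "distr Q (Pi\<^sub>M {1..k} (\<lambda>m. restrict_space borel (S m))) (\<lambda>q. \<lambda>m\<in>{1..k}. x q m) = Pi\<^sub>M {1..k} (component_law Q k S x)"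
    and "(\<lambda>q. \<lambda>m\<in>{1..k}. x q m) \<in> measurable Q (Pi\<^sub>M {1..k} (\<lambda>m. restrict_space borel (S m)))"
    and "\<And>m. prob_space (component_law Q k S x m)"
proof -
  interpret Q: prob_space Q by (rule Q)
  let ?I = "{1..k}"
  let ?M = "Pi\<^sub>M ?I (\<lambda>m. restrict_space borel (S m))"
  let ?G = "component_law Q k S x"
  have xm: "(\<lambda>q. x q m) \<in> measurable Q (restrict_space borel (S m))" if "m \<in> ?I" for m
    using g that by (intro measurable_restrict_space2) (auto simp: gaussian_dsum_def)
  then show xM: "(\<lambda>q. \<lambda>m\<in>?I. x q m) \<in> measurable Q ?M" by (intro measurable_restrict) auto
  show G: "prob_space (?G m)" for m
    using xm by (auto simp: component_law_def intro!: Q.prob_space_distr prob_space_return)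
  have sG: "sets (?G m) = sets (restrict_space borel (S m))" if "m \<in> ?I" for m
    using that by (simp add: component_law_def)
  interpret PG: product_prob_space ?G ?I
    using G by (simp add: product_prob_space_def product_prob_space_axioms_def product_sigma_finite_def prob_space_imp_sigma_finite)
  let ?\<mu> = "distr Q ?M (\<lambda>q. \<lambda>m\<in>?I. x q m)" and ?\<nu> = "Pi\<^sub>M ?I ?G"
  have sets: "sets ?\<nu> = sets ?\<mu>" using sets_PiM_cong[of ?I ?I ?G "\<lambda>m. restrict_space borel (S m)"] sG by simp
  have mu: "prob_space ?\<mu>" by (rule Q.prob_space_distr[OF xM])
  have nu: "prob_space ?\<nu>" by (rule prob_space_PiM) (rule G)
  have comp: "(\<lambda>\<omega>. \<omega> m) \<in> borel_measurable ?M" if "m \<in> ?I" for m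
    using measurable_component_singleton[OF that, of "\<lambda>m. restrict_space borel (S m)"]
    by (rule measurable_compose[OF _ measurable_restrict_space1[OF measurable_ident_sets[OF refl]]])
  define L where "L = {l. \<exists>h. (\<forall>m\<in>?I. h m \<in> S m) \<and> l = (\<lambda>\<omega>. \<Sum>m\<in>?I. \<omega> m \<bullet> h m)}"
  have LE: "\<exists>h. (\<forall>m\<in>?I. h m \<in> S m) \<and> l = (\<lambda>\<omega>. \<Sum>m\<in>?I. \<omega> m \<bullet> h m)" if "l \<in> L" for l
    using that unfolding L_def mem_Collect_eq .
  have Lm: "l \<in> borel_measurable ?\<mu>" if "l \<in> L" for l
  proof -
    from LE[OF that] obtain h where hl: "(\<forall>m\<in>?I. h m \<in> S m) \<and> l = (\<lambda>\<omega>. \<Sum>m\<in>?I. \<omega> m \<bullet> h m)" ..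
    then have l: "l = (\<lambda>\<omega>. \<Sum>m\<in>?I. \<omega> m \<bullet> h m)" by (rule conjunct2)
    have "(\<lambda>\<omega>. \<omega> m \<bullet> h m) \<in> borel_measurable ?M" if "m \<in> ?I" for m
      by (rule borel_measurable_inner[OF comp[OF that]]) simp
    then show ?thesis unfolding l by simp
  qed
  have Llin: "(\<lambda>x. s * l x + l' x) \<in> L" if l: "l \<in> L" and l': "l' \<in> L" for l l' s
  proof -
    from LE[OF l] obtain h where "(\<forall>m\<in>?I. h m \<in> S m) \<and> l = (\<lambda>\<omega>. \<Sum>m\<in>?I. \<omega> m \<bullet> h m)" ..
    note h = this[THEN conjunct1] this[THEN conjunct2]
    from LE[OF l'] obtain h' where "(\<forall>m\<in>?I. h' m \<in> S m) \<and> l' = (\<lambda>\<omega>. \<Sum>m\<in>?I. \<omega> m \<bullet> h' m)" ..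
    note h' = this[THEN conjunct1] this[THEN conjunct2]
    show ?thesis unfolding L_def
      using h h' S by (intro CollectI exI[of _ "\<lambda>m. s *\<^sub>R h m + h' m"])
        (auto simp: subspace_add subspace_scale inner_add_right sum_distrib_left sum.distrib)
  qed
  have L0: "(\<lambda>x. 0) \<in> L" unfolding L_def using S by (intro CollectI exI[of _ "\<lambda>_. 0"]) (auto simp: subspace_0)
  have single: "(\<lambda>\<omega>. \<Sum>j\<in>?I. \<omega> j \<bullet> (if j = m then h else 0)) \<in> L" "(\<Sum>j\<in>?I. \<omega> j \<bullet> (if j = m then h else 0)) = \<omega> m \<bullet> h"
    if m: "m \<in> ?I" and h: "h \<in> S m" for m h \<omega>
  proof -
    show "(\<lambda>\<omega>. \<Sum>j\<in>?I. \<omega> j \<bullet> (if j = m then h else 0)) \<in> L"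
      unfolding L_def using h S by (intro CollectI exI[of _ "\<lambda>j. if j = m then h else 0"]) (auto simp: subspace_0)
    have "(\<Sum>j\<in>?I. \<omega> j \<bullet> (if j = m then h else 0)) = (\<Sum>j\<in>?I. if j = m then \<omega> j \<bullet> h else 0)"
      by (rule sum.cong) auto
    then show "(\<Sum>j\<in>?I. \<omega> j \<bullet> (if j = m then h else 0)) = \<omega> m \<bullet> h" using m by simp
  qed
  have char1: "(\<integral>q. iexp (x q m \<bullet> h) \<partial>Q) = complex_of_real (exp (- (blinfun_apply (C m) h \<bullet> h) / 2))"
    if m: "m \<in> ?I" and h: "h \<in> S m" for m h
  proof -
    have "(\<lambda>q. x q m \<bullet> h) \<in> borel_measurable Q" using g m by (auto simp: gaussian_dsum_def intro!: borel_measurable_inner)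
    then have "(\<integral>q. iexp (x q m \<bullet> h) \<partial>Q) = (\<integral>y. iexp y \<partial>distr Q borel (\<lambda>q. x q m \<bullet> h))"
      by (subst integral_distr) auto
    then show ?thesis using gaussian_dsum_single[OF g S m h] char_real_gaussian[OF C[OF m h]] by simp
  qed
  have eq: "(\<integral>\<omega>. iexp (l \<omega>) \<partial>?\<mu>) = (\<integral>\<omega>. iexp (l \<omega>) \<partial>?\<nu>)" if l: "l \<in> L" for l
  proof -
    from LE[OF l] obtain h where "(\<forall>m\<in>?I. h m \<in> S m) \<and> l = (\<lambda>\<omega>. \<Sum>m\<in>?I. \<omega> m \<bullet> h m)" ..
    note h = this[THEN conjunct1] and leq = this[THEN conjunct2]
    define v where "v = (\<Sum>m\<in>?I. blinfun_apply (C m) (h m) \<bullet> h m)"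
    have v: "0 \<le> v" unfolding v_def using C h by (intro sum_nonneg) auto
    have lq: "l (\<lambda>m\<in>?I. x q m) = dsum_inner k (x q) h" for q
      unfolding leq dsum_inner_def by (rule sum.cong) auto
    have lM: "l \<in> borel_measurable ?M" using Lm[OF l] by simp
    have dm: "(\<lambda>q. dsum_inner k (x q) h) \<in> borel_measurable Q"
    proof -
      from measurable_compose[OF xM lM] show ?thesis unfolding lq .
    qed
    have "(\<integral>\<omega>. iexp (l \<omega>) \<partial>?\<mu>) = (\<integral>q. iexp (dsum_inner k (x q) h) \<partial>Q)"
    proof -
      have "(\<integral>\<omega>. iexp (l \<omega>) \<partial>?\<mu>) = (\<integral>q. iexp (l (\<lambda>m\<in>?I. x q m)) \<partial>Q)"
        by (rule integral_distr[OF xM]) (use lM in measurable)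
      then show ?thesis unfolding lq .
    qed
    also have "\<dots> = (\<integral>y. iexp y \<partial>distr Q borel (\<lambda>q. dsum_inner k (x q) h))"
      using dm by (subst integral_distr) auto
    also have "\<dots> = complex_of_real (exp (- v / 2))"
      using g h char_real_gaussian[OF v] by (simp add: gaussian_dsum_def v_def dsum_inner_def dsum_op_def)
    finally have 1: "(\<integral>\<omega>. iexp (l \<omega>) \<partial>?\<mu>) = complex_of_real (exp (- v / 2))" .
    have ic: "integrable (?G m) (\<lambda>y. iexp (y \<bullet> h m))"
      and ec: "(\<integral>y. iexp (y \<bullet> h m) \<partial>?G m) = complex_of_real (exp (- (blinfun_apply (C m) (h m) \<bullet> h m) / 2))" if m: "m \<in> ?I" for m
    proof -
      interpret Gm: prob_space "?G m" by (rule G)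
      have ym: "(\<lambda>y. y \<bullet> h m) \<in> borel_measurable (restrict_space borel (S m))"
        by (intro measurable_restrict_space1) simp
      then have ym': "(\<lambda>y. y \<bullet> h m) \<in> borel_measurable (?G m)"
        by (simp add: measurable_cong_sets[OF sG[OF m] refl])
      show "integrable (?G m) (\<lambda>y. iexp (y \<bullet> h m))"
        using ym' by (intro finite_measure.integrable_const_bound[OF prob_space.finite_measure[OF G], where B=1]) auto
      have "(\<integral>y. iexp (y \<bullet> h m) \<partial>?G m) = (\<integral>q. iexp (x q m \<bullet> h m) \<partial>Q)"
        using m ym unfolding component_law_def by (simp, subst integral_distr[OF xm[OF m]]) auto
      then show "(\<integral>y. iexp (y \<bullet> h m) \<partial>?G m) = complex_of_real (exp (- (blinfun_apply (C m) (h m) \<bullet> h m) / 2))"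
        using char1[OF m] h m by simp
    qed
    have "iexp (l \<omega>) = (\<Prod>m\<in>?I. iexp (\<omega> m \<bullet> h m))" for \<omega>
      unfolding leq by (simp add: exp_sum[symmetric] sum_distrib_left)
    then have "(\<integral>\<omega>. iexp (l \<omega>) \<partial>?\<nu>) = (\<integral>\<omega>. (\<Prod>m\<in>?I. iexp (\<omega> m \<bullet> h m)) \<partial>?\<nu>)" by simp
    also have "\<dots> = (\<Prod>m\<in>?I. (\<integral>y. iexp (y \<bullet> h m) \<partial>?G m))"
      by (rule PG.product_integral_prod) (use ic in auto)
    also have "\<dots> = (\<Prod>m\<in>?I. complex_of_real (exp (- (blinfun_apply (C m) (h m) \<bullet> h m) / 2)))"
      using ec by (intro prod.cong) auto
    also have "\<dots> = complex_of_real (exp (- v / 2))"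
      unfolding v_def by (simp add: exp_sum[symmetric] sum_negf sum_divide_distrib flip: of_real_prod)
    finally show ?thesis using 1 by simp
  qed
  let ?\<Omega> = "space ?M"
  define E where "E = {{\<omega>\<in>?\<Omega>. \<forall>(l, A)\<in>set xs. l \<omega> \<in> A} | xs. set xs \<subseteq> L \<times> sets borel}"
  have Esub: "E \<subseteq> Pow ?\<Omega>" by (auto simp: E_def)
  have gen1: "{\<omega>\<in>?\<Omega>. l \<omega> \<in> A} \<in> E" if "l \<in> L" "A \<in> sets borel" for l A
    unfolding E_def using that by (intro CollectI exI[of _ "[(l, A)]"]) auto
  have EM: "E \<subseteq> sets ?M"
  proof
    fix X assume "X \<in> E"
    then obtain xs where xs: "set xs \<subseteq> L \<times> sets borel" and X: "X = {\<omega>\<in>?\<Omega>. \<forall>(l, A)\<in>set xs. l \<omega> \<in> A}"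
      by (auto simp: E_def)
    have "{\<omega>\<in>?\<Omega>. case p of (l, A) \<Rightarrow> l \<omega> \<in> A} \<in> sets ?M" if p: "p \<in> set xs" for p
    proof -
      obtain l A where p': "p = (l, A)" by (cases p)
      then have "l \<in> borel_measurable ?M" "A \<in> sets borel" using Lm[of l] xs p by auto
      then have "l -` A \<inter> ?\<Omega> \<in> sets ?M" by (rule measurable_sets)
      also have "l -` A \<inter> ?\<Omega> = {\<omega>\<in>?\<Omega>. case p of (l, A) \<Rightarrow> l \<omega> \<in> A}" by (auto simp: p')
      finally show ?thesis .
    qed
    then show "X \<in> sets ?M" unfolding X by (intro sets.sets_Collect_countable_All' countable_finite) auto
  qed
  have sM: "sets ?M = sigma_sets ?\<Omega> E"
  proof
    show "sigma_sets ?\<Omega> E \<subseteq> sets ?M" by (rule sets.sigma_sets_subset[OF EM])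
    let ?N = "sigma ?\<Omega> E"
    have sp: "space ?N = ?\<Omega>" and se: "sets ?N = sigma_sets ?\<Omega> E" using Esub by (simp_all add: space_measure_of_conv)
    have "(\<lambda>\<omega> m. \<omega> m) \<in> measurable ?N ?M"
    proof (rule measurable_PiM_single')
      fix m assume m: "m \<in> ?I"
      have inS: "\<omega> m \<in> S m" if "\<omega> \<in> space ?N" for \<omega>
        using that m unfolding sp by (auto simp: space_PiM PiE_iff space_restrict_space)
      have "(\<lambda>\<omega>. \<omega> m) \<in> borel_measurable ?N"
      proof (rule borel_measurable_by_inner[OF S[OF m] inS])
        fix h assume h: "h \<in> S m"
        show "(\<lambda>\<omega>. \<omega> m \<bullet> h) \<in> borel_measurable ?N"
        proof (rule measurableI)
          fix A :: "real set" assume "A \<in> sets borel"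
          from gen1[OF single(1)[OF m h] this] have "{\<omega>\<in>?\<Omega>. \<omega> m \<bullet> h \<in> A} \<in> E" by (simp only: single(2)[OF m h])
          moreover have "(\<lambda>\<omega>. \<omega> m \<bullet> h) -` A \<inter> space ?N = {\<omega>\<in>?\<Omega>. \<omega> m \<bullet> h \<in> A}" using sp by auto
          ultimately show "(\<lambda>\<omega>. \<omega> m \<bullet> h) -` A \<inter> space ?N \<in> sets ?N" using se by auto
        qed simp
      qed
      then show "(\<lambda>\<omega>. \<omega> m) \<in> measurable ?N (restrict_space borel (S m))"
        using inS by (intro measurable_restrict_space2) auto
    qed (unfold sp, auto simp: space_PiM)
    note id = this
    have "A \<in> sets ?N" if "A \<in> sets ?M" for A
    proof -
      have "(\<lambda>\<omega> m. \<omega> m) -` A \<inter> space ?N = A" using sets.sets_into_space[OF that] sp by auto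
      then show ?thesis using measurable_sets[OF id that] by (simp only:)
    qed
    then show "sets ?M \<subseteq> sigma_sets ?\<Omega> E" using se by auto
  qed
  show "?\<mu> = ?\<nu>"
  proof (rule measure_eqI_generator_eq[where E=E and \<Omega>="?\<Omega>" and A="\<lambda>_. ?\<Omega>"])
    show "Int_stable E"
    proof (rule Int_stableI)
      fix X Y assume "X \<in> E" "Y \<in> E"
      then obtain xs ys where "set xs \<subseteq> L \<times> sets borel" "X = {\<omega>\<in>?\<Omega>. \<forall>(l, A)\<in>set xs. l \<omega> \<in> A}"
        "set ys \<subseteq> L \<times> sets borel" "Y = {\<omega>\<in>?\<Omega>. \<forall>(l, A)\<in>set ys. l \<omega> \<in> A}" by (auto simp: E_def)
      then show "X \<inter> Y \<in> E" unfolding E_def by (intro CollectI exI[of _ "xs @ ys"]) auto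
    qed
    show "emeasure ?\<mu> X = emeasure ?\<nu> X" if XE: "X \<in> E" for X
    proof -
      obtain xs where xs: "set xs \<subseteq> L \<times> sets borel" and X: "X = {\<omega>\<in>?\<Omega>. \<forall>(l, A)\<in>set xs. l \<omega> \<in> A}"
        using XE by (auto simp: E_def)
      have "emeasure ?\<mu> {\<omega>\<in>space ?\<mu>. \<forall>(l, A)\<in>set xs. l \<omega> \<in> A} = emeasure ?\<nu> {\<omega>\<in>space ?\<mu>. \<forall>(l, A)\<in>set xs. l \<omega> \<in> A}"
        by (rule char_determined_cylinder[OF mu nu sets Lm Llin L0 eq xs])
      then show ?thesis by (simp add: X)
    qed
    show "range (\<lambda>_. ?\<Omega>) \<subseteq> E" unfolding E_def by (auto intro!: exI[of _ "[]"])
    show "emeasure ?\<mu> ?\<Omega> \<noteq> \<infinity>" using prob_space.emeasure_space_1[OF mu] by simp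
  qed (use Esub sM sets in auto)
qed

text \<open>The Gram-Schmidt sequence of a sequence \<open>d\<close>. Since \<open>sgn 0 = 0\<close>, a vector that depends linearly on its
predecessors contributes \<open>0\<close>; the non-zero members are orthonormal.\<close>

fun gram_schmidt :: "(nat \<Rightarrow> 'h::real_inner) \<Rightarrow> nat \<Rightarrow> 'h" where
  "gram_schmidt d n = sgn (d n - (\<Sum>k\<in>{..<n}. (d n \<bullet> gram_schmidt d k) *\<^sub>R gram_schmidt d k))"

declare gram_schmidt.simps [simp del]

lemma gram_schmidt_in_subspace:
  assumes "subspace S" "\<And>n. d n \<in> S" shows "gram_schmidt d n \<in> S"
proof (induction n rule: less_induct)
  case (less n)
  show ?case unfolding gram_schmidt.simps[of d n] sgn_div_norm
    using assms less by (intro subspace_scale subspace_diff subspace_sum) auto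
qed

lemma gram_schmidt_orthogonal_less:
  "i < j \<Longrightarrow> gram_schmidt d j \<bullet> gram_schmidt d i = 0"
proof (induction j arbitrary: i rule: less_induct)
  case (less j)
  let ?e = "gram_schmidt d"
  have ei: "(?e i \<bullet> ?e i) *\<^sub>R ?e i = ?e i"
    by (subst (1 2 3 4) gram_schmidt.simps) (simp add: dot_square_norm norm_sgn)
  have orth: "?e k \<bullet> ?e i = 0" if "k < j" "k \<noteq> i" for k
    using less.IH[of k i] less.IH[of i k] less.prems that by (cases "i < k") (auto simp: inner_commute)
  have "(\<Sum>k\<in>{..<j}. (d j \<bullet> ?e k) * (?e k \<bullet> ?e i)) = (\<Sum>k\<in>{..<j}. if k = i then (d j \<bullet> ?e i) * (?e i \<bullet> ?e i) else 0)"
    using orth by (intro sum.cong) auto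
  also have "\<dots> = d j \<bullet> ((?e i \<bullet> ?e i) *\<^sub>R ?e i)" using less.prems by simp
  finally have "(\<Sum>k\<in>{..<j}. (d j \<bullet> ?e k) * (?e k \<bullet> ?e i)) = d j \<bullet> ?e i" by (simp only: ei)
  then have "(d j - (\<Sum>k\<in>{..<j}. (d j \<bullet> ?e k) *\<^sub>R ?e k)) \<bullet> ?e i = 0"
    by (simp add: inner_diff_left inner_sum_left)
  then show ?case by (subst gram_schmidt.simps) (simp add: sgn_div_norm)
qed

lemma gram_schmidt_orthogonal: "i \<noteq> j \<Longrightarrow> gram_schmidt d i \<bullet> gram_schmidt d j = 0"
  using gram_schmidt_orthogonal_less[of i j d] gram_schmidt_orthogonal_less[of j i d]
  by (cases "i < j") (auto simp: inner_commute)

lemma gram_schmidt_self: "(gram_schmidt d i \<bullet> gram_schmidt d i) *\<^sub>R gram_schmidt d i = gram_schmidt d i"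
  by (subst (1 2 3 4) gram_schmidt.simps) (simp add: dot_square_norm norm_sgn)

lemma gram_schmidt_residual:
  fixes x :: "'h::real_inner"
  shows "(norm (x - (\<Sum>k\<in>{..<n}. (x \<bullet> gram_schmidt d k) *\<^sub>R gram_schmidt d k)))\<^sup>2
      = (norm x)\<^sup>2 - (\<Sum>k\<in>{..<n}. (x \<bullet> gram_schmidt d k)\<^sup>2)"
proof -
  let ?e = "gram_schmidt d"
  let ?P = "\<Sum>k\<in>{..<n}. (x \<bullet> ?e k) *\<^sub>R ?e k"
  have xP: "x \<bullet> ?P = (\<Sum>k\<in>{..<n}. (x \<bullet> ?e k)\<^sup>2)" by (simp add: inner_sum_right power2_eq_square)
  have eP: "?e i \<bullet> ?P = ?e i \<bullet> x" if "i < n" for i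
  proof -
    have "?e i \<bullet> ?P = (\<Sum>k\<in>{..<n}. (x \<bullet> ?e k) * (?e i \<bullet> ?e k))" by (simp add: inner_sum_right)
    also have "\<dots> = (\<Sum>k\<in>{..<n}. if k = i then (x \<bullet> ?e i) * (?e i \<bullet> ?e i) else 0)"
      by (intro sum.cong) (auto simp: gram_schmidt_orthogonal)
    also have "\<dots> = ((?e i \<bullet> ?e i) *\<^sub>R ?e i) \<bullet> x" using that by (simp add: inner_commute)
    finally show ?thesis by (simp only: gram_schmidt_self)
  qed
  have "?P \<bullet> ?P = (\<Sum>k\<in>{..<n}. (x \<bullet> ?e k) * (?e k \<bullet> ?P))" by (simp add: inner_sum_left)
  also have "\<dots> = (\<Sum>k\<in>{..<n}. (x \<bullet> ?e k)\<^sup>2)"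
    using eP by (intro sum.cong) (auto simp: power2_eq_square inner_commute)
  finally have PP: "?P \<bullet> ?P = (\<Sum>k\<in>{..<n}. (x \<bullet> ?e k)\<^sup>2)" .
  have "(norm (x - ?P))\<^sup>2 = x \<bullet> x - 2 * (x \<bullet> ?P) + ?P \<bullet> ?P"
    by (simp add: power2_norm_eq_inner inner_diff_left inner_diff_right inner_commute)
  then show ?thesis by (simp only: xP PP power2_norm_eq_inner)
qed

lemma gram_schmidt_bessel: "(\<Sum>k\<in>{..<n}. (x \<bullet> gram_schmidt d k)\<^sup>2) \<le> (norm x)\<^sup>2"
  using gram_schmidt_residual[of x d n] zero_le_power2[of "norm (x - (\<Sum>k\<in>{..<n}. (x \<bullet> gram_schmidt d k) *\<^sub>R gram_schmidt d k))"]
  by linarith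

lemma gram_schmidt_reproduces:
  assumes "m < n"
  shows "(\<Sum>k\<in>{..<n}. (d m \<bullet> gram_schmidt d k) *\<^sub>R gram_schmidt d k) = d m"
proof -
  let ?e = "gram_schmidt d"
  define r where "r = d m - (\<Sum>k\<in>{..<m}. (d m \<bullet> ?e k) *\<^sub>R ?e k)"
  have em: "?e m = sgn r" unfolding r_def by (rule gram_schmidt.simps)
  have dm: "d m = norm r *\<^sub>R ?e m + (\<Sum>k\<in>{..<m}. (d m \<bullet> ?e k) *\<^sub>R ?e k)"
  proof -
    have "norm r *\<^sub>R sgn r = r"
    proof (cases "r = 0")
      case False
      then have n: "norm r \<noteq> 0" by simp
      show ?thesis unfolding sgn_div_norm scaleR_scaleR right_inverse[OF n] by simp
    qed simp
    then show ?thesis unfolding em by (simp add: r_def)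
  qed
  have c: "(d m \<bullet> ?e k) *\<^sub>R ?e k = 0" if "m < k" for k
  proof -
    have "d m \<bullet> ?e k = (norm r *\<^sub>R ?e m + (\<Sum>j\<in>{..<m}. (d m \<bullet> ?e j) *\<^sub>R ?e j)) \<bullet> ?e k" by (subst (1) dm) simp
    also have "\<dots> = 0" using that by (simp add: inner_add_left inner_sum_left gram_schmidt_orthogonal)
    finally show ?thesis by simp
  qed
  have "r \<bullet> sgn r = norm r"
    by (cases "r = 0") (simp_all add: sgn_div_norm dot_square_norm power2_eq_square)
  moreover have "d m \<bullet> ?e m = r \<bullet> ?e m"
    by (simp add: r_def inner_diff_left inner_sum_left gram_schmidt_orthogonal)
  ultimately have cm: "d m \<bullet> ?e m = norm r" by (simp add: em)
  have "(\<Sum>k\<in>{..<n}. (d m \<bullet> ?e k) *\<^sub>R ?e k) = (\<Sum>k\<in>{..<Suc m}. (d m \<bullet> ?e k) *\<^sub>R ?e k)"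
    using assms c by (intro sum.mono_neutral_right) auto
  also have "\<dots> = d m" using dm cm by (simp add: add.commute)
  finally show ?thesis .
qed

text \<open>The residual of \<open>x\<close> equals the residual of \<open>x - d m\<close> as soon as \<open>d m\<close> is reproduced, and \<open>x - d m\<close> can be made
small.\<close>

lemma gram_schmidt_parseval:
  assumes "x \<in> closure (range d)"
  shows "(\<lambda>n. \<Sum>k\<in>{..<n}. (x \<bullet> gram_schmidt d k)\<^sup>2) \<longlonglongrightarrow> (norm x)\<^sup>2"
proof (rule LIMSEQ_I)
  let ?e = "gram_schmidt d"
  fix r :: real assume r: "0 < r"
  obtain m where m: "dist (d m) x < sqrt r"
  proof -
    have "\<exists>y\<in>range d. dist y x < sqrt r" using assms r by (simp add: closure_approachable)
    then show thesis using that by auto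
  qed
  show "\<exists>no. \<forall>n\<ge>no. norm ((\<Sum>k\<in>{..<n}. (x \<bullet> ?e k)\<^sup>2) - (norm x)\<^sup>2) < r"
  proof (intro exI allI impI)
    fix n assume n: "Suc m \<le> n"
    let ?y = "x - d m"
    have "x - (\<Sum>k\<in>{..<n}. (x \<bullet> ?e k) *\<^sub>R ?e k) = ?y - (\<Sum>k\<in>{..<n}. (?y \<bullet> ?e k) *\<^sub>R ?e k)"
      using gram_schmidt_reproduces[of m n d] n
      by (simp add: inner_diff_left scaleR_left_diff_distrib sum_subtractf)
    then have "(norm x)\<^sup>2 - (\<Sum>k\<in>{..<n}. (x \<bullet> ?e k)\<^sup>2) = (norm ?y)\<^sup>2 - (\<Sum>k\<in>{..<n}. (?y \<bullet> ?e k)\<^sup>2)"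
      by (simp only: gram_schmidt_residual[symmetric])
    also have "\<dots> \<le> (norm ?y)\<^sup>2" by (simp add: sum_nonneg)
    also have "\<dots> < (sqrt r)\<^sup>2" using m by (intro power_strict_mono) (auto simp: dist_norm norm_minus_commute)
    finally have "(norm x)\<^sup>2 - (\<Sum>k\<in>{..<n}. (x \<bullet> ?e k)\<^sup>2) < r" using r by simp
    then show "norm ((\<Sum>k\<in>{..<n}. (x \<bullet> ?e k)\<^sup>2) - (norm x)\<^sup>2) < r"
      using gram_schmidt_bessel[where x=x and d=d and n=n] by simp
  qed
qed

lemma obtain_orthonormal_sequence:
  fixes S :: "'h::{real_inner, second_countable_topology} set"
  assumes S: "subspace S"
  obtains e where "\<And>n. e n \<in> S" "\<And>x n. (\<Sum>k\<in>{..<n}. (x \<bullet> e k)\<^sup>2) \<le> (norm x)\<^sup>2"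
    "\<And>x. x \<in> S \<Longrightarrow> (\<lambda>n. \<Sum>k\<in>{..<n}. (x \<bullet> e k)\<^sup>2) \<longlonglongrightarrow> (norm x)\<^sup>2"
proof -
  obtain D where D: "countable D" "D \<subseteq> S" "S \<subseteq> closure D" by (rule separable)
  have "D \<noteq> {}" using D(3) subspace_0[OF S] by auto
  then have r: "range (from_nat_into D) = D" using D(1) by (rule range_from_nat_into)
  show thesis
  proof (rule that[of "gram_schmidt (from_nat_into D)"])
    show "gram_schmidt (from_nat_into D) n \<in> S" for n
      using D(2) r by (intro gram_schmidt_in_subspace[OF S]) auto
    show "(\<lambda>n. \<Sum>k\<in>{..<n}. (x \<bullet> gram_schmidt (from_nat_into D) k)\<^sup>2) \<longlonglongrightarrow> (norm x)\<^sup>2" if "x \<in> S" for x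
      using D(3) that r by (intro gram_schmidt_parseval) auto
  qed (rule gram_schmidt_bessel)
qed

lemma nn_integral_mult_le_of_squares:
  fixes f g :: "'a \<Rightarrow> real"
  assumes [measurable]: "f \<in> borel_measurable M" "g \<in> borel_measurable M" and ab: "0 \<le> a" "0 \<le> b"
    and f: "(\<integral>\<^sup>+x. ennreal ((f x)\<^sup>2) \<partial>M) \<le> ennreal (a\<^sup>2)" and g: "(\<integral>\<^sup>+x. ennreal ((g x)\<^sup>2) \<partial>M) \<le> ennreal (b\<^sup>2)"
  shows "(\<integral>\<^sup>+x. ennreal \<bar>f x * g x\<bar> \<partial>M) \<le> ennreal (a * b)"
proof -
  have "(\<integral>\<^sup>+x. ennreal \<bar>f x * g x\<bar> \<partial>M)\<^sup>2 = (\<integral>\<^sup>+x. ennreal \<bar>f x\<bar> * ennreal \<bar>g x\<bar> \<partial>M)\<^sup>2"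
    by (simp add: abs_mult ennreal_mult)
  also have "\<dots> \<le> (\<integral>\<^sup>+x. (ennreal \<bar>f x\<bar>)\<^sup>2 \<partial>M) * (\<integral>\<^sup>+x. (ennreal \<bar>g x\<bar>)\<^sup>2 \<partial>M)"
    by (rule Cauchy_Schwarz_nn_integral) auto
  also have "\<dots> = (\<integral>\<^sup>+x. ennreal ((f x)\<^sup>2) \<partial>M) * (\<integral>\<^sup>+x. ennreal ((g x)\<^sup>2) \<partial>M)"
    by (simp add: ennreal_power)
  also have "\<dots> \<le> ennreal (a\<^sup>2) * ennreal (b\<^sup>2)" by (rule mult_mono[OF f g]) auto
  also have "\<dots> = (ennreal (a * b))\<^sup>2" using ab by (simp add: ennreal_power ennreal_mult[symmetric] power_mult_distrib)
  finally have le: "(\<integral>\<^sup>+x. ennreal \<bar>f x * g x\<bar> \<partial>M)\<^sup>2 \<le> (ennreal (a * b))\<^sup>2" .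
  show ?thesis
  proof (cases "\<integral>\<^sup>+x. ennreal \<bar>f x * g x\<bar> \<partial>M" rule: ennreal_cases)
    case (real r)
    then have "r\<^sup>2 \<le> (a * b)\<^sup>2" using le ab by (simp add: ennreal_power)
    then have "r \<le> a * b" by (rule power2_le_imp_le) (simp add: ab)
    then show ?thesis using real by (simp add: ennreal_leI)
  next
    case top
    have "(ennreal (a * b))\<^sup>2 < top" by (simp add: power_less_top_ennreal)
    then have "(\<integral>\<^sup>+x. ennreal \<bar>f x * g x\<bar> \<partial>M)\<^sup>2 < top" by (rule le_less_trans[OF le])
    then show ?thesis using top by (simp add: power_less_top_ennreal)
  qed
qed

text \<open>Along an orthonormal sequence the coordinates of \<open>X\<close> are Gaussian with variances \<open>s k\<close>, whose sum is at most
the second moment of \<open>U\<close> by Bessel's inequality. The fourth moment of the norm is the sum over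
\<open>j, k\<close> of the means of squared products of coordinates, each at most \<open>3 * (s j * s k)\<close> by Cauchy-Schwarz. Fatou's lemma passes from finitely many coordinates to the norm.\<close>

lemma gaussian_norm_fourth_moment:
  fixes X :: "'q \<Rightarrow> 'h::{real_inner, second_countable_topology}" and U :: "'w \<Rightarrow> 'h"
  assumes S: "subspace S" and X: "X \<in> borel_measurable Q" and XS: "\<And>q. q \<in> space Q \<Longrightarrow> X q \<in> S"
    and law: "\<And>h. h \<in> S \<Longrightarrow> distr Q borel (\<lambda>q. X q \<bullet> h) = real_gaussian (\<integral>w. (U w \<bullet> h)\<^sup>2 \<partial>N)"
    and U: "U \<in> borel_measurable N" and t: "0 \<le> \<tau>" "(\<integral>\<^sup>+w. ennreal ((norm (U w))\<^sup>2) \<partial>N) \<le> ennreal \<tau>"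
  shows "(\<integral>\<^sup>+q. ennreal (norm (X q) ^ 4) \<partial>Q) \<le> ennreal (3 * \<tau>\<^sup>2)"
proof -
  obtain e where eS: "\<And>n. e n \<in> S" and bessel: "\<And>x n. (\<Sum>k\<in>{..<n}. (x \<bullet> e k)\<^sup>2) \<le> (norm x)\<^sup>2"
    and pars: "\<And>x. x \<in> S \<Longrightarrow> (\<lambda>n. \<Sum>k\<in>{..<n}. (x \<bullet> e k)\<^sup>2) \<longlonglongrightarrow> (norm x)\<^sup>2"
    by (rule obtain_orthonormal_sequence[OF S]) (rule that)
  note [measurable] = X U
  define s where "s = (\<lambda>k. \<integral>w. (U w \<bullet> e k)\<^sup>2 \<partial>N)"
  have s0: "0 \<le> s k" for k by (simp add: s_def)
  have iU: "integrable N (\<lambda>w. (norm (U w))\<^sup>2)"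
    using t(2) by (intro integrableI_bounded) (auto simp: top_unique less_top[symmetric])
  have iUe: "integrable N (\<lambda>w. (U w \<bullet> e k)\<^sup>2)" for k
  proof (rule Bochner_Integration.integrable_bound[OF iU])
    have "(U w \<bullet> e k)\<^sup>2 \<le> (norm (U w))\<^sup>2" for w
    proof -
      have "(U w \<bullet> e k)\<^sup>2 \<le> (\<Sum>j\<in>{..<Suc k}. (U w \<bullet> e j)\<^sup>2)" by (simp add: sum_nonneg)
      then show ?thesis using bessel[of "U w" "Suc k"] by linarith
    qed
    then show "AE w in N. norm ((U w \<bullet> e k)\<^sup>2) \<le> norm ((norm (U w))\<^sup>2)" by simp
  qed measurable
  have ssum: "(\<Sum>k\<in>{..<n}. s k) \<le> \<tau>" for n
  proof -
    have "(\<Sum>k\<in>{..<n}. s k) = (\<integral>w. (\<Sum>k\<in>{..<n}. (U w \<bullet> e k)\<^sup>2) \<partial>N)" unfolding s_def using iUe by simp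
    also have "\<dots> \<le> (\<integral>w. (norm (U w))\<^sup>2 \<partial>N)" using iUe iU bessel by (intro integral_mono) auto
    also have "\<dots> \<le> \<tau>"
    proof -
      have "ennreal (\<integral>w. (norm (U w))\<^sup>2 \<partial>N) \<le> ennreal \<tau>"
        using t(2) nn_integral_eq_integral[OF iU] by simp
      then show ?thesis using t(1) by simp
    qed
    finally show ?thesis .
  qed
  have fourth: "(\<integral>\<^sup>+q. ennreal ((X q \<bullet> e k) ^ 4) \<partial>Q) = ennreal (3 * (s k)\<^sup>2)" for k
  proof -
    have "(\<integral>\<^sup>+q. ennreal ((X q \<bullet> e k) ^ 4) \<partial>Q) = (\<integral>\<^sup>+y. ennreal (y ^ 4) \<partial>distr Q borel (\<lambda>q. X q \<bullet> e k))"
      by (subst nn_integral_distr) auto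
    also have "\<dots> = (\<integral>\<^sup>+y. ennreal (y ^ 4) \<partial>real_gaussian (s k))" by (simp add: law[OF eS] s_def)
    also have "\<dots> = ennreal (\<integral>y. y ^ 4 \<partial>real_gaussian (s k))"
      by (intro nn_integral_eq_integral real_gaussian_moments(1)[OF s0]) auto
    finally show ?thesis by (simp add: real_gaussian_moments(4)[OF s0])
  qed
  have cross: "(\<integral>\<^sup>+q. ennreal ((X q \<bullet> e j)\<^sup>2 * (X q \<bullet> e k)\<^sup>2) \<partial>Q) \<le> ennreal (3 * (s j * s k))" for j k
  proof -
    have "(\<integral>\<^sup>+q. ennreal \<bar>(X q \<bullet> e j)\<^sup>2 * (X q \<bullet> e k)\<^sup>2\<bar> \<partial>Q) \<le> ennreal ((sqrt 3 * s j) * (sqrt 3 * s k))"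
      using s0 fourth by (intro nn_integral_mult_le_of_squares)
        (auto simp: power_mult_distrib power_mult[symmetric] simp flip: power_mult)
    also have "(sqrt 3 * s j) * (sqrt 3 * s k) = 3 * (s j * s k)" by (simp add: algebra_simps)
    finally show ?thesis by simp
  qed
  define Z where "Z = (\<lambda>n q. (\<Sum>k\<in>{..<n}. (X q \<bullet> e k)\<^sup>2)\<^sup>2)"
  have Zm[measurable]: "Z n \<in> borel_measurable Q" for n unfolding Z_def by measurable
  have EZ: "(\<integral>\<^sup>+q. ennreal (Z n q) \<partial>Q) \<le> ennreal (3 * \<tau>\<^sup>2)" for n
  proof -
    have "(\<integral>\<^sup>+q. ennreal (Z n q) \<partial>Q) = (\<integral>\<^sup>+q. (\<Sum>j\<in>{..<n}. \<Sum>k\<in>{..<n}. ennreal ((X q \<bullet> e j)\<^sup>2 * (X q \<bullet> e k)\<^sup>2)) \<partial>Q)"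
      by (simp add: Z_def power2_eq_square[of "sum _ _"] sum_product sum_nonneg)
    also have "\<dots> = (\<Sum>j\<in>{..<n}. \<Sum>k\<in>{..<n}. (\<integral>\<^sup>+q. ennreal ((X q \<bullet> e j)\<^sup>2 * (X q \<bullet> e k)\<^sup>2) \<partial>Q))"
      by (subst nn_integral_sum, measurable, subst nn_integral_sum, measurable)
    also have "\<dots> \<le> (\<Sum>j\<in>{..<n}. \<Sum>k\<in>{..<n}. ennreal (3 * (s j * s k)))" by (intro sum_mono cross)
    also have "\<dots> = ennreal (3 * (\<Sum>k\<in>{..<n}. s k)\<^sup>2)"
    proof -
      have "3 * (\<Sum>k\<in>{..<n}. s k)\<^sup>2 = (\<Sum>j\<in>{..<n}. \<Sum>k\<in>{..<n}. 3 * (s j * s k))"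
        unfolding power2_eq_square sum_product by (simp only: sum_distrib_left)
      then show ?thesis using s0 by (simp add: sum_nonneg)
    qed
    also have "\<dots> \<le> ennreal (3 * \<tau>\<^sup>2)"
      using ssum[of n] s0 by (intro ennreal_leI mult_left_mono power_mono) (auto intro: sum_nonneg)
    finally show ?thesis .
  qed
  have "(\<integral>\<^sup>+q. ennreal (norm (X q) ^ 4) \<partial>Q) = (\<integral>\<^sup>+q. liminf (\<lambda>n. ennreal (Z n q)) \<partial>Q)"
  proof (rule nn_integral_cong)
    fix q assume "q \<in> space Q"
    from pars[OF XS[OF this]] have "(\<lambda>n. Z n q) \<longlonglongrightarrow> ((norm (X q))\<^sup>2)\<^sup>2" unfolding Z_def by (intro tendsto_power)
    then have "(\<lambda>n. ennreal (Z n q)) \<longlonglongrightarrow> ennreal (norm (X q) ^ 4)" by (intro tendsto_ennrealI) (simp flip: power_mult)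
    then show "ennreal (norm (X q) ^ 4) = liminf (\<lambda>n. ennreal (Z n q))"
      by (rule lim_imp_Liminf[OF sequentially_bot, symmetric])
  qed
  also have "\<dots> \<le> liminf (\<lambda>n. \<integral>\<^sup>+q. ennreal (Z n q) \<partial>Q)" by (rule nn_integral_liminf) measurable
  also have "\<dots> \<le> ennreal (3 * \<tau>\<^sup>2)"
    using EZ by (intro order_trans[OF Liminf_le_Limsup[OF sequentially_bot]] Limsup_bounded) auto
  finally show ?thesis .
qed

section \<open>Moment bounds and exponential change of measure\<close>

text \<open>A bound on an absolute moment that includes measurability and finiteness.\<close>

definition mean_le :: "'w measure \<Rightarrow> ('w \<Rightarrow> real) \<Rightarrow> real \<Rightarrow> bool" where
  "mean_le N f K \<longleftrightarrow> f \<in> borel_measurable N \<and> 0 \<le> K \<and> (\<integral>\<^sup>+w. ennreal \<bar>f w\<bar> \<partial>N) \<le> ennreal K"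

lemma mean_le_meas: "mean_le N f K \<Longrightarrow> f \<in> borel_measurable N"
  by (simp add: mean_le_def)

lemma mean_le_nonneg: "mean_le N f K \<Longrightarrow> 0 \<le> K"
  by (simp add: mean_le_def)

lemma mean_le_integrable: "mean_le N f K \<Longrightarrow> integrable N f"
  unfolding mean_le_def by (intro integrableI_bounded) (auto intro: le_less_trans)

lemma mean_le_integral_abs: "mean_le N f K \<Longrightarrow> (\<integral>w. \<bar>f w\<bar> \<partial>N) \<le> K"
proof -
  assume f: "mean_le N f K"
  have "ennreal (\<integral>w. \<bar>f w\<bar> \<partial>N) = (\<integral>\<^sup>+w. ennreal \<bar>f w\<bar> \<partial>N)"
    using mean_le_integrable[OF f] by (intro nn_integral_eq_integral[symmetric]) auto
  then show ?thesis using f by (metis ennreal_le_iff mean_le_def)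
qed

lemma mean_le_abs_integral: "mean_le N f K \<Longrightarrow> \<bar>\<integral>w. f w \<partial>N\<bar> \<le> K"
  using mean_le_integral_abs[of N f K] integral_abs_bound[of N f] by linarith

lemma mean_le_integral: "mean_le N f K \<Longrightarrow> (\<integral>w. f w \<partial>N) \<le> K"
  using mean_le_abs_integral[of N f K] by linarith

lemma mean_le_add:
  assumes f: "mean_le N f K" and g: "mean_le N g K'"
  shows "mean_le N (\<lambda>w. f w + g w) (K + K')"
  unfolding mean_le_def
proof (intro conjI)
  note [measurable] = mean_le_meas[OF f] mean_le_meas[OF g]
  show "(\<lambda>w. f w + g w) \<in> borel_measurable N" by measurable
  show "0 \<le> K + K'" using mean_le_nonneg[OF f] mean_le_nonneg[OF g] by simp
  have "(\<integral>\<^sup>+w. ennreal \<bar>f w + g w\<bar> \<partial>N) \<le> (\<integral>\<^sup>+w. ennreal \<bar>f w\<bar> + ennreal \<bar>g w\<bar> \<partial>N)"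
    by (intro nn_integral_mono) (simp flip: ennreal_plus add: ennreal_leI)
  also have "\<dots> = (\<integral>\<^sup>+w. ennreal \<bar>f w\<bar> \<partial>N) + (\<integral>\<^sup>+w. ennreal \<bar>g w\<bar> \<partial>N)" by (rule nn_integral_add) auto
  also have "\<dots> \<le> ennreal K + ennreal K'" using f g by (intro add_mono) (auto simp: mean_le_def)
  finally show "(\<integral>\<^sup>+w. ennreal \<bar>f w + g w\<bar> \<partial>N) \<le> ennreal (K + K')"
    using mean_le_nonneg[OF f] mean_le_nonneg[OF g] by simp
qed

lemma mean_le_cmult:
  assumes f: "mean_le N f K" shows "mean_le N (\<lambda>w. a * f w) (\<bar>a\<bar> * K)"
  unfolding mean_le_def
proof (intro conjI)
  note [measurable] = mean_le_meas[OF f]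
  show "(\<lambda>w. a * f w) \<in> borel_measurable N" by measurable
  show "0 \<le> \<bar>a\<bar> * K" using mean_le_nonneg[OF f] by simp
  have "(\<integral>\<^sup>+w. ennreal \<bar>a * f w\<bar> \<partial>N) = ennreal \<bar>a\<bar> * (\<integral>\<^sup>+w. ennreal \<bar>f w\<bar> \<partial>N)"
    by (simp add: abs_mult ennreal_mult nn_integral_cmult)
  also have "\<dots> \<le> ennreal \<bar>a\<bar> * ennreal K" using f by (intro mult_left_mono) (auto simp: mean_le_def)
  finally show "(\<integral>\<^sup>+w. ennreal \<bar>a * f w\<bar> \<partial>N) \<le> ennreal (\<bar>a\<bar> * K)"
    using mean_le_nonneg[OF f] by (simp add: ennreal_mult)
qed

lemma mean_le_mono:
  assumes g: "mean_le N g K" and f: "f \<in> borel_measurable N" and le: "\<And>w. w \<in> space N \<Longrightarrow> \<bar>f w\<bar> \<le> \<bar>g w\<bar>"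
    and K: "K \<le> K'"
  shows "mean_le N f K'"
proof -
  have "(\<integral>\<^sup>+w. ennreal \<bar>f w\<bar> \<partial>N) \<le> (\<integral>\<^sup>+w. ennreal \<bar>g w\<bar> \<partial>N)" by (intro nn_integral_mono ennreal_leI le)
  also have "\<dots> \<le> ennreal K'" using g K by (auto simp: mean_le_def intro: order_trans[OF _ ennreal_leI])
  finally show ?thesis using g f K by (simp add: mean_le_def)
qed

lemma mean_le_mult:
  assumes f: "mean_le N (\<lambda>w. (f w)\<^sup>2) (a\<^sup>2)" and g: "mean_le N (\<lambda>w. (g w)\<^sup>2) (b\<^sup>2)"
    and "f \<in> borel_measurable N" "g \<in> borel_measurable N" "0 \<le> a" "0 \<le> b"
  shows "mean_le N (\<lambda>w. f w * g w) (a * b)"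
  unfolding mean_le_def
  using assms by (auto simp: mean_le_def intro!: nn_integral_mult_le_of_squares)

context prob_space begin

lemma mean_le_const: "\<bar>a\<bar> \<le> K \<Longrightarrow> mean_le M (\<lambda>_. a) K"
  by (auto simp: mean_le_def emeasure_space_1 intro: ennreal_leI)

lemma mean_le_first_of_square:
  assumes f: "mean_le M (\<lambda>w. (f w)\<^sup>2) (a\<^sup>2)" and m: "f \<in> borel_measurable M" and a: "0 \<le> a"
  shows "mean_le M f a"
proof -
  have "mean_le M (\<lambda>_. 1\<^sup>2) (1\<^sup>2)" by (rule mean_le_const) simp
  from mean_le_mult[OF f this m _ a] show ?thesis by simp
qed

text \<open>Interpolation between \<open>1\<close> and \<open>f\<^sup>3\<close> at the scale \<open>k\<close>: below \<open>k\<close> the function is bounded by \<open>k\<close>, above it by a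
multiple of its cube.\<close>

lemma mean_le_of_cube:
  assumes f: "mean_le M (\<lambda>w. f w ^ 3) (F * k ^ 3)" and m: "f \<in> borel_measurable M"
    and nonneg: "\<And>w. w \<in> space M \<Longrightarrow> 0 \<le> f w" and k: "0 < k"
  shows "mean_le M f ((1 + F) * k)" and "mean_le M (\<lambda>w. (f w)\<^sup>2) ((1 + F) * k\<^sup>2)"
proof -
  have 1: "f w \<le> k + (1 / k\<^sup>2) * f w ^ 3" "(f w)\<^sup>2 \<le> k\<^sup>2 + (1 / k) * f w ^ 3" if "w \<in> space M" for w
  proof -
    have f0: "0 \<le> f w" by (rule nonneg[OF that])
    show "f w \<le> k + (1 / k\<^sup>2) * f w ^ 3"
    proof (cases "f w \<le> k")
      case False
      then have "k\<^sup>2 * f w \<le> (f w)\<^sup>2 * f w" using k f0 by (intro mult_right_mono power_mono) auto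
      then have "f w \<le> (1 / k\<^sup>2) * f w ^ 3" using k by (simp add: field_simps power3_eq_cube power2_eq_square)
      then show ?thesis using k by simp
    qed (use k f0 in \<open>simp add: add_increasing2\<close>)
    show "(f w)\<^sup>2 \<le> k\<^sup>2 + (1 / k) * f w ^ 3"
    proof (cases "f w \<le> k")
      case True
      then have "(f w)\<^sup>2 \<le> k\<^sup>2" using f0 by (intro power_mono)
      moreover have "0 \<le> (1 / k) * f w ^ 3" using f0 k by simp
      ultimately show ?thesis by linarith
    next
      case False
      then have "k * (f w)\<^sup>2 \<le> f w * (f w)\<^sup>2" using f0 by (intro mult_right_mono) auto
      then have "(f w)\<^sup>2 \<le> (1 / k) * f w ^ 3" using k by (simp add: field_simps power3_eq_cube power2_eq_square)
      moreover have "0 \<le> k\<^sup>2" by simp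
      ultimately show ?thesis by linarith
    qed
  qed
  have a: "mean_le M (\<lambda>w. k + (1 / k\<^sup>2) * f w ^ 3) (k + \<bar>1 / k\<^sup>2\<bar> * (F * k ^ 3))"
    using k by (intro mean_le_add mean_le_cmult f mean_le_const) auto
  have b: "mean_le M (\<lambda>w. k\<^sup>2 + (1 / k) * f w ^ 3) (k\<^sup>2 + \<bar>1 / k\<bar> * (F * k ^ 3))"
    using k by (intro mean_le_add mean_le_cmult f mean_le_const) auto
  show "mean_le M f ((1 + F) * k)"
    using 1 nonneg k by (intro mean_le_mono[OF a m]) (fastforce simp: field_simps power3_eq_cube power2_eq_square)+
  show "mean_le M (\<lambda>w. (f w)\<^sup>2) ((1 + F) * k\<^sup>2)"
    using 1 k m by (intro mean_le_mono[OF b]) (fastforce simp: field_simps power3_eq_cube power2_eq_square)+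
qed

text \<open>Jensen's inequality for the cube, from the tangent of \<open>x\<^sup>3\<close> at the mean.\<close>

lemma cube_of_mean_le:
  assumes f: "mean_le M (\<lambda>w. f w ^ 3) Q" and i: "integrable M f" and nonneg: "\<And>w. w \<in> space M \<Longrightarrow> 0 \<le> f w"
  shows "(\<integral>w. f w \<partial>M) ^ 3 \<le> Q"
proof -
  define k where "k = (\<integral>w. f w \<partial>M)"
  have k: "0 \<le> k" unfolding k_def using nonneg by (intro integral_nonneg_AE) auto
  have "(\<integral>w. 3 * k\<^sup>2 * f w - 2 * k ^ 3 \<partial>M) \<le> (\<integral>w. f w ^ 3 \<partial>M)"
  proof (rule integral_mono)
    fix w assume w: "w \<in> space M"
    have "0 \<le> (f w - k)\<^sup>2 * (f w + 2 * k)" using nonneg[OF w] k by simp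
    then show "3 * k\<^sup>2 * f w - 2 * k ^ 3 \<le> f w ^ 3"
      by (simp add: power2_eq_square power3_eq_cube algebra_simps)
  qed (use i mean_le_integrable[OF f] in auto)
  also have "(\<integral>w. 3 * k\<^sup>2 * f w - 2 * k ^ 3 \<partial>M) = 3 * k\<^sup>2 * k - 2 * k ^ 3"
    using i by (simp add: prob_space k_def)
  also have "\<dots> = k ^ 3" by (simp add: power2_eq_square power3_eq_cube)
  finally show ?thesis using mean_le_integral[OF f] by (simp add: k_def)
qed

end

lemma prod3_le_cubes: "a * b * c \<le> a ^ 3 + b ^ 3 + c ^ 3" if "0 \<le> a" "0 \<le> b" "0 \<le> c" for a b c :: real
proof -
  define m where "m = max a (max b c)"
  have "a * b * c \<le> m * m * m" using that by (intro mult_mono) (auto simp: m_def)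
  also have "\<dots> = m ^ 3" by (simp add: power3_eq_cube)
  also have "\<dots> \<le> a ^ 3 + b ^ 3 + c ^ 3" using that by (auto simp: m_def max_def)
  finally show ?thesis .
qed

lemma cube_sum2: "(a + b) ^ 3 \<le> 4 * (a ^ 3 + b ^ 3)" if "0 \<le> a" "0 \<le> b" for a b :: real
proof -
  have "0 \<le> 3 * ((a - b)\<^sup>2 * (a + b))" using that by simp
  also have "\<dots> = 4 * (a ^ 3 + b ^ 3) - (a + b) ^ 3" by (simp add: power2_eq_square power3_eq_cube algebra_simps)
  finally show ?thesis by simp
qed

lemma cube_sum4: "(a + b + c + d) ^ 3 \<le> 16 * (a ^ 3 + b ^ 3 + c ^ 3 + d ^ 3)"
  if "0 \<le> a" "0 \<le> b" "0 \<le> c" "0 \<le> d" for a b c d :: real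
  using cube_sum2[of "a + b" "c + d"] cube_sum2[of a b] cube_sum2[of c d] that by (simp add: add.assoc)

text \<open>Two mutually absolutely continuous laws whose log-density \<open>z\<close> is dominated by \<open>s + d\<close>, with third
moments at most \<open>q\<close> under both of them.\<close>

locale tilted = N0: prob_space N0 + N: prob_space N for N0 N :: "'w measure" +
  fixes z s d :: "'w \<Rightarrow> real" and q :: real
  assumes z[measurable]: "z \<in> borel_measurable N0"
    and dens: "N = density N0 (\<lambda>w. ennreal (exp (z w)))"
    and z_le: "\<And>w. w \<in> space N0 \<Longrightarrow> \<bar>z w\<bar> \<le> s w + d w"
    and s0: "\<And>w. w \<in> space N0 \<Longrightarrow> 0 \<le> s w" and d0: "\<And>w. w \<in> space N0 \<Longrightarrow> 0 \<le> d w"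
    and s[measurable]: "s \<in> borel_measurable N0" and d[measurable]: "d \<in> borel_measurable N0"
    and s3: "mean_le N0 (\<lambda>w. s w ^ 3) q" "mean_le N (\<lambda>w. s w ^ 3) q"
    and d3: "mean_le N0 (\<lambda>w. d w ^ 3) q" "mean_le N (\<lambda>w. d w ^ 3) q"
begin

lemma sets_N: "sets N = sets N0" and space_N: "space N = space N0"
  by (simp_all add: dens)

lemma meas_N: "borel_measurable N = borel_measurable N0"
  by (rule measurable_cong_sets[OF sets_N refl])

lemma mean_le_density: "mean_le N f K \<longleftrightarrow> mean_le N0 (\<lambda>w. exp (z w) * f w) K"
proof (cases "f \<in> borel_measurable N0")
  case True
  note [measurable] = this
  have "(\<integral>\<^sup>+w. ennreal \<bar>f w\<bar> \<partial>N) = (\<integral>\<^sup>+w. ennreal \<bar>exp (z w) * f w\<bar> \<partial>N0)"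
    by (simp add: dens nn_integral_density abs_mult ennreal_mult)
  then show ?thesis by (simp add: mean_le_def meas_N)
next
  case False
  have "f \<in> borel_measurable N0" if [measurable]: "(\<lambda>w. exp (z w) * f w) \<in> borel_measurable N0"
  proof -
    have "(\<lambda>w. exp (- z w) * (exp (z w) * f w)) \<in> borel_measurable N0" by measurable
    moreover have "exp (- z w) * (exp (z w) * f w) = f w" for w
      by (simp add: mult.assoc[symmetric] mult_exp_exp)
    ultimately show ?thesis by simp
  qed
  with False have "\<not> mean_le N0 (\<lambda>w. exp (z w) * f w) K" by (metis mean_le_meas)
  moreover have "\<not> mean_le N f K" using False mean_le_meas[of N f K] unfolding meas_N by blast
  ultimately show ?thesis by blast
qed

lemma integral_N: "f \<in> borel_measurable N0 \<Longrightarrow> (\<integral>w. f w \<partial>N) = (\<integral>w. exp (z w) * f w \<partial>N0)" for f :: "'w \<Rightarrow> real"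
  unfolding dens by (subst integral_density) auto

lemma mean_le_both:
  assumes "mean_le N0 f K" "mean_le N f K'" shows "mean_le N0 (\<lambda>w. (1 + exp (z w)) * f w) (K + K')"
  using mean_le_add[OF assms(1) assms(2)[unfolded mean_le_density]] by (simp add: algebra_simps)

text \<open>To first order the mean under \<open>N\<close> differs from the mean under \<open>N0\<close> by the covariance with the
log-density; the remainder \<open>z\<^sup>2 f\<close>, weighted by \<open>1 + exp z\<close>, is dominated by third moments under the two
laws.\<close>

lemma mean_change_first_order:
  assumes f: "mean_le N0 (\<lambda>w. \<bar>f w\<bar> ^ 3) F" "mean_le N (\<lambda>w. \<bar>f w\<bar> ^ 3) F" and m[measurable]: "f \<in> borel_measurable N0"
    and i: "integrable N0 f" "integrable N f" "integrable N0 (\<lambda>w. z w * f w)"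
  shows "\<bar>(\<integral>w. f w \<partial>N) - (\<integral>w. f w \<partial>N0) - (\<integral>w. z w * f w \<partial>N0)\<bar> \<le> 16 * q + 8 * F"
proof -
  have le: "(z w)\<^sup>2 * \<bar>f w\<bar> \<le> 4 * (s w ^ 3 + d w ^ 3 + \<bar>f w\<bar> ^ 3)" if w: "w \<in> space N0" for w
  proof -
    have "(z w)\<^sup>2 \<le> (s w + d w)\<^sup>2" using z_le[OF w] by (metis abs_ge_zero power2_abs power_mono)
    also have "\<dots> \<le> 2 * ((s w)\<^sup>2 + (d w)\<^sup>2)" using sum_squares_bound[of "s w" "d w"] by (simp add: power2_sum)
    finally have "(z w)\<^sup>2 * \<bar>f w\<bar> \<le> 2 * ((s w)\<^sup>2 + (d w)\<^sup>2) * \<bar>f w\<bar>" by (rule mult_right_mono) simp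
    also have "\<dots> = 2 * (s w * s w * \<bar>f w\<bar>) + 2 * (d w * d w * \<bar>f w\<bar>)" by (simp add: algebra_simps power2_eq_square)
    also have "\<dots> \<le> 4 * (s w ^ 3 + d w ^ 3 + \<bar>f w\<bar> ^ 3)"
      using prod3_le_cubes[of "s w" "s w" "\<bar>f w\<bar>"] prod3_le_cubes[of "d w" "d w" "\<bar>f w\<bar>"] s0[OF w] d0[OF w] by simp
    finally show ?thesis .
  qed
  have b: "mean_le M (\<lambda>w. (z w)\<^sup>2 * \<bar>f w\<bar>) (8 * q + 4 * F)"
    if M: "mean_le M (\<lambda>w. s w ^ 3) q" "mean_le M (\<lambda>w. d w ^ 3) q" "mean_le M (\<lambda>w. \<bar>f w\<bar> ^ 3) F" "sets M = sets N0" for M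
  proof -
    have sp: "space M = space N0" by (rule sets_eq_imp_space_eq[OF M(4)])
    have "mean_le M (\<lambda>w. 4 * (s w ^ 3 + d w ^ 3 + \<bar>f w\<bar> ^ 3)) (\<bar>4\<bar> * (q + q + F))"
      by (intro mean_le_cmult mean_le_add M)
    then show ?thesis
    proof (rule mean_le_mono)
      show "(\<lambda>w. (z w)\<^sup>2 * \<bar>f w\<bar>) \<in> borel_measurable M"
        unfolding measurable_cong_sets[OF M(4) refl] by measurable
      fix w assume "w \<in> space M"
      then show "\<bar>(z w)\<^sup>2 * \<bar>f w\<bar>\<bar> \<le> \<bar>4 * (s w ^ 3 + d w ^ 3 + \<bar>f w\<bar> ^ 3)\<bar>"
        using le[of w] sp by (intro order_trans[OF _ abs_ge_self]) simp
    qed simp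
  qed
  have "mean_le N0 (\<lambda>w. (1 + exp (z w)) * ((z w)\<^sup>2 * \<bar>f w\<bar>)) ((8 * q + 4 * F) + (8 * q + 4 * F))"
    by (intro mean_le_both b s3 d3 f sets_N refl)
  then have "mean_le N0 (\<lambda>w. exp (z w) * f w - f w - z w * f w) ((8 * q + 4 * F) + (8 * q + 4 * F))"
  proof (rule mean_le_mono)
    fix w
    have "exp (z w) * f w - f w - z w * f w = (exp (z w) - 1 - z w) * f w" by (simp add: algebra_simps)
    then have "\<bar>exp (z w) * f w - f w - z w * f w\<bar> \<le> (z w)\<^sup>2 * (1 + exp (z w)) * \<bar>f w\<bar>"
      using abs_exp_minus_linear_le[of "z w"] by (simp only: abs_mult) (intro mult_right_mono, auto)
    then show "\<bar>exp (z w) * f w - f w - z w * f w\<bar> \<le> \<bar>(1 + exp (z w)) * ((z w)\<^sup>2 * \<bar>f w\<bar>)\<bar>"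
      by (intro order_trans[OF _ abs_ge_self]) (simp add: mult_ac)
  qed auto
  from mean_le_abs_integral[OF this]
  have "\<bar>\<integral>w. exp (z w) * f w - f w - z w * f w \<partial>N0\<bar> \<le> 16 * q + 8 * F" by simp
  moreover have "integrable N0 (\<lambda>w. exp (z w) * f w)"
    using i(2) unfolding dens by (subst (asm) integrable_density) auto
  ultimately show ?thesis using i integral_N[OF m] by simp
qed

text \<open>For a product of two functions the change of measure is already a third-order effect.\<close>

lemma mean_change_crude:
  assumes f: "mean_le N0 (\<lambda>w. \<bar>f w\<bar> ^ 3) F" "mean_le N (\<lambda>w. \<bar>f w\<bar> ^ 3) F" "f \<in> borel_measurable N0"
    and g: "mean_le N0 (\<lambda>w. \<bar>g w\<bar> ^ 3) G" "mean_le N (\<lambda>w. \<bar>g w\<bar> ^ 3) G" "g \<in> borel_measurable N0"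
    and fg: "mean_le N0 (\<lambda>w. f w * g w) K"
  shows "mean_le N (\<lambda>w. f w * g w) (K + 4 * (q + F + G))"
    and "\<bar>(\<integral>w. f w * g w \<partial>N) - (\<integral>w. f w * g w \<partial>N0)\<bar> \<le> 4 * (q + F + G)"
proof -
  note [measurable] = f(3) g(3)
  have b: "mean_le M (\<lambda>w. z w * (f w * g w)) (2 * (q + F + G))"
    if M: "mean_le M (\<lambda>w. s w ^ 3) q" "mean_le M (\<lambda>w. d w ^ 3) q" "mean_le M (\<lambda>w. \<bar>f w\<bar> ^ 3) F" "mean_le M (\<lambda>w. \<bar>g w\<bar> ^ 3) G" "sets M = sets N0" for M
  proof -
    have sp: "space M = space N0" by (rule sets_eq_imp_space_eq[OF M(5)])
    have "mean_le M (\<lambda>w. s w ^ 3 + d w ^ 3 + 2 * (\<bar>f w\<bar> ^ 3 + \<bar>g w\<bar> ^ 3)) (q + q + \<bar>2\<bar> * (F + G))"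
      by (intro mean_le_cmult mean_le_add M)
    then show ?thesis
    proof (rule mean_le_mono)
      show "(\<lambda>w. z w * (f w * g w)) \<in> borel_measurable M"
        unfolding measurable_cong_sets[OF M(5) refl] by measurable
      fix w assume "w \<in> space M"
      then have w: "w \<in> space N0" using sp by simp
      have "\<bar>z w * (f w * g w)\<bar> \<le> (s w + d w) * (\<bar>f w\<bar> * \<bar>g w\<bar>)"
        using z_le[OF w] by (simp add: abs_mult mult_right_mono)
      also have "\<dots> = s w * \<bar>f w\<bar> * \<bar>g w\<bar> + d w * \<bar>f w\<bar> * \<bar>g w\<bar>" by (simp add: algebra_simps)
      also have "\<dots> \<le> s w ^ 3 + d w ^ 3 + 2 * (\<bar>f w\<bar> ^ 3 + \<bar>g w\<bar> ^ 3)"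
        using prod3_le_cubes[of "s w" "\<bar>f w\<bar>" "\<bar>g w\<bar>"] prod3_le_cubes[of "d w" "\<bar>f w\<bar>" "\<bar>g w\<bar>"] s0[OF w] d0[OF w] by simp
      finally show "\<bar>z w * (f w * g w)\<bar> \<le> \<bar>s w ^ 3 + d w ^ 3 + 2 * (\<bar>f w\<bar> ^ 3 + \<bar>g w\<bar> ^ 3)\<bar>" by linarith
    qed simp
  qed
  have "mean_le N0 (\<lambda>w. (1 + exp (z w)) * (z w * (f w * g w))) (2 * (q + F + G) + 2 * (q + F + G))"
    by (intro mean_le_both b s3 d3 f(1,2) g(1,2) sets_N refl)
  then have m: "mean_le N0 (\<lambda>w. exp (z w) * (f w * g w) - f w * g w) (2 * (q + F + G) + 2 * (q + F + G))"
  proof (rule mean_le_mono)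
    fix w
    have "exp (z w) * (f w * g w) - f w * g w = (exp (z w) - 1) * (f w * g w)" by (simp add: algebra_simps)
    then have "\<bar>exp (z w) * (f w * g w) - f w * g w\<bar> \<le> (\<bar>z w\<bar> * (1 + exp (z w))) * \<bar>f w * g w\<bar>"
      using abs_exp_minus_one_le[of "z w"] by (simp only: abs_mult[of "exp _ - 1"]) (intro mult_right_mono, auto)
    then show "\<bar>exp (z w) * (f w * g w) - f w * g w\<bar> \<le> \<bar>(1 + exp (z w)) * (z w * (f w * g w))\<bar>"
      by (simp add: abs_mult mult_ac add_nonneg_nonneg)
  qed auto
  have "mean_le N0 (\<lambda>w. f w * g w + (exp (z w) * (f w * g w) - f w * g w)) (K + (2 * (q + F + G) + 2 * (q + F + G)))"
    by (rule mean_le_add[OF fg m])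
  then show N: "mean_le N (\<lambda>w. f w * g w) (K + 4 * (q + F + G))"
    unfolding mean_le_density by (simp add: algebra_simps)
  have "\<bar>\<integral>w. exp (z w) * (f w * g w) - f w * g w \<partial>N0\<bar> \<le> 4 * (q + F + G)"
    using mean_le_abs_integral[OF m] by simp
  then show "\<bar>(\<integral>w. f w * g w \<partial>N) - (\<integral>w. f w * g w \<partial>N0)\<bar> \<le> 4 * (q + F + G)"
    using mean_le_integrable[OF fg] mean_le_integrable[OF N[unfolded mean_le_density]]
    by (simp add: integral_N)
qed

end

section \<open>One component of the likelihood process\<close>

text \<open>The data of one component: \<open>N0\<close> and \<open>N\<close> are its null law and its law at \<open>\<theta>\<close>, \<open>D\<close> is the error bound, \<open>\<rho>\<close> an
envelope of the remainder \<open>R\<close>, \<open>\<alpha>\<close> stands for \<open>A \<eta>(\<theta>)\<close> and \<open>Sg\<close> for the covariance \<open>\<Sigma>\<close>. Lengths are measured in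
units of the feature radius \<open>r\<close>, so that \<open>r * norm (U w)\<close> and \<open>r\<^sup>2 * norm (V w)\<close> bound the linear and the
quadratic term.\<close>

locale likelihood_component =
  tilted N0 N z "\<lambda>w. r * norm (Sc w)" "\<lambda>w. \<bar>\<Delta> w\<bar>" "r\<^sup>2 * D"
  for N0 N :: "'w measure" and z :: "'w \<Rightarrow> real" and r D :: real
    and Sc :: "'w \<Rightarrow> 'h::{real_inner, banach, second_countable_topology}" and \<Delta> :: "'w \<Rightarrow> real" +
  fixes c :: real and S :: "'h set" and U :: "'w \<Rightarrow> 'h" and V :: "'w \<Rightarrow> 'h \<Rightarrow>\<^sub>L 'h"
    and R :: "'t \<Rightarrow> 'w \<Rightarrow> real" and \<rho> :: "'w \<Rightarrow> real" and K Sg :: "'h \<Rightarrow>\<^sub>L 'h" and \<alpha> :: 'h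
    and T :: "'t set" and \<eta> :: "'t \<Rightarrow> 'h" and \<eta>\<theta> :: 'h
  assumes r: "0 < r" and D: "0 < D" and c: "1 \<le> c"
    and S: "subspace S" and \<eta>\<theta>: "\<eta>\<theta> \<in> S" "norm \<eta>\<theta> \<le> r"
    and \<eta>: "\<And>t. t \<in> T \<Longrightarrow> \<eta> t \<in> S" "\<And>t. t \<in> T \<Longrightarrow> norm (\<eta> t) \<le> r"
    and z_eq: "\<And>w. z w = Sc w \<bullet> \<eta>\<theta> + \<Delta> w"
    and Sc_meas: "Sc \<in> borel_measurable N0" and D_meas: "\<Delta> \<in> borel_measurable N0"
    and U_meas: "U \<in> borel_measurable N0" and U_mean: "(\<integral>w. U w \<partial>N0) = 0"
    and U2: "mean_le N0 (\<lambda>w. (r * norm (U w))\<^sup>2) ((c * r)\<^sup>2)"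
    and S2: "mean_le N0 (\<lambda>w. (r * norm (Sc w))\<^sup>2) ((c * r)\<^sup>2)"
    and U3: "mean_le N0 (\<lambda>w. (r * norm (U w)) ^ 3) (r\<^sup>2 * D)" "mean_le N (\<lambda>w. (r * norm (U w)) ^ 3) (r\<^sup>2 * D)"
    and V_meas: "(\<lambda>w. norm (V w)) \<in> borel_measurable N0"
    and V_meas': "\<And>h g. (\<lambda>w. blinfun_apply (V w) h \<bullet> g) \<in> borel_measurable N0"
    and V2: "mean_le N0 (\<lambda>w. (r\<^sup>2 * norm (V w))\<^sup>2) ((r * D)\<^sup>2)"
    and V3: "mean_le N0 (\<lambda>w. (r\<^sup>2 * norm (V w)) ^ 3) (r\<^sup>2 * D)" "mean_le N (\<lambda>w. (r\<^sup>2 * norm (V w)) ^ 3) (r\<^sup>2 * D)"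
    and D2: "mean_le N0 (\<lambda>w. (\<Delta> w)\<^sup>2) ((r * D)\<^sup>2)"
    and R_meas: "\<And>t. t \<in> T \<Longrightarrow> R t \<in> borel_measurable N0"
    and R2: "\<And>t. t \<in> T \<Longrightarrow> mean_le N0 (\<lambda>w. (R t w)\<^sup>2) ((r * D)\<^sup>2)"
    and R1: "\<And>t. t \<in> T \<Longrightarrow> \<bar>\<integral>w. R t w \<partial>N0\<bar> \<le> r\<^sup>2 * D"
    and R3: "\<And>t. t \<in> T \<Longrightarrow> mean_le N0 (\<lambda>w. \<bar>R t w\<bar> ^ 3) (r\<^sup>2 * D)"
    and \<rho>: "\<rho> \<in> borel_measurable N0" "\<And>t w. t \<in> T \<Longrightarrow> w \<in> space N0 \<Longrightarrow> \<bar>R t w\<bar> \<le> \<rho> w" "\<And>w. w \<in> space N0 \<Longrightarrow> 0 \<le> \<rho> w"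
    and \<rho>3: "mean_le N (\<lambda>w. \<rho> w ^ 3) (r\<^sup>2 * D)"
    and \<alpha>: "\<alpha> \<in> S" "\<And>g. g \<in> S \<Longrightarrow> \<alpha> \<bullet> g = (\<integral>w. (Sc w \<bullet> \<eta>\<theta>) * (U w \<bullet> g) \<partial>N0)"
    and Sg: "\<And>h g. h \<in> S \<Longrightarrow> g \<in> S \<Longrightarrow> blinfun_apply Sg h \<bullet> g = (\<integral>w. (U w \<bullet> h) * (U w \<bullet> g) \<partial>N0)"
    and K: "\<And>h g. h \<in> S \<Longrightarrow> g \<in> S \<Longrightarrow> blinfun_apply K h \<bullet> g = (\<integral>w. blinfun_apply (V w) h \<bullet> g \<partial>N0)"
begin

text \<open>All third moments are at most \<open>q\<close>, so \<open>\<kappa>\<close> is the size of a component; \<open>\<gamma>\<close> is the error that one component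
may contribute. The function \<open>vt\<close> collects the centred quadratic term and the centred remainder.\<close>

definition "q = r\<^sup>2 * D"
definition "\<kappa> = root 3 q"
definition "\<gamma> = r\<^sup>2 * D * (1 + D)"
definition "u w = r * norm (U w)"
definition "v w = r\<^sup>2 * norm (V w)"
definition "k0 = (\<integral>w. v w \<partial>N0)"
definition "a0 = (\<integral>w. (r * norm (Sc w)) * u w \<partial>N0)"
definition "cent t = (\<integral>w. R t w \<partial>N0)"
definition "vt t w = - (1/2) * (blinfun_apply (V w) (\<eta> t) \<bullet> \<eta> t - blinfun_apply K (\<eta> t) \<bullet> \<eta> t) + (R t w - cent t)"

lemma q_pos: "0 < q" using r D by (simp add: q_def)
lemma \<kappa>_pos: "0 < \<kappa>" using q_pos by (simp add: \<kappa>_def)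
lemma \<kappa>3: "\<kappa> ^ 3 = q" using q_pos by (simp add: \<kappa>_def)
lemma q_\<gamma>: "q \<le> \<gamma>" using r D by (simp add: q_def \<gamma>_def)

lemmas q_facts = s3[folded q_def] d3[folded q_def] U3[folded q_def u_def] V3[folded q_def v_def] R1[folded q_def] R3[folded q_def] \<rho>3[folded q_def]

lemma u_meas[measurable]: "u \<in> borel_measurable N0" and v_meas[measurable]: "v \<in> borel_measurable N0"
  unfolding u_def v_def using U_meas V_meas by measurable

declare Sc_meas[measurable] D_meas[measurable] U_meas[measurable] V_meas'[measurable] \<rho>(1)[measurable]

lemma u_nonneg: "0 \<le> u w" and v_nonneg: "0 \<le> v w"
  using r by (simp_all add: u_def v_def)

lemma N0_lower:
  "mean_le N0 u (2 * \<kappa>)" "mean_le N0 (\<lambda>w. (u w)\<^sup>2) (2 * \<kappa>\<^sup>2)" "mean_le N0 (\<lambda>w. (r * norm (Sc w))\<^sup>2) (2 * \<kappa>\<^sup>2)" "mean_le N0 v (2 * \<kappa>)"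
  using N0.mean_le_of_cube[of u 1 \<kappa>] N0.mean_le_of_cube[of "\<lambda>w. r * norm (Sc w)" 1 \<kappa>] N0.mean_le_of_cube[of v 1 \<kappa>]
    q_facts \<kappa>_pos u_nonneg v_nonneg r by (simp_all add: \<kappa>3)

lemma N_lower: "mean_le N u (2 * \<kappa>)" "mean_le N v (2 * \<kappa>)" "mean_le N \<rho> (2 * \<kappa>)"
  using N.mean_le_of_cube(1)[of u 1 \<kappa>] N.mean_le_of_cube(1)[of v 1 \<kappa>] N.mean_le_of_cube(1)[of \<rho> 1 \<kappa>]
    q_facts \<kappa>_pos u_nonneg v_nonneg \<rho>(3) by (simp_all add: \<kappa>3 meas_N space_N)

lemma a0: "0 \<le> a0" "a0 \<le> 2 * \<kappa>\<^sup>2" "integrable N0 (\<lambda>w. (r * norm (Sc w)) * u w)"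
proof -
  have m: "mean_le N0 (\<lambda>w. (1/2) * ((u w)\<^sup>2 + (r * norm (Sc w))\<^sup>2)) (\<bar>1/2\<bar> * (2 * \<kappa>\<^sup>2 + 2 * \<kappa>\<^sup>2))"
    by (intro mean_le_cmult mean_le_add N0_lower)
  have le: "\<bar>r * norm (Sc w) * u w\<bar> \<le> \<bar>(1/2) * ((u w)\<^sup>2 + (r * norm (Sc w))\<^sup>2)\<bar>" for w
    using sum_squares_bound[of "u w" "r * norm (Sc w)"] u_nonneg[of w] r by (simp add: abs_mult mult_ac)
  have m': "mean_le N0 (\<lambda>w. (r * norm (Sc w)) * u w) (2 * \<kappa>\<^sup>2)"
    by (rule mean_le_mono[OF m _ le]) auto
  show "integrable N0 (\<lambda>w. (r * norm (Sc w)) * u w)" by (rule mean_le_integrable[OF m'])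
  show "a0 \<le> 2 * \<kappa>\<^sup>2" unfolding a0_def by (rule mean_le_integral[OF m'])
  show "0 \<le> a0" unfolding a0_def using u_nonneg r by (intro integral_nonneg_AE) auto
qed

lemma k0: "0 \<le> k0" "k0 \<le> 2 * \<kappa>" "k0 \<le> r * D" "k0 ^ 3 \<le> q"
proof -
  show "0 \<le> k0" unfolding k0_def using v_nonneg by (intro integral_nonneg_AE) auto
  show "k0 \<le> 2 * \<kappa>" unfolding k0_def by (rule mean_le_integral[OF N0_lower(4)])
  have "mean_le N0 v (r * D)" by (rule N0.mean_le_first_of_square) (use V2 r D in \<open>auto simp: v_def[symmetric]\<close>)
  then show "k0 \<le> r * D" unfolding k0_def by (rule mean_le_integral)
  show "k0 ^ 3 \<le> q" unfolding k0_def
    by (rule N0.cube_of_mean_le) (use q_facts mean_le_integrable[OF N0_lower(4)] v_nonneg in auto)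
qed

lemma cent: assumes t: "t \<in> T"
  shows "\<bar>cent t\<bar> \<le> q" "\<bar>cent t\<bar> \<le> r * D" "\<bar>cent t\<bar> ^ 3 \<le> q" "integrable N0 (R t)"
proof -
  note [measurable] = R_meas[OF t]
  have m: "mean_le N0 (R t) (r * D)"
    by (rule N0.mean_le_first_of_square) (use R2[OF t] r D in auto)
  show "integrable N0 (R t)" by (rule mean_le_integrable[OF m])
  show "\<bar>cent t\<bar> \<le> q" using q_facts(9)[OF t] by (simp add: cent_def)
  show "\<bar>cent t\<bar> \<le> r * D" unfolding cent_def by (rule mean_le_abs_integral[OF m])
  have "(\<integral>w. \<bar>R t w\<bar> \<partial>N0) ^ 3 \<le> q"
    by (rule N0.cube_of_mean_le) (use q_facts(10)[OF t] mean_le_integrable[OF m] in auto)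
  moreover have "\<bar>cent t\<bar> \<le> (\<integral>w. \<bar>R t w\<bar> \<partial>N0)" unfolding cent_def by (rule integral_abs_bound)
  ultimately show "\<bar>cent t\<bar> ^ 3 \<le> q" using power_mono[of "\<bar>cent t\<bar>" "\<integral>w. \<bar>R t w\<bar> \<partial>N0" 3] by linarith
qed

lemma inner_U_le: "norm e \<le> c * r \<Longrightarrow> \<bar>U w \<bullet> e\<bar> \<le> c * u w"
proof -
  assume "norm e \<le> c * r"
  then have "norm (U w) * norm e \<le> norm (U w) * (c * r)" by (rule mult_left_mono) simp
  then show ?thesis using Cauchy_Schwarz_ineq2[of "U w" e] by (simp add: u_def mult_ac)
qed

lemma inner_\<alpha>_le: assumes e: "e \<in> S" "norm e \<le> c * r" shows "\<bar>\<alpha> \<bullet> e\<bar> \<le> c * a0"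
proof -
  have "\<bar>\<alpha> \<bullet> e\<bar> \<le> (\<integral>w. \<bar>(Sc w \<bullet> \<eta>\<theta>) * (U w \<bullet> e)\<bar> \<partial>N0)" unfolding \<alpha>(2)[OF e(1)] by (rule integral_abs_bound)
  also have "\<dots> \<le> (\<integral>w. c * ((r * norm (Sc w)) * u w) \<partial>N0)"
  proof (rule integral_mono_AE')
    show "AE w in N0. \<bar>(Sc w \<bullet> \<eta>\<theta>) * (U w \<bullet> e)\<bar> \<le> c * ((r * norm (Sc w)) * u w)"
    proof (rule AE_I2)
      fix w
      have "\<bar>Sc w \<bullet> \<eta>\<theta>\<bar> \<le> norm (Sc w) * norm \<eta>\<theta>" by (rule Cauchy_Schwarz_ineq2)
      also have "\<dots> \<le> norm (Sc w) * r" using \<eta>\<theta> by (intro mult_left_mono) auto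
      finally have "\<bar>Sc w \<bullet> \<eta>\<theta>\<bar> * \<bar>U w \<bullet> e\<bar> \<le> (norm (Sc w) * r) * (c * u w)"
        using inner_U_le[OF e(2)] r by (intro mult_mono) auto
      then show "\<bar>(Sc w \<bullet> \<eta>\<theta>) * (U w \<bullet> e)\<bar> \<le> c * ((r * norm (Sc w)) * u w)" by (simp add: abs_mult mult_ac)
    qed
  qed (use a0(3) u_nonneg r c in auto)
  finally show ?thesis by (simp add: a0_def)
qed

lemma inner_\<alpha>_le': assumes e: "e \<in> S" "norm e \<le> c * r" shows "\<bar>\<alpha> \<bullet> e\<bar> \<le> 2 * c * \<kappa>\<^sup>2"
  using inner_\<alpha>_le[OF e] a0(2) c mult_left_mono[of a0 "2 * \<kappa>\<^sup>2" c] by linarith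

lemma inner_U_mean_le:
  assumes e: "norm e \<le> c * r"
  shows "mean_le N0 (\<lambda>w. \<bar>U w \<bullet> e\<bar> ^ 3) (c ^ 3 * q)" "mean_le N (\<lambda>w. \<bar>U w \<bullet> e\<bar> ^ 3) (c ^ 3 * q)"
    "mean_le N0 (\<lambda>w. (U w \<bullet> e)\<^sup>2) ((c\<^sup>2 * r)\<^sup>2)" "mean_le N (\<lambda>w. U w \<bullet> e) (2 * c * \<kappa>)" "mean_le N0 (\<lambda>w. U w \<bullet> e) (2 * c * \<kappa>)"
    "mean_le N0 (\<lambda>w. (U w \<bullet> e)\<^sup>2) (2 * c\<^sup>2 * \<kappa>\<^sup>2)"
proof -
  have 3: "\<bar>\<bar>U w \<bullet> e\<bar> ^ 3\<bar> \<le> \<bar>c ^ 3 * u w ^ 3\<bar>" for w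
    using power_mono[OF inner_U_le[OF e, of w], of 3] u_nonneg[of w] c by (simp add: power_mult_distrib)
  have 2: "\<bar>(U w \<bullet> e)\<^sup>2\<bar> \<le> \<bar>c\<^sup>2 * (u w)\<^sup>2\<bar>" for w
    using power_mono[OF inner_U_le[OF e, of w], of 2] u_nonneg[of w] c by (simp add: power_mult_distrib)
  have 1: "\<bar>U w \<bullet> e\<bar> \<le> \<bar>c * u w\<bar>" for w
    using inner_U_le[OF e, of w] by (rule order_trans[OF _ abs_ge_self])
  show "mean_le N0 (\<lambda>w. \<bar>U w \<bullet> e\<bar> ^ 3) (c ^ 3 * q)"
    using c by (intro mean_le_mono[OF mean_le_cmult[OF q_facts(5), of "c ^ 3"] _ 3]) auto
  show "mean_le N (\<lambda>w. \<bar>U w \<bullet> e\<bar> ^ 3) (c ^ 3 * q)"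
    using c by (intro mean_le_mono[OF mean_le_cmult[OF q_facts(6), of "c ^ 3"] _ 3]) (auto simp: meas_N)
  show "mean_le N0 (\<lambda>w. (U w \<bullet> e)\<^sup>2) ((c\<^sup>2 * r)\<^sup>2)"
    using c by (intro mean_le_mono[OF mean_le_cmult[OF U2[folded u_def], of "c\<^sup>2"] _ 2]) (auto simp: power_mult_distrib)
  show "mean_le N0 (\<lambda>w. (U w \<bullet> e)\<^sup>2) (2 * c\<^sup>2 * \<kappa>\<^sup>2)"
    using c by (intro mean_le_mono[OF mean_le_cmult[OF N0_lower(2), of "c\<^sup>2"] _ 2]) (auto simp: power_mult_distrib)
  show "mean_le N (\<lambda>w. U w \<bullet> e) (2 * c * \<kappa>)"
    using c by (intro mean_le_mono[OF mean_le_cmult[OF N_lower(1), of c] _ 1]) (auto simp: meas_N)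
  show "mean_le N0 (\<lambda>w. U w \<bullet> e) (2 * c * \<kappa>)"
    using c by (intro mean_le_mono[OF mean_le_cmult[OF N0_lower(1), of c] _ 1]) auto
qed

lemma c_powers: "1 \<le> c\<^sup>2" "c \<le> c\<^sup>2" "c\<^sup>2 \<le> c ^ 3" "c ^ 3 \<le> c ^ 5" "1 \<le> c ^ 3" "c \<le> c ^ 3"
  using c power_increasing[of 1 2 c] power_increasing[of 2 3 c] power_increasing[of 3 5 c] power_increasing[of 1 3 c] one_le_power[of c 2] one_le_power[of c 3] by auto

text \<open>The mean of \<open>U\<close> vanishes under \<open>N0\<close>, so its mean under \<open>N\<close> is to first order its covariance with the
log-density. The score contributes exactly \<open>\<alpha>\<close>, the remainder \<open>\<Delta>\<close> only an error.\<close>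

lemma mean_inner_U:
  assumes e: "e \<in> S" "norm e \<le> c * r"
  shows "\<bar>\<integral>w. (U w - \<alpha>) \<bullet> e \<partial>N\<bar> \<le> 25 * c ^ 3 * \<gamma>"
proof -
  note m = inner_U_mean_le[OF e(2)]
  have iU: "integrable N0 U"
  proof -
    have "integrable N0 (\<lambda>w. r * norm (U w))" using mean_le_integrable[OF N0_lower(1)] unfolding u_def[abs_def] .
    then have "integrable N0 (\<lambda>w. (1 / r) * (r * norm (U w)))" by (rule integrable_mult_right)
    then have "integrable N0 (\<lambda>w. norm (U w))" using r by simp
    then show ?thesis by (simp add: integrable_norm_iff[OF U_meas])
  qed
  have z0: "(\<integral>w. U w \<bullet> e \<partial>N0) = 0" using integral_inner_left[of e N0 U] iU U_mean by simp
  have D1: "mean_le N0 (\<lambda>w. \<Delta> w * (U w \<bullet> e)) ((r * D) * (c\<^sup>2 * r))"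
    using r D by (intro mean_le_mult D2 m) auto
  have SU: "integrable N0 (\<lambda>w. (Sc w \<bullet> \<eta>\<theta>) * (U w \<bullet> e))"
  proof (rule Bochner_Integration.integrable_bound[OF integrable_mult_right[OF a0(3), of c]])
    show "AE w in N0. norm ((Sc w \<bullet> \<eta>\<theta>) * (U w \<bullet> e)) \<le> norm (c * (r * norm (Sc w) * u w))"
    proof (rule AE_I2)
      fix w
      have "\<bar>Sc w \<bullet> \<eta>\<theta>\<bar> \<le> norm (Sc w) * norm \<eta>\<theta>" by (rule Cauchy_Schwarz_ineq2)
      also have "\<dots> \<le> norm (Sc w) * r" using \<eta>\<theta> by (intro mult_left_mono) auto
      finally have "\<bar>Sc w \<bullet> \<eta>\<theta>\<bar> * \<bar>U w \<bullet> e\<bar> \<le> (norm (Sc w) * r) * (c * u w)"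
        using inner_U_le[OF e(2)] r by (intro mult_mono) auto
      then show "norm ((Sc w \<bullet> \<eta>\<theta>) * (U w \<bullet> e)) \<le> norm (c * (r * norm (Sc w) * u w))"
        using r c u_nonneg[of w] by (simp add: abs_mult mult_ac)
    qed
  qed measurable
  have zeq: "z w * (U w \<bullet> e) = (Sc w \<bullet> \<eta>\<theta>) * (U w \<bullet> e) + \<Delta> w * (U w \<bullet> e)" for w
    by (simp add: z_eq algebra_simps)
  have iz: "integrable N0 (\<lambda>w. z w * (U w \<bullet> e))" unfolding zeq using SU mean_le_integrable[OF D1] by simp
  have "\<bar>(\<integral>w. U w \<bullet> e \<partial>N) - (\<integral>w. U w \<bullet> e \<partial>N0) - (\<integral>w. z w * (U w \<bullet> e) \<partial>N0)\<bar> \<le> 16 * q + 8 * (c ^ 3 * q)"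
    unfolding q_def
    by (rule mean_change_first_order[OF m(1,2)[unfolded q_def] _ mean_le_integrable[OF m(5)] mean_le_integrable[OF m(4)] iz]) measurable
  moreover have "(\<integral>w. z w * (U w \<bullet> e) \<partial>N0) = \<alpha> \<bullet> e + (\<integral>w. \<Delta> w * (U w \<bullet> e) \<partial>N0)"
    unfolding zeq using SU mean_le_integrable[OF D1] by (simp add: \<alpha>(2)[OF e(1)])
  moreover have "\<bar>\<integral>w. \<Delta> w * (U w \<bullet> e) \<partial>N0\<bar> \<le> c\<^sup>2 * q"
    using mean_le_abs_integral[OF D1] by (simp add: q_def power2_eq_square mult_ac)
  ultimately have "\<bar>(\<integral>w. U w \<bullet> e \<partial>N) - \<alpha> \<bullet> e\<bar> \<le> 16 * q + 8 * (c ^ 3 * q) + c\<^sup>2 * q" using z0 by linarith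
  also have "\<dots> \<le> 25 * (c ^ 3 * \<gamma>)"
  proof -
    have "q \<le> c ^ 3 * q" "c\<^sup>2 * q \<le> c ^ 3 * q" "c ^ 3 * q \<le> c ^ 3 * \<gamma>"
      using c_powers q_pos q_\<gamma> c by (auto intro!: mult_right_mono mult_left_mono)
    then show ?thesis by linarith
  qed
  finally show ?thesis
    using mean_le_integrable[OF m(4)] by (simp add: inner_diff_left N.prob_space mult.assoc)
qed

text \<open>Each of the four constituents of \<open>vt\<close> has third moment at most \<open>q\<close> under both laws and second moment at
most \<open>(r * D)\<^sup>2\<close> under the null law.\<close>

lemma vt_bounds:
  assumes t: "t \<in> T"
  shows "vt t \<in> borel_measurable N0"
    and "\<And>w. w \<in> space N0 \<Longrightarrow> \<bar>vt t w\<bar> \<le> v w / 2 + k0 / 2 + \<rho> w + \<bar>cent t\<bar>"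
    and "mean_le N0 (\<lambda>w. \<bar>vt t w\<bar> ^ 3) (64 * q)" "mean_le N (\<lambda>w. \<bar>vt t w\<bar> ^ 3) (64 * q)"
    and "mean_le N0 (\<lambda>w. (vt t w)\<^sup>2) ((4 * (r * D))\<^sup>2)" and "mean_le N (vt t) (65 * \<kappa>)" and "(\<integral>w. vt t w \<partial>N0) = 0"
proof -
  note [measurable] = R_meas[OF t]
  show m[measurable]: "vt t \<in> borel_measurable N0" unfolding vt_def by measurable
  have Vt: "\<bar>blinfun_apply (V w) (\<eta> t) \<bullet> \<eta> t\<bar> \<le> v w" for w
  proof -
    have "\<bar>blinfun_apply (V w) (\<eta> t) \<bullet> \<eta> t\<bar> \<le> norm (blinfun_apply (V w) (\<eta> t)) * norm (\<eta> t)" by (rule Cauchy_Schwarz_ineq2)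
    also have "\<dots> \<le> (norm (V w) * r) * r"
      using norm_blinfun[of "V w" "\<eta> t"] \<eta>(2)[OF t] r
      by (intro mult_mono) (auto intro: order_trans[OF _ mult_left_mono])
    finally show ?thesis by (simp add: v_def power2_eq_square mult_ac)
  qed
  have iV: "integrable N0 (\<lambda>w. blinfun_apply (V w) (\<eta> t) \<bullet> \<eta> t)"
    using Vt v_nonneg by (intro Bochner_Integration.integrable_bound[OF mean_le_integrable[OF N0_lower(4)]] AE_I2) (auto intro: order_trans[OF _ abs_ge_self])
  have Kt: "\<bar>blinfun_apply K (\<eta> t) \<bullet> \<eta> t\<bar> \<le> k0"
  proof -
    have "\<bar>blinfun_apply K (\<eta> t) \<bullet> \<eta> t\<bar> \<le> (\<integral>w. \<bar>blinfun_apply (V w) (\<eta> t) \<bullet> \<eta> t\<bar> \<partial>N0)"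
      unfolding K[OF \<eta>(1)[OF t] \<eta>(1)[OF t]] by (rule integral_abs_bound)
    also have "\<dots> \<le> k0" unfolding k0_def
      using iV Vt mean_le_integrable[OF N0_lower(4)] by (intro integral_mono) auto
    finally show ?thesis .
  qed
  have base: "\<bar>vt t w\<bar> \<le> v w / 2 + k0 / 2 + \<bar>R t w\<bar> + \<bar>cent t\<bar>" for w
  proof -
    have "\<bar>vt t w\<bar> \<le> \<bar>- (1/2) * (blinfun_apply (V w) (\<eta> t) \<bullet> \<eta> t - blinfun_apply K (\<eta> t) \<bullet> \<eta> t)\<bar> + \<bar>R t w - cent t\<bar>"
      unfolding vt_def by (rule abs_triangle_ineq)
    moreover have "\<bar>- (1/2) * (blinfun_apply (V w) (\<eta> t) \<bullet> \<eta> t - blinfun_apply K (\<eta> t) \<bullet> \<eta> t)\<bar>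
        = \<bar>blinfun_apply (V w) (\<eta> t) \<bullet> \<eta> t - blinfun_apply K (\<eta> t) \<bullet> \<eta> t\<bar> / 2" by (simp only: abs_mult)
    moreover have "\<bar>blinfun_apply (V w) (\<eta> t) \<bullet> \<eta> t - blinfun_apply K (\<eta> t) \<bullet> \<eta> t\<bar> \<le> v w + k0"
      using Vt[of w] Kt by linarith
    moreover have "\<bar>R t w - cent t\<bar> \<le> \<bar>R t w\<bar> + \<bar>cent t\<bar>" by (rule abs_triangle_ineq4)
    ultimately show ?thesis by linarith
  qed
  then show "\<bar>vt t w\<bar> \<le> v w / 2 + k0 / 2 + \<rho> w + \<bar>cent t\<bar>" if "w \<in> space N0" for w
    using \<rho>(2)[OF t that] base[of w] by linarith
  have c3: "\<bar>vt t w\<bar> ^ 3 \<le> 16 * ((1/8) * v w ^ 3 + (1/8) * k0 ^ 3 + \<bar>R t w\<bar> ^ 3 + \<bar>cent t\<bar> ^ 3)" for w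
  proof -
    have "\<bar>vt t w\<bar> ^ 3 \<le> (v w / 2 + k0 / 2 + \<bar>R t w\<bar> + \<bar>cent t\<bar>) ^ 3" by (intro power_mono base) auto
    also have "\<dots> \<le> 16 * ((v w / 2) ^ 3 + (k0 / 2) ^ 3 + \<bar>R t w\<bar> ^ 3 + \<bar>cent t\<bar> ^ 3)"
      using v_nonneg k0 by (intro cube_sum4) auto
    finally show ?thesis by (simp add: power_divide)
  qed
  have cube: "mean_le M (\<lambda>w. \<bar>vt t w\<bar> ^ 3) (64 * q)"
    if M: "prob_space M" "sets M = sets N0" "mean_le M (\<lambda>w. v w ^ 3) q" "mean_le M (\<lambda>w. \<bar>R t w\<bar> ^ 3) q" for M
  proof -
    interpret M: prob_space M by (rule M)
    have "mean_le M (\<lambda>w. 16 * ((1/8) * v w ^ 3 + (1/8) * k0 ^ 3 + \<bar>R t w\<bar> ^ 3 + \<bar>cent t\<bar> ^ 3)) (\<bar>16\<bar> * (\<bar>1/8\<bar> * q + (1/8) * q + q + q))"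
      using k0 cent[OF t] by (intro mean_le_cmult mean_le_add M M.mean_le_const) auto
    then show ?thesis
    proof (rule mean_le_mono)
      show "(\<lambda>w. \<bar>vt t w\<bar> ^ 3) \<in> borel_measurable M" unfolding measurable_cong_sets[OF M(2) refl] by measurable
      show "\<bar>\<bar>vt t w\<bar> ^ 3\<bar> \<le> \<bar>16 * ((1/8) * v w ^ 3 + (1/8) * k0 ^ 3 + \<bar>R t w\<bar> ^ 3 + \<bar>cent t\<bar> ^ 3)\<bar>" for w
        using c3[of w] by (intro order_trans[OF _ abs_ge_self]) simp
    qed (use q_pos in simp)
  qed
  show "mean_le N0 (\<lambda>w. \<bar>vt t w\<bar> ^ 3) (64 * q)"
    by (rule cube) (use q_facts(7,10) t N0.prob_space_axioms in auto)
  have RN: "mean_le N (\<lambda>w. \<bar>R t w\<bar> ^ 3) q"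
  proof (rule mean_le_mono[OF q_facts(11)])
    fix w assume "w \<in> space N"
    then show "\<bar>\<bar>R t w\<bar> ^ 3\<bar> \<le> \<bar>\<rho> w ^ 3\<bar>"
      using power_mono[OF \<rho>(2)[OF t], of w 3] \<rho>(3)[of w] by (simp add: space_N)
  qed (auto simp: meas_N)
  show N3: "mean_le N (\<lambda>w. \<bar>vt t w\<bar> ^ 3) (64 * q)"
    by (rule cube) (use q_facts(8) RN N.prob_space_axioms sets_N in auto)
  have "mean_le N (\<lambda>w. \<bar>vt t w\<bar>) ((1 + 64) * \<kappa>)"
    by (rule N.mean_le_of_cube(1)) (use N3 \<kappa>_pos in \<open>auto simp: \<kappa>3 meas_N\<close>)
  then show "mean_le N (vt t) (65 * \<kappa>)"
    by (rule mean_le_mono) (auto simp: meas_N)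
  have c2: "(vt t w)\<^sup>2 \<le> 4 * ((1/4) * (v w)\<^sup>2 + (1/4) * k0\<^sup>2 + (R t w)\<^sup>2 + (cent t)\<^sup>2)" for w
  proof -
    have s4: "(a + b + c + d)\<^sup>2 \<le> 4 * (a\<^sup>2 + b\<^sup>2 + c\<^sup>2 + d\<^sup>2)" for a b c d :: real
    proof -
      have "0 \<le> (a - b)\<^sup>2 + (a - c)\<^sup>2 + (a - d)\<^sup>2 + (b - c)\<^sup>2 + (b - d)\<^sup>2 + (c - d)\<^sup>2" by simp
      then show ?thesis by (simp add: power2_eq_square algebra_simps)
    qed
    have "(vt t w)\<^sup>2 = \<bar>vt t w\<bar>\<^sup>2" by simp
    also have "\<dots> \<le> (v w / 2 + k0 / 2 + \<bar>R t w\<bar> + \<bar>cent t\<bar>)\<^sup>2" by (intro power_mono base) auto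
    also have "\<dots> \<le> 4 * ((v w / 2)\<^sup>2 + (k0 / 2)\<^sup>2 + \<bar>R t w\<bar>\<^sup>2 + \<bar>cent t\<bar>\<^sup>2)" by (rule s4)
    finally show ?thesis by (simp add: power_divide)
  qed
  have k02: "k0\<^sup>2 \<le> (r * D)\<^sup>2" "(cent t)\<^sup>2 \<le> (r * D)\<^sup>2"
    using k0 cent(2)[OF t] power_mono[of "\<bar>cent t\<bar>" "r * D" 2] by (auto intro: power_mono)
  have "mean_le N0 (\<lambda>w. 4 * ((1/4) * (v w)\<^sup>2 + (1/4) * k0\<^sup>2 + (R t w)\<^sup>2 + (cent t)\<^sup>2))
      (\<bar>4\<bar> * (\<bar>1/4\<bar> * (r * D)\<^sup>2 + (1/4) * (r * D)\<^sup>2 + (r * D)\<^sup>2 + (r * D)\<^sup>2))"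
    using k02 V2[folded v_def] R2[OF t] by (intro mean_le_cmult mean_le_add N0.mean_le_const) auto
  then show "mean_le N0 (\<lambda>w. (vt t w)\<^sup>2) ((4 * (r * D))\<^sup>2)"
  proof (rule mean_le_mono)
    show "\<bar>(vt t w)\<^sup>2\<bar> \<le> \<bar>4 * ((1/4) * (v w)\<^sup>2 + (1/4) * k0\<^sup>2 + (R t w)\<^sup>2 + (cent t)\<^sup>2)\<bar>" for w
      using c2[of w] by (intro order_trans[OF _ abs_ge_self]) simp
    show "\<bar>4\<bar> * (\<bar>1 / 4\<bar> * (r * D)\<^sup>2 + 1 / 4 * (r * D)\<^sup>2 + (r * D)\<^sup>2 + (r * D)\<^sup>2) \<le> (4 * (r * D))\<^sup>2"
      using r D by (simp add: power2_eq_square)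
  qed auto
  show "(\<integral>w. vt t w \<partial>N0) = 0"
    unfolding vt_def using iV cent(4)[OF t] by (simp add: N0.prob_space K[OF \<eta>(1)[OF t] \<eta>(1)[OF t]] cent_def)
qed

text \<open>Here the second moments are used as well: the covariance of \<open>vt\<close> with the log-density is at most the
product of the standard deviations \<open>4 r D\<close> and \<open>2 r (c + D)\<close>, which is where the factor \<open>1 + D\<close> comes from.\<close>

lemma mean_vt:
  assumes t: "t \<in> T"
  shows "\<bar>\<integral>w. vt t w \<partial>N\<bar> \<le> 536 * c * \<gamma>" 
proof -
  note v = vt_bounds[OF t]
  note [measurable] = v(1)
  have z2: "mean_le N0 (\<lambda>w. (z w)\<^sup>2) ((2 * r * (c + D))\<^sup>2)"
  proof -
    have "mean_le N0 (\<lambda>w. 2 * ((r * norm (Sc w))\<^sup>2 + (\<Delta> w)\<^sup>2)) (\<bar>2\<bar> * ((c * r)\<^sup>2 + (r * D)\<^sup>2))"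
      by (intro mean_le_cmult mean_le_add S2 D2)
    then show ?thesis
    proof (rule mean_le_mono)
      fix w assume w: "w \<in> space N0"
      have "(z w)\<^sup>2 = \<bar>z w\<bar>\<^sup>2" by simp
      also have "\<dots> \<le> (r * norm (Sc w) + \<bar>\<Delta> w\<bar>)\<^sup>2" using z_le[OF w] by (intro power_mono) auto
      also have "\<dots> \<le> 2 * ((r * norm (Sc w))\<^sup>2 + (\<Delta> w)\<^sup>2)"
        using sum_squares_bound[of "r * norm (Sc w)" "\<bar>\<Delta> w\<bar>"] by (simp add: power2_sum)
      finally show "\<bar>(z w)\<^sup>2\<bar> \<le> \<bar>2 * ((r * norm (Sc w))\<^sup>2 + (\<Delta> w)\<^sup>2)\<bar>" by (intro order_trans[OF _ abs_ge_self]) simp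
 next
      have "0 \<le> r\<^sup>2 * (2 * c\<^sup>2 + 2 * D\<^sup>2 + 8 * c * D)" using c D by simp
      then show "\<bar>2\<bar> * ((c * r)\<^sup>2 + (r * D)\<^sup>2) \<le> (2 * r * (c + D))\<^sup>2"
        by (simp add: power2_eq_square algebra_simps)
    qed measurable
  qed
  have zf: "mean_le N0 (\<lambda>w. z w * vt t w) (2 * r * (c + D) * (4 * (r * D)))"
    using r D c by (intro mean_le_mult z2 v) auto
  have i0: "integrable N0 (vt t)"
    by (rule mean_le_integrable[OF N0.mean_le_first_of_square[OF v(5)]]) (use r D in auto)
  have "\<bar>(\<integral>w. vt t w \<partial>N) - (\<integral>w. vt t w \<partial>N0) - (\<integral>w. z w * vt t w \<partial>N0)\<bar> \<le> 16 * q + 8 * (64 * q)"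
    unfolding q_def
    by (rule mean_change_first_order[OF v(3,4)[unfolded q_def] v(1) i0 mean_le_integrable[OF v(6)] mean_le_integrable[OF zf]])
  then have "\<bar>\<integral>w. vt t w \<partial>N\<bar> \<le> 528 * q + 2 * r * (c + D) * (4 * (r * D))"
    using mean_le_abs_integral[OF zf] v(7) by linarith
  also have "\<dots> = 528 * q + 8 * (r\<^sup>2 * D * (c + D))" by (simp add: power2_eq_square algebra_simps)
  also have "r\<^sup>2 * D * (c + D) \<le> r\<^sup>2 * D * (c * (1 + D))"
    using c D by (intro mult_left_mono) (auto simp: algebra_simps mult_le_cancel_left1)
  also have "r\<^sup>2 * D * (c * (1 + D)) = c * \<gamma>" by (simp add: \<gamma>_def)
  also have "528 * q + 8 * (c * \<gamma>) \<le> 536 * (c * \<gamma>)"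
  proof -
    have "q \<le> \<gamma>" by (rule q_\<gamma>)
    also have "\<gamma> \<le> c * \<gamma>" using c q_\<gamma> q_pos by (simp add: mult_le_cancel_right1)
    finally show ?thesis by linarith
  qed
  finally show ?thesis by (simp add: mult.assoc)
qed

text \<open>The envelope of the centred field \<open>proc\<close>, which is the component of the likelihood process along \<open>e\<close> for
\<open>\<tau> = 1\<close> and its linear part for \<open>\<tau> = 0\<close>.\<close>

definition "env w = c * (u w + a0) + v w / 2 + k0 / 2 + \<rho> w + q"

definition "proc \<tau> e t w = (U w - \<alpha>) \<bullet> e t + \<tau> * vt t w"

lemma env_meas[measurable]: "env \<in> borel_measurable N0"
  unfolding env_def by measurable

lemma proc_le_env:
  assumes t: "t \<in> T" and e: "e t \<in> S" "norm (e t) \<le> c * r" and \<tau>: "\<bar>\<tau>\<bar> \<le> 1" and w: "w \<in> space N0"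
  shows "\<bar>proc \<tau> e t w\<bar> \<le> env w"
proof -
  have "\<bar>\<tau> * vt t w\<bar> \<le> 1 * \<bar>vt t w\<bar>" unfolding abs_mult by (rule mult_right_mono[OF \<tau>]) simp
  then show ?thesis
    unfolding proc_def env_def inner_diff_left
    using inner_U_le[OF e(2), of w] inner_\<alpha>_le[OF e] vt_bounds(2)[OF t w] cent(1)[OF t]
    by (simp add: distrib_left)
qed

lemma env_cube:
  assumes "\<kappa> \<le> 1"
  shows "mean_le N (\<lambda>w. env w ^ 3) (2000 * c ^ 3 * q)"
proof -
  have q1: "q \<le> 1" using power_le_one[of \<kappa> 3] assms \<kappa>_pos by (simp add: \<kappa>3)
  have q3: "q ^ 3 \<le> q" using power_decreasing[of 1 3 q] q1 q_pos by simp
  have a03: "a0 ^ 3 \<le> 8 * q"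
  proof -
    have "a0 ^ 3 \<le> (2 * \<kappa>\<^sup>2) ^ 3" by (intro power_mono a0)
    also have "\<dots> = 8 * (\<kappa> ^ 3) ^ 2" by (simp add: power_mult_distrib power_mult[symmetric])
    also have "\<dots> = 8 * q\<^sup>2" by (simp only: \<kappa>3)
    also have "\<dots> \<le> 8 * q" using q1 q_pos by (simp add: power2_eq_square mult_le_cancel_left1)
    finally show ?thesis .
  qed
  let ?X = "\<lambda>w. 16 * ((c ^ 3 * 4) * (u w ^ 3 + a0 ^ 3) + (1/8) * v w ^ 3 + (4 / 8) * (k0 ^ 3 + 8 * q ^ 3) + \<rho> w ^ 3)"
  have pt: "env w ^ 3 \<le> ?X w" and e0: "0 \<le> env w" if w: "w \<in> space N0" for w
  proof -
    note nn = u_nonneg[of w] v_nonneg[of w] k0(1) a0(1) \<rho>(3)[OF w] c q_pos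
    have "env w = c * (u w + a0) + v w / 2 + (k0 / 2 + q) + \<rho> w" by (simp add: env_def)
    then have "env w ^ 3 = (c * (u w + a0) + v w / 2 + (k0 / 2 + q) + \<rho> w) ^ 3" by (rule arg_cong)
    also have "\<dots> \<le> 16 * ((c * (u w + a0)) ^ 3 + (v w / 2) ^ 3 + (k0 / 2 + q) ^ 3 + \<rho> w ^ 3)"
      using nn by (intro cube_sum4) auto
    also have "(c * (u w + a0)) ^ 3 \<le> c ^ 3 * (4 * (u w ^ 3 + a0 ^ 3))"
      unfolding power_mult_distrib using nn by (intro mult_left_mono cube_sum2) auto
    also have "(k0 / 2 + q) ^ 3 \<le> 4 * ((k0 / 2) ^ 3 + q ^ 3)" using nn by (intro cube_sum2) auto
    finally show "env w ^ 3 \<le> ?X w" by (simp add: power_divide algebra_simps)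
    show "0 \<le> env w" using nn unfolding env_def by (intro add_nonneg_nonneg mult_nonneg_nonneg) auto
  qed
  have "mean_le N ?X (\<bar>16\<bar> * (\<bar>c ^ 3 * 4\<bar> * (q + 8 * q) + \<bar>1/8\<bar> * q + (4 / 8) * (q + 8 * q) + q))"
    using q_facts(6,8,11) a03 k0 q3 a0(1) q_pos
    by (intro mean_le_cmult mean_le_add N.mean_le_const) auto
  then show ?thesis
  proof (rule mean_le_mono)
    show "(\<lambda>w. env w ^ 3) \<in> borel_measurable N" unfolding meas_N by measurable
    show "\<bar>env w ^ 3\<bar> \<le> \<bar>?X w\<bar>" if "w \<in> space N" for w
      using that pt[of w] e0[of w] unfolding space_N by (intro order_trans[OF _ abs_ge_self]) simp
    have "q \<le> c ^ 3 * q" using c_powers q_pos by simp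
    show "\<bar>16\<bar> * (\<bar>c ^ 3 * 4\<bar> * (q + 8 * q) + \<bar>1/8\<bar> * q + (4 / 8) * (q + 8 * q) + q) \<le> 2000 * c ^ 3 * q"
    proof -
      have e: "\<bar>c ^ 3 * 4\<bar> = c ^ 3 * 4" using c by simp
      have "\<bar>16\<bar> * (\<bar>c ^ 3 * 4\<bar> * (q + 8 * q) + \<bar>1/8\<bar> * q + (4 / 8) * (q + 8 * q) + q) = 576 * (c ^ 3 * q) + 90 * q"
        unfolding e by (simp add: algebra_simps)
      moreover have "0 \<le> c ^ 3 * q" using c q_pos by simp
      ultimately show ?thesis using \<open>q \<le> c ^ 3 * q\<close> by (simp only: mult.assoc)
    qed
  qed
qed

lemma env_mean:
  shows "mean_le N env (\<bar>c\<bar> * (2 * \<kappa> + 2 * \<kappa>\<^sup>2) + \<kappa> + \<kappa> + 2 * \<kappa> + q)"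
proof -
  have "mean_le N (\<lambda>w. c * (u w + a0) + (1/2) * v w + k0 / 2 + \<rho> w + q) (\<bar>c\<bar> * (2 * \<kappa> + 2 * \<kappa>\<^sup>2) + \<bar>1/2\<bar> * (2 * \<kappa>) + \<kappa> + 2 * \<kappa> + q)"
    using k0 a0 q_pos by (intro mean_le_cmult mean_le_add N_lower N.mean_le_const) auto
  then show ?thesis unfolding env_def by simp
qed

lemma env_mean_large:
  assumes "1 \<le> \<kappa>"
  shows "mean_le N env (9 * c * q)"
proof (rule mean_le_mono[OF env_mean])
  have k: "\<kappa> \<le> q" "\<kappa>\<^sup>2 \<le> q" using power_increasing[of 1 3 \<kappa>] power_increasing[of 2 3 \<kappa>] assms by (auto simp: \<kappa>3)
  have "\<bar>c\<bar> * (2 * \<kappa> + 2 * \<kappa>\<^sup>2) \<le> c * (4 * q)" using c k by (simp add: mult_left_mono)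
  moreover have "q \<le> c * q" using c q_pos by simp
  ultimately show "\<bar>c\<bar> * (2 * \<kappa> + 2 * \<kappa>\<^sup>2) + \<kappa> + \<kappa> + 2 * \<kappa> + q \<le> 9 * c * q" using k by simp
qed (auto simp: meas_N)

lemma Sg_le:
  assumes h: "h \<in> S" "norm h \<le> c * r" and g: "g \<in> S" "norm g \<le> c * r"
  shows "\<bar>blinfun_apply Sg h \<bullet> g\<bar> \<le> 2 * c\<^sup>2 * \<kappa>\<^sup>2"
proof -
  have "\<bar>\<integral>w. (U w \<bullet> h) * (U w \<bullet> g) \<partial>N0\<bar> \<le> \<bar>1/2\<bar> * (2 * c\<^sup>2 * \<kappa>\<^sup>2 + 2 * c\<^sup>2 * \<kappa>\<^sup>2)"
  proof (rule mean_le_abs_integral, rule mean_le_mono[OF mean_le_cmult[OF mean_le_add[OF inner_U_mean_le(6)[OF h(2)] inner_U_mean_le(6)[OF g(2)]]]])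
    show "\<bar>(U w \<bullet> h) * (U w \<bullet> g)\<bar> \<le> \<bar>(1/2) * ((U w \<bullet> h)\<^sup>2 + (U w \<bullet> g)\<^sup>2)\<bar>" for w
      using sum_squares_bound[of "\<bar>U w \<bullet> h\<bar>" "\<bar>U w \<bullet> g\<bar>"] by (simp add: abs_mult)
  qed auto
  then show ?thesis by (simp add: Sg[OF h(1) g(1)])
qed

lemma proc_mean:
  assumes t: "t \<in> T" and e: "e t \<in> S" "norm (e t) \<le> c * r" and \<tau>: "\<bar>\<tau>\<bar> \<le> 1"
  shows "\<bar>\<integral>w. proc \<tau> e t w \<partial>N\<bar> \<le> 2000 * c ^ 5 * \<gamma>"
proof -
  have i: "integrable N (\<lambda>w. (U w - \<alpha>) \<bullet> e t)" "integrable N (\<lambda>w. \<tau> * vt t w)"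
    using mean_le_integrable[OF inner_U_mean_le(4)[OF e(2)]] mean_le_integrable[OF vt_bounds(6)[OF t]]
    by (auto simp: inner_diff_left)
  have "\<bar>\<tau> * (\<integral>w. vt t w \<partial>N)\<bar> \<le> 1 * \<bar>\<integral>w. vt t w \<partial>N\<bar>" unfolding abs_mult by (rule mult_right_mono[OF \<tau>]) simp
  moreover have "(\<integral>w. proc \<tau> e t w \<partial>N) = (\<integral>w. (U w - \<alpha>) \<bullet> e t \<partial>N) + \<tau> * (\<integral>w. vt t w \<partial>N)"
    unfolding proc_def using i by simp
  ultimately have "\<bar>\<integral>w. proc \<tau> e t w \<partial>N\<bar> \<le> 25 * (c ^ 3 * \<gamma>) + 536 * (c * \<gamma>)"
    using mean_inner_U[OF e] mean_vt[OF t] by (simp add: mult.assoc)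
  also have "\<dots> \<le> 2000 * (c ^ 5 * \<gamma>)"
  proof -
    have "0 \<le> \<gamma>" using q_pos q_\<gamma> by linarith
    then have "c ^ 3 * \<gamma> \<le> c ^ 5 * \<gamma>" "c * \<gamma> \<le> c ^ 5 * \<gamma>" "0 \<le> c ^ 5 * \<gamma>" using c_powers c by (auto intro!: mult_right_mono)
    then show ?thesis by linarith
  qed
  finally show ?thesis by (simp add: mult.assoc)
qed

text \<open>Under the null law the linear parts have covariance \<open>\<langle>\<Sigma> e(t), e'(t')\<rangle>\<close> by the definition of \<open>\<Sigma>\<close>. The
change of measure, the shift by \<open>\<alpha>\<close> and all products that contain \<open>vt\<close> are of third order; the shifts need
\<open>\<kappa> \<le> 1\<close>, since their product is of order \<open>\<kappa>\<^sup>4\<close>.\<close>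

lemma proc_cov:
  assumes \<kappa>: "\<kappa> \<le> 1" and t: "t \<in> T" and e: "e t \<in> S" "norm (e t) \<le> c * r" and \<tau>: "\<bar>\<tau>\<bar> \<le> 1"
    and t': "t' \<in> T" and e': "e' t' \<in> S" "norm (e' t') \<le> c * r" and \<tau>': "\<bar>\<tau>'\<bar> \<le> 1"
  shows "\<bar>(\<integral>w. proc \<tau> e t w * proc \<tau>' e' t' w \<partial>N) - blinfun_apply Sg (e t) \<bullet> e' t'\<bar> \<le> 2000 * c ^ 5 * \<gamma>"
proof -
  note v = vt_bounds[OF t] and v' = vt_bounds[OF t']
  note [measurable] = v(1) v'(1)
  note m = inner_U_mean_le[OF e(2)] and m' = inner_U_mean_le[OF e'(2)]
  define a where "a = \<alpha> \<bullet> e t"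
  define a' where "a' = \<alpha> \<bullet> e' t'"
  let ?u = "\<lambda>w. U w \<bullet> e t" and ?u' = "\<lambda>w. U w \<bullet> e' t'"
  have a: "\<bar>a\<bar> \<le> 2 * c * \<kappa>\<^sup>2" "\<bar>a'\<bar> \<le> 2 * c * \<kappa>\<^sup>2"
    unfolding a_def a'_def by (rule inner_\<alpha>_le'[OF e] inner_\<alpha>_le'[OF e'])+
  have c4: "(c\<^sup>2 * r) * (c\<^sup>2 * r) = c ^ 4 * r\<^sup>2" by (simp add: eval_nat_numeral)
  have uu0: "mean_le N0 (\<lambda>w. ?u w * ?u' w) ((c\<^sup>2 * r) * (c\<^sup>2 * r))"
    using c r by (intro mean_le_mult m m') auto
  have uu: "mean_le N (\<lambda>w. ?u w * ?u' w) ((c\<^sup>2 * r) * (c\<^sup>2 * r) + 4 * (q + c ^ 3 * q + c ^ 3 * q))"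
    and uud: "\<bar>(\<integral>w. ?u w * ?u' w \<partial>N) - (\<integral>w. ?u w * ?u' w \<partial>N0)\<bar> \<le> 4 * (q + c ^ 3 * q + c ^ 3 * q)"
    using mean_change_crude[OF m(1,2) _ m'(1,2) _ uu0] by (auto simp: q_def)
  have vu: "mean_le N (\<lambda>w. vt t w * ?u' w) ((4 * (r * D)) * (c\<^sup>2 * r) + 4 * (q + 64 * q + c ^ 3 * q))"
    using mean_change_crude(1)[OF v(3,4) v(1) m'(1,2) _ mean_le_mult[OF v(5) m'(3)]] r D by (simp add: q_def)
  have uv: "mean_le N (\<lambda>w. vt t' w * ?u w) ((4 * (r * D)) * (c\<^sup>2 * r) + 4 * (q + 64 * q + c ^ 3 * q))"
    using mean_change_crude(1)[OF v'(3,4) v'(1) m(1,2) _ mean_le_mult[OF v'(5) m(3)]] r D by (simp add: q_def)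
  have vv: "mean_le N (\<lambda>w. vt t w * vt t' w) ((4 * (r * D)) * (4 * (r * D)) + 4 * (q + 64 * q + 64 * q))"
    using mean_change_crude(1)[OF v(3,4) v(1) v'(3,4) v'(1) mean_le_mult[OF v(5) v'(5)]] r D by (simp add: q_def)
  have rest: "mean_le N (\<lambda>w. (- a) * ?u' w + (- a') * ?u w + a * a' + \<tau> * (vt t w * ?u' w) + (- (\<tau> * a')) * vt t w
      + \<tau>' * (vt t' w * ?u w) + (- (\<tau>' * a)) * vt t' w + (\<tau> * \<tau>') * (vt t w * vt t' w))
     (\<bar>-a\<bar> * (2 * c * \<kappa>) + \<bar>-a'\<bar> * (2 * c * \<kappa>) + \<bar>a * a'\<bar>
      + \<bar>\<tau>\<bar> * ((4 * (r * D)) * (c\<^sup>2 * r) + 4 * (q + 64 * q + c ^ 3 * q)) + \<bar>- (\<tau> * a')\<bar> * (65 * \<kappa>)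
      + \<bar>\<tau>'\<bar> * ((4 * (r * D)) * (c\<^sup>2 * r) + 4 * (q + 64 * q + c ^ 3 * q)) + \<bar>- (\<tau>' * a)\<bar> * (65 * \<kappa>)
      + \<bar>\<tau> * \<tau>'\<bar> * ((4 * (r * D)) * (4 * (r * D)) + 4 * (q + 64 * q + 64 * q)))" (is "mean_le N ?f ?B")
    by (intro mean_le_add mean_le_cmult m(4) m'(4) v(6) v'(6) vu uv vv N.mean_le_const) auto
  have split: "proc \<tau> e t w * proc \<tau>' e' t' w = ?u w * ?u' w + ?f w" for w
    unfolding proc_def inner_diff_left a_def[symmetric] a'_def[symmetric] by (simp add: algebra_simps)
  have "\<bar>(\<integral>w. proc \<tau> e t w * proc \<tau>' e' t' w \<partial>N) - blinfun_apply Sg (e t) \<bullet> e' t'\<bar>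
      \<le> 4 * (q + c ^ 3 * q + c ^ 3 * q) + ?B"
  proof -
    have eq: "(\<integral>w. proc \<tau> e t w * proc \<tau>' e' t' w \<partial>N) = (\<integral>w. ?u w * ?u' w \<partial>N) + (\<integral>w. ?f w \<partial>N)"
      unfolding split by (rule Bochner_Integration.integral_add[OF mean_le_integrable[OF uu] mean_le_integrable[OF rest]])
    have tri: "\<bar>x + y - z'\<bar> \<le> \<bar>x - z'\<bar> + \<bar>y\<bar>" for x y z' :: real by linarith
    show ?thesis
      unfolding Sg[OF e(1) e'(1)] eq by (rule order_trans[OF tri add_mono[OF uud mean_le_abs_integral[OF rest]]])
  qed
  also have "\<dots> \<le> 2000 * (c ^ 5 * \<gamma>)"
  proof -
    define G where "G = c ^ 5 * \<gamma>"
    have qG: "c ^ 3 * q \<le> G" "q \<le> G" "c\<^sup>2 * q \<le> G" "c * q \<le> G" "0 \<le> G"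
    proof -
      have 0: "0 \<le> \<gamma>" using q_pos q_\<gamma> by linarith
      have "c ^ 3 * q \<le> c ^ 5 * \<gamma>" using c_powers q_\<gamma> q_pos c by (intro mult_mono) auto
      moreover have "x * q \<le> c ^ 3 * q" if "x \<le> c ^ 3" for x using that q_pos by simp
      ultimately show "c ^ 3 * q \<le> G" "q \<le> G" "c\<^sup>2 * q \<le> G" "c * q \<le> G"
        using c_powers by (auto simp: G_def intro: order_trans) (metis dual_order.trans mult_1)
      show "0 \<le> G" using 0 c by (simp add: G_def)
    qed
    have absorb: "\<bar>\<sigma>\<bar> * L \<le> M" if "\<bar>\<sigma>\<bar> \<le> 1" "0 \<le> L" "L \<le> M" for \<sigma> L M :: real
      using mult_left_le_one_le[of L "\<bar>\<sigma>\<bar>"] that by linarith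
    have rD: "(r * D) * r = q" by (simp add: q_def power2_eq_square)
    have k3: "\<kappa>\<^sup>2 * \<kappa> = q" using \<kappa>3 by (simp add: power2_eq_square power3_eq_cube)
    have t1: "\<bar>x\<bar> * (2 * c * \<kappa>) \<le> 4 * G" if "\<bar>x\<bar> \<le> 2 * c * \<kappa>\<^sup>2" for x
    proof -
      have "\<bar>x\<bar> * (2 * c * \<kappa>) \<le> (2 * c * \<kappa>\<^sup>2) * (2 * c * \<kappa>)" using that c \<kappa>_pos by (intro mult_right_mono) auto
      also have "\<dots> = 4 * (c\<^sup>2 * (\<kappa>\<^sup>2 * \<kappa>))" by (simp add: power2_eq_square)
      finally show ?thesis using qG unfolding k3 by linarith
    qed
    have t2: "\<bar>a * a'\<bar> \<le> 4 * G"
    proof -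
      have "\<bar>a\<bar> * \<bar>a'\<bar> \<le> (2 * c * \<kappa>\<^sup>2) * (2 * c * \<kappa>\<^sup>2)" using a c by (intro mult_mono) auto
      also have "\<dots> = 4 * c\<^sup>2 * ((\<kappa>\<^sup>2 * \<kappa>) * \<kappa>)" by (simp add: power2_eq_square)
      also have "\<dots> = 4 * (c\<^sup>2 * q) * \<kappa>" using k3 by simp
      also have "\<dots> \<le> 4 * (c\<^sup>2 * q) * 1" using \<kappa> c q_pos by (intro mult_left_mono) auto
      finally show ?thesis using qG by (simp add: abs_mult)
    qed
    have t3: "\<bar>\<sigma>\<bar> * ((4 * (r * D)) * (c\<^sup>2 * r) + 4 * (q + 64 * q + c ^ 3 * q)) \<le> 268 * G" if "\<bar>\<sigma>\<bar> \<le> 1" for \<sigma>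
    proof -
      have "(4 * (r * D)) * (c\<^sup>2 * r) = 4 * (c\<^sup>2 * ((r * D) * r))" by (simp only: mult_ac)
      then have "(4 * (r * D)) * (c\<^sup>2 * r) = 4 * (c\<^sup>2 * q)" unfolding rD .
      note eq = this
      have "(4 * (r * D)) * (c\<^sup>2 * r) + 4 * (q + 64 * q + c ^ 3 * q) \<le> 268 * G"
      proof -
        have "4 * x + 4 * (y + 64 * y + w) \<le> 268 * G" if "x \<le> G" "y \<le> G" "w \<le> G" for x y w using that by simp
        then show ?thesis unfolding eq using qG by blast
      qed
      moreover have "0 \<le> (4 * (r * D)) * (c\<^sup>2 * r) + 4 * (q + 64 * q + c ^ 3 * q)" using r D q_pos c by simp
      ultimately show ?thesis using absorb[OF that] by blast
    qed
    have t4: "\<bar>- (\<sigma> * x)\<bar> * (65 * \<kappa>) \<le> 130 * G" if "\<bar>\<sigma>\<bar> \<le> 1" "\<bar>x\<bar> \<le> 2 * c * \<kappa>\<^sup>2" for \<sigma> x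
    proof -
      have "\<bar>\<sigma>\<bar> * \<bar>x\<bar> \<le> 1 * (2 * c * \<kappa>\<^sup>2)" using that by (intro mult_mono) auto
      then have "\<bar>- (\<sigma> * x)\<bar> * (65 * \<kappa>) \<le> (2 * c * \<kappa>\<^sup>2) * (65 * \<kappa>)" using \<kappa>_pos by (intro mult_right_mono) (auto simp: abs_mult)
      also have "\<dots> = 130 * (c * (\<kappa>\<^sup>2 * \<kappa>))" by simp
      finally show ?thesis using qG unfolding k3 by linarith
    qed
    have t5: "\<bar>\<tau> * \<tau>'\<bar> * ((4 * (r * D)) * (4 * (r * D)) + 4 * (q + 64 * q + 64 * q)) \<le> 532 * G"
    proof -
      have "(r * D) * (r * D) \<le> \<gamma>" using r D by (simp add: \<gamma>_def power2_eq_square algebra_simps)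
      also have "\<gamma> \<le> G" using c_powers q_\<gamma> q_pos unfolding G_def by (auto simp: mult_le_cancel_right1)
      finally have rD2: "(r * D) * (r * D) \<le> G" .
      have le: "(4 * (r * D)) * (4 * (r * D)) + 4 * (q + 64 * q + 64 * q) \<le> 532 * G" (is "?L \<le> _") using rD2 qG by simp
      have "\<bar>\<tau> * \<tau>'\<bar> \<le> 1" using mult_mono[OF \<tau> \<tau>'] by (simp add: abs_mult)
      moreover have "0 \<le> ?L" using r D q_pos by simp
      ultimately show ?thesis using le absorb by blast
    qed
    have "?B \<le> 4 * G + 4 * G + 4 * G + 268 * G + 130 * G + 268 * G + 130 * G + 532 * G"
      using a by (intro add_mono t1 t2 t3[OF \<tau>] t3[OF \<tau>'] t4[OF \<tau>] t4[OF \<tau>'] t5) auto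
    moreover have "4 * (x + y + y) + b \<le> 2000 * G"
      if "b \<le> 4 * G + 4 * G + 4 * G + 268 * G + 130 * G + 268 * G + 130 * G + 532 * G" "x \<le> G" "y \<le> G" for x y b
      using that qG(5) by simp
    ultimately show ?thesis unfolding G_def[symmetric] using qG(1,2) by blast
  qed
  finally show ?thesis by (simp add: mult.assoc)
qed


definition "err = 5000 * (c ^ 5 * \<gamma>)"

lemma gamma_bounds: "0 \<le> \<gamma> * c ^ 5" "0 \<le> c ^ 5 * \<gamma>" "c ^ 3 * q \<le> c ^ 5 * \<gamma>" "c\<^sup>2 * q \<le> c ^ 5 * \<gamma>" "c * q \<le> c ^ 5 * \<gamma>" "c ^ 5 * q \<le> c ^ 5 * \<gamma>"
proof -
  have g: "0 \<le> \<gamma>" using q_pos q_\<gamma> by linarith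
  then show "0 \<le> c ^ 5 * \<gamma>" "0 \<le> \<gamma> * c ^ 5" using c by simp_all
  show 3: "c ^ 3 * q \<le> c ^ 5 * \<gamma>" using c_powers q_\<gamma> q_pos c by (intro mult_mono) auto
  have "c\<^sup>2 * q \<le> c ^ 3 * q" "c * q \<le> c ^ 3 * q" using c_powers q_pos by (auto intro: mult_right_mono)
  then show "c\<^sup>2 * q \<le> c ^ 5 * \<gamma>" "c * q \<le> c ^ 5 * \<gamma>" using 3 by linarith+
  show "c ^ 5 * q \<le> c ^ 5 * \<gamma>" using q_\<gamma> c by (intro mult_left_mono) auto
qed

text \<open>The admissible directions include the features \<open>\<eta>\<close> themselves and their perturbations by \<open>B\<close>.\<close>

definition directions_ok :: "('t \<Rightarrow> 'h) \<Rightarrow> bool" where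
  "directions_ok e \<longleftrightarrow> (\<forall>t\<in>T. e t \<in> S \<and> norm (e t) \<le> c * r)"

definition cov_kernel :: "('t \<Rightarrow> 'h) \<Rightarrow> ('t \<Rightarrow> 'h) \<Rightarrow> 't \<Rightarrow> 't \<Rightarrow> real" where
  "cov_kernel e e' s t = blinfun_apply Sg (e s) \<bullet> e' t"

lemma cov_kernel_bdkernel:
  assumes mu: "space \<mu> = T" and e: "directions_ok e" "directions_ok e'"
    and em: "e \<in> borel_measurable \<mu>" "e' \<in> borel_measurable \<mu>"
  shows "bdkernel \<mu> (2 * c\<^sup>2 * \<kappa>\<^sup>2) (cov_kernel e e')"
  unfolding bdkernel_def
proof (rule bdmeasI)
  note [measurable] = em
  have [measurable]: "blinfun_apply Sg \<in> borel_measurable borel"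
    by (intro borel_measurable_continuous_onI linear_continuous_on blinfun.bounded_linear_right)
  show "(\<lambda>(s, t). cov_kernel e e' s t) \<in> borel_measurable (\<mu> \<Otimes>\<^sub>M \<mu>)"
    unfolding cov_kernel_def by measurable
  fix p assume "p \<in> space (\<mu> \<Otimes>\<^sub>M \<mu>)"
  then show "\<bar>case p of (s, t) \<Rightarrow> cov_kernel e e' s t\<bar> \<le> 2 * c\<^sup>2 * \<kappa>\<^sup>2"
    using e mu by (auto simp: space_pair_measure cov_kernel_def directions_ok_def intro!: Sg_le)
qed

lemma kernel_bound_large: "1 \<le> \<kappa> \<Longrightarrow> 2 * c\<^sup>2 * \<kappa>\<^sup>2 \<le> err"
proof -
  assume k: "1 \<le> \<kappa>"
  have "\<kappa>\<^sup>2 \<le> q" using power_increasing[of 2 3 \<kappa>] k by (simp add: \<kappa>3)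
  then have "c\<^sup>2 * \<kappa>\<^sup>2 \<le> c\<^sup>2 * q" by (rule mult_left_mono) simp
  then show ?thesis using gamma_bounds unfolding err_def by linarith
qed

lemma bdkernel_mono: "bdkernel \<mu> B h \<Longrightarrow> B \<le> B' \<Longrightarrow> bdkernel \<mu> B' h"
  unfolding bdkernel_def bdmeas_def by (auto intro: order_trans)

text \<open>Common to the likelihood field and the Gaussian field. For \<open>\<kappa> \<le> 1\<close> the second-order expansion applies;
for \<open>\<kappa> \<ge> 1\<close> the powers of \<open>\<kappa>\<close> that bound first moments and kernels are below \<open>\<kappa>\<^sup>3 = q\<close>, and the crude
bound suffices.\<close>

lemma logint_component:
  fixes P :: "'x measure"
  assumes mu: "prob_space \<mu>" "space \<mu> = T" and P: "prob_space P"
    and x: "dom_field \<mu> P W x" and e: "directions_ok e" "e \<in> borel_measurable \<mu>"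
    and W3: "\<kappa> \<le> 1 \<Longrightarrow> mean_le P (\<lambda>w. W w ^ 3) (2000 * c ^ 3 * q)"
    and W1: "1 \<le> \<kappa> \<Longrightarrow> mean_le P W (14 * c * q)"
    and mean: "\<And>t. t \<in> T \<Longrightarrow> \<bar>\<integral>w. x t w \<partial>P\<bar> \<le> 2000 * c ^ 5 * \<gamma>"
    and cov: "\<And>s t. \<kappa> \<le> 1 \<Longrightarrow> s \<in> T \<Longrightarrow> t \<in> T \<Longrightarrow> \<bar>(\<integral>w. x s w * x t w \<partial>P) - cov_kernel e e s t\<bar> \<le> 2000 * c ^ 5 * \<gamma>"
  shows "\<bar>(\<integral>w. logint \<mu> (\<lambda>t. x t w) \<partial>P) - diag_excess \<mu> (cov_kernel e e) / 2\<bar> \<le> 210 * err"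
proof -
  interpret tp: two_probs \<mu> P using mu P by (simp add: two_probs_def)
  have k: "bdkernel \<mu> (2 * c\<^sup>2 * \<kappa>\<^sup>2) (cov_kernel e e)"
    by (rule cov_kernel_bdkernel[OF mu(2) e(1) e(1) e(2) e(2)])
  have err: "2000 * c ^ 5 * \<gamma> \<le> err" "2000 * c ^ 3 * q \<le> err" "14 * c * q \<le> err" "0 \<le> err"
    using gamma_bounds unfolding err_def by (simp_all only: mult.assoc)
  show ?thesis
  proof (cases "\<kappa> \<le> 1")
    case True
    show ?thesis
      using mean cov[OF True] mean_le_integral[OF W3[OF True]] err mu(2)
      by (intro tp.logint_average_expansion[OF x mean_le_integrable[OF W3[OF True]] _ k])
        (auto intro: order_trans)
  next
    case False
    then have K: "1 \<le> \<kappa>" by simp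
    have "\<bar>(\<integral>w. logint \<mu> (\<lambda>t. x t w) \<partial>P) - diag_excess \<mu> (cov_kernel e e) / 2\<bar> \<le> 2 * err"
      using mean_le_integral[OF W1[OF K]] err
      by (intro tp.logint_average_crude[OF x mean_le_integrable[OF W1[OF K]] _ bdkernel_mono[OF k kernel_bound_large[OF K]]]) auto
    then show ?thesis using err by linarith
  qed
qed

lemma gibbs_component:
  fixes P :: "'x measure"
  assumes mu: "prob_space \<mu>" "space \<mu> = T" and P: "prob_space P"
    and x: "dom_field \<mu> P W x" and y: "dom_field \<mu> P W y"
    and e: "directions_ok e" "e \<in> borel_measurable \<mu>" and e': "directions_ok e'" "e' \<in> borel_measurable \<mu>"
    and W3: "\<kappa> \<le> 1 \<Longrightarrow> mean_le P (\<lambda>w. W w ^ 3) (2000 * c ^ 3 * q)"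
    and W1: "1 \<le> \<kappa> \<Longrightarrow> mean_le P W (14 * c * q)"
    and mean: "\<And>t. t \<in> T \<Longrightarrow> \<bar>\<integral>w. y t w \<partial>P\<bar> \<le> 2000 * c ^ 5 * \<gamma>"
    and cov: "\<And>s t. \<kappa> \<le> 1 \<Longrightarrow> s \<in> T \<Longrightarrow> t \<in> T \<Longrightarrow> \<bar>(\<integral>w. y s w * x t w \<partial>P) - cov_kernel e' e s t\<bar> \<le> 2000 * c ^ 5 * \<gamma>"
  shows "\<bar>(\<integral>w. (\<integral>t. y t w \<partial>gibbs \<mu> (\<lambda>t. x t w)) \<partial>P)
      - (\<integral>w. diag_excess (gibbs \<mu> (\<lambda>t. x t w)) (cov_kernel e' e) \<partial>P)\<bar> \<le> 210 * err"
proof -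
  interpret tp: two_probs \<mu> P using mu P by (simp add: two_probs_def)
  have k: "bdkernel \<mu> (2 * c\<^sup>2 * \<kappa>\<^sup>2) (cov_kernel e' e)"
    by (rule cov_kernel_bdkernel[OF mu(2) e'(1) e(1) e'(2) e(2)])
  have err: "2000 * c ^ 5 * \<gamma> \<le> err" "2000 * c ^ 3 * q \<le> err" "14 * c * q \<le> err" "0 \<le> err"
    using gamma_bounds unfolding err_def by (simp_all only: mult.assoc)
  show ?thesis
  proof (cases "\<kappa> \<le> 1")
    case True
    note W3 = W3[OF True]
    have cube: "W w * (W w)\<^sup>2 = W w ^ 3" for w by (simp add: power2_eq_square power3_eq_cube)
    have "mean_le P W ((1 + 2000 * c ^ 3) * \<kappa>)"
      using W3 dom_field_W[OF x] tp.dom_field_nonneg[OF x] \<kappa>_pos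
      by (intro prob_space.mean_le_of_cube(1)[OF P]) (auto simp: \<kappa>3)
    then have "2 * c\<^sup>2 * \<kappa>\<^sup>2 * (\<integral>w. W w \<partial>P) \<le> 2 * c\<^sup>2 * \<kappa>\<^sup>2 * ((1 + 2000 * c ^ 3) * \<kappa>)"
      by (intro mult_left_mono mean_le_integral) auto
    also have "\<dots> = 2 * (c\<^sup>2 * (\<kappa> ^ 3)) + 4000 * (c ^ 5 * \<kappa> ^ 3)"
      by (simp add: eval_nat_numeral algebra_simps)
    also have "\<dots> \<le> err" using gamma_bounds unfolding err_def \<kappa>3 by linarith
    finally have BW: "2 * c\<^sup>2 * \<kappa>\<^sup>2 * (\<integral>w. W w \<partial>P) \<le> err" .
    have "\<bar>(\<integral>w. (\<integral>t. y t w \<partial>gibbs \<mu> (\<lambda>t. x t w)) \<partial>P)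
      - (\<integral>w. diag_excess (gibbs \<mu> (\<lambda>t. x t w)) (cov_kernel e' e) \<partial>P)\<bar> \<le> 143 * err"
      using mean cov[OF True] mean_le_integral[OF W3] mean_le_integrable[OF W3] err mu(2) BW
      by (intro tp.gibbs_average_expansion[OF x y k]) (auto simp: cube intro: order_trans)
    then show ?thesis using err by linarith
  next
    case False
    then have K: "1 \<le> \<kappa>" by simp
    have "\<bar>(\<integral>w. (\<integral>t. y t w \<partial>gibbs \<mu> (\<lambda>t. x t w)) \<partial>P)
      - (\<integral>w. diag_excess (gibbs \<mu> (\<lambda>t. x t w)) (cov_kernel e' e) \<partial>P)\<bar> \<le> 3 * err"
      using mean_le_integral[OF W1[OF K]] err
      by (intro tp.gibbs_average_crude[OF x y bdkernel_mono[OF k kernel_bound_large[OF K]] mean_le_integrable[OF W1[OF K]]]) auto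
    then show ?thesis using err by linarith
  qed
qed

lemma proc_field:
  assumes mu: "space \<mu> = T" and e: "directions_ok e" and \<tau>: "\<bar>\<tau>\<bar> \<le> 1"
    and m: "(\<lambda>(t, w). proc \<tau> e t w) \<in> borel_measurable (\<mu> \<Otimes>\<^sub>M N)"
  shows "dom_field \<mu> N env (proc \<tau> e)"
  unfolding dom_field_def
  using m e mu proc_le_env[OF _ _ _ \<tau>] by (auto simp: meas_N space_N directions_ok_def)

lemma env_moments:
  "\<kappa> \<le> 1 \<Longrightarrow> mean_le N (\<lambda>w. env w ^ 3) (2000 * c ^ 3 * q)"
  "1 \<le> \<kappa> \<Longrightarrow> mean_le N env (14 * c * q)"
proof -
  show "\<kappa> \<le> 1 \<Longrightarrow> mean_le N (\<lambda>w. env w ^ 3) (2000 * c ^ 3 * q)" by (rule env_cube)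
  show "mean_le N env (14 * c * q)" if "1 \<le> \<kappa>"
    using env_mean_large[OF that] c q_pos by (rule_tac mean_le_mono[OF env_mean_large[OF that]]) (auto simp: meas_N)
qed

lemma env_integrable: "integrable N env"
  using mean_le_integrable[OF env_mean] .

lemma logint_proc:
  assumes mu: "prob_space \<mu>" "space \<mu> = T" and e: "directions_ok e" "e \<in> borel_measurable \<mu>"
    and m: "(\<lambda>(t, w). proc 1 e t w) \<in> borel_measurable (\<mu> \<Otimes>\<^sub>M N)"
  shows "\<bar>(\<integral>w. logint \<mu> (\<lambda>t. proc 1 e t w) \<partial>N) - diag_excess \<mu> (cov_kernel e e) / 2\<bar> \<le> 210 * err"
  using e by (intro logint_component[OF mu N.prob_space_axioms proc_field[OF mu(2) e(1) _ m] e env_moments])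
    (auto simp: cov_kernel_def directions_ok_def intro!: proc_mean proc_cov)

lemma gibbs_proc:
  assumes mu: "prob_space \<mu>" "space \<mu> = T" and e: "directions_ok e" "e \<in> borel_measurable \<mu>"
    and e': "directions_ok e'" "e' \<in> borel_measurable \<mu>"
    and m: "(\<lambda>(t, w). proc 1 e t w) \<in> borel_measurable (\<mu> \<Otimes>\<^sub>M N)"
    and m': "(\<lambda>(t, w). proc 0 e' t w) \<in> borel_measurable (\<mu> \<Otimes>\<^sub>M N)"
  shows "\<bar>(\<integral>w. (\<integral>t. proc 0 e' t w \<partial>gibbs \<mu> (\<lambda>t. proc 1 e t w)) \<partial>N)
      - (\<integral>w. diag_excess (gibbs \<mu> (\<lambda>t. proc 1 e t w)) (cov_kernel e' e) \<partial>N)\<bar> \<le> 210 * err"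
  using e e' by (intro gibbs_component[OF mu N.prob_space_axioms proc_field[OF mu(2) e(1) _ m] proc_field[OF mu(2) e'(1) _ m'] e e' env_moments])
    (auto simp: cov_kernel_def directions_ok_def intro!: proc_mean proc_cov)

definition genv :: "'h \<Rightarrow> real" where "genv y = c * (r * norm y)"

context
  fixes G :: "'h measure"
  assumes G: "prob_space G" and GX: "(\<lambda>y. y) \<in> borel_measurable G" and GS: "space G \<subseteq> S"
    and law: "\<And>h. h \<in> S \<Longrightarrow> distr G borel (\<lambda>y. y \<bullet> h) = real_gaussian (blinfun_apply Sg h \<bullet> h)"
begin

interpretation G: prob_space G by (rule G)

lemma Sg_sq: "h \<in> S \<Longrightarrow> blinfun_apply Sg h \<bullet> h = (\<integral>w. (U w \<bullet> h)\<^sup>2 \<partial>N0)"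
  by (simp add: Sg power2_eq_square)

lemma Sg_nonneg: "h \<in> S \<Longrightarrow> 0 \<le> blinfun_apply Sg h \<bullet> h"
  by (simp add: Sg_sq)

lemma gauss_inner_meas[measurable]: "(\<lambda>y. y \<bullet> h) \<in> borel_measurable G"
  using GX by measurable

lemma gauss_moments:
  assumes h: "h \<in> S"
  shows "integrable G (\<lambda>y. y \<bullet> h)" "integrable G (\<lambda>y. (y \<bullet> h)\<^sup>2)" "(\<integral>y. y \<bullet> h \<partial>G) = 0" "(\<integral>y. (y \<bullet> h)\<^sup>2 \<partial>G) = blinfun_apply Sg h \<bullet> h"
proof -
  note rg = real_gaussian_moments[OF Sg_nonneg[OF h]]
  have i: "integrable G (\<lambda>y. (y \<bullet> h) ^ k)" for k
    using rg(1)[of k] unfolding law[OF h, symmetric] by (subst (asm) integrable_distr_eq) auto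
  show "integrable G (\<lambda>y. y \<bullet> h)" "integrable G (\<lambda>y. (y \<bullet> h)\<^sup>2)" using i[of 1] i[of 2] by auto
  show "(\<integral>y. y \<bullet> h \<partial>G) = 0" using rg(2) unfolding law[OF h, symmetric] by (subst (asm) integral_distr) auto
  show "(\<integral>y. (y \<bullet> h)\<^sup>2 \<partial>G) = blinfun_apply Sg h \<bullet> h"
    using rg(3) unfolding law[OF h, symmetric] by (subst (asm) (1) integral_distr) (auto simp: law[OF h])
qed

text \<open>By polarization, since only the laws of single functionals are given.\<close>

lemma gauss_cov:
  assumes h: "h \<in> S" and g: "g \<in> S"
  shows "(\<integral>y. (y \<bullet> h) * (y \<bullet> g) \<partial>G) = blinfun_apply Sg h \<bullet> g"
proof -
  have hg: "h + g \<in> S" using S h g by (rule subspace_add)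
  have "(\<integral>y. (y \<bullet> h) * (y \<bullet> g) \<partial>G) = (\<integral>y. ((y \<bullet> (h + g))\<^sup>2 - (y \<bullet> h)\<^sup>2 - (y \<bullet> g)\<^sup>2) / 2 \<partial>G)"
    by (simp add: inner_add_right power2_eq_square algebra_simps)
  also have "\<dots> = (blinfun_apply Sg (h + g) \<bullet> (h + g) - blinfun_apply Sg h \<bullet> h - blinfun_apply Sg g \<bullet> g) / 2"
    using gauss_moments[OF hg] gauss_moments[OF h] gauss_moments[OF g] by simp
  also have "\<dots> = (blinfun_apply Sg h \<bullet> g + blinfun_apply Sg g \<bullet> h) / 2"
    by (simp add: blinfun.add_right inner_add_left inner_add_right)
  also have "blinfun_apply Sg g \<bullet> h = blinfun_apply Sg h \<bullet> g"
    by (simp add: Sg[OF h g] Sg[OF g h] mult.commute)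
  finally show ?thesis by simp
qed

lemma genv_meas: "genv \<in> borel_measurable G" 
  using GX unfolding genv_def[abs_def] by measurable

text \<open>The trace of \<open>Sg\<close> is the second moment of \<open>U\<close> under the null law, hence of order \<open>\<kappa>\<^sup>2 / r\<^sup>2\<close>; the fourth
moment of a Gaussian vector is controlled by the square of the trace, and the third by interpolation
at the scale \<open>\<kappa>\<close>.\<close>

lemma genv_moments:
  "mean_le G (\<lambda>y. genv y ^ 3) (13 * c ^ 3 * q)" "mean_le G genv (14 * c * \<kappa>)"
proof -
  note [measurable] = GX
  have U2': "(\<integral>\<^sup>+w. ennreal ((norm (U w))\<^sup>2) \<partial>N0) \<le> ennreal (2 * \<kappa>\<^sup>2 / r\<^sup>2)"
  proof -
    have "mean_le N0 (\<lambda>w. (1 / r\<^sup>2) * (u w)\<^sup>2) (\<bar>1 / r\<^sup>2\<bar> * (2 * \<kappa>\<^sup>2))" by (intro mean_le_cmult N0_lower)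
    then show ?thesis using r by (simp add: mean_le_def u_def power_mult_distrib)
  qed
  have "(\<integral>\<^sup>+y. ennreal (norm y ^ 4) \<partial>G) \<le> ennreal (3 * (2 * \<kappa>\<^sup>2 / r\<^sup>2)\<^sup>2)"
    using GS law r by (intro gaussian_norm_fourth_moment[OF S GX _ _ U_meas _ U2']) (auto simp: Sg_sq)
  then have "mean_le G (\<lambda>y. norm y ^ 4) (3 * (2 * \<kappa>\<^sup>2 / r\<^sup>2)\<^sup>2)" by (simp add: mean_le_def)
  then have 4: "mean_le G (\<lambda>y. r ^ 4 * norm y ^ 4) (\<bar>r ^ 4\<bar> * (3 * (2 * \<kappa>\<^sup>2 / r\<^sup>2)\<^sup>2))" by (rule mean_le_cmult)
  have "\<bar>r ^ 4\<bar> * (3 * (2 * \<kappa>\<^sup>2 / r\<^sup>2)\<^sup>2) = 12 * \<kappa> ^ 4"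
    using r by (simp add: power_divide power_mult_distrib power_mult[symmetric])
  then have 4: "mean_le G (\<lambda>y. r ^ 4 * norm y ^ 4) (12 * \<kappa> ^ 4)" using 4 by (simp only:)
  have m: "mean_le G (\<lambda>y. \<kappa> ^ 3 + (1 / \<kappa>) * (r ^ 4 * norm y ^ 4)) (\<kappa> ^ 3 + \<bar>1 / \<kappa>\<bar> * (12 * \<kappa> ^ 4))"
    using \<kappa>_pos by (intro mean_le_add mean_le_cmult 4 G.mean_le_const) auto
  have m3: "mean_le G (\<lambda>y. (r * norm y) ^ 3) (13 * \<kappa> ^ 3)"
  proof (rule mean_le_mono[OF m])
    fix y :: 'h
    define x where "x = r * norm y"
    have x: "0 \<le> x" using r by (simp add: x_def)
    have "x ^ 3 \<le> \<kappa> ^ 3 + (1 / \<kappa>) * x ^ 4"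
    proof (cases "x \<le> \<kappa>")
      case True
      then have "x ^ 3 \<le> \<kappa> ^ 3" using x by (intro power_mono)
      moreover have "0 \<le> (1 / \<kappa>) * x ^ 4" using x \<kappa>_pos by simp
      ultimately show ?thesis by linarith
    next
      case False
      then have "\<kappa> * x ^ 3 \<le> x * x ^ 3" using x by (intro mult_right_mono) auto
      then have "x ^ 3 \<le> (1 / \<kappa>) * x ^ 4" using \<kappa>_pos by (simp add: field_simps eval_nat_numeral)
      moreover have "0 \<le> \<kappa> ^ 3" using \<kappa>_pos by simp
      ultimately show ?thesis by linarith
    qed
    then show "\<bar>(r * norm y) ^ 3\<bar> \<le> \<bar>\<kappa> ^ 3 + (1 / \<kappa>) * (r ^ 4 * norm y ^ 4)\<bar>"
      using x r unfolding x_def power_mult_distrib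
      by (intro order_trans[OF _ abs_ge_self]) (simp add: abs_mult power_abs)
  next
    show "\<kappa> ^ 3 + \<bar>1 / \<kappa>\<bar> * (12 * \<kappa> ^ 4) \<le> 13 * \<kappa> ^ 3" using \<kappa>_pos by (simp add: field_simps eval_nat_numeral)
  qed measurable
  have "mean_le G (\<lambda>y. c ^ 3 * (r * norm y) ^ 3) (\<bar>c ^ 3\<bar> * (13 * \<kappa> ^ 3))" by (rule mean_le_cmult[OF m3])
  then show "mean_le G (\<lambda>y. genv y ^ 3) (13 * c ^ 3 * q)"
    using c by (simp add: genv_def power_mult_distrib \<kappa>3 mult_ac)
  have "mean_le G (\<lambda>y. r * norm y) ((1 + 13) * \<kappa>)"
    using r \<kappa>_pos by (intro G.mean_le_of_cube(1)[OF m3]) auto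
  then have "mean_le G (\<lambda>y. c * (r * norm y)) (\<bar>c\<bar> * ((1 + 13) * \<kappa>))" by (rule mean_le_cmult)
  then show "mean_le G genv (14 * c * \<kappa>)" using c by (simp add: genv_def[abs_def] mult_ac)
qed

lemma genv_integrable: "integrable G genv"
  by (rule mean_le_integrable[OF genv_moments(2)])

lemma genv_moments':
  "\<kappa> \<le> 1 \<Longrightarrow> mean_le G (\<lambda>w. genv w ^ 3) (2000 * c ^ 3 * q)"
  "1 \<le> \<kappa> \<Longrightarrow> mean_le G genv (14 * c * q)"
proof -
  have "13 * c ^ 3 * q \<le> 2000 * c ^ 3 * q" using c q_pos by simp
  then show "mean_le G (\<lambda>w. genv w ^ 3) (2000 * c ^ 3 * q)"
    using genv_meas by (intro mean_le_mono[OF genv_moments(1)]) auto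
  assume "1 \<le> \<kappa>"
  then have "\<kappa> \<le> q" using power_increasing[of 1 3 \<kappa>] by (simp add: \<kappa>3)
  then have "14 * c * \<kappa> \<le> 14 * c * q" using c by simp
  then show "mean_le G genv (14 * c * q)" using genv_meas by (intro mean_le_mono[OF genv_moments(2)]) auto
qed

lemma gauss_field:
  assumes mu: "space \<mu> = T" and e: "directions_ok e" and em[measurable]: "e \<in> borel_measurable \<mu>"
  shows "dom_field \<mu> G genv (\<lambda>t y. y \<bullet> e t)"
  unfolding dom_field_def
proof (intro conjI ballI genv_meas)
  note [measurable] = GX
  show "(\<lambda>(t, w). w \<bullet> e t) \<in> borel_measurable (\<mu> \<Otimes>\<^sub>M G)" by measurable
  fix t y assume "t \<in> space \<mu>" "y \<in> space G"
  then have "norm (e t) \<le> c * r" using e mu by (simp add: directions_ok_def)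
  then have "norm y * norm (e t) \<le> norm y * (c * r)" by (rule mult_left_mono) simp
  then show "\<bar>y \<bullet> e t\<bar> \<le> genv y" using Cauchy_Schwarz_ineq2[of y "e t"] by (simp add: genv_def mult_ac)
qed

lemma logint_gauss:
  assumes mu: "prob_space \<mu>" "space \<mu> = T" and e: "directions_ok e" "e \<in> borel_measurable \<mu>"
  shows "\<bar>(\<integral>y. logint \<mu> (\<lambda>t. y \<bullet> e t) \<partial>G) - diag_excess \<mu> (cov_kernel e e) / 2\<bar> \<le> 210 * err"
  using e gamma_bounds by (intro logint_component[OF mu G gauss_field[OF mu(2) e] e genv_moments'])
    (auto simp: cov_kernel_def directions_ok_def gauss_moments gauss_cov)

lemma gibbs_gauss:
  assumes mu: "prob_space \<mu>" "space \<mu> = T" and e: "directions_ok e" "e \<in> borel_measurable \<mu>"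
    and e': "directions_ok e'" "e' \<in> borel_measurable \<mu>"
  shows "\<bar>(\<integral>y. (\<integral>t. y \<bullet> e' t \<partial>gibbs \<mu> (\<lambda>t. y \<bullet> e t)) \<partial>G)
      - (\<integral>y. diag_excess (gibbs \<mu> (\<lambda>t. y \<bullet> e t)) (cov_kernel e' e) \<partial>G)\<bar> \<le> 210 * err"
  using e e' gamma_bounds by (intro gibbs_component[OF mu G gauss_field[OF mu(2) e] gauss_field[OF mu(2) e'] e e' genv_moments'])
    (auto simp: cov_kernel_def directions_ok_def gauss_moments gauss_cov)

end

end

section \<open>Measurability on compact parameter spaces and of random operators\<close>

lemma openin_in_borel_of: "openin X W \<Longrightarrow> W \<in> sets (borel_of X)"
  unfolding borel_of_def by (subst sets_measure_of) (auto dest: openin_subset)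

lemma continuous_map_borel_measurable:
  fixes f :: "'p \<Rightarrow> 'h::topological_space"
  assumes f: "continuous_map X euclidean f" and sp: "space \<pi> = topspace X" and se: "sets \<pi> = sets (borel_of X)"
  shows "f \<in> borel_measurable \<pi>"
proof (rule borel_measurableI)
  fix U :: "'h set" assume "open U"
  then have "openin X {x \<in> topspace X. f x \<in> U}" using f by (simp add: continuous_map_def)
  moreover have "f -` U \<inter> space \<pi> = {x \<in> topspace X. f x \<in> U}" using sp by auto
  ultimately show "f -` U \<inter> space \<pi> \<in> sets \<pi>" using se openin_in_borel_of by simp
qed

text \<open>A function that is continuous in \<open>t\<close> and measurable in \<open>w\<close> is a pointwise limit of functions that are
constant in \<open>t\<close> on the cells of finite partitions. The partitions come from total boundedness: the cell
of \<open>t\<close> is given by the first member of a finite \<open>1 / Suc n\<close>-net that is closer than \<open>1 / Suc n\<close>.\<close>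

lemma caratheodory_measurable:
  fixes f :: "'p \<Rightarrow> 'w \<Rightarrow> real"
  assumes X: "compact_space X" "metrizable_space X" and sp: "space \<pi> = topspace X" and se: "sets \<pi> = sets (borel_of X)"
    and cont: "\<And>w. w \<in> space N \<Longrightarrow> continuous_map X euclidean (\<lambda>t. f t w)"
    and meas: "\<And>t. t \<in> topspace X \<Longrightarrow> f t \<in> borel_measurable N"
  shows "(\<lambda>(t, w). f t w) \<in> borel_measurable (\<pi> \<Otimes>\<^sub>M N)"
proof -
  obtain M d where "Metric_space M d" and Xd: "X = Metric_space.mtopology M d"
    using X(2) unfolding metrizable_space_def by blast
  then interpret Metric_space M d by simp
  have M: "M = topspace X" by (simp add: Xd)
  have "mtotally_bounded M"
    using X(1) unfolding Xd compact_space_def by (simp add: compactin_imp_mtotally_bounded)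
  then have "\<exists>K. finite K \<and> K \<subseteq> M \<and> M \<subseteq> (\<Union>x\<in>K. mball x (1 / Suc n))" for n
    unfolding mtotally_bounded_def by simp
  then obtain K where K: "\<And>n. finite (K n)" "\<And>n. K n \<subseteq> M" "\<And>n. M \<subseteq> (\<Union>x\<in>K n. mball x (1 / Suc n))" by metis
  have "\<exists>xs. set xs = K n" for n using K(1) by (rule finite_list)
  then obtain xs where xs: "\<And>n. set (xs n) = K n" by metis
  define A where "A = (\<lambda>n i. mball (xs n ! i) (1 / Suc n) - (\<Union>j<i. mball (xs n ! j) (1 / Suc n)))"
  have Am[measurable]: "A n i \<in> sets \<pi>" for n i
  proof -
    have "mball c r \<in> sets \<pi>" for c r unfolding se by (rule openin_in_borel_of) (simp add: Xd)
    then show ?thesis unfolding A_def by auto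
  qed
  define g where "g = (\<lambda>n t w. \<Sum>i<length (xs n). indicator (A n i) t * f (xs n ! i) w)"
  have gval: "\<exists>c\<in>M. d c t < 1 / Suc n \<and> (\<forall>w. g n t w = f c w)" if t: "t \<in> M" for n t
  proof -
    have "\<exists>i<length (xs n). t \<in> mball (xs n ! i) (1 / Suc n)"
    proof -
      obtain c where "c \<in> set (xs n)" "t \<in> mball c (1 / Suc n)" using K(3)[of n] t unfolding xs[symmetric] by blast
      then show ?thesis by (metis in_set_conv_nth)
    qed
    then have ex: "\<exists>i. i < length (xs n) \<and> t \<in> mball (xs n ! i) (1 / Suc n)" by blast
    define i where "i = (LEAST i. i < length (xs n) \<and> t \<in> mball (xs n ! i) (1 / Suc n))"
    have i: "i < length (xs n)" "t \<in> mball (xs n ! i) (1 / Suc n)"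
      using LeastI_ex[OF ex] unfolding i_def by auto
    have least: "t \<notin> mball (xs n ! j) (1 / Suc n)" if "j < i" for j
      using not_less_Least[of j "\<lambda>i. i < length (xs n) \<and> t \<in> mball (xs n ! i) (1 / Suc n)"] that i(1)
      unfolding i_def[symmetric] by (meson less_trans)
    have ind: "indicator (A n j) t = (if j = i then 1 else 0 :: real)" if j: "j < length (xs n)" for j
    proof (cases j i rule: linorder_cases)
      case less then show ?thesis using least by (auto simp: A_def indicator_def)
    next
      case equal then show ?thesis using i least unfolding A_def indicator_def by fastforce
    next
      case greater then show ?thesis using i unfolding A_def indicator_def by fastforce
    qed
    have "g n t w = f (xs n ! i) w" for w
    proof -
      have "g n t w = (\<Sum>j<length (xs n). if j = i then f (xs n ! i) w else 0)"
        unfolding g_def by (rule sum.cong) (auto simp: ind)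
      then show ?thesis using i(1) by simp
    qed
    then show ?thesis using i(2) by (intro bexI[of _ "xs n ! i"]) auto
  qed
  have "(\<lambda>p. f (fst p) (snd p)) \<in> borel_measurable (\<pi> \<Otimes>\<^sub>M N)"
  proof (rule borel_measurable_LIMSEQ_real)
    fix n
    have "f (xs n ! i) \<in> borel_measurable N" if "i < length (xs n)" for i
      using K(2)[of n] xs[of n] that by (intro meas) (auto simp flip: M)
    then have "(\<lambda>p. indicator (A n i) (fst p) * f (xs n ! i) (snd p)) \<in> borel_measurable (\<pi> \<Otimes>\<^sub>M N)" if "i < length (xs n)" for i
      using that by measurable
    then show "(\<lambda>p. g n (fst p) (snd p)) \<in> borel_measurable (\<pi> \<Otimes>\<^sub>M N)"
      unfolding g_def by (intro borel_measurable_sum) auto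
  next
    fix p assume "p \<in> space (\<pi> \<Otimes>\<^sub>M N)"
    then have p: "fst p \<in> M" "snd p \<in> space N" by (auto simp: space_pair_measure sp M)
    obtain c where c: "\<And>n. c n \<in> M" "\<And>n. d (c n) (fst p) < 1 / Suc n" "\<And>n w. g n (fst p) w = f (c n) w"
      using gval[OF p(1)] by metis
    have "limitin mtopology c (fst p) sequentially"
      unfolding limitin_metric
    proof (intro conjI allI impI p(1))
      fix \<epsilon> :: real assume e: "0 < \<epsilon>"
      have "eventually (\<lambda>n. 1 / real (Suc n) < \<epsilon>) sequentially"
        using LIMSEQ_inverse_real_of_nat e by (auto simp: inverse_eq_divide dest: order_tendstoD(2))
      then show "eventually (\<lambda>n. c n \<in> M \<and> d (c n) (fst p) < \<epsilon>) sequentially"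
        by eventually_elim (use c less_trans in blast)
    qed
    then have "limitin X c (fst p) sequentially" by (simp add: Xd)
    from continuous_map_limit[OF cont[OF p(2)] this]
    have "(\<lambda>n. f (c n) (snd p)) \<longlonglongrightarrow> f (fst p) (snd p)" by (simp add: comp_def)
    then show "(\<lambda>n. g n (fst p) (snd p)) \<longlonglongrightarrow> f (fst p) (snd p)" by (simp add: c(3))
  qed
  then show ?thesis by (simp add: split_beta')
qed

text \<open>The norm is a supremum over a countable dense set.\<close>

lemma norm_operator_measurable:
  fixes V :: "'w \<Rightarrow> 'h::{real_inner, second_countable_topology} \<Rightarrow>\<^sub>L 'h"
  assumes [measurable]: "\<And>h. (\<lambda>w. blinfun_apply (V w) h) \<in> borel_measurable N"
  shows "(\<lambda>w. norm (V w)) \<in> borel_measurable N"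
  unfolding borel_measurable_iff_le
proof
  fix a :: real
  obtain D where D: "countable D" "D \<subseteq> (UNIV :: 'h set)" "UNIV \<subseteq> closure D" by (rule separable)
  show "{w \<in> space N. norm (V w) \<le> a} \<in> sets N"
  proof (cases "0 \<le> a")
    case True
    have "norm (V w) \<le> a \<longleftrightarrow> (\<forall>h\<in>D. norm (blinfun_apply (V w) h) \<le> a * norm h)" for w
    proof
      assume "norm (V w) \<le> a"
      then show "\<forall>h\<in>D. norm (blinfun_apply (V w) h) \<le> a * norm h"
        by (auto intro!: order_trans[OF norm_blinfun] mult_right_mono)
    next
      assume a: "\<forall>h\<in>D. norm (blinfun_apply (V w) h) \<le> a * norm h"
      have "closed {h. norm (blinfun_apply (V w) h) \<le> a * norm h}"
        by (intro closed_Collect_le continuous_intros)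
      then have "closure D \<subseteq> {h. norm (blinfun_apply (V w) h) \<le> a * norm h}"
        using a by (intro closure_minimal) auto
      then show "norm (V w) \<le> a" using D(3) True by (intro norm_blinfun_bound) auto
    qed
    then have "{w \<in> space N. norm (V w) \<le> a} = {w \<in> space N. \<forall>h\<in>D. norm (blinfun_apply (V w) h) \<le> a * norm h}" by auto
    also have "\<dots> \<in> sets N" by (rule sets.sets_Collect_countable_All'[OF _ D(1)]) measurable
    finally show ?thesis .
  next
    case False
    have "\<not> norm (V w) \<le> a" for w using False norm_ge_zero[of "V w"] by linarith
    then have "{w \<in> space N. norm (V w) \<le> a} = {}" by blast
    then show ?thesis by (simp only: sets.empty_sets)
  qed
qed

text \<open>Strong measurability of \<open>V\<close> gives the claim for simple functions in place of \<open>e\<close>, and these approximate \<open>e\<close>.\<close>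

lemma operator_apply_measurable:
  fixes V :: "'w \<Rightarrow> 'h::{real_inner, second_countable_topology} \<Rightarrow>\<^sub>L 'h"
  assumes V: "\<And>h. (\<lambda>w. blinfun_apply (V w) h) \<in> borel_measurable N" and e: "e \<in> borel_measurable \<pi>"
  shows "(\<lambda>(t, w). blinfun_apply (V w) (e t)) \<in> borel_measurable (\<pi> \<Otimes>\<^sub>M N)"
proof -
  obtain F where F: "\<And>i. simple_function \<pi> (F i)" "\<And>t. t \<in> space \<pi> \<Longrightarrow> (\<lambda>i. F i t) \<longlonglongrightarrow> e t"
    using borel_measurable_implies_sequence_metric[OF e, of 0] by blast
  have "(\<lambda>p. blinfun_apply (V (snd p)) (e (fst p))) \<in> borel_measurable (\<pi> \<Otimes>\<^sub>M N)"
  proof (rule borel_measurable_LIMSEQ_metric)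
    fix i
    let ?R = "F i ` space \<pi>"
    have fin: "finite ?R" using F(1) by (simp add: simple_function_def)
    have A[measurable]: "F i -` {y} \<inter> space \<pi> \<in> sets \<pi>" for y by (rule simple_functionD(2)[OF F(1)])
    have "(\<lambda>p. \<Sum>y\<in>?R. indicator (F i -` {y} \<inter> space \<pi>) (fst p) *\<^sub>R blinfun_apply (V (snd p)) y) \<in> borel_measurable (\<pi> \<Otimes>\<^sub>M N)"
      by (intro borel_measurable_sum borel_measurable_scaleR measurable_compose[OF measurable_fst borel_measurable_indicator[OF A]]
          measurable_compose[OF measurable_snd V])
    moreover have "(\<Sum>y\<in>?R. indicator (F i -` {y} \<inter> space \<pi>) (fst p) *\<^sub>R blinfun_apply (V (snd p)) y)
        = blinfun_apply (V (snd p)) (F i (fst p))" if "p \<in> space (\<pi> \<Otimes>\<^sub>M N)" for p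
    proof -
      have p: "fst p \<in> space \<pi>" using that by (auto simp: space_pair_measure)
      have "(\<Sum>y\<in>?R. indicator (F i -` {y} \<inter> space \<pi>) (fst p) *\<^sub>R blinfun_apply (V (snd p)) y)
          = (\<Sum>y\<in>?R. if y = F i (fst p) then blinfun_apply (V (snd p)) y else 0)"
        using p by (intro sum.cong) (auto simp: indicator_def)
      then show ?thesis using p fin by simp
    qed
    ultimately show "(\<lambda>p. blinfun_apply (V (snd p)) (F i (fst p))) \<in> borel_measurable (\<pi> \<Otimes>\<^sub>M N)"
      by (simp cong: measurable_cong)
  next
    fix p assume "p \<in> space (\<pi> \<Otimes>\<^sub>M N)"
    then have "(\<lambda>i. F i (fst p)) \<longlonglongrightarrow> e (fst p)" by (intro F) (auto simp: space_pair_measure)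
    then show "(\<lambda>i. blinfun_apply (V (snd p)) (F i (fst p))) \<longlonglongrightarrow> blinfun_apply (V (snd p)) (e (fst p))"
      by (intro tendsto_intros)
  qed
  then show ?thesis by (simp add: split_beta')
qed

section \<open>Limits of convex functions\<close>

lemma convex_slope_mono:
  fixes f :: "real \<Rightarrow> real"
  assumes f: "convex_on {-\<epsilon><..<\<epsilon>} f" and a: "\<bar>a\<bar> < \<epsilon>" "a \<noteq> 0" and b: "\<bar>b\<bar> < \<epsilon>" "b \<noteq> 0" and ab: "a < b"
  shows "(f a - f 0) / a \<le> (f b - f 0) / b"
proof -
  have e: "0 < \<epsilon>" using a(1) by linarith
  have in': "a \<in> {-\<epsilon><..<\<epsilon>}" "b \<in> {-\<epsilon><..<\<epsilon>}" "0 \<in> {-\<epsilon><..<\<epsilon>}" using a b e by auto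
  have flip: "(f 0 - f x) / (0 - x) = (f x - f 0) / x" for x
    using minus_divide_divide[of "f x - f 0" x] by simp
  consider "0 < a" | "b < 0" | "a < 0" "0 < b" using a(2) b(2) ab by linarith
  then show ?thesis
  proof cases
    case 1
    then show ?thesis using convex_on_slope_le(1)[OF f in'(3,2), of a] ab by (simp only: flip)
  next
    case 2
    then show ?thesis using convex_on_slope_le(2)[OF f in'(1,3), of b] ab by simp
  next
    case 3
    have "(f a - f 0) / (a - 0) \<le> (f a - f b) / (a - b)" by (rule convex_on_slope_le(1)[OF f in'(1,2) 3])
    also have "\<dots> \<le> (f 0 - f b) / (0 - b)" by (rule convex_on_slope_le(2)[OF f in'(1,2) 3])
    finally show ?thesis by (simp only: flip diff_zero)
  qed
qed

lemma convex_one_sided_derivatives: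
  fixes f :: "real \<Rightarrow> real"
  assumes e: "0 < \<epsilon>" and f: "convex_on {-\<epsilon><..<\<epsilon>} f"
  obtains Dm Dp where "(f has_real_derivative Dm) (at_left 0)" "(f has_real_derivative Dp) (at_right 0)"
proof -
  define g where "g = (\<lambda>x. (f x - f 0) / x)"
  have mono: "g a \<le> g b" if "\<bar>a\<bar> < \<epsilon>" "a \<noteq> 0" "\<bar>b\<bar> < \<epsilon>" "b \<noteq> 0" "a \<le> b" for a b
    using convex_slope_mono[OF f that(1-4)] that(5) unfolding g_def by (cases "a = b") auto
  define R where "R = g ` {0<..<\<epsilon>}"
  define L where "L = g ` {-\<epsilon><..<0}"
  have ne: "R \<noteq> {}" "L \<noteq> {}" using e by (auto simp: R_def L_def)
  have "\<exists>x. \<forall>y\<in>R. x \<le> y"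
  proof (intro exI ballI)
    fix y assume "y \<in> R"
    then show "g (-\<epsilon>/2) \<le> y" using e by (auto simp: R_def intro!: mono)
  qed
  then have bR: "bdd_below R" by (auto simp: bdd_below_def)
  have "\<exists>x. \<forall>y\<in>L. y \<le> x"
  proof (intro exI ballI)
    fix y assume "y \<in> L"
    then show "y \<le> g (\<epsilon>/2)" using e by (auto simp: L_def intro!: mono)
  qed
  then have bL: "bdd_above L" by (auto simp: bdd_above_def)
  have r: "(g \<longlongrightarrow> Inf R) (at_right 0)"
  proof (rule order_tendstoI)
    fix y assume y: "y < Inf R"
    have "g x > y" if "0 < x" "x < \<epsilon>" for x
      using cInf_lower[OF _ bR, of "g x"] that y by (auto simp: R_def intro: less_le_trans)
    then show "eventually (\<lambda>x. y < g x) (at_right 0)" using e by (auto simp: eventually_at_right_field)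
  next
    fix y assume "Inf R < y"
    then obtain b where b: "0 < b" "b < \<epsilon>" "g b < y" using cInf_less_iff[OF ne(1) bR] by (auto simp: R_def)
    have "g x < y" if "0 < x" "x < b" for x using mono[of x b] that b by auto
    then show "eventually (\<lambda>x. g x < y) (at_right 0)" using b(1) by (auto simp: eventually_at_right_field)
  qed
  have l: "(g \<longlongrightarrow> Sup L) (at_left 0)"
  proof (rule order_tendstoI)
    fix y assume y: "Sup L < y"
    have "g x < y" if "x < 0" "- \<epsilon> < x" for x
      using cSup_upper[OF _ bL, of "g x"] that y by (auto simp: L_def intro: le_less_trans)
    then show "eventually (\<lambda>x. g x < y) (at_left 0)" using e by (auto simp: eventually_at_left_field intro!: exI[of _ "-\<epsilon>"])
  next
    fix y assume "y < Sup L"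
    then obtain b where b: "b < 0" "- \<epsilon> < b" "y < g b" using less_cSup_iff[OF ne(2) bL] by (auto simp: L_def)
    have "y < g x" if "x < 0" "b < x" for x using mono[of b x] that b by auto
    then show "eventually (\<lambda>x. y < g x) (at_left 0)" using b(1) by (auto simp: eventually_at_left_field)
  qed
  show thesis
    using r l by (intro that[of "Sup L" "Inf R"]) (auto simp: has_field_derivative_iff g_def)
qed

lemma limsup_le_of_tendsto:
  fixes p u :: "nat \<Rightarrow> real"
  assumes "eventually (\<lambda>n. p n \<le> u n) sequentially" "u \<longlonglongrightarrow> l"
  shows "limsup (\<lambda>n. ereal (p n)) \<le> ereal l"
proof -
  have "limsup (\<lambda>n. ereal (p n)) \<le> limsup (\<lambda>n. ereal (u n))"
    using assms(1) by (intro Limsup_mono) (auto elim: eventually_mono)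
  also have "\<dots> = ereal l" using assms(2) by (intro lim_imp_Limsup) auto
  finally show ?thesis .
qed

lemma liminf_ge_of_tendsto:
  fixes p u :: "nat \<Rightarrow> real"
  assumes "eventually (\<lambda>n. u n \<le> p n) sequentially" "u \<longlonglongrightarrow> l"
  shows "ereal l \<le> liminf (\<lambda>n. ereal (p n))"
proof -
  have "ereal l = liminf (\<lambda>n. ereal (u n))" using assms(2) by (intro lim_imp_Liminf[symmetric]) auto
  also have "\<dots> \<le> liminf (\<lambda>n. ereal (p n))"
    using assms(1) by (intro Liminf_mono) (auto elim: eventually_mono)
  finally show ?thesis .
qed

text \<open>Griffiths' lemma in the form in which only subgradient inequalities with vanishing errors \<open>r n\<close> are
known. Dividing by \<open>\<beta>\<close> bounds \<open>p n\<close> by a difference quotient, from above for \<open>\<beta> > 0\<close> and from below for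
\<open>\<beta> < 0\<close>.\<close>

lemma griffiths_sandwich:
  fixes f :: "nat \<Rightarrow> real \<Rightarrow> real" and F :: "real \<Rightarrow> real"
  assumes e: "0 < \<epsilon>" and lim: "\<And>\<beta>. \<bar>\<beta>\<bar> < \<epsilon> \<Longrightarrow> (\<lambda>n. f n \<beta>) \<longlonglongrightarrow> F \<beta>"
    and Dm: "(F has_real_derivative Dm) (at_left 0)" and Dp: "(F has_real_derivative Dp) (at_right 0)"
    and r: "r \<longlonglongrightarrow> 0"
    and sub: "\<And>\<beta>. \<bar>\<beta>\<bar> < \<epsilon> \<Longrightarrow> eventually (\<lambda>n. \<beta> * p n - r n \<le> f n \<beta> - f n 0) sequentially"
  shows "ereal Dm \<le> liminf (\<lambda>n. ereal (p n))" "limsup (\<lambda>n. ereal (p n)) \<le> ereal Dp"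
proof -
  have q: "(\<lambda>n. (f n \<beta> - f n 0 + r n) / \<beta>) \<longlonglongrightarrow> (F \<beta> - F 0) / \<beta>" if "\<bar>\<beta>\<bar> < \<epsilon>" "\<beta> \<noteq> 0" for \<beta>
    using tendsto_divide[OF tendsto_add[OF tendsto_diff[OF lim[OF that(1)] lim[of 0]] r] tendsto_const, of \<beta>] that e by simp
  have up: "limsup (\<lambda>n. ereal (p n)) \<le> ereal ((F \<beta> - F 0) / \<beta>)" if b: "0 < \<beta>" "\<beta> < \<epsilon>" for \<beta>
  proof (rule limsup_le_of_tendsto)
    show "eventually (\<lambda>n. p n \<le> (f n \<beta> - f n 0 + r n) / \<beta>) sequentially"
      using sub[of \<beta>] b by (auto elim!: eventually_mono simp: field_simps)
    show "(\<lambda>n. (f n \<beta> - f n 0 + r n) / \<beta>) \<longlonglongrightarrow> (F \<beta> - F 0) / \<beta>" using b by (intro q) auto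
  qed
  have lo: "ereal ((F \<beta> - F 0) / \<beta>) \<le> liminf (\<lambda>n. ereal (p n))" if b: "\<beta> < 0" "- \<epsilon> < \<beta>" for \<beta>
  proof (rule liminf_ge_of_tendsto)
    show "eventually (\<lambda>n. (f n \<beta> - f n 0 + r n) / \<beta> \<le> p n) sequentially"
      using sub[of \<beta>] b by (auto elim!: eventually_mono simp: field_simps)
    show "(\<lambda>n. (f n \<beta> - f n 0 + r n) / \<beta>) \<longlonglongrightarrow> (F \<beta> - F 0) / \<beta>" using b by (intro q) auto
  qed
  have "((\<lambda>\<beta>. ereal ((F \<beta> - F 0) / \<beta>)) \<longlongrightarrow> ereal Dp) (at_right 0)"
    using Dp by (auto simp: has_field_derivative_iff)
  moreover have "eventually (\<lambda>\<beta>. limsup (\<lambda>n. ereal (p n)) \<le> ereal ((F \<beta> - F 0) / \<beta>)) (at_right 0)"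
    using up e by (auto simp: eventually_at_right_field)
  ultimately show "limsup (\<lambda>n. ereal (p n)) \<le> ereal Dp"
    by (intro tendsto_lowerbound) auto
  have "((\<lambda>\<beta>. ereal ((F \<beta> - F 0) / \<beta>)) \<longlongrightarrow> ereal Dm) (at_left 0)"
    using Dm by (auto simp: has_field_derivative_iff)
  moreover have "eventually (\<lambda>\<beta>. ereal ((F \<beta> - F 0) / \<beta>) \<le> liminf (\<lambda>n. ereal (p n))) (at_left 0)"
    using lo e by (auto simp: eventually_at_left_field intro!: exI[of _ "-\<epsilon>"])
  ultimately show "ereal Dm \<le> liminf (\<lambda>n. ereal (p n))"
    by (intro tendsto_upperbound) auto
qed

lemma one_sided_derivatives_eq:
  fixes F :: "real \<Rightarrow> real"
  assumes "F differentiable (at 0)" "(F has_real_derivative Dm) (at_left 0)" "(F has_real_derivative Dp) (at_right 0)"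
  shows "Dm = deriv F 0" "Dp = deriv F 0"
proof -
  have "(F has_real_derivative deriv F 0) (at 0)" using assms(1) DERIV_deriv_iff_real_differentiable by blast
  then have D: "(F has_real_derivative deriv F 0) (at_left 0)" "(F has_real_derivative deriv F 0) (at_right 0)"
    by (auto intro: has_field_derivative_at_within)
  show "Dm = deriv F 0" using D(1) assms(2) tendsto_unique[OF trivial_limit_at_left_real] by (auto simp: has_field_derivative_iff)
  show "Dp = deriv F 0" using D(2) assms(3) tendsto_unique[OF trivial_limit_at_right_real] by (auto simp: has_field_derivative_iff)
qed

lemma tendsto_of_liminf_limsup:
  fixes p :: "nat \<Rightarrow> real"
  assumes "ereal D \<le> liminf (\<lambda>n. ereal (p n))" "limsup (\<lambda>n. ereal (p n)) \<le> ereal D"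
  shows "p \<longlonglongrightarrow> D"
proof -
  have "liminf (\<lambda>n. ereal (p n)) \<le> limsup (\<lambda>n. ereal (p n))" by (intro Liminf_le_Limsup) simp
  then have "liminf (\<lambda>n. ereal (p n)) = ereal D" "limsup (\<lambda>n. ereal (p n)) = ereal D" using assms by auto
  then have "(\<lambda>n. ereal (p n)) \<longlonglongrightarrow> ereal D" by (intro Liminf_eq_Limsup) auto
  then show ?thesis by simp
qed

lemma convex_on_limit:
  fixes f :: "nat \<Rightarrow> real \<Rightarrow> real"
  assumes S: "convex S" and lim: "\<And>x. x \<in> S \<Longrightarrow> (\<lambda>n. f n x) \<longlonglongrightarrow> F x"
    and cvx: "eventually (\<lambda>n. convex_on S (f n)) sequentially"
  shows "convex_on S F"
proof (rule convex_onI[OF _ S])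
  fix t x y :: real assume t: "0 < t" "t < 1" and x: "x \<in> S" and y: "y \<in> S"
  have z: "(1 - t) *\<^sub>R x + t *\<^sub>R y \<in> S" using convexD[OF S x y, of "1 - t" t] t by auto
  have "(\<lambda>n. (1 - t) * f n x + t * f n y) \<longlonglongrightarrow> (1 - t) * F x + t * F y" by (intro tendsto_intros lim x y)
  moreover have "eventually (\<lambda>n. f n ((1 - t) *\<^sub>R x + t *\<^sub>R y) \<le> (1 - t) * f n x + t * f n y) sequentially"
    using cvx by eventually_elim (use t x y convex_onD in fastforce)
  ultimately show "F ((1 - t) *\<^sub>R x + t *\<^sub>R y) \<le> (1 - t) * F x + t * F y"
    using lim[OF z] by (intro tendsto_le[OF sequentially_bot])
qed

section \<open>Replica averages and the tangent of the mean free energy\<close>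

lemma (in two_probs) gibbs_kernel:
  assumes Z: "dom_field \<mu> N W Z"
  shows "(\<lambda>w. gibbs \<mu> (\<lambda>t. Z t w)) \<in> measurable N (subprob_algebra \<mu>)"
proof (rule measurable_subprob_algebra)
  fix w assume w: "w \<in> space N"
  show "subprob_space (gibbs \<mu> (\<lambda>t. Z t w))"
    by (rule prob_space_imp_subprob_space[OF mu.prob_space_gibbs[OF dom_field_bdmeas[OF Z w]]])
  show "sets (gibbs \<mu> (\<lambda>t. Z t w)) = sets \<mu>" by (rule mu.sets_gibbs)
next
  fix A assume A[measurable]: "A \<in> sets \<mu>"
  have "(\<lambda>(t, w). indicator A t :: real) \<in> borel_measurable (\<mu> \<Otimes>\<^sub>M N)" by measurable
  from gibbs_integral_measurable[OF Z this]
  have "(\<lambda>w. ennreal (\<integral>t. indicator A t \<partial>gibbs \<mu> (\<lambda>t. Z t w))) \<in> borel_measurable N" by measurable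
  moreover have "emeasure (gibbs \<mu> (\<lambda>t. Z t w)) A = ennreal (\<integral>t. indicator A t \<partial>gibbs \<mu> (\<lambda>t. Z t w))"
    if w: "w \<in> space N" for w
  proof -
    interpret G: prob_space "gibbs \<mu> (\<lambda>t. Z t w)" by (rule mu.prob_space_gibbs[OF dom_field_bdmeas[OF Z w]])
    have "A \<in> sets (gibbs \<mu> (\<lambda>t. Z t w))" using A by (simp add: mu.sets_gibbs)
    then show ?thesis by (simp add: G.emeasure_eq_measure sets.Int_space_eq2)
  qed
  ultimately show "(\<lambda>w. emeasure (gibbs \<mu> (\<lambda>t. Z t w)) A) \<in> borel_measurable N"
    by (simp cong: measurable_cong)
qed

lemma (in two_probs) integral_mean_gibbs2:
  assumes Z: "dom_field \<mu> N W Z" and \<phi>: "bdmeas (\<mu> \<Otimes>\<^sub>M \<mu>) B \<phi>"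
  shows "(\<integral>p. \<phi> p \<partial>mean_gibbs2 N \<mu> Z)
      = (\<integral>w. (\<integral>s. (\<integral>t. \<phi> (s, t) \<partial>gibbs \<mu> (\<lambda>t. Z t w)) \<partial>gibbs \<mu> (\<lambda>t. Z t w)) \<partial>N)"
proof -
  let ?g = "\<lambda>w. gibbs \<mu> (\<lambda>t. Z t w)"
  have k: "(\<lambda>w. ?g w \<Otimes>\<^sub>M ?g w) \<in> measurable N (subprob_algebra (\<mu> \<Otimes>\<^sub>M \<mu>))"
    by (rule measurable_pair_measure[OF gibbs_kernel[OF Z] gibbs_kernel[OF Z]])
  have pg: "pair_prob_space (?g w) (?g w)" if "w \<in> space N" for w
    using mu.prob_space_gibbs[OF dom_field_bdmeas[OF Z that]]
    by (simp add: pair_prob_space_def pair_sigma_finite_def prob_space_imp_sigma_finite)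
  have "mean_gibbs2 N \<mu> Z = join (distr N (subprob_algebra (\<mu> \<Otimes>\<^sub>M \<mu>)) (\<lambda>w. ?g w \<Otimes>\<^sub>M ?g w))"
    unfolding mean_gibbs2_def by (rule bind_nonempty''[OF k]) (use N.not_empty in simp)
  then have "(\<integral>p. \<phi> p \<partial>mean_gibbs2 N \<mu> Z) =
      (\<integral>M'. (\<integral>p. \<phi> p \<partial>M') \<partial>distr N (subprob_algebra (\<mu> \<Otimes>\<^sub>M \<mu>)) (\<lambda>w. ?g w \<Otimes>\<^sub>M ?g w))"
  proof (simp only:, intro integral_join[where B=B and B'=1])
    show "\<phi> \<in> borel_measurable (\<mu> \<Otimes>\<^sub>M \<mu>)" using \<phi> by (rule bdmeas_meas)
    show "\<bar>\<phi> x\<bar> \<le> B" if "x \<in> space (\<mu> \<Otimes>\<^sub>M \<mu>)" for x using \<phi> that by (rule bdmeas_bound)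
    show "finite_measure (distr N (subprob_algebra (\<mu> \<Otimes>\<^sub>M \<mu>)) (\<lambda>w. ?g w \<Otimes>\<^sub>M ?g w))"
      by (rule prob_space.finite_measure[OF N.prob_space_distr[OF k]])
    show "AE M' in distr N (subprob_algebra (\<mu> \<Otimes>\<^sub>M \<mu>)) (\<lambda>w. ?g w \<Otimes>\<^sub>M ?g w). emeasure M' (space M') \<le> ennreal 1"
      by (rule AE_I2) (auto simp: space_subprob_algebra dest: subprob_space.emeasure_space_le_1)
  qed simp
  also have "\<dots> = (\<integral>w. (\<integral>p. \<phi> p \<partial>(?g w \<Otimes>\<^sub>M ?g w)) \<partial>N)"
    by (rule integral_distr[OF k integral_measurable_subprob_algebra[OF bdmeas_meas[OF \<phi>]]])
  also have "\<dots> = (\<integral>w. (\<integral>s. (\<integral>t. \<phi> (s, t) \<partial>?g w) \<partial>?g w) \<partial>N)"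
  proof (rule Bochner_Integration.integral_cong[OF refl])
    fix w assume w: "w \<in> space N"
    interpret GG: pair_prob_space "?g w" "?g w" by (rule pg[OF w])
    have "bdmeas (?g w \<Otimes>\<^sub>M ?g w) B \<phi>"
      using \<phi> sets_pair_measure_cong[OF mu.sets_gibbs mu.sets_gibbs]
      by (auto simp: bdmeas_def space_pair_measure mu.space_gibbs cong: measurable_cong_sets)
    then have "integrable (?g w \<Otimes>\<^sub>M ?g w) \<phi>" by (rule GG.bdmeas_integrable)
    from GG.integral_fst'[OF this] show "(\<integral>p. \<phi> p \<partial>(?g w \<Otimes>\<^sub>M ?g w)) = (\<integral>s. (\<integral>t. \<phi> (s, t) \<partial>?g w) \<partial>?g w)" by simp
  qed
  finally show ?thesis .
qed

text \<open>An observable of two replicas that is a function of the second replica plus kernels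
\<open>h i t t - h i s t\<close> averages to a sum of diagonal excesses; \<open>\<phi>\<^sub>\<theta>\<close> has this form.\<close>

lemma (in two_probs) integral_mean_gibbs2_excess:
  assumes Z: "dom_field \<mu> N W Z" and p: "bdmeas \<mu> B p" and I: "finite I"
    and h: "\<And>i. i \<in> I \<Longrightarrow> bdkernel \<mu> (H i) (h i)"
  shows "(\<integral>(s, t). p t + (\<Sum>i\<in>I. h i t t) - (\<Sum>i\<in>I. h i s t) \<partial>mean_gibbs2 N \<mu> Z)
      = (\<integral>w. (\<integral>t. p t \<partial>gibbs \<mu> (\<lambda>t. Z t w)) + (\<Sum>i\<in>I. diag_excess (gibbs \<mu> (\<lambda>t. Z t w)) (h i)) \<partial>N)"
proof -
  interpret mm: pair_prob_space \<mu> \<mu> ..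
  let ?g = "\<lambda>w. gibbs \<mu> (\<lambda>t. Z t w)"
  have "bdmeas (\<mu> \<Otimes>\<^sub>M \<mu>) (B + (\<Sum>i\<in>I. H i) + (\<Sum>i\<in>I. H i)) (\<lambda>(s, t). p t + (\<Sum>i\<in>I. h i t t) - (\<Sum>i\<in>I. h i s t))"
  proof (rule bdmeasI)
    have 1: "(\<lambda>q. h i (fst q) (snd q)) \<in> borel_measurable (\<mu> \<Otimes>\<^sub>M \<mu>)" if "i \<in> I" for i
      using bdkernel_measurable[OF h[OF that]] by (simp add: split_beta')
    have 2: "(\<lambda>q. h i (snd q) (snd q)) \<in> borel_measurable (\<mu> \<Otimes>\<^sub>M \<mu>)" if "i \<in> I" for i
      by (rule measurable_compose[OF measurable_snd bdmeas_meas[OF bdkernel_diag[OF h[OF that]]]])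
    have 3: "(\<lambda>q. p (snd q)) \<in> borel_measurable (\<mu> \<Otimes>\<^sub>M \<mu>)"
      by (rule measurable_compose[OF measurable_snd bdmeas_meas[OF p]])
    show "(\<lambda>(s, t). p t + (\<Sum>i\<in>I. h i t t) - (\<Sum>i\<in>I. h i s t)) \<in> borel_measurable (\<mu> \<Otimes>\<^sub>M \<mu>)"
      unfolding split_beta' by (intro borel_measurable_diff borel_measurable_add borel_measurable_sum 1 2 3)
    fix q assume "q \<in> space (\<mu> \<Otimes>\<^sub>M \<mu>)"
    then obtain s t where q: "q = (s, t)" "s \<in> space \<mu>" "t \<in> space \<mu>" by (auto simp: space_pair_measure)
    have "\<bar>\<Sum>i\<in>I. h i t t\<bar> \<le> (\<Sum>i\<in>I. H i)" "\<bar>\<Sum>i\<in>I. h i s t\<bar> \<le> (\<Sum>i\<in>I. H i)"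
      using q by (auto intro!: order_trans[OF sum_abs] sum_mono bdmeas_bound[OF bdkernel_diag[OF h]] bdmeas_bound[OF bdkernel_section[OF h]])
    then show "\<bar>case q of (s, t) \<Rightarrow> p t + (\<Sum>i\<in>I. h i t t) - (\<Sum>i\<in>I. h i s t)\<bar> \<le> B + (\<Sum>i\<in>I. H i) + (\<Sum>i\<in>I. H i)"
      using bdmeas_bound[OF p q(3)] q(1) by auto
  qed
  from integral_mean_gibbs2[OF Z this]
  have "(\<integral>(s, t). p t + (\<Sum>i\<in>I. h i t t) - (\<Sum>i\<in>I. h i s t) \<partial>mean_gibbs2 N \<mu> Z)
    = (\<integral>w. (\<integral>s. (\<integral>t. p t + (\<Sum>i\<in>I. h i t t) - (\<Sum>i\<in>I. h i s t) \<partial>?g w) \<partial>?g w) \<partial>N)" by simp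
  also have "\<dots> = (\<integral>w. (\<integral>t. p t \<partial>?g w) + (\<Sum>i\<in>I. diag_excess (?g w) (h i)) \<partial>N)"
  proof (rule Bochner_Integration.integral_cong[OF refl])
    fix w assume w: "w \<in> space N"
    interpret G: prob_space "?g w" by (rule mu.prob_space_gibbs[OF dom_field_bdmeas[OF Z w]])
    have hG: "bdkernel (?g w) (H i) (h i)" if "i \<in> I" for i
      using h[OF that] bdkernel_cong_sets[OF mu.sets_gibbs] by blast
    have ip: "integrable (?g w) p" using p by (intro G.bdmeas_integrable) (simp add: mu.bdmeas_gibbs)
    have id: "integrable (?g w) (\<lambda>t. h i t t)" if "i \<in> I" for i by (rule G.bdmeas_integrable[OF bdkernel_diag[OF hG[OF that]]])
    have isec: "integrable (?g w) (h i s)" if "i \<in> I" "s \<in> space \<mu>" for i s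
      using that by (intro G.bdmeas_integrable[OF bdkernel_section[OF hG]]) (auto simp: mu.space_gibbs)
    have ii: "integrable (?g w) (\<lambda>s. \<integral>t. h i s t \<partial>?g w)" if "i \<in> I" for i
      by (rule G.bdmeas_integrable[OF G.bdkernel_inner[OF hG[OF that]]])
    have "(\<integral>s. (\<integral>t. p t + (\<Sum>i\<in>I. h i t t) - (\<Sum>i\<in>I. h i s t) \<partial>?g w) \<partial>?g w)
        = (\<integral>s. ((\<integral>t. p t \<partial>?g w) + (\<Sum>i\<in>I. \<integral>t. h i t t \<partial>?g w)) - (\<Sum>i\<in>I. \<integral>t. h i s t \<partial>?g w) \<partial>?g w)"
    proof (rule Bochner_Integration.integral_cong[OF refl])
      fix s assume "s \<in> space (?g w)"
      then have s: "s \<in> space \<mu>" by (simp add: mu.space_gibbs)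
      show "(\<integral>t. p t + (\<Sum>i\<in>I. h i t t) - (\<Sum>i\<in>I. h i s t) \<partial>?g w)
        = ((\<integral>t. p t \<partial>?g w) + (\<Sum>i\<in>I. \<integral>t. h i t t \<partial>?g w)) - (\<Sum>i\<in>I. \<integral>t. h i s t \<partial>?g w)"
        using ip id isec[OF _ s] by simp
    qed
    also have "\<dots> = (\<integral>t. p t \<partial>?g w) + (\<Sum>i\<in>I. \<integral>t. h i t t \<partial>?g w) - (\<Sum>i\<in>I. \<integral>s. (\<integral>t. h i s t \<partial>?g w) \<partial>?g w)"
      using ii by (simp add: G.prob_space)
    also have "\<dots> = (\<integral>t. p t \<partial>?g w) + (\<Sum>i\<in>I. diag_excess (?g w) (h i))"
      by (simp add: diag_excess_def sum_subtractf)
    finally show "(\<integral>s. (\<integral>t. p t + (\<Sum>i\<in>I. h i t t) - (\<Sum>i\<in>I. h i s t) \<partial>?g w) \<partial>?g w)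
        = (\<integral>t. p t \<partial>?g w) + (\<Sum>i\<in>I. diag_excess (?g w) (h i))" .
  qed
  finally show ?thesis .
qed

context indep_fields begin

text \<open>The tangent inequality for the sum of the fields, in which the Gibbs average of the random slope
\<open>\<Sum>i. v i t (\<omega> i)\<close> is replaced by diagonal excesses through \<open>mean_gibbs_sum\<close>. The sign of \<open>\<beta>\<close> is arbitrary.\<close>

lemma free_energy_tangent:
  assumes b: "bdmeas \<pi> B b" and p: "bdmeas \<pi> B' p"
    and v: "\<And>i. i \<in> I \<Longrightarrow> dom_field \<pi> (N i) (V i) (v i)" and V: "\<And>i. i \<in> I \<Longrightarrow> integrable (N i) (V i)"
    and h: "\<And>i. i \<in> I \<Longrightarrow> bdkernel \<pi> (H i) (h i)"
    and single: "\<And>i b B. i \<in> I \<Longrightarrow> bdmeas \<pi> B b \<Longrightarrow>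
      \<bar>(\<integral>w. (\<integral>t. v i t w \<partial>gibbs \<pi> (\<lambda>t. b t + x i t w)) \<partial>N i)
        - (\<integral>w. diag_excess (gibbs \<pi> (\<lambda>t. b t + x i t w)) (h i) \<partial>N i)\<bar> \<le> e i"
  shows "\<beta> * (\<integral>\<omega>. (\<integral>t. p t \<partial>gibbs \<pi> (\<lambda>t. field b t \<omega>)) + (\<Sum>i\<in>I. diag_excess (gibbs \<pi> (\<lambda>t. field b t \<omega>)) (h i)) \<partial>Pi\<^sub>M I N)
       - \<bar>\<beta>\<bar> * (\<Sum>i\<in>I. e i)
     \<le> (\<integral>\<omega>. logint \<pi> (\<lambda>t. (b t + \<beta> * p t) + (\<Sum>i\<in>I. x i t (\<omega> i) + \<beta> * v i t (\<omega> i))) \<partial>Pi\<^sub>M I N)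
       - (\<integral>\<omega>. logint \<pi> (\<lambda>t. field b t \<omega>) \<partial>Pi\<^sub>M I N)"
proof -
  interpret T: two_probs \<pi> "Pi\<^sub>M I N" by (rule two_probs_PiM)
  note fd = field_dom[OF b]
  let ?g = "\<lambda>\<omega>. gibbs \<pi> (\<lambda>t. field b t \<omega>)"
  define Vs where "Vs = (\<lambda>\<omega>. \<Sum>i\<in>I. V i (\<omega> i))"
  define vs where "vs = (\<lambda>t \<omega>. \<Sum>i\<in>I. v i t (\<omega> i))"
  have vs: "dom_field \<pi> (Pi\<^sub>M I N) Vs vs"
    unfolding Vs_def vs_def
    by (intro dom_field_sum[OF fin], rule dom_field_component[where N=N]) (use v in auto)
  have iV: "integrable (Pi\<^sub>M I N) Vs"
  proof -
    have "integrable (Pi\<^sub>M I N) (\<lambda>\<omega>. V i (\<omega> i))" if "i \<in> I" for i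
      by (rule integrable_PiM_component(1)[where N=N and i=i, OF N that V[OF that]])
    then show ?thesis unfolding Vs_def by (intro Bochner_Integration.integrable_sum) auto
  qed
  have pf: "dom_field \<pi> (Pi\<^sub>M I N) (\<lambda>_. B') (\<lambda>t _. p t)" by (rule dom_field_const[OF p])
  have dir: "dom_field \<pi> (Pi\<^sub>M I N) (\<lambda>\<omega>. \<bar>\<beta>\<bar> * (B' + Vs \<omega>)) (\<lambda>t \<omega>. \<beta> * (p t + vs t \<omega>))"
    by (intro dom_field_cmult dom_field_add pf vs)
  have all: "dom_field \<pi> (Pi\<^sub>M I N) (\<lambda>\<omega>. (B + (\<Sum>i\<in>I. W i (\<omega> i))) + \<bar>\<beta>\<bar> * (B' + Vs \<omega>)) (\<lambda>t \<omega>. field b t \<omega> + \<beta> * (p t + vs t \<omega>))"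
    by (rule dom_field_add[OF fd dir])
  have iall: "integrable (Pi\<^sub>M I N) (\<lambda>\<omega>. (B + (\<Sum>i\<in>I. W i (\<omega> i))) + \<bar>\<beta>\<bar> * (B' + Vs \<omega>))"
    by (rule Bochner_Integration.integrable_add[OF envelope_integrable integrable_mult_right[OF
          Bochner_Integration.integrable_add[OF finite_measure.integrable_const[OF prob_space.finite_measure[OF prob_PiM]] iV]]])
  have eq: "(b t + \<beta> * p t) + (\<Sum>i\<in>I. x i t (\<omega> i) + \<beta> * v i t (\<omega> i)) = field b t \<omega> + \<beta> * (p t + vs t \<omega>)" for t \<omega>
    by (simp add: field_def vs_def sum.distrib sum_distrib_left algebra_simps)
  have ip: "integrable (Pi\<^sub>M I N) (\<lambda>\<omega>. \<integral>t. p t \<partial>?g \<omega>)"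
    by (rule T.gibbs_field_integrable(1)[OF fd pf]) simp
  have iv: "integrable (Pi\<^sub>M I N) (\<lambda>\<omega>. \<integral>t. vs t \<omega> \<partial>?g \<omega>)"
    by (rule T.gibbs_field_integrable(1)[OF fd vs iV])
  have ih: "integrable (Pi\<^sub>M I N) (\<lambda>\<omega>. \<Sum>i\<in>I. diag_excess (?g \<omega>) (h i))"
    by (intro Bochner_Integration.integrable_sum T.diag_excess_gibbs_integrable(1)[OF fd h])
  have il: "integrable (Pi\<^sub>M I N) (\<lambda>\<omega>. logint \<pi> (\<lambda>t. field b t \<omega>))" by (rule integrable_logint[OF b])
  have il': "integrable (Pi\<^sub>M I N) (\<lambda>\<omega>. logint \<pi> (\<lambda>t. field b t \<omega> + \<beta> * (p t + vs t \<omega>)))"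
    by (rule T.logint_integrable(1)[OF all iall])
  have "(\<integral>\<omega>. \<beta> * ((\<integral>t. p t \<partial>?g \<omega>) + (\<integral>t. vs t \<omega> \<partial>?g \<omega>)) \<partial>Pi\<^sub>M I N)
      \<le> (\<integral>\<omega>. logint \<pi> (\<lambda>t. field b t \<omega> + \<beta> * (p t + vs t \<omega>)) - logint \<pi> (\<lambda>t. field b t \<omega>) \<partial>Pi\<^sub>M I N)"
  proof (rule integral_mono)
    fix \<omega> assume w: "\<omega> \<in> space (Pi\<^sub>M I N)"
    interpret G: prob_space "?g \<omega>" by (rule mu.prob_space_gibbs[OF field_bdmeas[OF b w]])
    have i: "integrable (?g \<omega>) p" "integrable (?g \<omega>) (\<lambda>t. vs t \<omega>)"
      using p dom_field_bdmeas[OF vs w] by (auto intro!: G.bdmeas_integrable simp: mu.bdmeas_gibbs)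
    have eqi: "(\<integral>t. \<beta> * (p t + vs t \<omega>) \<partial>?g \<omega>) = \<beta> * ((\<integral>t. p t \<partial>?g \<omega>) + (\<integral>t. vs t \<omega> \<partial>?g \<omega>))"
      unfolding Bochner_Integration.integral_mult_right_zero using i by simp
    show "\<beta> * ((\<integral>t. p t \<partial>?g \<omega>) + (\<integral>t. vs t \<omega> \<partial>?g \<omega>))
        \<le> logint \<pi> (\<lambda>t. field b t \<omega> + \<beta> * (p t + vs t \<omega>)) - logint \<pi> (\<lambda>t. field b t \<omega>)"
      using mu.logint_tangent[OF field_bdmeas[OF b w] dom_field_bdmeas[OF dir w], unfolded eqi] by linarith
  qed (use ip iv il il' in auto)
  then have 1: "\<beta> * ((\<integral>\<omega>. (\<integral>t. p t \<partial>?g \<omega>) \<partial>Pi\<^sub>M I N) + (\<integral>\<omega>. (\<integral>t. vs t \<omega> \<partial>?g \<omega>) \<partial>Pi\<^sub>M I N))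
      \<le> (\<integral>\<omega>. logint \<pi> (\<lambda>t. field b t \<omega> + \<beta> * (p t + vs t \<omega>)) \<partial>Pi\<^sub>M I N) - (\<integral>\<omega>. logint \<pi> (\<lambda>t. field b t \<omega>) \<partial>Pi\<^sub>M I N)"
    using ip iv il il' by simp
  have 2: "\<bar>(\<integral>\<omega>. (\<integral>t. vs t \<omega> \<partial>?g \<omega>) \<partial>Pi\<^sub>M I N) - (\<integral>\<omega>. (\<Sum>i\<in>I. diag_excess (?g \<omega>) (h i)) \<partial>Pi\<^sub>M I N)\<bar> \<le> (\<Sum>i\<in>I. e i)"
    unfolding vs_def by (rule mean_gibbs_sum[OF b v V h single])
  have 3: "\<beta> * (X + Y) - \<bar>\<beta>\<bar> * E \<le> R" if "\<beta> * (X + Z) \<le> R" "\<bar>Z - Y\<bar> \<le> E" for X Y Z E R :: real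
  proof -
    have "\<beta> * (Y - Z) \<le> \<bar>\<beta>\<bar> * \<bar>Y - Z\<bar>" by (metis abs_ge_self abs_mult)
    also have "\<dots> \<le> \<bar>\<beta>\<bar> * E" using that(2) by (intro mult_left_mono) (auto simp: abs_minus_commute)
    finally show ?thesis using that(1) by (simp add: algebra_simps)
  qed
  show ?thesis unfolding eq using 3[OF 1 2] ip ih by simp
qed

end

text \<open>The error quantities of a local experiment are sums of scaled extended moments. The next lemmas
extract bounds in the sense of \<open>mean_le\<close> from them.\<close>

lemma ennreal_add_leD: "x + y \<le> z \<Longrightarrow> x \<le> z" "x + y \<le> z \<Longrightarrow> y \<le> z" for x y z :: ennreal
  by (auto intro: order_trans[OF add_increasing2[OF zero_le order_refl]] order_trans[OF add_increasing[OF zero_le order_refl]])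

lemma mean_le_of_scaled_moment:
  assumes le: "ennreal a * moment N f \<le> ennreal D" and m: "f \<in> borel_measurable N" and f: "\<And>w. w \<in> space N \<Longrightarrow> 0 \<le> f w"
    and nn: "0 \<le> a" "0 \<le> b" "0 \<le> D"
  shows "mean_le N (\<lambda>w. (b * a) * f w) (b * D)"
proof -
  note [measurable] = m
  have "(\<integral>\<^sup>+w. ennreal \<bar>(b * a) * f w\<bar> \<partial>N) = (\<integral>\<^sup>+w. ennreal b * (ennreal a * ennreal (f w)) \<partial>N)"
    using f nn by (intro nn_integral_cong) (simp add: abs_mult ennreal_mult[symmetric] mult.assoc)
  also have "\<dots> = ennreal b * (ennreal a * moment N f)"
    by (simp add: nn_integral_cmult)
  also have "\<dots> \<le> ennreal b * ennreal D" by (rule mult_left_mono[OF le]) simp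
  finally show ?thesis using nn by (simp add: mean_le_def ennreal_mult)
qed

lemma mean_le_of_scaled_root:
  assumes le: "ennreal a * esqrt (moment N (\<lambda>w. f w ^ 2)) \<le> ennreal D" and m: "f \<in> borel_measurable N"
    and nn: "0 < a" "0 \<le> b" "0 \<le> D"
  shows "mean_le N (\<lambda>w. ((b * a) * f w)\<^sup>2) ((b * D)\<^sup>2)"
proof -
  note [measurable] = m
  have "esqrt (moment N (\<lambda>w. f w ^ 2)) \<noteq> \<infinity>"
    using le nn by (auto simp: ennreal_mult_top top_unique)
  then have fin: "moment N (\<lambda>w. f w ^ 2) \<noteq> \<infinity>" by (auto simp: esqrt_def)
  then obtain m where m: "moment N (\<lambda>w. f w ^ 2) = ennreal m" "0 \<le> m" by (cases "moment N (\<lambda>w. f w ^ 2)") auto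
  have "ennreal (a * sqrt m) \<le> ennreal D"
    using le m nn by (simp add: esqrt_def ennreal_mult)
  then have "a * sqrt m \<le> D" using nn by simp
  then have "(a * sqrt m)\<^sup>2 \<le> D\<^sup>2" using nn m by (intro power_mono) auto
  then have am: "a\<^sup>2 * m \<le> D\<^sup>2" using m by (simp add: power_mult_distrib)
  have "(\<integral>\<^sup>+w. ennreal \<bar>((b * a) * f w)\<^sup>2\<bar> \<partial>N) = (\<integral>\<^sup>+w. ennreal ((b * a)\<^sup>2) * ennreal (f w ^ 2) \<partial>N)"
    by (intro nn_integral_cong) (simp add: power_mult_distrib ennreal_mult[symmetric])
  also have "\<dots> = ennreal ((b * a)\<^sup>2) * ennreal m" by (simp add: nn_integral_cmult m)
  also have "\<dots> = ennreal (b\<^sup>2 * (a\<^sup>2 * m))" using m by (simp add: ennreal_mult[symmetric] power_mult_distrib mult.assoc)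
  also have "\<dots> \<le> ennreal (b\<^sup>2 * D\<^sup>2)" using am by (intro ennreal_leI mult_left_mono) auto
  finally show ?thesis by (simp add: mean_le_def power_mult_distrib)
qed

text \<open>A deterministic part of the exponent is absorbed into the prior.\<close>

lemma (in two_probs) mean_logint_shift:
  assumes x: "dom_field \<mu> N W x" and W: "integrable N W" and b: "bdmeas \<mu> B b"
  shows "(\<integral>w. logint \<mu> (\<lambda>t. b t + x t w) \<partial>N) = logint \<mu> b + (\<integral>w. logint (gibbs \<mu> b) (\<lambda>t. x t w) \<partial>N)"
proof -
  interpret g: two_probs "gibbs \<mu> b" N
    using mu.prob_space_gibbs[OF b] N.prob_space_axioms by (simp add: two_probs_def)
  have xg: "dom_field (gibbs \<mu> b) N W x" using x dom_field_cong_sets[OF mu.sets_gibbs refl] by blast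
  have "(\<integral>w. logint \<mu> (\<lambda>t. b t + x t w) \<partial>N) = (\<integral>w. logint \<mu> b + logint (gibbs \<mu> b) (\<lambda>t. x t w) \<partial>N)"
    by (rule Bochner_Integration.integral_cong[OF refl]) (rule mu.logint_add[OF b dom_field_bdmeas[OF x]])
  then show ?thesis using g.logint_integrable(1)[OF xg W] by (simp add: N.prob_space)
qed

section \<open>The local experiment at a fixed parameter\<close>

text \<open>One sample size and one parameter \<open>\<theta>\<close>, with all constants made explicit: \<open>D\<close> bounds the sum of the local
errors at \<open>\<theta>\<close>, \<open>c\<^sup>2\<close> the second moments under the null laws, and \<open>c\<close> the numbers \<open>1 + \<parallel>B\<^sub>m\<parallel>\<close>. The error bound is strictly positive because it is
used as a scale.\<close>

locale regular_model =
  fixes E :: "('p, 'w, 'h::{real_inner,banach,second_countable_topology}, 'q) gauss_experiment"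
    and \<theta> :: 'p and a c D :: real
  assumes reg: "regular_experiment E" and gc: "gaussian_counterpart E" and dirs: "directions E"
    and th: "\<theta> \<in> topspace (Theta E)" and c: "1 \<le> c" and D: "0 < D"
    and L: "\<And>m. m \<in> {1..comps E} \<Longrightarrow> L_loc E m \<le> ennreal (c\<^sup>2)"
    and errs: "\<And>m. m \<in> {1..comps E} \<Longrightarrow>
        err_U E m \<theta> + err_S E m \<theta> + err_V E m \<theta> + err_R E m \<theta> + err_D E m \<theta> \<le> ennreal D"
    and U_mean: "\<And>m. m \<in> {1..comps E} \<Longrightarrow> (\<integral>w. Uvec E m w \<partial>P0 E m) = 0"
    and Bop_le: "\<And>m. m \<in> {1..comps E} \<Longrightarrow> 1 + norm (Bop E m) \<le> c"
begin

abbreviation I where "I \<equiv> {1..comps E}"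
abbreviation r where "r \<equiv> radius E"
abbreviation T where "T \<equiv> Tset E"
abbreviation \<pi> where "\<pi> \<equiv> prior E"
abbreviation X where "X \<equiv> subtopology (Theta E) T"
abbreviation P where "P m \<equiv> P0 E m"
abbreviation Q where "Q m \<equiv> Pth E m \<theta>"

lemma topology:
  "compact_space (Theta E)" "T \<subseteq> topspace (Theta E)" "compact_space X" "metrizable_space X" "prob_space \<pi>" "space \<pi> = T"
  "space \<pi> = topspace X" "sets \<pi> = sets (borel_of X)" "0 < r"
proof -
  show "compact_space X" using reg by (simp add: regular_experiment_def compactin_subspace)
  show "space \<pi> = topspace X" using reg by (auto simp: regular_experiment_def topspace_subtopology)
qed (use reg in \<open>auto simp: regular_experiment_def\<close>)

lemma component:
  assumes m: "m \<in> I"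
  shows "subspace (hilb E m)" "continuous_map (Theta E) (top_of_set (hilb E m)) (feat E m)" "prob_space (P m)"
    "Uvec E m \<in> borel_measurable (P m)" "Svec E m \<in> borel_measurable (P m)"
    "\<And>h. (\<lambda>w. blinfun_apply (Vop E m w) h) \<in> borel_measurable (P m)"
    "\<And>t. t \<in> T \<Longrightarrow> Rrem E m t \<in> borel_measurable (P m)"
    "(\<lambda>w. SUP t\<in>T. ennreal (\<bar>Rrem E m t w\<bar> ^ 3)) \<in> borel_measurable (P m)"
    "Drem E m \<theta> \<in> borel_measurable (P m)" "prob_space (Q m)"
    "Q m = density (P m) (\<lambda>w. ennreal (exp (Svec E m w \<bullet> feat E m \<theta> + Drem E m \<theta> w)))"
  using reg m th unfolding regular_experiment_def by blast+

lemma paths: "\<omega> \<in> space (Pi\<^sub>M I (P0 E)) \<Longrightarrow> continuous_map X euclidean (\<lambda>t. Xproc E t \<omega>)"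
  using reg unfolding regular_experiment_def by blast

lemma sets_Q: "m \<in> I \<Longrightarrow> sets (Q m) = sets (P m)" and space_Q: "m \<in> I \<Longrightarrow> space (Q m) = space (P m)"
  by (simp_all add: component(11))

lemma feat:
  assumes m: "m \<in> I"
  shows feat_continuous: "continuous_map (Theta E) euclidean (feat E m)"
    and feat_in: "u \<in> topspace (Theta E) \<Longrightarrow> feat E m u \<in> hilb E m"
    and feat_le: "u \<in> topspace (Theta E) \<Longrightarrow> norm (feat E m u) \<le> r"
    and feat_X: "continuous_map X euclidean (feat E m)"
    and feat_measurable: "feat E m \<in> borel_measurable \<pi>"
proof -
  show fc: "continuous_map (Theta E) euclidean (feat E m)"
    by (rule continuous_map_into_fulltopology[OF component(2)[OF m]])
  show "u \<in> topspace (Theta E) \<Longrightarrow> feat E m u \<in> hilb E m"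
    using component(2)[OF m] by (auto simp: continuous_map_in_subtopology)
  show fX: "continuous_map X euclidean (feat E m)" by (rule continuous_map_from_subtopology[OF fc])
  show "feat E m \<in> borel_measurable \<pi>"
    by (rule continuous_map_borel_measurable[OF fX topology(7,8)])
  have "compactin euclidean (feat E m ` topspace (Theta E))"
    using image_compactin[OF _ fc] topology(1) by (simp add: compact_space_def)
  then have "compact (feat E m ` topspace (Theta E))" by simp
  then have "bounded (feat E m ` topspace (Theta E))" by (rule compact_imp_bounded)
  then have bdd: "bdd_above ((\<lambda>u. norm (feat E m u)) ` topspace (Theta E))"
    by (auto simp: bounded_iff bdd_above_def)
  show "norm (feat E m u) \<le> r" if u: "u \<in> topspace (Theta E)"
  proof -
    have "norm (feat E m u) \<le> (SUP u\<in>topspace (Theta E). norm (feat E m u))" by (rule cSUP_upper[OF u bdd])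
    also have "\<dots> \<le> r" unfolding radius_def using m by (intro Max_ge) auto
    finally show ?thesis .
  qed
qed

lemma P_space_nonempty: "m \<in> I \<Longrightarrow> \<exists>w. w \<in> space (P m)"
  using prob_space.not_empty[OF component(3)] by blast

text \<open>Only the sum \<open>X\<close> over the components has continuous paths by assumption. Changing a single coordinate
isolates one component, and the linear and quadratic terms are continuous in \<open>t\<close> because the features are;
so increments \<open>R(t, w) - R(t, w')\<close> of a single remainder are continuous in \<open>t\<close>, although \<open>R(t, w)\<close> itself need
not be measurable in \<open>t\<close>.\<close>

lemma remainder_increment_continuous:
  assumes m: "m \<in> I" and w: "w \<in> space (P m)" "w' \<in> space (P m)"
  shows "continuous_map X euclidean (\<lambda>t. Rrem E m t w - Rrem E m t w')"
proof -
  define \<omega>0 where "\<omega>0 = (\<lambda>k\<in>I. SOME v. v \<in> space (P k))"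
  define om where "om = (\<lambda>v. fun_upd \<omega>0 m v)"
  have om: "om v \<in> space (Pi\<^sub>M I (P0 E))" if "v \<in> space (P m)" for v
    using that m someI_ex[OF P_space_nonempty] by (auto simp: om_def \<omega>0_def space_PiM PiE_iff extensional_def)
  have X: "Xproc E t (om v) = Xcomp E m t v + (\<Sum>k\<in>I - {m}. Xcomp E k t (\<omega>0 k))" for t v
  proof -
    have "Xproc E t (om v) = Xcomp E m t (om v m) + (\<Sum>k\<in>I - {m}. Xcomp E k t (om v k))"
      unfolding Xproc_def by (rule sum.remove) (use m in auto)
    also have "(\<Sum>k\<in>I - {m}. Xcomp E k t (om v k)) = (\<Sum>k\<in>I - {m}. Xcomp E k t (\<omega>0 k))"
      by (rule sum.cong) (auto simp: om_def)
    also have "om v m = v" by (simp add: om_def)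
    finally show ?thesis .
  qed
  define g where "g = (\<lambda>h. - (Uvec E m w - Uvec E m w') \<bullet> h
      + 1/2 * (blinfun_apply (Vop E m w) h \<bullet> h - blinfun_apply (Vop E m w') h \<bullet> h))"
  have "continuous_on UNIV g" unfolding g_def by (intro continuous_intros)
  then have "continuous_map euclidean euclidean g" by simp
  from continuous_map_compose[OF feat_X[OF m] this]
  have "continuous_map X euclidean (\<lambda>t. g (feat E m t))" by (simp add: comp_def)
  then have "continuous_map X euclidean (\<lambda>t. (Xproc E t (om w) - Xproc E t (om w')) + g (feat E m t))"
    by (intro continuous_map_add continuous_map_diff paths om w)
  then show ?thesis unfolding X g_def by (simp add: Xcomp_def inner_diff_left algebra_simps)
qed

lemma errors_le:
  assumes m: "m \<in> I"
  shows "err_U E m \<theta> \<le> ennreal D" "err_S E m \<theta> \<le> ennreal D" "err_V E m \<theta> \<le> ennreal D"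
    "err_R E m \<theta> \<le> ennreal D" "err_D E m \<theta> \<le> ennreal D"
  using errs[OF m] by (meson ennreal_add_leD)+

text \<open>Every component satisfies the hypotheses collected in \<open>likelihood_component\<close>. The envelope \<open>\<rho>\<close> is the
supremum over \<open>T\<close> of the absolute value of the remainder. It is finite at almost every sample point, hence at some point
\<open>w0\<close>, and then everywhere because increments of the remainder are continuous on a compact space.\<close>

lemma obtain_likelihood_component:
  assumes m: "m \<in> I"
  obtains \<rho> where "likelihood_component (P m) (Q m) (\<lambda>w. Svec E m w \<bullet> feat E m \<theta> + Drem E m \<theta> w) r D
    (Svec E m) (Drem E m \<theta>) c (hilb E m) (Uvec E m) (Vop E m) (Rrem E m) \<rho> (Kop E m) (Sigma_op E m)
    (blinfun_apply (Aop E m) (feat E m \<theta>)) T (feat E m) (feat E m \<theta>)"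
proof -
  note co = component[OF m]
  interpret P: prob_space "P m" by (rule co(3))
  interpret Q: prob_space "Q m" by (rule co(10))
  note [measurable] = co(4,5,6,9)
  have nV[measurable]: "(\<lambda>w. norm (Vop E m w)) \<in> borel_measurable (P m)" by (rule norm_operator_measurable) measurable
  have mQ: "borel_measurable (Q m) = borel_measurable (P m)" by (rule measurable_cong_sets[OF sets_Q[OF m] refl])
  have r: "0 < r" by (rule topology)
  have D0: "0 \<le> D" using D by simp
  note se = errors_le[OF m]
  have third: "mean_le (P m) (\<lambda>w. (b * aa) * f w) (b * D)" "mean_le (Q m) (\<lambda>w. (b * aa) * f w) (b * D)"
    if le: "ennreal aa * (moment (P m) f + moment (Q m) f) \<le> ennreal D"
      and f: "f \<in> borel_measurable (P m)" "\<And>w. 0 \<le> f w" and ab: "0 \<le> aa" "0 \<le> b" for f aa b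
  proof -
    have le': "ennreal aa * moment (P m) f \<le> ennreal D" "ennreal aa * moment (Q m) f \<le> ennreal D"
      using le unfolding distrib_left by (meson ennreal_add_leD)+
    show "mean_le (P m) (\<lambda>w. (b * aa) * f w) (b * D)"
      by (rule mean_le_of_scaled_moment[OF le'(1)]) (use f ab D0 in auto)
    show "mean_le (Q m) (\<lambda>w. (b * aa) * f w) (b * D)"
      by (rule mean_le_of_scaled_moment[OF le'(2)]) (use f ab D0 in \<open>auto simp: mQ\<close>)
  qed
  have r3: "r\<^sup>2 * r * y ^ 3 = (r * y) ^ 3" "r\<^sup>2 * r ^ 4 * y ^ 3 = (r\<^sup>2 * y) ^ 3" "r\<^sup>2 * (1 / r\<^sup>2) * y = y" for y :: real
    using r by (simp_all add: power_mult_distrib eval_nat_numeral)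
  have U3: "mean_le (P m) (\<lambda>w. (r * norm (Uvec E m w)) ^ 3) (r\<^sup>2 * D)" "mean_le (Q m) (\<lambda>w. (r * norm (Uvec E m w)) ^ 3) (r\<^sup>2 * D)"
    using third[of r "\<lambda>w. norm (Uvec E m w) ^ 3" "r\<^sup>2"] se(1) r unfolding err_U_def r3 by auto
  have S3: "mean_le (P m) (\<lambda>w. (r * norm (Svec E m w)) ^ 3) (r\<^sup>2 * D)" "mean_le (Q m) (\<lambda>w. (r * norm (Svec E m w)) ^ 3) (r\<^sup>2 * D)"
    using third[of r "\<lambda>w. norm (Svec E m w) ^ 3" "r\<^sup>2"] se(2) r unfolding err_S_def r3 by auto
  have V: "ennreal r * esqrt (moment (P m) (\<lambda>w. norm (Vop E m w) ^ 2)) \<le> ennreal D"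
    "ennreal (r ^ 4) * (moment (P m) (\<lambda>w. norm (Vop E m w) ^ 3) + moment (Q m) (\<lambda>w. norm (Vop E m w) ^ 3)) \<le> ennreal D"
    using se(3) unfolding err_V_def by (meson ennreal_add_leD)+
  have V3: "mean_le (P m) (\<lambda>w. (r\<^sup>2 * norm (Vop E m w)) ^ 3) (r\<^sup>2 * D)" "mean_le (Q m) (\<lambda>w. (r\<^sup>2 * norm (Vop E m w)) ^ 3) (r\<^sup>2 * D)"
    using third[of "r ^ 4" "\<lambda>w. norm (Vop E m w) ^ 3" "r\<^sup>2"] V(2) r unfolding r3 by auto
  have V2: "mean_le (P m) (\<lambda>w. (r\<^sup>2 * norm (Vop E m w))\<^sup>2) ((r * D)\<^sup>2)"
    using mean_le_of_scaled_root[OF V(1) nV r, of r] r D0 by (simp add: power2_eq_square[of r])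
  have Dl: "ennreal (1 / r) * esqrt (moment (P m) (\<lambda>w. \<bar>Drem E m \<theta> w\<bar> ^ 2)) \<le> ennreal D"
    "ennreal (1 / r\<^sup>2) * (moment (P m) (\<lambda>w. \<bar>Drem E m \<theta> w\<bar> ^ 3) + moment (Q m) (\<lambda>w. \<bar>Drem E m \<theta> w\<bar> ^ 3)) \<le> ennreal D"
    using se(5) unfolding err_D_def by (meson ennreal_add_leD)+
  have D3: "mean_le (P m) (\<lambda>w. \<bar>Drem E m \<theta> w\<bar> ^ 3) (r\<^sup>2 * D)" "mean_le (Q m) (\<lambda>w. \<bar>Drem E m \<theta> w\<bar> ^ 3) (r\<^sup>2 * D)"
    using third[of "1 / r\<^sup>2" "\<lambda>w. \<bar>Drem E m \<theta> w\<bar> ^ 3" "r\<^sup>2"] Dl(2) r unfolding r3 by auto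
  have D2: "mean_le (P m) (\<lambda>w. (Drem E m \<theta> w)\<^sup>2) ((r * D)\<^sup>2)"
    using mean_le_of_scaled_root[OF Dl(1), of r] r D0 by simp
  have Lm: "moment (P m) (\<lambda>w. norm (Uvec E m w) ^ 2) \<le> ennreal (c\<^sup>2)" "moment (P m) (\<lambda>w. norm (Svec E m w) ^ 2) \<le> ennreal (c\<^sup>2)"
    using L[OF m] unfolding L_loc_def by (meson ennreal_add_leD)+
  have U2: "mean_le (P m) (\<lambda>w. (r * norm (Uvec E m w))\<^sup>2) ((c * r)\<^sup>2)"
    using mean_le_of_scaled_moment[of 1 "P m" "\<lambda>w. norm (Uvec E m w) ^ 2" "c\<^sup>2" "r\<^sup>2"] Lm by (simp add: power_mult_distrib mult.commute)
  have S2: "mean_le (P m) (\<lambda>w. (r * norm (Svec E m w))\<^sup>2) ((c * r)\<^sup>2)"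
    using mean_le_of_scaled_moment[of 1 "P m" "\<lambda>w. norm (Svec E m w) ^ 2" "c\<^sup>2" "r\<^sup>2"] Lm by (simp add: power_mult_distrib mult.commute)
  let ?S = "\<lambda>w. SUP t\<in>T. ennreal (\<bar>Rrem E m t w\<bar> ^ 3)"
  have R: "(SUP t\<in>T. ennreal (1 / r\<^sup>2) * ennreal \<bar>\<integral>w. Rrem E m t w \<partial>P m\<bar> +
        ennreal (1 / r) * esqrt (moment (P m) (\<lambda>w. \<bar>Rrem E m t w\<bar> ^ 2)) +
        ennreal (1 / r\<^sup>2) * moment (P m) (\<lambda>w. \<bar>Rrem E m t w\<bar> ^ 3)) \<le> ennreal D"
    "ennreal (1 / r\<^sup>2) * (\<integral>\<^sup>+ w. ?S w \<partial>Q m) \<le> ennreal D"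
    using se(4) unfolding err_R_def by (meson ennreal_add_leD)+
  have Rt: "ennreal (1 / r\<^sup>2) * ennreal \<bar>\<integral>w. Rrem E m t w \<partial>P m\<bar> \<le> ennreal D"
    "ennreal (1 / r) * esqrt (moment (P m) (\<lambda>w. \<bar>Rrem E m t w\<bar> ^ 2)) \<le> ennreal D"
    "ennreal (1 / r\<^sup>2) * moment (P m) (\<lambda>w. \<bar>Rrem E m t w\<bar> ^ 3) \<le> ennreal D" if t: "t \<in> T" for t
    using order_trans[OF SUP_upper[OF t] R(1)] by (meson ennreal_add_leD)+
  have R1: "\<bar>\<integral>w. Rrem E m t w \<partial>P m\<bar> \<le> r\<^sup>2 * D" if t: "t \<in> T" for t
  proof -
    have "ennreal ((1 / r\<^sup>2) * \<bar>\<integral>w. Rrem E m t w \<partial>P m\<bar>) \<le> ennreal D" using Rt(1)[OF t] by (subst ennreal_mult) auto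
    then have "(1 / r\<^sup>2) * \<bar>\<integral>w. Rrem E m t w \<partial>P m\<bar> \<le> D" using D0 by simp
    then show ?thesis using r by (simp add: field_simps)
  qed
  have R2: "mean_le (P m) (\<lambda>w. (Rrem E m t w)\<^sup>2) ((r * D)\<^sup>2)" if t: "t \<in> T" for t
    using mean_le_of_scaled_root[OF Rt(2)[OF t], of r] r D0 co(7)[OF t] by simp
  have R3: "mean_le (P m) (\<lambda>w. \<bar>Rrem E m t w\<bar> ^ 3) (r\<^sup>2 * D)" if t: "t \<in> T" for t
    using mean_le_of_scaled_moment[OF Rt(3)[OF t], of "r\<^sup>2"] r D0 co(7)[OF t] by simp
  have "(\<integral>\<^sup>+ w. ?S w \<partial>Q m) \<noteq> \<infinity>" using R(2) r by (auto simp: ennreal_mult_top top_unique)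
  then have "AE w in Q m. ?S w \<noteq> \<infinity>" using co(8) by (intro nn_integral_PInf_AE) (auto simp: mQ)
  then have "\<exists>w\<in>space (Q m). ?S w \<noteq> \<infinity>"
  proof (rule contrapos_pp)
    assume no: "\<not> (\<exists>w\<in>space (Q m). ?S w \<noteq> \<infinity>)"
    show "\<not> (AE w in Q m. ?S w \<noteq> \<infinity>)"
    proof
      assume "AE w in Q m. ?S w \<noteq> \<infinity>"
      then have "AE w in Q m. False" by (rule AE_mp) (use no in \<open>auto intro!: AE_I2\<close>)
      then show False by simp
    qed
  qed
  then obtain w0 where w0: "w0 \<in> space (P m)" "?S w0 \<noteq> \<infinity>" by (auto simp: space_Q[OF m])
  have Sfin: "?S w \<noteq> \<infinity>" if w: "w \<in> space (P m)" for w
  proof -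
    have "compactin euclidean ((\<lambda>t. Rrem E m t w - Rrem E m t w0) ` topspace X)"
      using image_compactin[OF _ remainder_increment_continuous[OF m w w0(1)]] topology(3) by (simp add: compact_space_def)
    then have "bounded ((\<lambda>t. Rrem E m t w - Rrem E m t w0) ` T)"
      using topology(6,7) by (simp add: compact_imp_bounded)
    then obtain B where B: "\<And>t. t \<in> T \<Longrightarrow> \<bar>Rrem E m t w - Rrem E m t w0\<bar> \<le> B" by (auto simp: bounded_iff)
    define s0 where "s0 = enn2real (?S w0)"
    have s0: "?S w0 = ennreal s0" unfolding s0_def by (rule ennreal_enn2real[symmetric]) (use w0(2) in \<open>simp only: less_top infinity_ennreal_def not_False_eq_True\<close>)
    have "ennreal (\<bar>Rrem E m t w\<bar> ^ 3) \<le> ennreal (4 * (s0 + \<bar>B\<bar> ^ 3))" if t: "t \<in> T" for t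
    proof (rule ennreal_leI)
      have "ennreal (\<bar>Rrem E m t w0\<bar> ^ 3) \<le> ennreal s0" unfolding s0[symmetric] by (rule SUP_upper[OF t])
      then have 1: "\<bar>Rrem E m t w0\<bar> ^ 3 \<le> s0" by (simp add: s0_def)
      have "\<bar>Rrem E m t w\<bar> \<le> \<bar>Rrem E m t w0\<bar> + \<bar>B\<bar>" using B[OF t] by linarith
      then have "\<bar>Rrem E m t w\<bar> ^ 3 \<le> (\<bar>Rrem E m t w0\<bar> + \<bar>B\<bar>) ^ 3" by (intro power_mono) auto
      also have "\<dots> \<le> 4 * (\<bar>Rrem E m t w0\<bar> ^ 3 + \<bar>B\<bar> ^ 3)" by (intro cube_sum2) auto
      finally show "\<bar>Rrem E m t w\<bar> ^ 3 \<le> 4 * (s0 + \<bar>B\<bar> ^ 3)" using 1 by simp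
    qed
    then have "?S w \<le> ennreal (4 * (s0 + \<bar>B\<bar> ^ 3))" by (intro SUP_least)
    also have "\<dots> < top" by simp
    finally show ?thesis unfolding infinity_ennreal_def by (rule less_imp_neq)
  qed
  define \<rho> where "\<rho> = (\<lambda>w. root 3 (enn2real (?S w)))"
  have \<rho>m[measurable]: "\<rho> \<in> borel_measurable (P m)" unfolding \<rho>_def using co(8) by measurable
  have \<rho>3: "ennreal (\<rho> w ^ 3) = ?S w" if "w \<in> space (P m)" for w
  proof -
    have "?S w < top" using Sfin[OF that] by (simp only: less_top infinity_ennreal_def)
    from ennreal_enn2real[OF this] show ?thesis by (simp add: \<rho>_def)
  qed
  have \<rho>0: "0 \<le> \<rho> w" for w by (simp add: \<rho>_def)
  have \<rho>R: "\<bar>Rrem E m t w\<bar> \<le> \<rho> w" if t: "t \<in> T" and w: "w \<in> space (P m)" for t w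
  proof -
    have "ennreal (\<bar>Rrem E m t w\<bar> ^ 3) \<le> ennreal (\<rho> w ^ 3)" unfolding \<rho>3[OF w] by (rule SUP_upper[OF t])
    then have "\<bar>Rrem E m t w\<bar> ^ 3 \<le> \<rho> w ^ 3" using \<rho>0 by simp
    then show ?thesis using \<rho>0 power_mono_iff[of "\<bar>Rrem E m t w\<bar>" "\<rho> w" 3] by simp
  qed
  have \<rho>N: "mean_le (Q m) (\<lambda>w. \<rho> w ^ 3) (r\<^sup>2 * D)"
  proof -
    have "(\<integral>\<^sup>+ w. ennreal (\<rho> w ^ 3) \<partial>Q m) = (\<integral>\<^sup>+ w. ?S w \<partial>Q m)"
      using \<rho>3 space_Q[OF m] by (intro nn_integral_cong) simp
    then have "ennreal (1 / r\<^sup>2) * moment (Q m) (\<lambda>w. \<rho> w ^ 3) \<le> ennreal D" using R(2) by simp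
    from mean_le_of_scaled_moment[OF this, of "r\<^sup>2"] show ?thesis using r D0 \<rho>0 by (simp add: mQ)
  qed
  have gcm: "Aop E m \<in> ops_on (hilb E m)"
    "\<And>h g. h \<in> hilb E m \<Longrightarrow> g \<in> hilb E m \<Longrightarrow> blinfun_apply (Aop E m) h \<bullet> g = (\<integral>w. (Svec E m w \<bullet> h) * (Uvec E m w \<bullet> g) \<partial>P m)"
    "\<And>h g. h \<in> hilb E m \<Longrightarrow> g \<in> hilb E m \<Longrightarrow> blinfun_apply (Sigma_op E m) h \<bullet> g = (\<integral>w. (Uvec E m w \<bullet> h) * (Uvec E m w \<bullet> g) \<partial>P m)"
    "\<And>h g. h \<in> hilb E m \<Longrightarrow> g \<in> hilb E m \<Longrightarrow> blinfun_apply (Kop E m) h \<bullet> g = (\<integral>w. blinfun_apply (Vop E m w) h \<bullet> g \<partial>P m)"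
    using gc m unfolding gaussian_counterpart_def by blast+
  have \<eta>\<theta>: "feat E m \<theta> \<in> hilb E m" "norm (feat E m \<theta>) \<le> r" using feat_in[OF m th] feat_le[OF m th] by auto
  have lc: "likelihood_component (P m) (Q m) (\<lambda>w. Svec E m w \<bullet> feat E m \<theta> + Drem E m \<theta> w) r D
    (Svec E m) (Drem E m \<theta>) c (hilb E m) (Uvec E m) (Vop E m) (Rrem E m) \<rho> (Kop E m) (Sigma_op E m)
    (blinfun_apply (Aop E m) (feat E m \<theta>)) T (feat E m) (feat E m \<theta>)"
  proof unfold_locales
    show "Q m = density (P m) (\<lambda>w. ennreal (exp (Svec E m w \<bullet> feat E m \<theta> + Drem E m \<theta> w)))" by (rule co(11))
    show "\<bar>Svec E m w \<bullet> feat E m \<theta> + Drem E m \<theta> w\<bar> \<le> r * norm (Svec E m w) + \<bar>Drem E m \<theta> w\<bar>" for w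
    proof -
      have "\<bar>Svec E m w \<bullet> feat E m \<theta>\<bar> \<le> norm (Svec E m w) * norm (feat E m \<theta>)" by (rule Cauchy_Schwarz_ineq2)
      also have "\<dots> \<le> r * norm (Svec E m w)" unfolding mult.commute[of r] using \<eta>\<theta>(2) by (rule mult_left_mono) simp
      finally show ?thesis by linarith
    qed
    show "\<And>t. t \<in> T \<Longrightarrow> feat E m t \<in> hilb E m" "\<And>t. t \<in> T \<Longrightarrow> norm (feat E m t) \<le> r"
      using feat_in[OF m] feat_le[OF m] topology(2) by auto
    show "blinfun_apply (Aop E m) (feat E m \<theta>) \<in> hilb E m" using gcm(1) by (simp add: ops_on_def)
    show "\<And>t. t \<in> T \<Longrightarrow> \<bar>\<integral>w. Rrem E m t w \<partial>P m\<bar> \<le> r\<^sup>2 * D" by (rule R1)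
    show "mean_le (P m) (\<lambda>w. (r * norm (Svec E m w)) ^ 3) (r\<^sup>2 * D)" "mean_le (Q m) (\<lambda>w. (r * norm (Svec E m w)) ^ 3) (r\<^sup>2 * D)"
      "mean_le (P m) (\<lambda>w. \<bar>Drem E m \<theta> w\<bar> ^ 3) (r\<^sup>2 * D)" "mean_le (Q m) (\<lambda>w. \<bar>Drem E m \<theta> w\<bar> ^ 3) (r\<^sup>2 * D)"
      by (fact S3 D3)+
    show "\<And>w. 0 \<le> r * norm (Svec E m w)" using r by simp
    show "(\<lambda>w. blinfun_apply (Vop E m w) h \<bullet> g) \<in> borel_measurable (P m)" for h g by measurable
    show "0 < r" "0 < D" "1 \<le> c" "subspace (hilb E m)" "feat E m \<theta> \<in> hilb E m" "norm (feat E m \<theta>) \<le> r"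
      by (fact r D c co(1) \<eta>\<theta>(1) \<eta>\<theta>(2))+
    show "(\<lambda>w. Svec E m w \<bullet> feat E m \<theta> + Drem E m \<theta> w) \<in> borel_measurable (P m)"
      "(\<lambda>w. r * norm (Svec E m w)) \<in> borel_measurable (P m)" "(\<lambda>w. \<bar>Drem E m \<theta> w\<bar>) \<in> borel_measurable (P m)"
      by measurable
    show "Svec E m \<in> borel_measurable (P m)" "Drem E m \<theta> \<in> borel_measurable (P m)" "Uvec E m \<in> borel_measurable (P m)"
      "(\<integral>w. Uvec E m w \<partial>P m) = 0" "(\<lambda>w. norm (Vop E m w)) \<in> borel_measurable (P m)" "\<rho> \<in> borel_measurable (P m)"
      by (fact co(5) co(9) co(4) U_mean[OF m] nV \<rho>m)+
    show "mean_le (P m) (\<lambda>w. (r * norm (Uvec E m w))\<^sup>2) ((c * r)\<^sup>2)" "mean_le (P m) (\<lambda>w. (r * norm (Svec E m w))\<^sup>2) ((c * r)\<^sup>2)"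
      "mean_le (P m) (\<lambda>w. (r * norm (Uvec E m w)) ^ 3) (r\<^sup>2 * D)" "mean_le (Q m) (\<lambda>w. (r * norm (Uvec E m w)) ^ 3) (r\<^sup>2 * D)"
      "mean_le (P m) (\<lambda>w. (r\<^sup>2 * norm (Vop E m w))\<^sup>2) ((r * D)\<^sup>2)"
      "mean_le (P m) (\<lambda>w. (r\<^sup>2 * norm (Vop E m w)) ^ 3) (r\<^sup>2 * D)" "mean_le (Q m) (\<lambda>w. (r\<^sup>2 * norm (Vop E m w)) ^ 3) (r\<^sup>2 * D)"
      "mean_le (P m) (\<lambda>w. (Drem E m \<theta> w)\<^sup>2) ((r * D)\<^sup>2)" "mean_le (Q m) (\<lambda>w. \<rho> w ^ 3) (r\<^sup>2 * D)"
      by (fact U2 S2 U3 V2 V3 D2 \<rho>N)+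
    show "\<And>t. t \<in> T \<Longrightarrow> Rrem E m t \<in> borel_measurable (P m)" by (rule co(7))
    show "\<And>t. t \<in> T \<Longrightarrow> mean_le (P m) (\<lambda>w. (Rrem E m t w)\<^sup>2) ((r * D)\<^sup>2)" by (rule R2)
    show "\<And>t. t \<in> T \<Longrightarrow> mean_le (P m) (\<lambda>w. \<bar>Rrem E m t w\<bar> ^ 3) (r\<^sup>2 * D)" by (rule R3)
    show "\<And>t w. t \<in> T \<Longrightarrow> w \<in> space (P m) \<Longrightarrow> \<bar>Rrem E m t w\<bar> \<le> \<rho> w" by (rule \<rho>R)
    show "\<And>w. 0 \<le> \<rho> w" by (rule \<rho>0)
    show "\<And>g. g \<in> hilb E m \<Longrightarrow> blinfun_apply (Aop E m) (feat E m \<theta>) \<bullet> g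
        = (\<integral>w. (Svec E m w \<bullet> feat E m \<theta>) * (Uvec E m w \<bullet> g) \<partial>P m)" by (rule gcm(2)[OF \<eta>\<theta>(1)])
    show "\<And>h g. h \<in> hilb E m \<Longrightarrow> g \<in> hilb E m \<Longrightarrow> blinfun_apply (Sigma_op E m) h \<bullet> g = (\<integral>w. (Uvec E m w \<bullet> h) * (Uvec E m w \<bullet> g) \<partial>P m)" by (rule gcm(3))
    show "\<And>h g. h \<in> hilb E m \<Longrightarrow> g \<in> hilb E m \<Longrightarrow> blinfun_apply (Kop E m) h \<bullet> g = (\<integral>w. blinfun_apply (Vop E m w) h \<bullet> g \<partial>P m)" by (rule gcm(4))
  qed (rule abs_ge_zero refl)+
  then show thesis by (rule that)
qed


text \<open>The component fields of the perturbed processes. The perturbation with parameter \<open>\<beta>\<close> moves the direction of the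
linear term from \<open>\<eta>\<close> to \<open>\<eta> + \<beta> B \<eta>\<close> and leaves the quadratic term and the remainder alone; all fields are (nearly) centred under the laws at \<open>\<theta>\<close>.
Laws of components outside the index range are filled up by a point mass.\<close>

definition B_feat where "B_feat m t = blinfun_apply (Bop E m) (feat E m t)"
definition feat_dir where "feat_dir \<beta> m t = feat E m t + \<beta> *\<^sub>R B_feat m t"
definition \<alpha> where "\<alpha> m = blinfun_apply (Aop E m) (feat E m \<theta>)"
definition cent where "cent m t = (\<integral>w. Rrem E m t w \<partial>P m)"
definition comp_quad where
  "comp_quad m t w = - (1/2) * (blinfun_apply (Vop E m w) (feat E m t) \<bullet> feat E m t - blinfun_apply (Kop E m) (feat E m t) \<bullet> feat E m t)
    + (Rrem E m t w - cent m t)"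
definition comp_field where "comp_field \<beta> m t w = (Uvec E m w - \<alpha> m) \<bullet> feat_dir \<beta> m t + comp_quad m t w"
definition comp_tilt where "comp_tilt m t w = (Uvec E m w - \<alpha> m) \<bullet> B_feat m t"
definition H_kernel where "H_kernel m s t = blinfun_apply (Hop E m) (feat E m s) \<bullet> feat E m t"
definition G where "G = component_law (Qlaw E \<theta>) (comps E) (hilb E) (xi E)"
definition comp_law where "comp_law m = (if m \<in> I then Q m else return (count_space UNIV) undefined)"
definition comp_error where "comp_error = 5000 * (c ^ 5 * (r\<^sup>2 * D * (1 + D)))"

lemma B_feat_measurable: "m \<in> I \<Longrightarrow> B_feat m \<in> borel_measurable \<pi>"
  and feat_dir_measurable: "m \<in> I \<Longrightarrow> feat_dir \<beta> m \<in> borel_measurable \<pi>"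
proof -
  assume m: "m \<in> I"
  note [measurable] = feat_measurable[OF m]
  have [measurable]: "blinfun_apply (Bop E m) \<in> borel_measurable borel"
    by (intro borel_measurable_continuous_onI linear_continuous_on blinfun.bounded_linear_right)
  show [measurable]: "B_feat m \<in> borel_measurable \<pi>" unfolding B_feat_def by measurable
  show "feat_dir \<beta> m \<in> borel_measurable \<pi>" unfolding feat_dir_def by measurable
qed

text \<open>The centred remainder is the centred increment with respect to a fixed sample point, and the increment
is jointly measurable by continuity in \<open>t\<close>.\<close>

lemma comp_quad_measurable:
  assumes m: "m \<in> I"
  shows "(\<lambda>(t, w). comp_quad m t w) \<in> borel_measurable (\<pi> \<Otimes>\<^sub>M P m)"
proof -
  interpret P: prob_space "P m" by (rule component(3)[OF m])
  interpret pi: prob_space \<pi> by (rule topology)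
  obtain w0 where w0: "w0 \<in> space (P m)" using P_space_nonempty[OF m] by blast
  obtain \<rho> where "likelihood_component (P m) (Q m) (\<lambda>w. Svec E m w \<bullet> feat E m \<theta> + Drem E m \<theta> w) r D
    (Svec E m) (Drem E m \<theta>) c (hilb E m) (Uvec E m) (Vop E m) (Rrem E m) \<rho> (Kop E m) (Sigma_op E m)
    (blinfun_apply (Aop E m) (feat E m \<theta>)) T (feat E m) (feat E m \<theta>)"
    by (rule obtain_likelihood_component[OF m])
  then interpret lc: likelihood_component "P m" "Q m" "\<lambda>w. Svec E m w \<bullet> feat E m \<theta> + Drem E m \<theta> w" r D
    "Svec E m" "Drem E m \<theta>" c "hilb E m" "Uvec E m" "Vop E m" "Rrem E m" \<rho> "Kop E m" "Sigma_op E m"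
    "blinfun_apply (Aop E m) (feat E m \<theta>)" T "feat E m" "feat E m \<theta>" .
  have inc[measurable]: "(\<lambda>(t, w). Rrem E m t w - Rrem E m t w0) \<in> borel_measurable (\<pi> \<Otimes>\<^sub>M P m)"
  proof (rule caratheodory_measurable[OF topology(3,4,7,8)])
    show "continuous_map X euclidean (\<lambda>t. Rrem E m t w - Rrem E m t w0)" if "w \<in> space (P m)" for w
      by (rule remainder_increment_continuous[OF m that w0])
    show "(\<lambda>w. Rrem E m t w - Rrem E m t w0) \<in> borel_measurable (P m)" if "t \<in> topspace X" for t
      using component(7)[OF m] that topology(6,7) by auto
  qed
  have im: "(\<lambda>t. \<integral>w. Rrem E m t w - Rrem E m t w0 \<partial>P m) \<in> borel_measurable \<pi>"
    by (rule P.borel_measurable_lebesgue_integral[OF inc])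
  have eqR: "Rrem E m t w - cent m t = (Rrem E m t w - Rrem E m t w0) - (\<integral>w. Rrem E m t w - Rrem E m t w0 \<partial>P m)"
    if t: "t \<in> T" for t w
  proof -
    have "integrable (P m) (Rrem E m t)" by (rule lc.cent(4)[OF t])
    then show ?thesis by (simp add: cent_def P.prob_space)
  qed
  note [measurable] = feat_measurable[OF m] im
  have [measurable]: "(\<lambda>(t, w). blinfun_apply (Vop E m w) (feat E m t)) \<in> borel_measurable (\<pi> \<Otimes>\<^sub>M P m)"
    by (rule operator_apply_measurable[OF component(6)[OF m] feat_measurable[OF m]])
  have [measurable]: "blinfun_apply (Kop E m) \<in> borel_measurable borel"
    by (intro borel_measurable_continuous_onI linear_continuous_on blinfun.bounded_linear_right)
  have "(\<lambda>(t, w). - (1/2) * (blinfun_apply (Vop E m w) (feat E m t) \<bullet> feat E m t - blinfun_apply (Kop E m) (feat E m t) \<bullet> feat E m t)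
    + ((Rrem E m t w - Rrem E m t w0) - (\<integral>w. Rrem E m t w - Rrem E m t w0 \<partial>P m))) \<in> borel_measurable (\<pi> \<Otimes>\<^sub>M P m)"
    by measurable
  then show ?thesis
    by (rule measurable_cong[THEN iffD1, rotated]) (auto simp: comp_quad_def eqR space_pair_measure topology(6))
qed

lemma linear_measurable:
  assumes m: "m \<in> I" and e: "e \<in> borel_measurable \<pi>" and \<mu>: "sets \<mu> = sets \<pi>"
  shows "(\<lambda>(t, w). (Uvec E m w - \<alpha> m) \<bullet> e t + \<tau> * comp_quad m t w) \<in> borel_measurable (\<mu> \<Otimes>\<^sub>M Q m)"
proof -
  note [measurable] = comp_quad_measurable[OF m] e component(4)[OF m]
  have "(\<lambda>(t, w). (Uvec E m w - \<alpha> m) \<bullet> e t + \<tau> * comp_quad m t w) \<in> borel_measurable (\<pi> \<Otimes>\<^sub>M P m)" by measurable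
  then show ?thesis
    using measurable_cong_sets[OF sets_pair_measure_cong[OF \<mu> sets_Q[OF m]] refl] by blast
qed

lemma Sigma_nonneg: "m \<in> I \<Longrightarrow> h \<in> hilb E m \<Longrightarrow> 0 \<le> blinfun_apply (Sigma_op E m) h \<bullet> h"
  using gc unfolding gaussian_counterpart_def by (simp add: Bochner_Integration.integral_nonneg)

lemma Q_prob: "prob_space (Qlaw E \<theta>)" and Q_gauss: "gaussian_dsum (Qlaw E \<theta>) (comps E) (hilb E) (Sigma_op E) (xi E)"
  using gc th unfolding gaussian_counterpart_def by blast+

lemmas gauss_distr = gaussian_dsum_distr[OF Q_prob Q_gauss component(1) Sigma_nonneg, folded G_def]

lemma G_law:
  assumes m: "m \<in> I"
  shows "(\<lambda>y. y) \<in> borel_measurable (G m)" "space (G m) \<subseteq> hilb E m"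
    "h \<in> hilb E m \<Longrightarrow> distr (G m) borel (\<lambda>y. y \<bullet> h) = real_gaussian (blinfun_apply (Sigma_op E m) h \<bullet> h)"
proof -
  have G: "G m = distr (Qlaw E \<theta>) (restrict_space borel (hilb E m)) (\<lambda>q. xi E q m)"
    using m by (simp add: G_def component_law_def)
  have xm: "(\<lambda>q. xi E q m) \<in> measurable (Qlaw E \<theta>) (restrict_space borel (hilb E m))"
    using Q_gauss m by (intro measurable_restrict_space2) (auto simp: gaussian_dsum_def)
  show "(\<lambda>y. y) \<in> borel_measurable (G m)" unfolding G by (simp add: measurable_restrict_space1)
  show "space (G m) \<subseteq> hilb E m" unfolding G by (simp add: space_restrict_space)
  assume h: "h \<in> hilb E m"
  have im: "(\<lambda>y. y \<bullet> h) \<in> borel_measurable (restrict_space borel (hilb E m))" by (intro measurable_restrict_space1) measurable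
  have "distr (G m) borel (\<lambda>y. y \<bullet> h) = distr (Qlaw E \<theta>) borel (\<lambda>q. xi E q m \<bullet> h)"
    unfolding G by (subst distr_distr[OF im xm]) (simp add: comp_def)
  also have "\<dots> = real_gaussian (blinfun_apply (Sigma_op E m) h \<bullet> h)"
    by (rule gaussian_dsum_single[OF Q_gauss component(1) m h])
  finally show "distr (G m) borel (\<lambda>y. y \<bullet> h) = real_gaussian (blinfun_apply (Sigma_op E m) h \<bullet> h)" .
qed


definition gauss_envelope :: "'h \<Rightarrow> real" where "gauss_envelope y = c * (r * norm y)"
definition gauss_comp :: "real \<Rightarrow> nat \<Rightarrow> 'p \<Rightarrow> 'h \<Rightarrow> real" where "gauss_comp \<beta> m t y = y \<bullet> feat_dir \<beta> m t"
definition gauss_tilt :: "nat \<Rightarrow> 'p \<Rightarrow> 'h \<Rightarrow> real" where "gauss_tilt m t y = y \<bullet> B_feat m t"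

lemma direction_bounds:
  assumes m: "m \<in> I" and t: "t \<in> T"
  shows "B_feat m t \<in> hilb E m" "norm (B_feat m t) \<le> c * r"
    "feat_dir \<beta> m t \<in> hilb E m" "\<bar>\<beta>\<bar> \<le> 1 \<Longrightarrow> norm (feat_dir \<beta> m t) \<le> c * r"
proof -
  have t': "t \<in> topspace (Theta E)" using t topology(2) by blast
  have r: "0 < r" by (rule topology)
  show B: "B_feat m t \<in> hilb E m" using dirs m by (auto simp: directions_def ops_on_def B_feat_def)
  have "norm (B_feat m t) \<le> norm (Bop E m) * norm (feat E m t)" unfolding B_feat_def by (rule norm_blinfun)
  also have "\<dots> \<le> norm (Bop E m) * r" using feat_le[OF m t'] by (rule mult_left_mono) simp
  finally have nB: "norm (B_feat m t) \<le> norm (Bop E m) * r" .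
  have cr: "(1 + norm (Bop E m)) * r \<le> c * r" using Bop_le[OF m] r by (intro mult_right_mono) auto
  show "norm (B_feat m t) \<le> c * r" using nB cr r by (simp add: distrib_right)
  show "feat_dir \<beta> m t \<in> hilb E m" unfolding feat_dir_def
    using component(1)[OF m] B feat_in[OF m t'] by (intro subspace_add subspace_mul)
  assume \<beta>: "\<bar>\<beta>\<bar> \<le> 1"
  have "norm (feat_dir \<beta> m t) \<le> norm (feat E m t) + \<bar>\<beta>\<bar> * norm (B_feat m t)"
    unfolding feat_dir_def using norm_triangle_ineq[of "feat E m t" "\<beta> *\<^sub>R B_feat m t"] by simp
  also have "\<bar>\<beta>\<bar> * norm (B_feat m t) \<le> 1 * norm (B_feat m t)" using \<beta> by (rule mult_right_mono) simp
  finally show "norm (feat_dir \<beta> m t) \<le> c * r"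
    using nB cr feat_le[OF m t'] by (simp add: distrib_right)
qed

text \<open>For either field, adding a deterministic exponent \<open>b\<close> replaces the prior by \<open>gibbs \<pi> b\<close>. The expansions hold
for every prior, with the same leading term for the likelihood field and the Gaussian field; so the
latter can be exchanged at the cost of the two errors.\<close>

lemma component_facts:
  assumes m: "m \<in> I"
  shows fields_exist: "\<exists>W. integrable (Q m) W \<and> (\<forall>\<beta>. \<bar>\<beta>\<bar> \<le> 1 \<longrightarrow> dom_field \<pi> (Q m) W (comp_field \<beta> m)) \<and> dom_field \<pi> (Q m) W (comp_tilt m)"
    and cent_le: "t \<in> T \<Longrightarrow> \<bar>cent m t\<bar> \<le> r\<^sup>2 * D"
    and H_kernel_exists: "\<exists>B. bdkernel \<pi> B (H_kernel m)"
    and gauss_envelope_integrable: "integrable (G m) gauss_envelope"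
    and gauss_comp_field: "\<bar>\<beta>\<bar> \<le> 1 \<Longrightarrow> dom_field \<pi> (G m) gauss_envelope (gauss_comp \<beta> m)"
    and gauss_tilt_field: "dom_field \<pi> (G m) gauss_envelope (gauss_tilt m)"
    and swap: "\<bar>\<beta>\<bar> \<le> 1 \<Longrightarrow> bdmeas \<pi> B b \<Longrightarrow>
       \<bar>(\<integral>w. logint \<pi> (\<lambda>t. b t + comp_field \<beta> m t w) \<partial>Q m) - (\<integral>y. logint \<pi> (\<lambda>t. b t + gauss_comp \<beta> m t y) \<partial>G m)\<bar> \<le> 420 * comp_error"
    and gibbs_x: "bdmeas \<pi> B b \<Longrightarrow>
       \<bar>(\<integral>w. (\<integral>t. comp_tilt m t w \<partial>gibbs \<pi> (\<lambda>t. b t + comp_field 0 m t w)) \<partial>Q m)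
        - (\<integral>w. diag_excess (gibbs \<pi> (\<lambda>t. b t + comp_field 0 m t w)) (H_kernel m) \<partial>Q m)\<bar> \<le> 210 * comp_error"
    and gibbs_g: "bdmeas \<pi> B b \<Longrightarrow>
       \<bar>(\<integral>y. (\<integral>t. gauss_tilt m t y \<partial>gibbs \<pi> (\<lambda>t. b t + gauss_comp 0 m t y)) \<partial>G m)
        - (\<integral>y. diag_excess (gibbs \<pi> (\<lambda>t. b t + gauss_comp 0 m t y)) (H_kernel m) \<partial>G m)\<bar> \<le> 210 * comp_error"
proof -
  interpret pi: prob_space \<pi> by (rule topology)
  obtain \<rho> where "likelihood_component (P m) (Q m) (\<lambda>w. Svec E m w \<bullet> feat E m \<theta> + Drem E m \<theta> w) r D
    (Svec E m) (Drem E m \<theta>) c (hilb E m) (Uvec E m) (Vop E m) (Rrem E m) \<rho> (Kop E m) (Sigma_op E m)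
    (blinfun_apply (Aop E m) (feat E m \<theta>)) T (feat E m) (feat E m \<theta>)"
    by (rule obtain_likelihood_component[OF m])
  then interpret lc: likelihood_component "P m" "Q m" "\<lambda>w. Svec E m w \<bullet> feat E m \<theta> + Drem E m \<theta> w" r D
    "Svec E m" "Drem E m \<theta>" c "hilb E m" "Uvec E m" "Vop E m" "Rrem E m" \<rho> "Kop E m" "Sigma_op E m"
    "blinfun_apply (Aop E m) (feat E m \<theta>)" T "feat E m" "feat E m \<theta>" .
  have sp: "space \<pi> = T" by (rule topology)
  have err: "lc.err = comp_error" by (simp add: lc.err_def comp_error_def lc.\<gamma>_def)
  have x: "comp_field \<beta> m = lc.proc 1 (feat_dir \<beta> m)" for \<beta>
    by (auto simp: fun_eq_iff comp_field_def lc.proc_def lc.vt_def comp_quad_def cent_def lc.cent_def \<alpha>_def)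
  have w: "comp_tilt m = lc.proc 0 (B_feat m)" by (auto simp: fun_eq_iff comp_tilt_def lc.proc_def \<alpha>_def)
  have ok: "\<bar>\<beta>\<bar> \<le> 1 \<Longrightarrow> lc.directions_ok (feat_dir \<beta> m)" "lc.directions_ok (B_feat m)" for \<beta>
    using direction_bounds[OF m] by (auto simp: lc.directions_ok_def)
  have ok0: "lc.directions_ok (feat_dir 0 m)" by (rule ok) simp
  have meas: "(\<lambda>(t, w). lc.proc \<tau> e t w) \<in> borel_measurable (\<mu> \<Otimes>\<^sub>M Q m)" if "e \<in> borel_measurable \<pi>" "sets \<mu> = sets \<pi>" for e \<tau> \<mu>
    using linear_measurable[OF m that, of \<tau>]
    by (simp add: lc.proc_def lc.vt_def comp_quad_def cent_def lc.cent_def \<alpha>_def)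
  note em = feat_dir_measurable[OF m] B_feat_measurable[OF m]
  have fx: "dom_field \<pi> (Q m) lc.env (comp_field \<beta> m)" if "\<bar>\<beta>\<bar> \<le> 1" for \<beta>
    unfolding x by (rule lc.proc_field[OF sp ok(1)[OF that] _ meas[OF em(1) refl]]) simp
  have fw: "dom_field \<pi> (Q m) lc.env (comp_tilt m)"
    unfolding w by (rule lc.proc_field[OF sp ok(2) _ meas[OF em(2) refl]]) simp
  show "\<exists>W. integrable (Q m) W \<and> (\<forall>\<beta>. \<bar>\<beta>\<bar> \<le> 1 \<longrightarrow> dom_field \<pi> (Q m) W (comp_field \<beta> m)) \<and> dom_field \<pi> (Q m) W (comp_tilt m)"
    using fx fw lc.env_integrable by blast
  show "\<bar>cent m t\<bar> \<le> r\<^sup>2 * D" if "t \<in> T" using lc.cent(1)[OF that] by (simp add: lc.cent_def cent_def lc.q_def)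
  have k: "H_kernel m = lc.cov_kernel (B_feat m) (feat_dir 0 m)"
    using dirs m by (auto simp: fun_eq_iff H_kernel_def lc.cov_kernel_def B_feat_def feat_dir_def directions_def)
  have kb: "bdkernel \<pi> (2 * c\<^sup>2 * lc.\<kappa>\<^sup>2) (H_kernel m)"
    unfolding k by (rule lc.cov_kernel_bdkernel[OF sp ok(2) ok0 em(2) em(1)])
  then show "\<exists>B. bdkernel \<pi> B (H_kernel m)" by blast
  have Gp: "prob_space (G m)" by (rule gauss_distr(3))
  interpret Gm: prob_space "G m" by (rule Gp)
  note Gl = Gp G_law(1)[OF m] G_law(2)[OF m] G_law(3)[OF m]
  have gw: "gauss_envelope = lc.genv" by (simp add: fun_eq_iff gauss_envelope_def lc.genv_def)
  show gi: "integrable (G m) gauss_envelope" unfolding gw by (rule lc.genv_integrable[OF Gl])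
  have gx: "gauss_comp \<beta> m = (\<lambda>t y. y \<bullet> feat_dir \<beta> m t)" "gauss_tilt m = (\<lambda>t y. y \<bullet> B_feat m t)" for \<beta>
    by (simp_all add: fun_eq_iff gauss_comp_def gauss_tilt_def)
  show fg: "dom_field \<pi> (G m) gauss_envelope (gauss_comp \<beta> m)" if "\<bar>\<beta>\<bar> \<le> 1" for \<beta>
    unfolding gx gw by (rule lc.gauss_field[OF Gl sp ok(1)[OF that] em(1)])
  show fB: "dom_field \<pi> (G m) gauss_envelope (gauss_tilt m)"
    unfolding gx gw by (rule lc.gauss_field[OF Gl sp ok(2) em(2)])
  interpret tx: two_probs \<pi> "Q m" by unfold_locales
  interpret tg: two_probs \<pi> "G m" by unfold_locales
  {
    fix B b assume b: "bdmeas \<pi> B b"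
    let ?\<mu> = "gibbs \<pi> b"
    have mu: "prob_space ?\<mu>" "space ?\<mu> = T" "sets ?\<mu> = sets \<pi>"
      using pi.prob_space_gibbs[OF b] pi.sets_gibbs pi.space_gibbs sp by auto
    have em': "e \<in> borel_measurable ?\<mu>" if "e \<in> borel_measurable \<pi>" for e :: "'p \<Rightarrow> 'h"
      using that measurable_cong_sets[OF mu(3) refl] by blast
    show "\<bar>(\<integral>w. logint \<pi> (\<lambda>t. b t + comp_field \<beta> m t w) \<partial>Q m) - (\<integral>y. logint \<pi> (\<lambda>t. b t + gauss_comp \<beta> m t y) \<partial>G m)\<bar> \<le> 420 * comp_error"
      if \<beta>: "\<bar>\<beta>\<bar> \<le> 1" for \<beta>
    proof -
      have "\<bar>(\<integral>w. logint ?\<mu> (\<lambda>t. comp_field \<beta> m t w) \<partial>Q m) - diag_excess ?\<mu> (lc.cov_kernel (feat_dir \<beta> m) (feat_dir \<beta> m)) / 2\<bar> \<le> 210 * comp_error"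
        unfolding x err[symmetric] by (rule lc.logint_proc[OF mu(1,2) ok(1)[OF \<beta>] em'[OF em(1)] meas[OF em(1) mu(3)]])
      moreover have "\<bar>(\<integral>w. logint ?\<mu> (\<lambda>t. gauss_comp \<beta> m t w) \<partial>G m) - diag_excess ?\<mu> (lc.cov_kernel (feat_dir \<beta> m) (feat_dir \<beta> m)) / 2\<bar> \<le> 210 * comp_error"
        unfolding gx err[symmetric] by (rule lc.logint_gauss[OF Gl mu(1,2) ok(1)[OF \<beta>] em'[OF em(1)]])
      ultimately show ?thesis
        unfolding tx.mean_logint_shift[OF fx[OF \<beta>] lc.env_integrable b] tg.mean_logint_shift[OF fg[OF \<beta>] gi b]
        by linarith
    qed
    have ga: "gibbs \<pi> (\<lambda>t. b t + f t) = gibbs ?\<mu> f" if "bdmeas \<pi> B' f" for f B'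
      by (rule pi.gibbs_add[OF b that])
    have ex: "gibbs \<pi> (\<lambda>t. b t + comp_field 0 m t w) = gibbs ?\<mu> (\<lambda>t. comp_field 0 m t w)" if "w \<in> space (Q m)" for w
      by (rule ga[OF dom_field_bdmeas[OF fx that]]) simp
    have eg: "gibbs \<pi> (\<lambda>t. b t + gauss_comp 0 m t w) = gibbs ?\<mu> (\<lambda>t. gauss_comp 0 m t w)" if "w \<in> space (G m)" for w
      by (rule ga[OF dom_field_bdmeas[OF fg that]]) simp
    show "\<bar>(\<integral>w. (\<integral>t. comp_tilt m t w \<partial>gibbs \<pi> (\<lambda>t. b t + comp_field 0 m t w)) \<partial>Q m)
        - (\<integral>w. diag_excess (gibbs \<pi> (\<lambda>t. b t + comp_field 0 m t w)) (H_kernel m) \<partial>Q m)\<bar> \<le> 210 * comp_error"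
    proof -
      have 1: "(\<integral>w. (\<integral>t. comp_tilt m t w \<partial>gibbs \<pi> (\<lambda>t. b t + comp_field 0 m t w)) \<partial>Q m) = (\<integral>w. (\<integral>t. comp_tilt m t w \<partial>gibbs ?\<mu> (\<lambda>t. comp_field 0 m t w)) \<partial>Q m)"
        by (rule Bochner_Integration.integral_cong[OF refl]) (simp only: ex)
      have 2: "(\<integral>w. diag_excess (gibbs \<pi> (\<lambda>t. b t + comp_field 0 m t w)) (H_kernel m) \<partial>Q m) = (\<integral>w. diag_excess (gibbs ?\<mu> (\<lambda>t. comp_field 0 m t w)) (H_kernel m) \<partial>Q m)"
        by (rule Bochner_Integration.integral_cong[OF refl]) (simp only: ex)
      show ?thesis unfolding 1 2 unfolding x w k err[symmetric]
        by (rule lc.gibbs_proc[OF mu(1,2) ok0 em'[OF em(1)] ok(2) em'[OF em(2)] meas[OF em(1) mu(3)] meas[OF em(2) mu(3)]])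
    qed
    show "\<bar>(\<integral>y. (\<integral>t. gauss_tilt m t y \<partial>gibbs \<pi> (\<lambda>t. b t + gauss_comp 0 m t y)) \<partial>G m)
        - (\<integral>y. diag_excess (gibbs \<pi> (\<lambda>t. b t + gauss_comp 0 m t y)) (H_kernel m) \<partial>G m)\<bar> \<le> 210 * comp_error"
    proof -
      have 1: "(\<integral>y. (\<integral>t. gauss_tilt m t y \<partial>gibbs \<pi> (\<lambda>t. b t + gauss_comp 0 m t y)) \<partial>G m) = (\<integral>y. (\<integral>t. gauss_tilt m t y \<partial>gibbs ?\<mu> (\<lambda>t. gauss_comp 0 m t y)) \<partial>G m)"
        by (rule Bochner_Integration.integral_cong[OF refl]) (simp only: eg)
      have 2: "(\<integral>y. diag_excess (gibbs \<pi> (\<lambda>t. b t + gauss_comp 0 m t y)) (H_kernel m) \<partial>G m) = (\<integral>y. diag_excess (gibbs ?\<mu> (\<lambda>t. gauss_comp 0 m t y)) (H_kernel m) \<partial>G m)"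
        by (rule Bochner_Integration.integral_cong[OF refl]) (simp only: eg)
      show ?thesis unfolding 1 2 unfolding gx k err[symmetric]
        by (rule lc.gibbs_gauss[OF Gl mu(1,2) ok0 em'[OF em(1)] ok(2) em'[OF em(2)]])
    qed
  }
qed

end

text \<open>A function that lies above an affine function through each point of its graph is convex.\<close>

lemma (in two_probs) mean_logint_convex:
  assumes x: "dom_field \<mu> N W x" and v: "dom_field \<mu> N V v" and W: "integrable N W" and V: "integrable N V"
  shows "convex_on UNIV (\<lambda>\<beta>. \<integral>w. logint \<mu> (\<lambda>t. x t w + \<beta> * v t w) \<partial>N)"
proof (rule convex_onI)
  fix s y z :: real assume s: "0 < s" "s < 1"
  define f where "f = (\<lambda>\<beta> w. logint \<mu> (\<lambda>t. x t w + \<beta> * v t w))"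
  have fd: "dom_field \<mu> N (\<lambda>w. W w + \<bar>\<beta>\<bar> * V w) (\<lambda>t w. x t w + \<beta> * v t w)" for \<beta>
    by (intro dom_field_add dom_field_cmult x v)
  have i: "integrable N (f \<beta>)" for \<beta>
    unfolding f_def using W V by (intro logint_integrable(1)[OF fd]) auto
  let ?m = "(1 - s) * y + s * z"
  have "f ?m w \<le> (1 - s) * f y w + s * f z w" if w: "w \<in> space N" for w
  proof -
    define k where "k = (\<integral>t. v t w \<partial>gibbs \<mu> (\<lambda>t. x t w + ?m * v t w))"
    have tan: "f ?m w + (b - ?m) * k \<le> f b w" for b
    proof -
      have g: "bdmeas \<mu> (\<bar>b - ?m\<bar> * V w) (\<lambda>t. (b - ?m) * v t w)"
        by (rule dom_field_bdmeas[OF dom_field_cmult[OF v] w])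
      have "(\<lambda>t. (x t w + ?m * v t w) + (b - ?m) * v t w) = (\<lambda>t. x t w + b * v t w)" by (simp add: fun_eq_iff algebra_simps)
      then show ?thesis
        using mu.logint_tangent[OF dom_field_bdmeas[OF fd[of ?m] w] g] unfolding f_def k_def by simp
    qed
    have "(1 - s) * (f ?m w + (y - ?m) * k) \<le> (1 - s) * f y w" using tan s by (intro mult_left_mono) auto
    moreover have "s * (f ?m w + (z - ?m) * k) \<le> s * f z w" using tan s by (intro mult_left_mono) auto
    moreover have "(1 - s) * (f ?m w + (y - ?m) * k) + s * (f ?m w + (z - ?m) * k) = f ?m w"
      by (simp add: algebra_simps)
    ultimately show ?thesis by linarith
  qed
  then have "(\<integral>w. f ?m w \<partial>N) \<le> (\<integral>w. (1 - s) * f y w + s * f z w \<partial>N)"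
    using i by (intro integral_mono) auto
  also have "\<dots> = (1 - s) * (\<integral>w. f y w \<partial>N) + s * (\<integral>w. f z w \<partial>N)" using i by simp
  finally show "(\<integral>w. logint \<mu> (\<lambda>t. x t w + ((1 - s) *\<^sub>R y + s *\<^sub>R z) * v t w) \<partial>N)
      \<le> (1 - s) * (\<integral>w. logint \<mu> (\<lambda>t. x t w + y * v t w) \<partial>N) + s * (\<integral>w. logint \<mu> (\<lambda>t. x t w + z * v t w) \<partial>N)"
    by (simp add: f_def)
qed simp

lemma (in two_probs) mean_gibbs2_distr:
  assumes Z: "dom_field \<mu> N W Z" and M: "prob_space M" and f: "f \<in> measurable M L" and d: "distr M L f = N"
  shows "mean_gibbs2 N \<mu> Z = mean_gibbs2 M \<mu> (\<lambda>t q. Z t (f q))"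
proof -
  have k: "(\<lambda>w. gibbs \<mu> (\<lambda>t. Z t w) \<Otimes>\<^sub>M gibbs \<mu> (\<lambda>t. Z t w)) \<in> measurable N (subprob_algebra (\<mu> \<Otimes>\<^sub>M \<mu>))"
    by (rule measurable_pair_measure[OF gibbs_kernel[OF Z] gibbs_kernel[OF Z]])
  have "sets N = sets L" using d by auto
  then have k': "(\<lambda>w. gibbs \<mu> (\<lambda>t. Z t w) \<Otimes>\<^sub>M gibbs \<mu> (\<lambda>t. Z t w)) \<in> measurable L (subprob_algebra (\<mu> \<Otimes>\<^sub>M \<mu>))"
    using k measurable_cong_sets by blast
  show ?thesis unfolding mean_gibbs2_def d[symmetric]
    by (subst bind_distr[OF f k' prob_space.not_empty[OF M]]) simp
qed

lemma bdmeas_sum: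
  assumes "finite J" "\<And>j. j \<in> J \<Longrightarrow> \<exists>B. bdmeas M B (f j)"
  shows "\<exists>B. bdmeas M B (\<lambda>t. \<Sum>j\<in>J. f j t)"
proof -
  obtain B where B: "\<And>j. j \<in> J \<Longrightarrow> bdmeas M (B j) (f j)" using assms(2) by metis
  have "bdmeas M (\<Sum>j\<in>J. B j) (\<lambda>t. \<Sum>j\<in>J. f j t)"
  proof (rule bdmeasI)
    show "(\<lambda>t. \<Sum>j\<in>J. f j t) \<in> borel_measurable M" using bdmeas_meas[OF B] by (intro borel_measurable_sum) auto
    show "\<bar>\<Sum>j\<in>J. f j t\<bar> \<le> (\<Sum>j\<in>J. B j)" if "t \<in> space M" for t
      by (rule order_trans[OF sum_abs sum_mono[OF bdmeas_bound[OF B that]]])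
  qed
  then show ?thesis by blast
qed

context regular_model begin

lemma xi_distr:
  "distr (Qlaw E \<theta>) (Pi\<^sub>M I (\<lambda>m. restrict_space borel (hilb E m))) (\<lambda>q. \<lambda>m\<in>I. xi E q m) = Pi\<^sub>M I G"
  by (rule gauss_distr(1))

text \<open>The deterministic parts of the exponents. That of the likelihood process contains the means of the
remainders in addition, which change the free energy by at most \<open>r\<^sup>2 * D\<close> per component.\<close>

definition loss where "loss t = a * Hquad E \<theta> t"
definition drift where
  "drift t = (\<Sum>m\<in>I. \<alpha> m \<bullet> feat E m t - 1/2 * (blinfun_apply (Kop E m) (feat E m t) \<bullet> feat E m t))"
definition base where "base t = drift t + (\<Sum>m\<in>I. cent m t)"

lemma Xproc_eq: "Xproc E t \<omega> = base t + (\<Sum>m\<in>I. comp_field 0 m t (\<omega> m))"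
  unfolding Xproc_def base_def drift_def sum.distrib[symmetric]
  by (rule sum.cong) (auto simp: Xcomp_def comp_field_def comp_quad_def feat_dir_def inner_diff_left algebra_simps)

lemma Ybeta_eq: "Ybeta E a \<beta> \<theta> t q = (drift t + \<beta> * loss t) + (\<Sum>m\<in>I. gauss_comp \<beta> m t ((\<lambda>m\<in>I. xi E q m) m))"
proof -
  have 1: "Yproc E \<theta> t q = drift t + (\<Sum>m\<in>I. xi E q m \<bullet> feat E m t)"
    unfolding Yproc_def drift_def dsum_inner_def dsum_op_def eta_def \<alpha>_def sum_distrib_left sum.distrib[symmetric] sum_subtractf[symmetric]
    by (rule sum.cong) (auto simp: algebra_simps)
  have 2: "Ytilde E a \<theta> t q = (\<Sum>m\<in>I. xi E q m \<bullet> B_feat m t) + loss t"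
    by (simp add: Ytilde_def dsum_inner_def dsum_op_def eta_def B_feat_def loss_def)
  have 3: "(\<Sum>m\<in>I. gauss_comp \<beta> m t ((\<lambda>m\<in>I. xi E q m) m)) = (\<Sum>m\<in>I. xi E q m \<bullet> feat E m t) + \<beta> * (\<Sum>m\<in>I. xi E q m \<bullet> B_feat m t)"
    unfolding sum_distrib_left sum.distrib[symmetric]
    by (rule sum.cong) (auto simp: gauss_comp_def feat_dir_def inner_add_right)
  show ?thesis unfolding Ybeta_def 1 2 3 by (simp add: algebra_simps)
qed

lemma Yproc_eq: "Yproc E \<theta> t q = drift t + (\<Sum>m\<in>I. gauss_comp 0 m t ((\<lambda>m\<in>I. xi E q m) m))"
  using Ybeta_eq[of 0 t q] by (simp add: Ybeta_def)

lemma phi_eq: "phi E a \<theta> s t = loss t + (\<Sum>m\<in>I. H_kernel m t t) - (\<Sum>m\<in>I. H_kernel m s t)"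
  by (simp add: phi_def loss_def dsum_inner_def dsum_op_def eta_def H_kernel_def)

lemma comp_field_eq: "comp_field \<beta> m t w = comp_field 0 m t w + \<beta> * comp_tilt m t w"
  and gauss_comp_eq: "gauss_comp \<beta> m t y = gauss_comp 0 m t y + \<beta> * gauss_tilt m t y"
  by (simp_all add: comp_field_def comp_tilt_def gauss_comp_def gauss_tilt_def feat_dir_def inner_add_right algebra_simps)

lemma continuous_of_feat_bdmeas:
  assumes m: "m \<in> I" and g: "continuous_on UNIV g"
  shows "\<exists>B. bdmeas \<pi> B (\<lambda>t. g (feat E m t) :: real)"
proof -
  have "continuous_map euclidean euclidean g" using g by simp
  from continuous_map_compose[OF feat_X[OF m] this]
  have gc: "continuous_map X euclidean (\<lambda>t. g (feat E m t))" by (simp add: comp_def)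
  have "compactin euclidean ((\<lambda>t. g (feat E m t)) ` topspace X)"
    using image_compactin[OF _ gc] topology(3) by (simp add: compact_space_def)
  then have "bounded ((\<lambda>t. g (feat E m t)) ` space \<pi>)" using topology(7) by (simp add: compact_imp_bounded)
  then obtain B where "\<And>t. t \<in> space \<pi> \<Longrightarrow> \<bar>g (feat E m t)\<bar> \<le> B" by (auto simp: bounded_iff)
  then have "bdmeas \<pi> B (\<lambda>t. g (feat E m t))"
    by (intro bdmeasI continuous_map_borel_measurable[OF gc topology(7,8)])
  then show ?thesis by blast
qed

lemma loss_bdmeas: "\<exists>B. bdmeas \<pi> B loss" and drift_bdmeas: "\<exists>B. bdmeas \<pi> B drift"
proof -
  have pe: "loss = (\<lambda>t. \<Sum>m\<in>I. a * (blinfun_apply (Hop E m) (feat E m \<theta> - feat E m t) \<bullet> (feat E m \<theta> - feat E m t)))"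
    by (simp add: fun_eq_iff loss_def Hquad_def dsum_inner_def dsum_op_def eta_def sum_distrib_left)
  show "\<exists>B. bdmeas \<pi> B loss" unfolding pe
    by (intro bdmeas_sum continuous_of_feat_bdmeas) (auto intro!: continuous_intros)
  have de: "drift = (\<lambda>t. \<Sum>m\<in>I. \<alpha> m \<bullet> feat E m t - 1/2 * (blinfun_apply (Kop E m) (feat E m t) \<bullet> feat E m t))"
    by (simp add: fun_eq_iff drift_def)
  show "\<exists>B. bdmeas \<pi> B drift" unfolding de
    by (intro bdmeas_sum continuous_of_feat_bdmeas) (auto intro!: continuous_intros)
qed

lemma comp_law_prob: "prob_space (comp_law m)"
  using component(10) by (auto simp: comp_law_def intro!: prob_space_return)

lemma Plaw_eq: "Plaw E \<theta> = Pi\<^sub>M I comp_law"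
  unfolding Plaw_def by (rule PiM_cong) (auto simp: comp_law_def)

text \<open>The mean \<open>cent m\<close> of a single remainder need not be measurable. The sum of all means is, being the difference
of the continuous path \<open>X\<close> and measurable component fields at a fixed sample point.\<close>

lemma base_bdmeas: "\<exists>B. bdmeas \<pi> B base"
proof -
  obtain Bd where Bd: "bdmeas \<pi> Bd drift" using drift_bdmeas by blast
  define \<omega>0 where "\<omega>0 = (\<lambda>k\<in>I. SOME v. v \<in> space (P k))"
  have w: "\<omega>0 m \<in> space (P m)" if "m \<in> I" for m using that someI_ex[OF P_space_nonempty] by (auto simp: \<omega>0_def)
  then have w0: "\<omega>0 \<in> space (Pi\<^sub>M I (P0 E))" by (auto simp: \<omega>0_def space_PiM PiE_iff)
  have "(\<lambda>t. Xproc E t \<omega>0) \<in> borel_measurable \<pi>"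
    by (rule continuous_map_borel_measurable[OF paths[OF w0] topology(7,8)])
  moreover have "(\<lambda>t. comp_field 0 m t (\<omega>0 m)) \<in> borel_measurable \<pi>" if "m \<in> I" for m
    using fields_exist[OF that] w[OF that] space_Q[OF that]
    by (auto dest!: spec[of _ 0] intro!: bdmeas_meas[OF dom_field_bdmeas])
  ultimately have "(\<lambda>t. Xproc E t \<omega>0 - (\<Sum>m\<in>I. comp_field 0 m t (\<omega>0 m))) \<in> borel_measurable \<pi>" by measurable
  then have bm: "base \<in> borel_measurable \<pi>" by (simp add: Xproc_eq)
  have "bdmeas \<pi> (Bd + (\<Sum>m\<in>I. r\<^sup>2 * D)) base"
  proof (rule bdmeasI[OF bm])
    fix t assume t: "t \<in> space \<pi>"
    have "\<bar>\<Sum>m\<in>I. cent m t\<bar> \<le> (\<Sum>m\<in>I. r\<^sup>2 * D)"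
      using t topology(6) by (intro order_trans[OF sum_abs sum_mono] cent_le) auto
    then show "\<bar>base t\<bar> \<le> Bd + (\<Sum>m\<in>I. r\<^sup>2 * D)" using bdmeas_bound[OF Bd t] unfolding base_def by linarith
  qed
  then show ?thesis by blast
qed

lemma bdmeas_line: "\<exists>B. bdmeas \<pi> B f \<Longrightarrow> \<exists>B. bdmeas \<pi> B (\<lambda>t. f t + \<beta> * loss t)"
proof -
  assume "\<exists>B. bdmeas \<pi> B f"
  then obtain B B' where B: "bdmeas \<pi> B f" and B': "bdmeas \<pi> B' loss" using loss_bdmeas by blast
  have "bdmeas \<pi> (\<bar>\<beta>\<bar> * B') (\<lambda>t. \<beta> * loss t)"
    using B' by (auto simp: bdmeas_def abs_mult intro!: mult_left_mono)
  from bdmeas_add[OF B this] show ?thesis by blast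
qed

text \<open>One envelope serves all \<open>\<beta>\<close> with \<open>\<bar>\<beta>\<bar> \<le> 1\<close> and the direction of the perturbation.\<close>

definition comp_envelope where
  "comp_envelope m = (SOME W. integrable (Q m) W \<and> (\<forall>\<beta>. \<bar>\<beta>\<bar> \<le> 1 \<longrightarrow> dom_field \<pi> (Q m) W (comp_field \<beta> m)) \<and> dom_field \<pi> (Q m) W (comp_tilt m))"

lemma comp_envelope:
  assumes m: "m \<in> I"
  shows "integrable (comp_law m) (comp_envelope m)" "\<bar>\<beta>\<bar> \<le> 1 \<Longrightarrow> dom_field \<pi> (comp_law m) (comp_envelope m) (comp_field \<beta> m)" "dom_field \<pi> (comp_law m) (comp_envelope m) (comp_tilt m)"
  using someI_ex[OF fields_exist[OF m], folded comp_envelope_def] m by (auto simp: comp_law_def)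

lemma X_fields: "\<bar>\<beta>\<bar> \<le> 1 \<Longrightarrow> indep_fields \<pi> comp_law I comp_envelope (comp_field \<beta>)"
  using topology(5) comp_law_prob comp_envelope by (intro indep_fields.intro indep_fields_axioms.intro) auto

lemma G_fields: "\<bar>\<beta>\<bar> \<le> 1 \<Longrightarrow> indep_fields \<pi> G I (\<lambda>_. gauss_envelope) (gauss_comp \<beta>)"
  using topology(5) gauss_distr(3) gauss_comp_field gauss_envelope_integrable by (intro indep_fields.intro indep_fields_axioms.intro) auto

definition meanX where "meanX \<beta> = (\<integral>\<omega>. logint \<pi> (\<lambda>t. (base t + \<beta> * loss t) + (\<Sum>m\<in>I. comp_field \<beta> m t (\<omega> m))) \<partial>Pi\<^sub>M I comp_law)"
definition meanG where "meanG \<beta> = (\<integral>\<omega>. logint \<pi> (\<lambda>t. (drift t + \<beta> * loss t) + (\<Sum>m\<in>I. gauss_comp \<beta> m t (\<omega> m))) \<partial>Pi\<^sub>M I G)"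

lemma free_energies_close:
  assumes \<beta>: "\<bar>\<beta>\<bar> \<le> 1"
  shows "\<bar>meanX \<beta> - meanG \<beta>\<bar> \<le> real (comps E) * (420 * comp_error + r\<^sup>2 * D)"
proof -
  interpret FG: indep_fields \<pi> G I "\<lambda>_. gauss_envelope" "gauss_comp \<beta>" by (rule G_fields[OF \<beta>])
  obtain B where B: "bdmeas \<pi> B (\<lambda>t. base t + \<beta> * loss t)" using bdmeas_line[OF base_bdmeas] by blast
  obtain B' where B': "bdmeas \<pi> B' (\<lambda>t. drift t + \<beta> * loss t)" using bdmeas_line[OF drift_bdmeas] by blast
  have 1: "\<bar>meanX \<beta> - (\<integral>\<omega>. logint \<pi> (\<lambda>t. (base t + \<beta> * loss t) + (\<Sum>m\<in>I. gauss_comp \<beta> m t (\<omega> m))) \<partial>Pi\<^sub>M I G)\<bar> \<le> (\<Sum>m\<in>I. 420 * comp_error)"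
    unfolding meanX_def
    by (rule mean_logint_swap[OF X_fields[OF \<beta>] G_fields[OF \<beta>] _ B]) (use swap \<beta> in \<open>auto simp: comp_law_def\<close>)
  have "\<bar>(\<integral>\<omega>. logint \<pi> (\<lambda>t. FG.field (\<lambda>t. base t + \<beta> * loss t) t \<omega>) \<partial>Pi\<^sub>M I G)
      - (\<integral>\<omega>. logint \<pi> (\<lambda>t. FG.field (\<lambda>t. drift t + \<beta> * loss t) t \<omega>) \<partial>Pi\<^sub>M I G)\<bar> \<le> real (comps E) * (r\<^sup>2 * D)"
  proof (rule FG.mean_logint_base_change[OF B' B])
    fix t assume t: "t \<in> space \<pi>"
    have "\<bar>\<Sum>m\<in>I. cent m t\<bar> \<le> (\<Sum>m\<in>I. r\<^sup>2 * D)"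
      using t topology(6) by (intro order_trans[OF sum_abs sum_mono] cent_le) auto
    then show "\<bar>(base t + \<beta> * loss t) - (drift t + \<beta> * loss t)\<bar> \<le> real (comps E) * (r\<^sup>2 * D)" by (simp add: base_def)
  qed
  then have 2: "\<bar>(\<integral>\<omega>. logint \<pi> (\<lambda>t. (base t + \<beta> * loss t) + (\<Sum>m\<in>I. gauss_comp \<beta> m t (\<omega> m))) \<partial>Pi\<^sub>M I G) - meanG \<beta>\<bar> \<le> real (comps E) * (r\<^sup>2 * D)"
    unfolding FG.field_def meanG_def .
  show ?thesis using 1 2 by (simp add: distrib_left)
qed

lemma tangents:
  assumes \<beta>: "\<bar>\<beta>\<bar> \<le> 1"
  shows X_tangent: "\<beta> * (\<integral>(s, t). phi E a \<theta> s t \<partial>mean_gibbs2 (Plaw E \<theta>) \<pi> (Xproc E)) - real (comps E) * (210 * comp_error) \<le> meanX \<beta> - meanX 0"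
    and G_tangent: "\<beta> * (\<integral>(s, t). phi E a \<theta> s t \<partial>mean_gibbs2 (Qlaw E \<theta>) \<pi> (Yproc E \<theta>)) - real (comps E) * (210 * comp_error) \<le> meanG \<beta> - meanG 0"
proof -
  obtain Bp where Bp: "bdmeas \<pi> Bp loss" using loss_bdmeas by blast
  obtain Bb where Bb: "bdmeas \<pi> Bb base" using base_bdmeas by blast
  obtain Bd where Bd: "bdmeas \<pi> Bd drift" using drift_bdmeas by blast
  obtain H where H: "\<And>m. m \<in> I \<Longrightarrow> bdkernel \<pi> (H m) (H_kernel m)" using H_kernel_exists by metis
  have e0: "0 \<le> comp_error" using c D by (simp add: comp_error_def)
  have le: "\<bar>\<beta>\<bar> * (\<Sum>m\<in>I. 210 * comp_error) \<le> real (comps E) * (210 * comp_error)"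
    using mult_right_mono[OF \<beta>, of "real (comps E) * (210 * comp_error)"] e0 by simp
  interpret FX: indep_fields \<pi> comp_law I comp_envelope "comp_field 0" by (rule X_fields) simp
  interpret FG: indep_fields \<pi> G I "\<lambda>_. gauss_envelope" "gauss_comp 0" by (rule G_fields) simp
  interpret TX: two_probs \<pi> "Pi\<^sub>M I comp_law" by (rule FX.two_probs_PiM)
  interpret TG: two_probs \<pi> "Pi\<^sub>M I G" by (rule FG.two_probs_PiM)
  have X: "Xproc E = FX.field base" unfolding fun_eq_iff Xproc_eq FX.field_def by simp
  have 1: "(\<integral>(s, t). phi E a \<theta> s t \<partial>mean_gibbs2 (Plaw E \<theta>) \<pi> (Xproc E))
    = (\<integral>\<omega>. (\<integral>t. loss t \<partial>gibbs \<pi> (\<lambda>t. FX.field base t \<omega>)) + (\<Sum>m\<in>I. diag_excess (gibbs \<pi> (\<lambda>t. FX.field base t \<omega>)) (H_kernel m)) \<partial>Pi\<^sub>M I comp_law)"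
    unfolding X Plaw_eq phi_eq by (rule TX.integral_mean_gibbs2_excess[OF FX.field_dom[OF Bb] Bp _ H]) auto
  have 2: "meanX 0 = (\<integral>\<omega>. logint \<pi> (\<lambda>t. FX.field base t \<omega>) \<partial>Pi\<^sub>M I comp_law)" unfolding meanX_def FX.field_def by simp
  have 3: "meanX \<beta> = (\<integral>\<omega>. logint \<pi> (\<lambda>t. (base t + \<beta> * loss t) + (\<Sum>m\<in>I. comp_field 0 m t (\<omega> m) + \<beta> * comp_tilt m t (\<omega> m))) \<partial>Pi\<^sub>M I comp_law)"
    unfolding meanX_def by (subst comp_field_eq) (rule refl)
  have "\<beta> * (\<integral>(s, t). phi E a \<theta> s t \<partial>mean_gibbs2 (Plaw E \<theta>) \<pi> (Xproc E)) - \<bar>\<beta>\<bar> * (\<Sum>m\<in>I. 210 * comp_error) \<le> meanX \<beta> - meanX 0"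
    unfolding 1 2 3
    by (rule FX.free_energy_tangent[OF Bb Bp comp_envelope(3) comp_envelope(1) H]) (use gibbs_x in \<open>auto simp: comp_law_def\<close>)
  then show "\<beta> * (\<integral>(s, t). phi E a \<theta> s t \<partial>mean_gibbs2 (Plaw E \<theta>) \<pi> (Xproc E)) - real (comps E) * (210 * comp_error) \<le> meanX \<beta> - meanX 0"
    using le by linarith
  have Y: "Yproc E \<theta> = (\<lambda>t q. FG.field drift t (\<lambda>m\<in>I. xi E q m))" unfolding fun_eq_iff Yproc_eq FG.field_def by simp
  have 4: "mean_gibbs2 (Qlaw E \<theta>) \<pi> (Yproc E \<theta>) = mean_gibbs2 (Pi\<^sub>M I G) \<pi> (FG.field drift)"
    unfolding Y by (rule TG.mean_gibbs2_distr[OF FG.field_dom[OF Bd] Q_prob gauss_distr(2) gauss_distr(1), symmetric])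
  have 5: "(\<integral>(s, t). phi E a \<theta> s t \<partial>mean_gibbs2 (Qlaw E \<theta>) \<pi> (Yproc E \<theta>))
    = (\<integral>\<omega>. (\<integral>t. loss t \<partial>gibbs \<pi> (\<lambda>t. FG.field drift t \<omega>)) + (\<Sum>m\<in>I. diag_excess (gibbs \<pi> (\<lambda>t. FG.field drift t \<omega>)) (H_kernel m)) \<partial>Pi\<^sub>M I G)"
    unfolding 4 phi_eq by (rule TG.integral_mean_gibbs2_excess[OF FG.field_dom[OF Bd] Bp _ H]) auto
  have 6: "meanG 0 = (\<integral>\<omega>. logint \<pi> (\<lambda>t. FG.field drift t \<omega>) \<partial>Pi\<^sub>M I G)" unfolding meanG_def FG.field_def by simp
  have 7: "meanG \<beta> = (\<integral>\<omega>. logint \<pi> (\<lambda>t. (drift t + \<beta> * loss t) + (\<Sum>m\<in>I. gauss_comp 0 m t (\<omega> m) + \<beta> * gauss_tilt m t (\<omega> m))) \<partial>Pi\<^sub>M I G)"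
    unfolding meanG_def by (subst gauss_comp_eq) (rule refl)
  have "\<beta> * (\<integral>(s, t). phi E a \<theta> s t \<partial>mean_gibbs2 (Qlaw E \<theta>) \<pi> (Yproc E \<theta>)) - \<bar>\<beta>\<bar> * (\<Sum>m\<in>I. 210 * comp_error) \<le> meanG \<beta> - meanG 0"
    unfolding 5 6 7
    by (rule FG.free_energy_tangent[OF Bd Bp gauss_tilt_field gauss_envelope_integrable H]) (use gibbs_g in auto)
  then show "\<beta> * (\<integral>(s, t). phi E a \<theta> s t \<partial>mean_gibbs2 (Qlaw E \<theta>) \<pi> (Yproc E \<theta>)) - real (comps E) * (210 * comp_error) \<le> meanG \<beta> - meanG 0"
    using le by linarith
qed

lemma gaussian_free_energy:
  shows F_G_eq: "\<bar>\<beta>\<bar> \<le> 1 \<Longrightarrow> F_G n E a \<theta> \<beta> = 1 / real n * meanG \<beta>"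
    and meanG_convex: "convex_on UNIV meanG"
proof -
  interpret FG: indep_fields \<pi> G I "\<lambda>_. gauss_envelope" "gauss_comp 0" by (rule G_fields) simp
  interpret TG: two_probs \<pi> "Pi\<^sub>M I G" by (rule FG.two_probs_PiM)
  obtain Bp where Bp: "bdmeas \<pi> Bp loss" using loss_bdmeas by blast
  obtain Bd where Bd: "bdmeas \<pi> Bd drift" using drift_bdmeas by blast
  show "F_G n E a \<theta> \<beta> = 1 / real n * meanG \<beta>" if \<beta>: "\<bar>\<beta>\<bar> \<le> 1"
  proof -
    interpret FB: indep_fields \<pi> G I "\<lambda>_. gauss_envelope" "gauss_comp \<beta>" by (rule G_fields[OF \<beta>])
    obtain B where B: "bdmeas \<pi> B (\<lambda>t. drift t + \<beta> * loss t)" using bdmeas_line[OF drift_bdmeas] by blast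
    have m: "(\<lambda>\<omega>. logint \<pi> (\<lambda>t. FB.field (\<lambda>t. drift t + \<beta> * loss t) t \<omega>)) \<in> borel_measurable (Pi\<^sub>M I G)"
      using FB.integrable_logint[OF B] by simp
    have mm: "(\<lambda>\<omega>. logint \<pi> (\<lambda>t. FB.field (\<lambda>t. drift t + \<beta> * loss t) t \<omega>)) \<in> borel_measurable (Pi\<^sub>M I (\<lambda>m. restrict_space borel (hilb E m)))"
      using m unfolding xi_distr[symmetric] by simp
    have "meanG \<beta> = (\<integral>\<omega>. logint \<pi> (\<lambda>t. FB.field (\<lambda>t. drift t + \<beta> * loss t) t \<omega>) \<partial>Pi\<^sub>M I G)"
      unfolding meanG_def FB.field_def by simp
    also have "\<dots> = (\<integral>q. logint \<pi> (\<lambda>t. FB.field (\<lambda>t. drift t + \<beta> * loss t) t (\<lambda>m\<in>I. xi E q m)) \<partial>Qlaw E \<theta>)"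
      by (rule integral_distr[OF gauss_distr(2) mm, unfolded xi_distr])
    finally show ?thesis unfolding F_G_def Ybeta_eq FB.field_def logint_def by simp
  qed
  define vs where "vs = (\<lambda>t \<omega>. loss t + (\<Sum>m\<in>I. gauss_tilt m t (\<omega> m)))"
  have pG: "\<And>m. prob_space (G m)" by (rule gauss_distr(3))
  have vd: "dom_field \<pi> (Pi\<^sub>M I G) (\<lambda>\<omega>. Bp + (\<Sum>m\<in>I. gauss_envelope (\<omega> m))) vs"
    unfolding vs_def
    by (intro dom_field_add dom_field_const[OF Bp] dom_field_sum finite_atLeastAtMost) (rule dom_field_component[where N=G], auto intro: gauss_tilt_field)
  have "convex_on UNIV (\<lambda>\<beta>. \<integral>\<omega>. logint \<pi> (\<lambda>t. FG.field drift t \<omega> + \<beta> * vs t \<omega>) \<partial>Pi\<^sub>M I G)"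
    by (rule TG.mean_logint_convex[OF FG.field_dom[OF Bd] vd FG.envelope_integrable FG.envelope_integrable])
  moreover have "meanG = (\<lambda>\<beta>. \<integral>\<omega>. logint \<pi> (\<lambda>t. FG.field drift t \<omega> + \<beta> * vs t \<omega>) \<partial>Pi\<^sub>M I G)"
    unfolding meanG_def FG.field_def vs_def
    by (subst gauss_comp_eq) (simp add: fun_eq_iff sum.distrib sum_distrib_left algebra_simps)
  ultimately show "convex_on UNIV meanG" by simp
qed

text \<open>The likelihood free energy is compared with the Gaussian one at \<open>\<beta>\<close> and at \<open>0\<close>, and the tangent inequality is
used for the likelihood free energy. For \<open>\<Phi>\<^sup>G\<close> the Gaussian tangent inequality suffices.\<close>

lemma free_energy_increment:
  assumes \<beta>: "\<bar>\<beta>\<bar> \<le> 1"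
  shows "\<beta> * Phi n E a \<theta> - real (comps E) * r\<^sup>2 / real n * ((2 + 5250000 * c ^ 5) * (D * (1 + D)))
      \<le> F_G n E a \<theta> \<beta> - F_G n E a \<theta> 0"
    and "\<beta> * Phi_G n E a \<theta> - real (comps E) * r\<^sup>2 / real n * ((2 + 5250000 * c ^ 5) * (D * (1 + D)))
      \<le> F_G n E a \<theta> \<beta> - F_G n E a \<theta> 0"
proof -
  let ?M = "real (comps E)"
  have DD: "D \<le> D * (1 + D)" using D by simp
  have e0: "0 \<le> comp_error" using c D by (simp add: comp_error_def)
  have K: "?M * (1050 * comp_error + 2 * (r\<^sup>2 * D)) \<le> ?M * r\<^sup>2 * ((2 + 5250000 * c ^ 5) * (D * (1 + D)))"
  proof -
    have "r\<^sup>2 * D \<le> r\<^sup>2 * (D * (1 + D))" using DD by (rule mult_left_mono) simp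
    then have "1050 * comp_error + 2 * (r\<^sup>2 * D) \<le> r\<^sup>2 * ((2 + 5250000 * c ^ 5) * (D * (1 + D)))"
      unfolding comp_error_def by (simp add: algebra_simps)
    from mult_left_mono[OF this, of ?M] show ?thesis by (simp add: mult.assoc)
  qed
  have scale: "\<beta> * (1 / real n * x) - ?M * r\<^sup>2 / real n * k \<le> 1 / real n * y - 1 / real n * y0"
    if "\<beta> * x - ?M * r\<^sup>2 * k \<le> y - y0" for x y y0 k :: real
  proof -
    have "1 / real n * (\<beta> * x - ?M * r\<^sup>2 * k) \<le> 1 / real n * (y - y0)" using that by (rule mult_left_mono) simp
    then show ?thesis by (simp add: algebra_simps diff_divide_distrib)
  qed
  have c0: "\<bar>meanX \<beta> - meanG \<beta>\<bar> \<le> ?M * (420 * comp_error + r\<^sup>2 * D)" "\<bar>meanX 0 - meanG 0\<bar> \<le> ?M * (420 * comp_error + r\<^sup>2 * D)"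
    by (rule free_energies_close, use \<beta> in simp)+
  have Kx: "?M * (210 * comp_error) + 2 * (?M * (420 * comp_error + r\<^sup>2 * D)) = ?M * (1050 * comp_error + 2 * (r\<^sup>2 * D))"
    by (simp add: algebra_simps)
  have zero: "\<bar>0::real\<bar> \<le> 1" by simp
  show "\<beta> * Phi n E a \<theta> - ?M * r\<^sup>2 / real n * ((2 + 5250000 * c ^ 5) * (D * (1 + D))) \<le> F_G n E a \<theta> \<beta> - F_G n E a \<theta> 0"
    unfolding Phi_def F_G_eq[OF \<beta>] F_G_eq[OF zero]
    by (rule scale) (use X_tangent[OF \<beta>] c0 K Kx in linarith)
  have "?M * (210 * comp_error) \<le> ?M * (1050 * comp_error + 2 * (r\<^sup>2 * D))" using e0 D by (intro mult_left_mono) auto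
  then show "\<beta> * Phi_G n E a \<theta> - ?M * r\<^sup>2 / real n * ((2 + 5250000 * c ^ 5) * (D * (1 + D))) \<le> F_G n E a \<theta> \<beta> - F_G n E a \<theta> 0"
    unfolding Phi_G_def F_G_eq[OF \<beta>] F_G_eq[OF zero]
    by (intro scale) (use G_tangent[OF \<beta>] K in linarith)
qed

end

section \<open>The limit theorem\<close>

theorem corollary10:
  fixes E :: "nat \<Rightarrow> ('p, 'w, 'h::{real_inner,banach,second_countable_topology}, 'q) gauss_experiment"
    and \<delta> :: "nat \<Rightarrow> 'p \<Rightarrow> real"
    and \<nu> :: "nat \<Rightarrow> 'p measure"
    and FG :: "real \<Rightarrow> real"
    and a \<epsilon> :: real
  assumes a: "a \<in> {-1, 0}"
    and regular: "\<And>n. n \<ge> 1 \<Longrightarrow> regular_experiment (E n)"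
    and gaussian: "\<And>n. n \<ge> 1 \<Longrightarrow> gaussian_counterpart (E n)"
    and dirs: "\<And>n. n \<ge> 1 \<Longrightarrow> directions (E n)"
    and moments: "local_moment_bounds E \<delta>"
    and radius: "\<exists>C. \<forall>n\<ge>1. radius (E n) \<le> C * sqrt (real n / real (comps (E n)))"
    and ops_bound: "(\<lambda>n. MAX m\<in>{1..comps (E n)}. norm (Hop (E n) m) + norm (Bop (E n) m)) \<in> O(\<lambda>_. 1)"
    and nu: "\<And>n. n \<ge> 1 \<Longrightarrow> prob_space (\<nu> n) \<and> space (\<nu> n) = topspace (Theta (E n))"
    and delta_meas: "\<And>n. n \<ge> 1 \<Longrightarrow> (\<lambda>\<theta>. \<delta> n \<theta> * (1 + \<delta> n \<theta>)) \<in> borel_measurable (\<nu> n)"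
    and delta_lim: "(\<lambda>n. \<integral>\<^sup>+ \<theta>. ennreal (\<delta> n \<theta> * (1 + \<delta> n \<theta>)) \<partial>\<nu> n) \<longlonglongrightarrow> 0"
    and Phi_int: "\<And>n. n \<ge> 1 \<Longrightarrow> integrable (\<nu> n) (Phi n (E n) a)"
    and Phi_G_int: "\<And>n. n \<ge> 1 \<Longrightarrow> integrable (\<nu> n) (Phi_G n (E n) a)"
    and eps: "\<epsilon> > 0"
    and F_G_int: "\<And>n \<beta>. n \<ge> 1 \<Longrightarrow> \<bar>\<beta>\<bar> < \<epsilon> \<Longrightarrow> integrable (\<nu> n) (\<lambda>\<theta>. F_G n (E n) a \<theta> \<beta>)"
    and F_G_lim: "\<And>\<beta>. \<bar>\<beta>\<bar> < \<epsilon> \<Longrightarrow> (\<lambda>n. \<integral>\<theta>. F_G n (E n) a \<theta> \<beta> \<partial>\<nu> n) \<longlonglongrightarrow> FG \<beta>"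
  shows "(\<exists>Dm Dp. (FG has_real_derivative Dm) (at_left 0) \<and> (FG has_real_derivative Dp) (at_right 0) \<and>
            ereal Dm \<le> liminf (\<lambda>n. ereal (\<integral>\<theta>. Phi n (E n) a \<theta> \<partial>\<nu> n)) \<and>
            liminf (\<lambda>n. ereal (\<integral>\<theta>. Phi n (E n) a \<theta> \<partial>\<nu> n)) \<le> limsup (\<lambda>n. ereal (\<integral>\<theta>. Phi n (E n) a \<theta> \<partial>\<nu> n)) \<and>
            limsup (\<lambda>n. ereal (\<integral>\<theta>. Phi n (E n) a \<theta> \<partial>\<nu> n)) \<le> ereal Dp)
       \<and> (FG differentiable (at 0) \<longrightarrow>
            (\<lambda>n. \<integral>\<theta>. Phi n (E n) a \<theta> \<partial>\<nu> n) \<longlonglongrightarrow> deriv FG 0 \<and>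
            (\<lambda>n. \<integral>\<theta>. Phi_G n (E n) a \<theta> \<partial>\<nu> n) \<longlonglongrightarrow> deriv FG 0)"
proof -
  from moments obtain C1 C2 where
    delta_nn: "\<And>n \<theta>. n \<ge> 1 \<Longrightarrow> \<theta> \<in> topspace (Theta (E n)) \<Longrightarrow> 0 \<le> \<delta> n \<theta>"
    and U_mean: "\<And>n m. n \<ge> 1 \<Longrightarrow> m \<in> {1..comps (E n)} \<Longrightarrow> (\<integral>w. Uvec (E n) m w \<partial>P0 (E n) m) = 0"
    and C1: "\<And>n m. n \<ge> 1 \<Longrightarrow> m \<in> {1..comps (E n)} \<Longrightarrow> L_loc (E n) m \<le> ennreal C1"
    and C2: "\<And>n m \<theta>. n \<ge> 1 \<Longrightarrow> m \<in> {1..comps (E n)} \<Longrightarrow> \<theta> \<in> topspace (Theta (E n)) \<Longrightarrow>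
      err_U (E n) m \<theta> + err_S (E n) m \<theta> + err_V (E n) m \<theta> + err_R (E n) m \<theta> + err_D (E n) m \<theta> \<le> ennreal (C2 * \<delta> n \<theta>)"
    unfolding local_moment_bounds_def by blast
  obtain C3 where C3: "\<And>n. n \<ge> 1 \<Longrightarrow> radius (E n) \<le> C3 * sqrt (real n / real (comps (E n)))" using radius by blast
  obtain cB where cB: "\<forall>\<^sub>F n in sequentially. norm (MAX m\<in>{1..comps (E n)}. norm (Hop (E n) m) + norm (Bop (E n) m)) \<le> cB * norm (1::real)"
    using ops_bound by (elim landau_o.bigE)
  \<comment> \<open>Large enough for both \<open>C1 \<le> c\<^sup>2\<close> and \<open>1 + \<parallel>B\<^sub>m\<parallel> \<le> c\<close>.\<close>
  define c where "c = 1 + \<bar>cB\<bar> + \<bar>C1\<bar>"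
  define C where "C = max C2 1"
  define L where "L = C3\<^sup>2 * (2 + 5250000 * c ^ 5) * C\<^sup>2"
  \<comment> \<open>The envelopes of the component fields cover \<open>\<bar>\<beta>\<bar> \<le> 1\<close> only.\<close>
  define e where "e = min \<epsilon> 1"
  have c: "1 \<le> c" and C: "1 \<le> C" and e: "0 < e" using eps by (simp_all add: c_def C_def e_def)
  have cC: "C1 \<le> c\<^sup>2"
  proof -
    have "C1 \<le> c * 1" by (simp add: c_def)
    also have "\<dots> \<le> c * c" using c by (intro mult_left_mono) auto
    finally show ?thesis by (simp add: power2_eq_square)
  qed
  have ev: "\<forall>\<^sub>F n in sequentially. n \<ge> 1 \<and> (\<forall>m\<in>{1..comps (E n)}. 1 + norm (Bop (E n) m) \<le> c)"
    using cB eventually_ge_at_top[of 1]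
  proof eventually_elim
    case (elim n)
    have "1 + norm (Bop (E n) m) \<le> c" if m: "m \<in> {1..comps (E n)}" for m
    proof -
      have "norm (Hop (E n) m) + norm (Bop (E n) m) \<le> (MAX m\<in>{1..comps (E n)}. norm (Hop (E n) m) + norm (Bop (E n) m))"
        using m by (intro Max_ge) auto
      then have "norm (Bop (E n) m) \<le> (MAX m\<in>{1..comps (E n)}. norm (Hop (E n) m) + norm (Bop (E n) m))"
        using norm_ge_zero[of "Hop (E n) m"] by linarith
      also have "\<dots> \<le> \<bar>cB\<bar>" using elim(1) by simp
      finally show ?thesis by (simp add: c_def)
    qed
    then show ?case using elim(2) by blast
  qed
  have model: "regular_model (E n) \<theta> c D"
    if n: "n \<ge> 1" and B: "\<forall>m\<in>{1..comps (E n)}. 1 + norm (Bop (E n) m) \<le> c"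
      and \<theta>: "\<theta> \<in> topspace (Theta (E n))" and D: "C * \<delta> n \<theta> < D" for n \<theta> D
  proof
    have "0 \<le> C * \<delta> n \<theta>" using delta_nn[OF n \<theta>] C by simp
    then show "0 < D" using D by linarith
    have "C2 * \<delta> n \<theta> \<le> C * \<delta> n \<theta>" using delta_nn[OF n \<theta>] by (intro mult_right_mono) (auto simp: C_def)
    then have "ennreal (C2 * \<delta> n \<theta>) \<le> ennreal D" using D by (intro ennreal_leI) linarith
    then show "err_U (E n) m \<theta> + err_S (E n) m \<theta> + err_V (E n) m \<theta> + err_R (E n) m \<theta> + err_D (E n) m \<theta> \<le> ennreal D"
      if "m \<in> {1..comps (E n)}" for m using C2[OF n that \<theta>] by (rule order_trans[rotated])
    show "L_loc (E n) m \<le> ennreal (c\<^sup>2)" if "m \<in> {1..comps (E n)}" for m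
      using C1[OF n that] cC by (meson ennreal_leI order_trans)
    show "1 + norm (Bop (E n) m) \<le> c" if "m \<in> {1..comps (E n)}" for m using B that by blast
  qed (use n \<theta> c regular gaussian dirs U_mean in auto)
  have scale: "real (comps (E n)) * (radius (E n))\<^sup>2 / real n \<le> C3\<^sup>2" if n: "n \<ge> 1" for n
  proof -
    have M: "1 \<le> comps (E n)" and r: "0 < radius (E n)" using regular[OF n] by (auto simp: regular_experiment_def)
    have "(radius (E n))\<^sup>2 \<le> (C3 * sqrt (real n / real (comps (E n))))\<^sup>2" using C3[OF n] r by (intro power_mono) auto
    also have "\<dots> = C3\<^sup>2 * (real n / real (comps (E n)))" by (simp add: power_mult_distrib)
    finally show ?thesis using M n by (simp add: field_simps)
  qed
  define d where "d = (\<lambda>n \<theta>. \<delta> n \<theta> * (1 + \<delta> n \<theta>))"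
  have d0: "0 \<le> d n \<theta>" if "n \<ge> 1" "\<theta> \<in> topspace (Theta (E n))" for n \<theta>
    using delta_nn[OF that] by (simp add: d_def)
  have pointwise: "\<beta> * \<Phi> - L * d n \<theta> \<le> F_G n (E n) a \<theta> \<beta> - F_G n (E n) a \<theta> 0"
    if n: "n \<ge> 1" and B: "\<forall>m\<in>{1..comps (E n)}. 1 + norm (Bop (E n) m) \<le> c"
      and \<theta>: "\<theta> \<in> topspace (Theta (E n))" and \<beta>: "\<bar>\<beta>\<bar> < e" and \<Phi>: "\<Phi> \<in> {Phi n (E n) a \<theta>, Phi_G n (E n) a \<theta>}" for n \<theta> \<beta> \<Phi>
  proof -
    \<comment> \<open>The model requires a strictly positive error bound, while \<open>\<delta>\<close> may vanish. The inequality
      holds for all \<open>D > C \<delta>\<close>; let \<open>D\<close> decrease to \<open>C \<delta>\<close>.\<close>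
    let ?k = "C3\<^sup>2 * (2 + 5250000 * c ^ 5)"
    define y where "y = C * \<delta> n \<theta>"
    have D: "\<beta> * \<Phi> - ?k * (D * (1 + D)) \<le> F_G n (E n) a \<theta> \<beta> - F_G n (E n) a \<theta> 0" if D: "y < D" for D
    proof -
      interpret regular_model "E n" \<theta> a c D by (rule model[OF n B \<theta> D[unfolded y_def]])
      have "0 < D" by (rule regular_model.D[OF regular_model_axioms])
      then have "real (comps (E n)) * (radius (E n))\<^sup>2 / real n * ((2 + 5250000 * c ^ 5) * (D * (1 + D))) \<le> C3\<^sup>2 * ((2 + 5250000 * c ^ 5) * (D * (1 + D)))"
        using c by (intro mult_right_mono[OF scale[OF n]]) simp
      then show ?thesis using free_energy_increment[of \<beta> n] \<beta> \<Phi> by (auto simp: e_def mult.assoc)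
    qed
    have "((\<lambda>D. \<beta> * \<Phi> - ?k * (D * (1 + D))) \<longlongrightarrow> \<beta> * \<Phi> - ?k * (y * (1 + y))) (at_right y)"
      by (intro tendsto_intros)
    moreover have "eventually (\<lambda>D. \<beta> * \<Phi> - ?k * (D * (1 + D)) \<le> F_G n (E n) a \<theta> \<beta> - F_G n (E n) a \<theta> 0) (at_right y)"
      using D by (auto simp: eventually_at_right_less intro: eventually_mono[OF eventually_at_right_less])
    ultimately have "\<beta> * \<Phi> - ?k * (y * (1 + y)) \<le> F_G n (E n) a \<theta> \<beta> - F_G n (E n) a \<theta> 0"
      by (rule tendsto_upperbound) simp
    moreover have "?k * (y * (1 + y)) \<le> L * d n \<theta>"
    proof -
      have "1 + y \<le> C * (1 + \<delta> n \<theta>)" using C by (simp add: y_def distrib_left)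
      then have "y * (1 + y) \<le> y * (C * (1 + \<delta> n \<theta>))"
        using delta_nn[OF n \<theta>] C by (intro mult_left_mono) (auto simp: y_def)
      also have "\<dots> = C\<^sup>2 * d n \<theta>" by (simp add: y_def d_def power2_eq_square)
      finally have "?k * (y * (1 + y)) \<le> ?k * (C\<^sup>2 * d n \<theta>)" using c by (intro mult_left_mono) auto
      then show ?thesis by (simp add: L_def mult.assoc)
    qed
    ultimately show ?thesis by linarith
  qed
  have d_ev: "\<forall>\<^sub>F n in sequentially. integrable (\<nu> n) (d n) \<and> (\<integral>\<theta>. d n \<theta> \<partial>\<nu> n) = enn2real (\<integral>\<^sup>+ \<theta>. ennreal (d n \<theta>) \<partial>\<nu> n)"
    using order_tendstoD(2)[OF delta_lim zero_less_one] eventually_ge_at_top[of 1]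
  proof eventually_elim
    case (elim n)
    have m: "d n \<in> borel_measurable (\<nu> n)" using delta_meas[OF elim(2)] by (simp add: d_def)
    have nn: "AE \<theta> in \<nu> n. 0 \<le> d n \<theta>" using nu[OF elim(2)] d0[OF elim(2)] by (intro AE_I2) auto
    have "(\<integral>\<^sup>+ \<theta>. ennreal (d n \<theta>) \<partial>\<nu> n) < \<infinity>" using elim(1) by (auto simp: d_def intro: less_trans)
    then have "integrable (\<nu> n) (d n)" by (rule integrableI_nonneg[OF m nn])
    then show ?case using integral_eq_nn_integral[OF m nn] by simp
  qed
  define r where "r = (\<lambda>n. L * (\<integral>\<theta>. d n \<theta> \<partial>\<nu> n))"
  have "(\<lambda>n. enn2real (\<integral>\<^sup>+ \<theta>. ennreal (d n \<theta>) \<partial>\<nu> n)) \<longlonglongrightarrow> 0"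
    by (rule tendsto_enn2real) (use delta_lim in \<open>simp_all add: d_def\<close>)
  then have "(\<lambda>n. \<integral>\<theta>. d n \<theta> \<partial>\<nu> n) \<longlonglongrightarrow> 0"
    by (rule Lim_transform_eventually) (use d_ev in \<open>auto elim: eventually_mono\<close>)
  then have r: "r \<longlonglongrightarrow> 0" unfolding r_def using tendsto_mult_right_zero by blast
  have averaged: "\<forall>\<^sub>F n in sequentially. \<beta> * (\<integral>\<theta>. \<Phi> n \<theta> \<partial>\<nu> n) - r n
      \<le> (\<integral>\<theta>. F_G n (E n) a \<theta> \<beta> \<partial>\<nu> n) - (\<integral>\<theta>. F_G n (E n) a \<theta> 0 \<partial>\<nu> n)"
    if \<Phi>: "\<Phi> = (\<lambda>n. Phi n (E n) a) \<or> \<Phi> = (\<lambda>n. Phi_G n (E n) a)" and \<beta>: "\<bar>\<beta>\<bar> < e" for \<Phi> \<beta>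
    using ev d_ev
  proof eventually_elim
    case (elim n)
    have n: "n \<ge> 1" and B: "\<forall>m\<in>{1..comps (E n)}. 1 + norm (Bop (E n) m) \<le> c" using elim by auto
    have i: "integrable (\<nu> n) (d n)" "integrable (\<nu> n) (\<Phi> n)" using elim \<Phi> Phi_int[OF n] Phi_G_int[OF n] by auto
    have iF: "integrable (\<nu> n) (\<lambda>\<theta>. F_G n (E n) a \<theta> \<beta>)" "integrable (\<nu> n) (\<lambda>\<theta>. F_G n (E n) a \<theta> 0)"
      using \<beta> eps F_G_int[OF n] by (auto simp: e_def)
    have "(\<integral>\<theta>. \<beta> * \<Phi> n \<theta> - L * d n \<theta> \<partial>\<nu> n) \<le> (\<integral>\<theta>. F_G n (E n) a \<theta> \<beta> - F_G n (E n) a \<theta> 0 \<partial>\<nu> n)"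
    proof (rule integral_mono)
      fix \<theta> assume "\<theta> \<in> space (\<nu> n)"
      then have "\<theta> \<in> topspace (Theta (E n))" using nu[OF n] by simp
      from pointwise[OF n B this \<beta>] \<Phi>
      show "\<beta> * \<Phi> n \<theta> - L * d n \<theta> \<le> F_G n (E n) a \<theta> \<beta> - F_G n (E n) a \<theta> 0" by auto
    qed (use i iF in auto)
    then show ?case using i iF by (simp add: r_def)
  qed
  have limF: "(\<lambda>n. \<integral>\<theta>. F_G n (E n) a \<theta> \<beta> \<partial>\<nu> n) \<longlonglongrightarrow> FG \<beta>" if "\<bar>\<beta>\<bar> < e" for \<beta>
    using F_G_lim that by (simp add: e_def)
  have cvx: "convex_on {-e<..<e} FG"
  proof (rule convex_on_limit[where f="\<lambda>n \<beta>. \<integral>\<theta>. F_G n (E n) a \<theta> \<beta> \<partial>\<nu> n"])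
    show "(\<lambda>n. \<integral>\<theta>. F_G n (E n) a \<theta> \<beta> \<partial>\<nu> n) \<longlonglongrightarrow> FG \<beta>" if "\<beta> \<in> {-e<..<e}" for \<beta>
      using that by (intro limF) auto
    show "\<forall>\<^sub>F n in sequentially. convex_on {-e<..<e} (\<lambda>\<beta>. \<integral>\<theta>. F_G n (E n) a \<theta> \<beta> \<partial>\<nu> n)"
      using ev
    proof eventually_elim
      case (elim n)
      have n: "n \<ge> 1" using elim by simp
      show ?case
      proof (rule convex_onI)
        fix s x y :: real assume s: "0 < s" "s < 1" and x: "x \<in> {-e<..<e}" and y: "y \<in> {-e<..<e}"
        define z where "z = (1 - s) * x + s * y"
        have z: "z \<in> {-e<..<e}"
          using convexD[OF convex_real_interval(8) x y, of "1 - s" s] s by (simp add: z_def)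
        have iF: "integrable (\<nu> n) (\<lambda>\<theta>. F_G n (E n) a \<theta> b)" if "b \<in> {-e<..<e}" for b
          using that F_G_int[OF n] by (auto simp: e_def)
        have "(\<integral>\<theta>. F_G n (E n) a \<theta> z \<partial>\<nu> n) \<le> (\<integral>\<theta>. (1 - s) * F_G n (E n) a \<theta> x + s * F_G n (E n) a \<theta> y \<partial>\<nu> n)"
        proof (rule integral_mono)
          fix \<theta> assume "\<theta> \<in> space (\<nu> n)"
          then have \<theta>: "\<theta> \<in> topspace (Theta (E n))" using nu[OF n] by simp
          interpret regular_model "E n" \<theta> a c "C * \<delta> n \<theta> + 1" by (rule model) (use elim \<theta> in auto)
          have F: "F_G n (E n) a \<theta> b = 1 / real n * meanG b" if "b \<in> {-e<..<e}" for b
            using that by (intro F_G_eq) (auto simp: e_def)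
          have "meanG z \<le> (1 - s) * meanG x + s * meanG y"
            using convex_onD[OF meanG_convex, of s x y] s by (simp add: z_def)
          from mult_left_mono[OF this, of "1 / real n"]
          show "F_G n (E n) a \<theta> z \<le> (1 - s) * F_G n (E n) a \<theta> x + s * F_G n (E n) a \<theta> y"
            unfolding F[OF x] F[OF y] F[OF z] by (simp add: algebra_simps add_divide_distrib diff_divide_distrib)
        qed (use iF x y z in auto)
        also have "\<dots> = (1 - s) * (\<integral>\<theta>. F_G n (E n) a \<theta> x \<partial>\<nu> n) + s * (\<integral>\<theta>. F_G n (E n) a \<theta> y \<partial>\<nu> n)"
          using iF[OF x] iF[OF y] by simp
        finally show "(\<integral>\<theta>. F_G n (E n) a \<theta> ((1 - s) *\<^sub>R x + s *\<^sub>R y) \<partial>\<nu> n)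
          \<le> (1 - s) * (\<integral>\<theta>. F_G n (E n) a \<theta> x \<partial>\<nu> n) + s * (\<integral>\<theta>. F_G n (E n) a \<theta> y \<partial>\<nu> n)"
          by (simp add: z_def)
      qed simp
    qed
  qed simp
  obtain Dm Dp where Dm: "(FG has_real_derivative Dm) (at_left 0)" and Dp: "(FG has_real_derivative Dp) (at_right 0)"
    using convex_one_sided_derivatives[OF e cvx] by blast
  have sandwich: "ereal Dm \<le> liminf (\<lambda>n. ereal (\<integral>\<theta>. \<Phi> n \<theta> \<partial>\<nu> n))" "limsup (\<lambda>n. ereal (\<integral>\<theta>. \<Phi> n \<theta> \<partial>\<nu> n)) \<le> ereal Dp"
    if "\<Phi> = (\<lambda>n. Phi n (E n) a) \<or> \<Phi> = (\<lambda>n. Phi_G n (E n) a)" for \<Phi>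
    using griffiths_sandwich[OF e limF Dm Dp r averaged[OF that]] by auto
  have "liminf (\<lambda>n. ereal (\<integral>\<theta>. Phi n (E n) a \<theta> \<partial>\<nu> n)) \<le> limsup (\<lambda>n. ereal (\<integral>\<theta>. Phi n (E n) a \<theta> \<partial>\<nu> n))"
    by (rule Liminf_le_Limsup) simp
  moreover have "(\<lambda>n. \<integral>\<theta>. Phi n (E n) a \<theta> \<partial>\<nu> n) \<longlonglongrightarrow> deriv FG 0 \<and> (\<lambda>n. \<integral>\<theta>. Phi_G n (E n) a \<theta> \<partial>\<nu> n) \<longlonglongrightarrow> deriv FG 0"
    if diff: "FG differentiable (at 0)"
    using sandwich one_sided_derivatives_eq[OF diff Dm Dp] by (intro conjI tendsto_of_liminf_limsup) simp_all
  ultimately show ?thesis using Dm Dp sandwich by blast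
qed

end
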